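(* The process $(A_{L_t},\gamma_t)$, $t\ge 0$, is a homogeneous Markov process whose transition probabilities $p_t^\gamma((x,v);dy,dw)$ satisfy $$p_t^\gamma((x,0);dy,dw)=\mathbb{P}^{(x,0)}(A_{L_t}\in dy,\ \gamma_t\in dw),$$ $$p_t^\gamma((x,v);dy,dw)=\delta_x(dy)\,\delta_{v+t}(dw)\,\frac{\nu[v+t,+\infty)}{\nu[v,+\infty)}+\int_{[v,v+t)}p^\gamma_{v+t-s}((x,0);dy,dw)\,\frac{\nu(ds)}{\nu[v,+\infty)},$$ for all $x\in\mathbb{R}$ and $v>0$.
   Context: Let $\phi(\lambda)=b\lambda+\int_{(0,+\infty)}(1-e^{-\lambda s})\,\nu(ds)$, where $b\ge 0$ and $\nu$ is a measure on $(0,+\infty)$ with $\int_{(0,+\infty)}(1\wedge s)\,\nu(ds)<+\infty$. Assume $b>0$ or $\nu(0,+\infty)=+\infty$. Let $\mu_t$ be the one-dimensional law of the subordinator with Laplace exponent $\phi$, i.e. $\int e^{-\lambda w}\mu_t(dw)=e^{-t\phi(\lambda)}$. The assumption makes the subordinator strictly increasing. Consider the convolution (Feller) semigroup $T_tu(x,v)=\int_{\mathbb{R}^2}u(x+y,v+w)\,\delta_t(dy)\,\mu_t(dw)$ on $C_0(\mathbb{R}^2)$, and let $(A_t,\sigma_t)_{t\ge0}$ be the associated canonical càdlàg process on $(\Omega,\mathcal{F}_\infty,(\mathcal{F}_t)_{t\ge0},\mathbb{P}^{(x,v)})$, with $(\mathcal{F}_t)$ the natural filtration and $\mathbb{P}^{(x,v)}(A_0=x,\sigma_0=v)=1$,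 $(x,v)\in\mathbb{R}^2$. Thus $A_t=x+t$ is a pure drift, and $\sigma$ is an independent strictly increasing subordinator started from $v$. Define $L_t=\inf\{s>0:\sigma_s>t\}$, $H_t=\sigma_{L_t-}=\lim_{\delta\downarrow0}\sigma_{L_t-\delta}$ (undershooting) and $\gamma_t=t-H_t$ (age process, left-continuous). Under $\mathbb{P}^{(x,0)}$ one has $L_0=0$, $\gamma_0=0$ and $A_{L_t}=x+L_t$. A state $(x,v)$ with $v>0$ corresponds to conditioning on $A_{L_0}=x$, $\gamma_0=v$. $\delta_z$ denotes the Dirac mass at $z$. *)

theory Defs
  imports "HOL-Probability.Probability"
begin

section \<open>Subordinators\<close>

text \<open>Measures on \<open>(0,\<infinity>)\<close> are encoded as Borel measures on the real line that do not charge
  \<open>(-\<infinity>,0]\<close>.\<close>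

definition levy_measure :: "real measure \<Rightarrow> bool" where
  "levy_measure \<nu> \<longleftrightarrow> sets \<nu> = sets borel \<and> emeasure \<nu> {..0} = 0 \<and>
     (\<integral>\<^sup>+ s\<in>{0<..}. ennreal (min 1 s) \<partial>\<nu>) < \<infinity>"

definition laplace_exponent :: "real \<Rightarrow> real measure \<Rightarrow> real \<Rightarrow> real" where
  "laplace_exponent b \<nu> \<theta> = b * \<theta> + (LINT s:{0<..}|\<nu>. 1 - exp (- \<theta> * s))"

definition subordinator_laws :: "(real \<Rightarrow> real) \<Rightarrow> (real \<Rightarrow> real measure) \<Rightarrow> bool" where
  "subordinator_laws \<phi> \<mu> \<longleftrightarrow>
     (\<forall>t\<ge>0. prob_space (\<mu> t) \<and> sets (\<mu> t) = sets borel \<and> emeasure (\<mu> t) {..<0} = 0 \<and>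
        (\<forall>\<theta>\<ge>0. (\<integral>w. exp (- \<theta> * w) \<partial>\<mu> t) = exp (- t * \<phi> \<theta>)))"

section \<open>The canonical cadlag process of the convolution semigroup\<close>

definition C0_functions :: "(real \<times> real \<Rightarrow> real) set" where
  "C0_functions = {u. continuous_on UNIV u \<and> (u \<longlongrightarrow> 0) at_infinity}"

definition conv_semigroup ::
    "(real \<Rightarrow> real measure) \<Rightarrow> real \<Rightarrow> (real \<times> real \<Rightarrow> real) \<Rightarrow> real \<times> real \<Rightarrow> real" where
  "conv_semigroup \<mu> t u = (\<lambda>(x, v).
     \<integral>(y, w). u (x + y, v + w) \<partial>(return borel t \<Otimes>\<^sub>M \<mu> t))"

text \<open>Paths have time set \<open>[0,\<infinity>)\<close>; values at negative times carry no information
  (\<open>extensional\<close>).\<close>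

definition cadlag_paths :: "(real \<Rightarrow> real \<times> real) set" where
  "cadlag_paths = {\<omega> \<in> extensional {0..}.
     (\<forall>t\<ge>0. (\<omega> \<longlongrightarrow> \<omega> t) (at_right t)) \<and> (\<forall>t>0. \<exists>l. (\<omega> \<longlongrightarrow> l) (at_left t))}"

text \<open>The sigma-algebra generated by all coordinate maps.\<close>

definition path_space :: "(real \<Rightarrow> real \<times> real) measure" where
  "path_space = restrict_space (Pi\<^sub>M {0..} (\<lambda>_. borel)) cadlag_paths"

definition natural_filtration ::
    "'w measure \<Rightarrow> (real \<Rightarrow> 'w \<Rightarrow> 'a::topological_space) \<Rightarrow> real \<Rightarrow> 'w measure" where
  "natural_filtration M X t =
     sigma (space M) {X s -` B \<inter> space M | s B. 0 \<le> s \<and> s \<le> t \<and> B \<in> sets borel}"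

definition canonical_process ::
    "(real \<Rightarrow> (real \<times> real \<Rightarrow> real) \<Rightarrow> real \<times> real \<Rightarrow> real) \<Rightarrow>
     (real \<times> real \<Rightarrow> (real \<Rightarrow> real \<times> real) measure) \<Rightarrow> bool" where
  "canonical_process T P \<longleftrightarrow>
     (\<forall>z. prob_space (P z) \<and> sets (P z) = sets path_space \<and>
        measure (P z) {\<omega> \<in> space (P z). \<omega> 0 = z} = 1 \<and>
        (\<forall>u\<in>C0_functions. \<forall>s\<ge>0. \<forall>t\<ge>0. AE \<omega> in P z.
           real_cond_exp (P z) (natural_filtration (P z) (\<lambda>r \<omega>. \<omega> r) s) (\<lambda>\<omega>. u (\<omega> (s + t))) \<omega>
             = T t u (\<omega> s)))"

section \<open>Inverse, undershooting and age\<close>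

definition proc_A :: "real \<Rightarrow> (real \<Rightarrow> real \<times> real) \<Rightarrow> real" where
  "proc_A t \<omega> = fst (\<omega> t)"

definition proc_sigma :: "real \<Rightarrow> (real \<Rightarrow> real \<times> real) \<Rightarrow> real" where
  "proc_sigma t \<omega> = snd (\<omega> t)"

text \<open>The set below is nonempty for almost every path, because the subordinator tends to
  infinity; on the remaining paths the real-valued infimum is an arbitrary constant.\<close>

definition proc_L :: "real \<Rightarrow> (real \<Rightarrow> real \<times> real) \<Rightarrow> real" where
  "proc_L t \<omega> = Inf {s. 0 < s \<and> t < proc_sigma s \<omega>}"

text \<open>There is no time before \<open>0\<close>, so the left limit at \<open>0\<close> is read as \<open>\<sigma>\<^sub>0\<close>; this gives
  \<open>\<gamma>\<^sub>0 = 0\<close> when the process starts from \<open>(x,0)\<close>.\<close>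

definition proc_H :: "real \<Rightarrow> (real \<Rightarrow> real \<times> real) \<Rightarrow> real" where
  "proc_H t \<omega> = (if proc_L t \<omega> \<le> 0 then proc_sigma 0 \<omega>
     else Lim (at_right 0) (\<lambda>\<delta>. proc_sigma (proc_L t \<omega> - \<delta>) \<omega>))"

definition proc_gamma :: "real \<Rightarrow> (real \<Rightarrow> real \<times> real) \<Rightarrow> real" where
  "proc_gamma t \<omega> = t - proc_H t \<omega>"

definition age_process :: "real \<Rightarrow> (real \<Rightarrow> real \<times> real) \<Rightarrow> real \<times> real" where
  "age_process t \<omega> = (proc_A (proc_L t \<omega>) \<omega>, proc_gamma t \<omega>)"

section \<open>Homogeneous Markov processes\<close>

text \<open>Time-homogeneous transition function on the Borel set \<open>E\<close>: probability kernels, jointly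
  measurable in time and state, with \<open>p\<^sub>0(z) = \<delta>\<^sub>z\<close> and the Chapman-Kolmogorov equations.\<close>

definition transition_function ::
    "'a::topological_space set \<Rightarrow> (real \<Rightarrow> 'a \<Rightarrow> 'a measure) \<Rightarrow> bool" where
  "transition_function E p \<longleftrightarrow>
     (\<lambda>(t, z). p t z) \<in> restrict_space borel {0..} \<Otimes>\<^sub>M restrict_space borel E
        \<rightarrow>\<^sub>M prob_algebra (restrict_space borel E) \<and>
     (\<forall>z\<in>E. p 0 z = return (restrict_space borel E) z) \<and>
     (\<forall>s\<ge>0. \<forall>t\<ge>0. \<forall>z\<in>E. p (s + t) z = p s z \<bind> p t)"

definition homogeneous_markov_process ::
    "'w measure \<Rightarrow> 'a::topological_space set \<Rightarrow> (real \<Rightarrow> 'w \<Rightarrow> 'a) \<Rightarrow>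
     (real \<Rightarrow> 'a \<Rightarrow> 'a measure) \<Rightarrow> bool" where
  "homogeneous_markov_process M E X p \<longleftrightarrow>
     prob_space M \<and> transition_function E p \<and>
     (\<forall>t\<ge>0. X t \<in> borel_measurable M \<and> (AE \<omega> in M. X t \<omega> \<in> E)) \<and>
     (\<forall>s\<ge>0. \<forall>t\<ge>0. \<forall>B\<in>sets borel. B \<subseteq> E \<longrightarrow> (AE \<omega> in M.
        real_cond_exp M (natural_filtration M X s) (\<lambda>\<omega>. indicator B (X (s + t) \<omega>)) \<omega>
          = measure (p t (X s \<omega>)) B))"

definition age_states :: "(real \<times> real) set" where
  "age_states = UNIV \<times> {0..}"

end

theory Submission
  imports Defs
begin

text \<open>
  Write \<open>u = L\<^sub>s\<close> for the first passage over \<open>s\<close>. The inverse \<open>L\<close> is discretised by the grid points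
  of mesh \<open>h = 1/(n+1)\<close> lying immediately before and immediately after \<open>u\<close>; at a deterministic grid point the simple
  Markov property says that an independent copy of the subordinator may be pasted onto the path.
  With the grid point after \<open>u\<close> and \<open>h \<rightarrow> 0\<close> this gives the renewal property at \<open>L\<^sub>s\<close>. With the grid
  point before \<open>u\<close> the increment over one cell has law \<open>\<mu>\<^sub>h\<close>, and \<open>\<mu>\<^sub>h[v,\<infinity>)/h \<rightarrow> \<nu>[v,\<infinity>)\<close> at continuity points
  yields the compensation formula for the jump straddling \<open>s\<close>. Dividing by the same formula with
  the jump only required to be at least the age shows that, given the past of the age process,
  the straddling jump has law \<open>\<nu>\<close> conditioned to \<open>[\<gamma>\<^sub>s,\<infinity>)\<close>. At age zero the
  level is almost surely not jumped over, so the jump law there is the Dirac mass at zero.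
  The jump law and the renewal property together determine the future of the age process
  from its present value, which is the Markov property and the two formulas at once; Chapman-Kolmogorov
  follows by applying the same decomposition to the kernel.
\<close>

section \<open>Measures determined by continuous functions\<close>

text \<open>Neither the Poisson random measure of the jumps nor the potential measure of \<sigma> is
  built: a cell of the grid has deterministic ends, so only independence of increments and the
  one-dimensional laws enter. The price is that a test of the past may depend on the path before the
  cell only; it is therefore stopped at the left grid point, and the stopped tests converge back as
  the mesh shrinks. The limit of the rescaled tails needs a level that is not an atom of \<nu>. The
  levels that occur, s minus the left limit at u, are distinct for distinct u, so the countably many
  atoms cost only a null set of times u. The quotient of two compensation formulas is formed between
  integrands, and the unknown occupation measure of \<sigma> cancels. All this happens under one law
  \<open>Q\<close> on increasing paths started at 0, which is the same for every x; the starting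
  point enters as a translation of the first coordinate. Because the limits require continuous
  tests, events of the past are treated through closed cylinders, which still generate the
  filtration.\<close>

lemma measure_eqI_rectangles:
  assumes M: "sets M = sets (A \<Otimes>\<^sub>M B)" and N: "sets N = sets (A \<Otimes>\<^sub>M B)"
    and eq: "\<And>X Y. X \<in> sets A \<Longrightarrow> Y \<in> sets B \<Longrightarrow> emeasure M (X \<times> Y) = emeasure N (X \<times> Y)"
    and fin: "emeasure M (space A \<times> space B) \<noteq> \<infinity>"
  shows "M = N"
proof (rule measure_eqI_generator_eq[OF Int_stable_pair_measure_generator pair_measure_closed])
  show "range (\<lambda>_::nat. space A \<times> space B) \<subseteq> {a \<times> b |a b. a \<in> sets A \<and> b \<in> sets B}"
    by auto
qed (use eq M N fin in \<open>auto simp: sets_pair_measure\<close>)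

text \<open>Lipschitz functions that decrease in n to the indicator of a closed set. As
  \<open>infdist x {}\<close> is 0, the bump of the empty set is constantly 1; hence the
  nonemptiness in the limit lemmas.\<close>

definition bump :: "'a::metric_space set \<Rightarrow> nat \<Rightarrow> 'a \<Rightarrow> real" where
  "bump K n x = max 0 (1 - real (Suc n) * infdist x K)"

lemma bump_bounds: "0 \<le> bump K n x" "bump K n x \<le> 1"
  by (auto simp: bump_def infdist_nonneg)

lemma bump_le_0: "bump K n x \<le> bump K 0 x"
  unfolding bump_def by (intro max.mono diff_mono mult_right_mono) (auto simp: infdist_nonneg)

lemma continuous_on_bump [continuous_intros]: "continuous_on A (bump K n)"
  unfolding bump_def[abs_def] by (intro continuous_intros)

lemma borel_measurable_bump [measurable]: "bump K n \<in> borel_measurable borel"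
  by (intro borel_measurable_continuous_onI continuous_on_bump)

lemma bump_tendsto:
  assumes "closed K" "K \<noteq> {}"
  shows "(\<lambda>n. bump K n x) \<longlonglongrightarrow> indicator K x"
proof (cases "x \<in> K")
  case True
  then show ?thesis by (simp add: bump_def)
next
  case False
  define d where "d = infdist x K"
  have d: "0 < d"
    using False assms in_closed_iff_infdist_zero[of K x] infdist_nonneg[of x K] by (auto simp: d_def)
  obtain m where m: "1 / d < real m" using reals_Archimedean2 by blast
  have "bump K n x = 0" if "n \<ge> m" for n
  proof -
    have "1 / d < real (Suc n)" using m that by auto
    then have "1 < real (Suc n) * d" using d by (simp add: field_simps)
    then show ?thesis unfolding bump_def d_def by simp
  qed
  then show ?thesis using False
    by (intro tendsto_eventually) (auto simp: eventually_sequentially intro!: exI[of _ m])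
qed

lemma bump_compact_support:
  fixes K :: "'a::real_normed_vector set"
  assumes "bounded K" "K \<noteq> {}"
  shows "\<exists>R. \<forall>x. R \<le> norm x \<longrightarrow> bump K n x = 0"
proof -
  obtain R where R: "\<And>x. x \<in> K \<Longrightarrow> norm x \<le> R" using assms unfolding bounded_iff by blast
  have "bump K n x = 0" if "R + 1 \<le> norm x" for x
  proof -
    have "1 \<le> dist x y" if "y \<in> K" for y
      using R[OF that] \<open>R + 1 \<le> norm x\<close> norm_triangle_ineq2[of x y] by (auto simp: dist_norm)
    then have "1 \<le> infdist x K"
      using assms unfolding infdist_def by (auto intro!: cINF_greatest)
    moreover have "infdist x K \<le> real (Suc n) * infdist x K"
      using infdist_nonneg[of x K] by (simp add: algebra_simps)
    ultimately have "1 \<le> real (Suc n) * infdist x K" by linarith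
    then show ?thesis unfolding bump_def by linarith
  qed
  then show ?thesis by blast
qed

text \<open>Dominated convergence with the integrand for n = 0 as majorant, since bumps decrease in
  n. The weight \<open>W\<close> may be infinite, but finiteness of the majorant forces
  \<open>bump K 0\<close> to vanish at almost every such point, and then all later bumps vanish
  there too.\<close>

lemma nn_integral_bump_tendsto:
  assumes K: "closed K" "K \<noteq> {}" and X[measurable]: "X \<in> borel_measurable M"
    and W[measurable]: "W \<in> borel_measurable M"
    and fin: "(\<integral>\<^sup>+x. W x * ennreal (bump K 0 (X x)) \<partial>M) < \<infinity>"
  shows "(\<lambda>n. \<integral>\<^sup>+x. W x * ennreal (bump K n (X x)) \<partial>M) \<longlonglongrightarrow> (\<integral>\<^sup>+x. W x * indicator K (X x) \<partial>M)"
proof (rule nn_integral_dominated_convergence[where w = "\<lambda>x. W x * ennreal (bump K 0 (X x))"])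
  have [measurable]: "K \<in> sets borel" using K by auto
  show "(\<lambda>x. W x * indicator K (X x)) \<in> borel_measurable M" by measurable
  show "AE x in M. W x * ennreal (bump K j (X x)) \<le> W x * ennreal (bump K 0 (X x))" for j
    by (intro AE_I2 mult_left_mono ennreal_leI bump_le_0) auto
  have "AE x in M. W x * ennreal (bump K 0 (X x)) \<noteq> \<infinity>"
    using fin by (intro nn_integral_noteq_infinite) auto
  then show "AE x in M. (\<lambda>n. W x * ennreal (bump K n (X x))) \<longlonglongrightarrow> W x * indicator K (X x)"
  proof eventually_elim
    case (elim x)
    show ?case
    proof (cases "W x = \<infinity>")
      case False
      have "(\<lambda>n. ennreal (bump K n (X x))) \<longlonglongrightarrow> ennreal (indicator K (X x))"
        by (intro tendsto_ennrealI bump_tendsto K)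
      then show ?thesis using False
        by (intro tendsto_mult_ennreal) (auto simp: ennreal_indicator indicator_def)
    next
      case True
      then have 0: "bump K 0 (X x) = 0"
        using elim bump_bounds(1)[of K 0 "X x"] by (auto simp: ennreal_top_mult ennreal_eq_0_iff split: if_splits)
      have "bump K n (X x) = 0" for n
        using bump_le_0[of K n "X x"] bump_bounds(1)[of K n "X x"] 0 by simp
      moreover have "indicator K (X x) = (0::real)"
        using LIMSEQ_unique[OF bump_tendsto[OF K, of "X x"]] calculation by (auto simp: tendsto_const_iff)
      then have "indicator K (X x) = (0::ennreal)" by (auto simp: indicator_def split: if_splits)
      ultimately show ?thesis by simp
    qed
  qed
qed (use fin in auto)

text \<open>A closed set is the countable union of its intersections with the balls
  \<open>cball 0 (real n)\<close>, which are compact.\<close>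

lemma sigma_sets_compact: "sigma_sets UNIV {K::'a::euclidean_space set. compact K} = sets borel"
proof -
  have "sigma_sets UNIV {K::'a set. closed K} = sets borel"
    unfolding borel_eq_closed by simp
  moreover have "K \<in> sigma_sets UNIV {K. compact K}" if "closed K" for K :: "'a set"
  proof -
    have "K = (\<Union>n. K \<inter> cball 0 (real n))"
      using real_arch_simple by auto
    moreover have "(\<Union>n. K \<inter> cball 0 (real n)) \<in> sigma_sets UNIV {K. compact K}"
      using that by (intro sigma_sets.Union sigma_sets.Basic) (auto intro: closed_Int_compact)
    ultimately show ?thesis by simp
  qed
  then have "sigma_sets UNIV {K. closed K} \<subseteq> sigma_sets UNIV {K::'a set. compact K}"
    by (intro sigma_sets_mono) auto
  moreover have "sigma_sets UNIV {K::'a set. compact K} \<subseteq> sigma_sets UNIV {K. closed K}"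
    by (intro sigma_sets_mono subsetI sigma_sets.Basic) (auto intro: compact_imp_closed)
  ultimately show ?thesis by auto
qed

text \<open>Compact sets are stable under intersection and generate the Borel sets, and bumps around
  them have compact support. Compact support matters in the applications: such functions belong to
  \<open>C0_functions\<close>, and they vanish for large first coordinate.\<close>

lemma measure_eqI_compact_support:
  fixes M N :: "'a::euclidean_space measure"
  assumes M: "sets M = sets borel" "emeasure M UNIV \<noteq> \<infinity>" and N: "sets N = sets borel"
    and eq: "\<And>f. continuous_on UNIV f \<Longrightarrow> (\<And>x. 0 \<le> f x) \<Longrightarrow> (\<And>x. f x \<le> 1) \<Longrightarrow>
      (\<exists>R. \<forall>x. R \<le> norm x \<longrightarrow> f x = 0) \<Longrightarrow> (\<integral>\<^sup>+x. ennreal (f x) \<partial>M) = (\<integral>\<^sup>+x. ennreal (f x) \<partial>N)"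
  shows "M = N"
proof (rule measure_eqI_generator_eq[where \<Omega>=UNIV and E="{K. compact K}" and A="\<lambda>n. cball 0 (real n)"])
  show "Int_stable {K::'a set. compact K}" by (auto simp: Int_stable_def compact_Int)
  have [measurable_cong]: "sets M = sets borel" "sets N = sets borel" by fact+
  show "sets M = sigma_sets UNIV {K. compact K}" "sets N = sigma_sets UNIV {K. compact K}"
    using M N by (simp_all add: sigma_sets_compact)
  show "(\<Union>i. cball (0::'a) (real i)) = UNIV" using real_arch_simple by auto
  show "emeasure M (cball 0 (real i)) \<noteq> \<infinity>" for i
    using M emeasure_space[of M "cball 0 (real i)"] sets_eq_imp_space_eq[OF M(1)] by (auto simp: top_unique)
  show "emeasure M K = emeasure N K" if "K \<in> {K. compact K}" for K
  proof (cases "K = {}")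
    case False
    have K: "closed K" "compact K" using that by (auto intro: compact_imp_closed)
    then have [measurable]: "K \<in> sets borel" by auto
    have eq': "(\<integral>\<^sup>+x. ennreal (bump K n x) \<partial>M) = (\<integral>\<^sup>+x. ennreal (bump K n x) \<partial>N)" for n
      using K False by (intro eq bump_bounds continuous_intros bump_compact_support compact_imp_bounded)
    have "(\<integral>\<^sup>+x. ennreal (bump K 0 x) \<partial>M) \<le> (\<integral>\<^sup>+x. 1 \<partial>M)"
      by (intro nn_integral_mono) (auto simp: bump_bounds ennreal_le_1)
    also have "\<dots> < \<infinity>" using M(2) sets_eq_imp_space_eq[OF M(1)] by (simp add: less_top)
    finally have fM: "(\<integral>\<^sup>+x. 1 * ennreal (bump K 0 x) \<partial>M) < \<infinity>" by simp
    then have fN: "(\<integral>\<^sup>+x. 1 * ennreal (bump K 0 x) \<partial>N) < \<infinity>" using eq' by simp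
    have "(\<lambda>n. \<integral>\<^sup>+x. ennreal (bump K n x) \<partial>M) \<longlonglongrightarrow> emeasure M K"
      using nn_integral_bump_tendsto[OF K(1) False _ _ fM, simplified] M(1) by simp
    moreover have "(\<lambda>n. \<integral>\<^sup>+x. ennreal (bump K n x) \<partial>N) \<longlonglongrightarrow> emeasure N K"
      using nn_integral_bump_tendsto[OF K(1) False _ _ fN, simplified] N(1) by simp
    ultimately show ?thesis using LIMSEQ_unique by (simp add: eq')
  qed simp
qed (auto simp: compact_imp_closed)

section \<open>The tail of the Levy measure as a limit of one-dimensional laws\<close>

lemma one_minus_exp_le: "0 \<le> x \<Longrightarrow> 0 \<le> s \<Longrightarrow> 1 - exp (- x * s) \<le> max 1 x * min 1 (s::real)"
proof -
  assume *: "0 \<le> x" "0 \<le> s"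
  show ?thesis
  proof (cases "s \<le> 1")
    case True
    have "1 - exp (- x * s) \<le> x * s" using exp_ge_add_one_self[of "- x * s"] by simp
    also have "\<dots> \<le> max 1 x * s" using * by (intro mult_right_mono) auto
    finally show ?thesis using True by (simp add: min_def)
  next
    case False
    have "1 - exp (- x * s) \<le> 1" by simp
    also have "\<dots> \<le> max 1 x * min 1 s" using False by (simp add: min_def)
    finally show ?thesis .
  qed
qed

section \<open>Elementary estimates for the Levy measure, its Laplace exponent and the laws of the
  subordinator\<close>

locale subordinator =
  fixes b :: real and \<nu> :: "real measure" and \<mu> :: "real \<Rightarrow> real measure"
  assumes b: "b \<ge> 0" and levy: "levy_measure \<nu>" and inf: "b > 0 \<or> emeasure \<nu> {0<..} = \<infinity>"
    and laws: "subordinator_laws (laplace_exponent b \<nu>) \<mu>"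
begin

abbreviation \<phi> where "\<phi> \<equiv> laplace_exponent b \<nu>"
text \<open>\<open>measure\<close> returns 0 on a set of infinite mass, which can happen for v \<le>
  0, so the value is trusted only for v > 0.\<close>

definition tail :: "real \<Rightarrow> real" where "tail v = measure \<nu> {v..}"
definition tail_n :: "nat \<Rightarrow> real \<Rightarrow> real" where
  "tail_n n v = real (Suc n) * measure (\<mu> (1 / real (Suc n))) {v..}"

lemma sets_nu [simp, measurable_cong]: "sets \<nu> = sets borel"
  using levy by (simp add: levy_measure_def)
lemma space_nu [simp]: "space \<nu> = UNIV"
  using sets_eq_imp_space_eq[OF sets_nu] by simp
lemma nu_nonpos: "emeasure \<nu> {..0} = 0"
  using levy by (simp add: levy_measure_def)
lemma nu_int: "(\<integral>\<^sup>+ s\<in>{0<..}. ennreal (min 1 s) \<partial>\<nu>) < \<infinity>"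
  using levy by (simp add: levy_measure_def)

lemma prob_mu: "0 \<le> t \<Longrightarrow> prob_space (\<mu> t)" and sets_mu: "0 \<le> t \<Longrightarrow> sets (\<mu> t) = sets borel"
  and mu_neg: "0 \<le> t \<Longrightarrow> emeasure (\<mu> t) {..<0} = 0"
  and mu_laplace: "0 \<le> t \<Longrightarrow> 0 \<le> \<theta> \<Longrightarrow> (\<integral>w. exp (- \<theta> * w) \<partial>\<mu> t) = exp (- t * \<phi> \<theta>)"
  using laws by (auto simp: subordinator_laws_def)

lemma space_mu: "0 \<le> t \<Longrightarrow> space (\<mu> t) = UNIV"
  using sets_eq_imp_space_eq[OF sets_mu] by simp

lemma AE_nu: "AE s in \<nu>. 0 < s"
  by (rule AE_I[OF _ nu_nonpos]) auto

lemma AE_mu: "0 \<le> t \<Longrightarrow> AE w in \<mu> t. 0 \<le> w"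
  by (rule AE_I[OF _ mu_neg]) (auto simp: sets_mu)

lemma integrable_mu:
  fixes f :: "real \<Rightarrow> real"
  assumes "0 \<le> t" "f \<in> borel_measurable borel" "\<And>w. 0 \<le> w \<Longrightarrow> \<bar>f w\<bar> \<le> C"
  shows "integrable (\<mu> t) f"
proof -
  interpret prob_space "\<mu> t" by (rule prob_mu) fact
  show ?thesis
    using AE_mu[OF assms(1)] assms(2,3)
    by (intro integrable_const_bound[where B=C])
       (auto elim!: eventually_mono simp: measurable_cong_sets[OF sets_mu[OF assms(1)] refl])
qed

lemma integrable_nu:
  fixes f :: "real \<Rightarrow> real"
  assumes [measurable]: "f \<in> borel_measurable borel" and le: "\<And>s. 0 < s \<Longrightarrow> \<bar>f s\<bar> \<le> C * min 1 s"
  shows "integrable \<nu> f"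
proof (rule Bochner_Integration.integrable_bound)
  show "AE x in \<nu>. norm (f x) \<le> norm (C * (indicator {0<..} x * min 1 x))"
    using AE_nu by eventually_elim (use le in force)
  have "integrable \<nu> (\<lambda>x. indicator {0<..} x * min 1 x)"
    using nu_int by (intro integrableI_nonneg)
      (auto simp: ennreal_mult' mult.commute ennreal_indicator[symmetric] indicator_def
        intro!: arg_cong[where f="\<lambda>x. x < \<infinity>"] nn_integral_cong elim!: back_subst[where P="\<lambda>x. x < top"])
  then show "integrable \<nu> (\<lambda>x. C * (indicator {0<..} x * min 1 x))" by simp
qed simp

lemma integrable_one_minus_exp: "0 \<le> \<theta> \<Longrightarrow> integrable \<nu> (\<lambda>s. 1 - exp (- \<theta> * s))"
  proof (rule integrable_nu[where C="max 1 \<theta>"])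
  fix s :: real assume *: "0 \<le> \<theta>" "0 < s"
  then have "0 \<le> 1 - exp (- \<theta> * s)" by simp
  then show "\<bar>1 - exp (- \<theta> * s)\<bar> \<le> max 1 \<theta> * min 1 s"
    using one_minus_exp_le[of \<theta> s] * by (simp only: abs_of_nonneg less_imp_le)
qed simp

lemma phi_eq: "0 \<le> \<theta> \<Longrightarrow> \<phi> \<theta> = b * \<theta> + (\<integral>s. 1 - exp (- \<theta> * s) \<partial>\<nu>)"
  unfolding laplace_exponent_def set_lebesgue_integral_def using AE_nu
  by (auto intro!: integral_cong_AE elim!: eventually_mono)

text \<open>Markov inequality: on [v,\<infinity>) the integrable function min(1,s) is at least
  min(1,v).\<close>

lemma nu_tail_finite: "0 < v \<Longrightarrow> emeasure \<nu> {v..} < \<infinity>"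
proof -
  assume v: "0 < v"
  have "ennreal (min 1 v) * emeasure \<nu> {v..} = (\<integral>\<^sup>+ s\<in>{v..}. ennreal (min 1 v) \<partial>\<nu>)"
    by (simp add: nn_integral_cmult_indicator)
  also have "\<dots> \<le> (\<integral>\<^sup>+ s\<in>{0<..}. ennreal (min 1 s) \<partial>\<nu>)"
    using v by (intro nn_integral_mono) (auto simp: indicator_def intro!: ennreal_leI)
  also have "\<dots> < \<infinity>" by (rule nu_int)
  finally show ?thesis using v by (auto simp: ennreal_mult_less_top)
qed

lemma emeasure_tail: "0 < v \<Longrightarrow> emeasure \<nu> {v..} = ennreal (tail v)"
  using nu_tail_finite[of v] by (auto simp: tail_def emeasure_eq_ennreal_measure)

lemma tail_nonneg: "0 \<le> tail v"
  by (simp add: tail_def)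

lemma tail_antimono: "0 < v \<Longrightarrow> v \<le> w \<Longrightarrow> tail w \<le> tail v"
  unfolding tail_def using nu_tail_finite[of v]
  by (intro measure_mono_fmeasurable) (auto simp: fmeasurable_def)

lemma tail_phi_le:
  assumes "0 < v" "0 \<le> \<theta>"
  shows "(1 - exp (- \<theta> * v)) * tail v \<le> (\<integral>s. 1 - exp (- \<theta> * s) \<partial>\<nu>)"
proof -
  have "(1 - exp (- \<theta> * v)) * tail v = (\<integral>s. (1 - exp (- \<theta> * v)) * indicator {v..} s \<partial>\<nu>)"
    by (simp add: tail_def)
  also have "\<dots> \<le> (\<integral>s. 1 - exp (- \<theta> * s) \<partial>\<nu>)"
    using assms AE_nu nu_tail_finite[of v]
    by (intro integral_mono_AE integrable_mult_right integrable_real_indicator integrable_one_minus_exp)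
       (auto elim!: eventually_mono simp: indicator_def intro!: mult_left_mono)
  finally show ?thesis .
qed

lemma integral_exp_nonneg: "0 \<le> \<theta> \<Longrightarrow> 0 \<le> (\<integral>s. 1 - exp (- \<theta> * s) \<partial>\<nu>)"
  using AE_nu by (intro integral_nonneg_AE) (auto elim!: eventually_mono)

lemma tail_unbounded:
  assumes "emeasure \<nu> {0<..} = \<infinity>"
  shows "\<exists>v>0. C < tail v"
proof -
  have "(\<lambda>n. emeasure \<nu> {1 / real (Suc n)..}) \<longlonglongrightarrow> emeasure \<nu> (\<Union>n. {1 / real (Suc n)..})"
    by (intro Lim_emeasure_incseq) (auto simp: incseq_def divide_le_eq mult_le_cancel_left1 field_simps intro: order_trans)
  also have "(\<Union>n. {1 / real (Suc n)..}) = {0<..}"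
  proof safe
    fix x :: real assume "0 < x"
    then obtain n where "inverse (real (Suc n)) < x" using reals_Archimedean by blast
    then show "x \<in> (\<Union>n. {1 / real (Suc n)..})" by (auto simp: inverse_eq_divide intro!: exI[of _ n])
  qed (auto intro: less_le_trans[rotated])
  finally have "eventually (\<lambda>n. ennreal C < emeasure \<nu> {1 / real (Suc n)..}) sequentially"
    using assms by (intro order_tendstoD) auto
  then obtain n where "ennreal C < emeasure \<nu> {1 / real (Suc n)..}"
    by (auto simp: eventually_sequentially)
  then have "ennreal C < ennreal (tail (1 / real (Suc n)))" by (subst (asm) emeasure_tail) auto
  then have "C < tail (1 / real (Suc n))"
    by (metis ennreal_leI linorder_not_less)
  then show ?thesis by (intro exI[of _ "1 / real (Suc n)"]) simp
qed

text \<open>The assumption on b and \<nu> enters here. A positive drift makes the linear part large;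
  infinite mass makes some tail large, which is seen at \<theta> = 1/v because 1 - e^(-\<theta>s)
  \<ge> 1 - e^(-1) \<ge> 1/2 for s \<ge> v. The consequence drawn from it is that
  \<open>\<mu> t\<close> has no mass at 0.\<close>

lemma phi_unbounded: "\<exists>\<theta>\<ge>0. C < \<phi> \<theta>"
  using inf
proof
  assume "b > 0"
  define \<theta> where "\<theta> = (\<bar>C\<bar> + 1) / b"
  have "C < b * \<theta>" using \<open>b > 0\<close> by (simp add: \<theta>_def)
  moreover have "0 \<le> \<theta>" using \<open>b > 0\<close> by (simp add: \<theta>_def)
  ultimately show ?thesis using integral_exp_nonneg[of \<theta>] phi_eq[of \<theta>] by (intro exI[of _ \<theta>]) auto
next
  assume "emeasure \<nu> {0<..} = \<infinity>"
  then obtain v where v: "0 < v" "2 * \<bar>C\<bar> < tail v" using tail_unbounded by blast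
  have "exp (- 1) \<le> (1/2::real)"
    using exp_ge_add_one_self[of "1::real"] by (simp add: exp_minus field_simps)
  then have "\<bar>C\<bar> < (1 - exp (-1)) * tail v" using v mult_right_mono[of "1/2" "1 - exp (-1)" "tail v"] tail_nonneg[of v] by auto
  also have "\<dots> \<le> \<phi> (1 / v)" using tail_phi_le[of v "1 / v"] phi_eq[of "1 / v"] v divide_nonneg_pos[OF b v(1)] by auto
  finally show ?thesis using v by (intro exI[of _ "1 / v"]) auto
qed

text \<open>Positivity of \<phi>(1) makes the subordinator tend to infinity, and it provides the
  scale of the errors in the approximation by polynomials.\<close>

lemma phi_1_pos: "0 < \<phi> 1"
  using inf
proof
  assume "b > 0" then show ?thesis using phi_eq[of 1] integral_exp_nonneg[of 1] by auto
next
  assume "emeasure \<nu> {0<..} = \<infinity>"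
  then obtain v where v: "0 < v" "0 < tail v" using tail_unbounded by blast
  then have "0 < (1 - exp (- 1 * v)) * tail v" by auto
  also have "\<dots> \<le> \<phi> 1" using tail_phi_le[of v 1] phi_eq[of 1] v b by auto
  finally show ?thesis .
qed

text \<open>Chernoff bound: the indicator of w \<le> c is at most e^(\<theta>(c-w)).\<close>

lemma mu_le_exp:
  assumes "0 \<le> t" "0 \<le> \<theta>"
  shows "measure (\<mu> t) {..c} \<le> exp (\<theta> * c - t * \<phi> \<theta>)"
proof -
  interpret prob_space "\<mu> t" by (rule prob_mu) fact
  note [measurable_cong] = sets_mu[OF assms(1)]
  have "measure (\<mu> t) {..c} = (\<integral>w. indicator {..c} w \<partial>\<mu> t)" using space_mu[OF assms(1)] by simp
  also have "\<dots> \<le> (\<integral>w. exp (\<theta> * c) * exp (- \<theta> * w) \<partial>\<mu> t)"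
    using assms
    by (intro integral_mono integrable_mult_right integrable_mu[where C=1] integrable_real_indicator)
       (auto simp: indicator_def emeasure_eq_measure mult_exp_exp mult_left_mono sets_mu)
  also have "\<dots> = exp (\<theta> * c) * exp (- t * \<phi> \<theta>)"
    by (subst integral_mult_right_zero) (simp only: mu_laplace[OF assms])
  also have "\<dots> = exp (\<theta> * c - t * \<phi> \<theta>)" by (simp add: mult_exp_exp)
  finally show ?thesis .
qed

text \<open>At c = 0 the Chernoff bound is e^(-t\<phi>(\<theta>)), which becomes arbitrarily small
  because \<phi> is unbounded.\<close>

lemma mu_nonpos: "0 < t \<Longrightarrow> emeasure (\<mu> t) {..0} = 0"
proof -
  assume t: "0 < t"
  interpret prob_space "\<mu> t" by (rule prob_mu) (use t in auto)
  have "measure (\<mu> t) {..0} \<le> 0 + e" if "e > 0" for e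
  proof -
    obtain \<theta> where "\<theta> \<ge> 0" "- ln e / t < \<phi> \<theta>" using phi_unbounded by blast
    then have "- t * \<phi> \<theta> < ln e" using t by (simp add: field_simps)
    then have "exp (- t * \<phi> \<theta>) < e" using that by (metis exp_less_cancel_iff exp_ln)
    then show ?thesis using mu_le_exp[of t \<theta> 0] \<open>\<theta> \<ge> 0\<close> t by auto
  qed
  then have "measure (\<mu> t) {..0} \<le> 0" by (rule field_le_epsilon)
  then show ?thesis by (simp add: emeasure_eq_measure measure_le_0_iff)
qed

text \<open>A bound uniform in n, which later dominates the discretised compensation formula. It
  compares the indicator of w \<ge> v with (1-e^(-w))/(1-e^(-v)) and uses 1 - e^(-h\<phi>(1)) \<le>
  h\<phi>(1).\<close>

lemma tail_n_le:
  assumes "0 < v" shows "tail_n n v \<le> \<phi> 1 / (1 - exp (- v))"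
proof -
  define h where "h = 1 / real (Suc n)"
  have h: "0 < h" by (simp add: h_def)
  interpret prob_space "\<mu> h" by (rule prob_mu) (use h in auto)
  note [measurable_cong] = sets_mu[of h]
  have "(1 - exp (- v)) * measure (\<mu> h) {v..} = (\<integral>w. (1 - exp (- v)) * indicator {v..} w \<partial>\<mu> h)"
    using space_mu[of h] h by simp
  also have "\<dots> \<le> (\<integral>w. 1 - exp (- 1 * w) \<partial>\<mu> h)"
    using assms h AE_mu[of h]
    by (intro integral_mono_AE integrable_mult_right integrable_mu[where C=1] integrable_real_indicator)
       (auto simp: indicator_def emeasure_eq_measure sets_mu elim!: eventually_mono)
  also have "\<dots> = 1 - exp (- h * \<phi> 1)"
    using h mu_laplace[of h 1] by (subst Bochner_Integration.integral_diff) (auto intro!: integrable_mu[where C=1] simp: prob_space)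
  also have "\<dots> \<le> h * \<phi> 1" using exp_ge_add_one_self[of "- h * \<phi> 1"] by simp
  finally show ?thesis using assms unfolding tail_n_def h_def by (simp add: field_simps)
qed

section \<open>Convergence of the rescaled laws tested against continuous functions\<close>

lemma tail_n_nonneg: "0 \<le> tail_n n v"
  by (simp add: tail_n_def)

text \<open>The identity (1-e^(-w)) e^(-jw) = e^(-jw) - e^(-(j+1)w) reduces the moments to Laplace
  transforms, and (1 - e^(-hx))/h tends to x as h tends to 0. The summand b is the growth of the
  linear part of \<phi> from j to j+1: in the limit the drift appears as a point mass at w =
  0.\<close>

lemma moment_tendsto:
  "(\<lambda>n. real (Suc n) * (\<integral>w. (1 - exp (- w)) * exp (- w) ^ j \<partial>\<mu> (1 / real (Suc n))))
    \<longlonglongrightarrow> b + (\<integral>s. (1 - exp (- s)) * exp (- s) ^ j \<partial>\<nu>)"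
proof -
  have *: "(1 - exp (- w)) * exp (- w) ^ j = exp (- real j * w) - exp (- real (Suc j) * w)" for w :: real
    by (simp add: algebra_simps flip: exp_of_nat_mult exp_add)
  have lim: "(\<lambda>n. real (Suc n) * (1 - exp (- (1 / real (Suc n)) * x))) \<longlonglongrightarrow> x" for x :: real
  proof -
    have "((\<lambda>h. exp (- h * x)) has_real_derivative - x) (at 0)"
      by (auto intro!: derivative_eq_intros)
    then have "((\<lambda>h. (exp (- h * x) - 1) / h) \<longlongrightarrow> - x) (at 0)"
      using DERIV_D by fastforce
    moreover have "filterlim (\<lambda>n. 1 / real (Suc n)) (at 0) sequentially"
      using LIMSEQ_inverse_real_of_nat unfolding filterlim_at inverse_eq_divide by auto
    ultimately have "(\<lambda>n. (exp (- (1 / real (Suc n)) * x) - 1) / (1 / real (Suc n))) \<longlonglongrightarrow> - x"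
      by (rule filterlim_compose)
    from tendsto_minus[OF this] show ?thesis by (simp add: algebra_simps)
  qed
  have mu: "real (Suc n) * (\<integral>w. (1 - exp (- w)) * exp (- w) ^ j \<partial>\<mu> (1 / real (Suc n)))
    = real (Suc n) * (1 - exp (- (1 / real (Suc n)) * \<phi> (real (Suc j))))
      - real (Suc n) * (1 - exp (- (1 / real (Suc n)) * \<phi> (real j)))" for n
    proof -
    define h where "h = 1 / real (Suc n)"
    have h: "0 \<le> h" by (simp add: h_def)
    have "(\<integral>w. (1 - exp (- w)) * exp (- w) ^ j \<partial>\<mu> h)
      = (\<integral>w. exp (- real j * w) \<partial>\<mu> h) - (\<integral>w. exp (- real (Suc j) * w) \<partial>\<mu> h)"
      unfolding * using h by (intro Bochner_Integration.integral_diff integrable_mu[where C=1]) (auto simp del: of_nat_Suc)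
    also have "\<dots> = exp (- h * \<phi> (real j)) - exp (- h * \<phi> (real (Suc j)))"
      by (simp only: mu_laplace[OF h] of_nat_0_le_iff)
    finally show ?thesis unfolding h_def[symmetric] by (simp only:) (simp add: algebra_simps)
  qed
  have "(\<integral>s. (1 - exp (- s)) * exp (- s) ^ j \<partial>\<nu>)
    = (\<integral>s. (1 - exp (- real (Suc j) * s)) - (1 - exp (- real j * s)) \<partial>\<nu>)"
    unfolding * by (intro Bochner_Integration.integral_cong) auto
  also have "\<dots> = (\<phi> (real (Suc j)) - b * real (Suc j)) - (\<phi> (real j) - b * real j)"
    by (subst Bochner_Integration.integral_diff[OF integrable_one_minus_exp integrable_one_minus_exp])
      (simp_all add: phi_eq del: of_nat_Suc)
  finally have nu: "b + (\<integral>s. (1 - exp (- s)) * exp (- s) ^ j \<partial>\<nu>) = \<phi> (real (Suc j)) - \<phi> (real j)"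
    by (simp add: algebra_simps)
  show ?thesis unfolding mu nu by (intro tendsto_diff lim)
qed

text \<open>The weight 1 - e^(-w) turns the rescaled laws, and likewise \<nu> completed by a mass b
  at w = 0, into measures of total mass at most \<phi>(1). A bound C for q on [0,1] therefore
  becomes the bound C\<phi>(1) for both integrals.\<close>

lemma moment_mu_bounds:
  fixes q :: "real \<Rightarrow> real"
  assumes "q \<in> borel_measurable borel" "\<And>y. y \<in> {0..1} \<Longrightarrow> \<bar>q y\<bar> \<le> C"
  shows "0 \<le> t \<Longrightarrow> integrable (\<mu> t) (\<lambda>w. (1 - exp (- w)) * q (exp (- w)))"
    and "integrable \<nu> (\<lambda>w. (1 - exp (- w)) * q (exp (- w)))"
    and "\<bar>real (Suc n) * (\<integral>w. (1 - exp (- w)) * q (exp (- w)) \<partial>\<mu> (1 / real (Suc n)))\<bar> \<le> C * \<phi> 1"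
    and "\<bar>b * q 1 + (\<integral>w. (1 - exp (- w)) * q (exp (- w)) \<partial>\<nu>)\<bar> \<le> C * \<phi> 1"
proof -
  note [measurable] = assms(1)
  have C: "0 \<le> C" using assms(2)[of 0] by auto
  have bd: "\<bar>(1 - exp (- w)) * q (exp (- w))\<bar> \<le> C * (1 - exp (- w))" if "0 \<le> w" for w
    using assms(2)[of "exp (- w)"] that mult_right_mono[of "\<bar>q (exp (- w))\<bar>" C "1 - exp (- w)"]
    by (auto simp: abs_mult mult.commute)
  show 1: "integrable (\<mu> t) (\<lambda>w. (1 - exp (- w)) * q (exp (- w)))" if "0 \<le> t" for t
  proof (rule integrable_mu[OF that, where C=C])
    fix w :: real assume w: "0 \<le> w"
    have "C * (1 - exp (- w)) \<le> C * 1" using C w by (intro mult_left_mono) auto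
    then show "\<bar>(1 - exp (- w)) * q (exp (- w))\<bar> \<le> C" using bd[OF w] by simp
  qed measurable
  show 2: "integrable \<nu> (\<lambda>w. (1 - exp (- w)) * q (exp (- w)))"
  proof (rule integrable_nu[where C=C])
    fix w :: real assume w: "0 < w"
    have "C * (1 - exp (- w)) \<le> C * min 1 w" using C w one_minus_exp_le[of 1 w] by (intro mult_left_mono) auto
    then show "\<bar>(1 - exp (- w)) * q (exp (- w))\<bar> \<le> C * min 1 w" using bd[of w] w by simp
  qed measurable
  define h where "h = 1 / real (Suc n)"
  have h: "0 < h" by (simp add: h_def)
  interpret prob_space "\<mu> h" by (rule prob_mu) (use h in auto)
  have "\<bar>\<integral>w. (1 - exp (- w)) * q (exp (- w)) \<partial>\<mu> h\<bar> \<le> (\<integral>w. C * (1 - exp (- 1 * w)) \<partial>\<mu> h)"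
    using h AE_mu[of h] bd
    by (intro integral_abs_bound[THEN order_trans] integral_mono_AE integrable_abs 1 integrable_mult_right integrable_mu[where C=1])
       (auto elim!: eventually_mono)
  also have "\<dots> = C * (1 - exp (- h * \<phi> 1))"
    using h mu_laplace[of h 1] by (subst integral_mult_right_zero, subst Bochner_Integration.integral_diff)
      (auto intro!: integrable_mu[where C=1] simp: prob_space)
  also have "\<dots> \<le> C * (h * \<phi> 1)"
    using exp_ge_add_one_self[of "- h * \<phi> 1"] C by (intro mult_left_mono) auto
  finally have "real (Suc n) * \<bar>\<integral>w. (1 - exp (- w)) * q (exp (- w)) \<partial>\<mu> h\<bar> \<le> real (Suc n) * (C * (h * \<phi> 1))"
    by (rule mult_left_mono) simp
  also have "\<dots> = C * \<phi> 1" by (simp add: h_def)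
  finally show "\<bar>real (Suc n) * (\<integral>w. (1 - exp (- w)) * q (exp (- w)) \<partial>\<mu> (1 / real (Suc n)))\<bar> \<le> C * \<phi> 1"
    unfolding h_def abs_mult by simp
  have "\<bar>\<integral>w. (1 - exp (- w)) * q (exp (- w)) \<partial>\<nu>\<bar> \<le> (\<integral>w. C * (1 - exp (- 1 * w)) \<partial>\<nu>)"
    using AE_nu bd
    by (intro integral_abs_bound[THEN order_trans] integral_mono_AE integrable_abs 2 integrable_mult_right integrable_one_minus_exp)
       (auto elim!: eventually_mono)
  also have "\<dots> = C * (\<phi> 1 - b)" by (subst integral_mult_right_zero) (simp add: phi_eq[of 1])
  finally have "\<bar>\<integral>w. (1 - exp (- w)) * q (exp (- w)) \<partial>\<nu>\<bar> \<le> C * \<phi> 1 - b * C" by (simp add: algebra_simps)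
  moreover have "\<bar>b * q 1\<bar> \<le> b * C" using b assms(2)[of 1] by (simp add: abs_mult mult_left_mono)
  ultimately show "\<bar>b * q 1 + (\<integral>w. (1 - exp (- w)) * q (exp (- w)) \<partial>\<nu>)\<bar> \<le> C * \<phi> 1" by linarith
qed

text \<open>Since \<open>y = e\<^sup>-\<^sup>w\<close> turns Laplace transforms at integers into moments on \<open>[0,1]\<close>, the
  Weierstrass theorem upgrades their convergence to continuous functions of \<open>y\<close>.\<close>

lemma vague_tendsto:
  fixes q :: "real \<Rightarrow> real"
  assumes q: "continuous_on UNIV q"
  shows "(\<lambda>n. real (Suc n) * (\<integral>w. (1 - exp (- w)) * q (exp (- w)) \<partial>\<mu> (1 / real (Suc n))))
    \<longlonglongrightarrow> b * q 1 + (\<integral>s. (1 - exp (- s)) * q (exp (- s)) \<partial>\<nu>)"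
proof -
  define I where "I n f = real (Suc n) * (\<integral>w. (1 - exp (- w)) * f (exp (- w)) \<partial>\<mu> (1 / real (Suc n)))" for n f
  define J where "J f = b * f 1 + (\<integral>s. (1 - exp (- s)) * f (exp (- s)) \<partial>\<nu>)" for f
  have bdd: "\<exists>C. \<forall>y\<in>{0..1}. \<bar>f y\<bar> \<le> C" if "continuous_on UNIV f" for f :: "real \<Rightarrow> real"
    using compact_imp_bounded[OF compact_continuous_image[OF continuous_on_subset[OF that] compact_Icc[of 0 1]]]
    by (auto simp: bounded_iff)
  have diff: "I n (\<lambda>y. f y - g y) = I n f - I n g" "J (\<lambda>y. f y - g y) = J f - J g"
    if f: "continuous_on UNIV f" and g: "continuous_on UNIV g" for n and f g :: "real \<Rightarrow> real"
  proof -
    obtain C D where C: "\<forall>y\<in>{0..1}. \<bar>f y\<bar> \<le> C" "\<forall>y\<in>{0..1}. \<bar>g y\<bar> \<le> D" using bdd f g by meson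
    note m = borel_measurable_continuous_onI[OF f] borel_measurable_continuous_onI[OF g]
    show "I n (\<lambda>y. f y - g y) = I n f - I n g"
      unfolding I_def right_diff_distrib
      by (subst Bochner_Integration.integral_diff)
         (use C moment_mu_bounds(1)[OF m(1), of C] moment_mu_bounds(1)[OF m(2), of D] in \<open>auto simp: algebra_simps\<close>)
    show "J (\<lambda>y. f y - g y) = J f - J g"
      unfolding J_def right_diff_distrib
      by (subst Bochner_Integration.integral_diff)
         (use C moment_mu_bounds(2)[OF m(1), of C] moment_mu_bounds(2)[OF m(2), of D] in \<open>auto simp: algebra_simps\<close>)
  qed
  have sums: "I n (\<lambda>y. \<Sum>i\<le>N. a i * y ^ i) = (\<Sum>i\<le>N. a i * I n (\<lambda>y. y ^ i))"
    "J (\<lambda>y. \<Sum>i\<le>N. a i * y ^ i) = (\<Sum>i\<le>N. a i * J (\<lambda>y. y ^ i))" for n N and a :: "nat \<Rightarrow> real"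
  proof -
    have m: "(\<lambda>y::real. y ^ i) \<in> borel_measurable borel" "\<And>y. y \<in> {0..1} \<Longrightarrow> \<bar>y ^ i\<bar> \<le> (1::real)" for i
      by (auto simp: power_le_one)
    have e: "(1 - exp (- w)) * (\<Sum>i\<le>N. a i * exp (- w) ^ i) = (\<Sum>i\<le>N. a i * ((1 - exp (- w)) * exp (- w) ^ i))" for w :: real
      by (simp add: sum_distrib_left algebra_simps)
    have "(\<integral>w. (\<Sum>i\<le>N. a i * ((1 - exp (- w)) * exp (- w) ^ i)) \<partial>M)
      = (\<Sum>i\<le>N. a i * (\<integral>w. (1 - exp (- w)) * exp (- w) ^ i \<partial>M))"
      if "\<And>i. integrable M (\<lambda>w. (1 - exp (- w)) * exp (- w) ^ i)" for M :: "real measure"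
      using that by (subst Bochner_Integration.integral_sum) auto
    note I = this[OF moment_mu_bounds(1)[OF m]] this[OF moment_mu_bounds(2)[OF m]]
    show "I n (\<lambda>y. \<Sum>i\<le>N. a i * y ^ i) = (\<Sum>i\<le>N. a i * I n (\<lambda>y. y ^ i))"
      unfolding I_def e by (subst I) (simp_all add: sum_distrib_left mult.left_commute)
    show "J (\<lambda>y. \<Sum>i\<le>N. a i * y ^ i) = (\<Sum>i\<le>N. a i * J (\<lambda>y. y ^ i))"
    proof -
      have "b * (\<Sum>i\<le>N. a i * 1 ^ i) = (\<Sum>i\<le>N. a i * (b * 1 ^ i))"
        by (simp add: sum_distrib_left mult.commute)
      then show ?thesis unfolding J_def e by (subst I(2)) (simp_all only: distrib_left sum.distrib)
    qed
  qed
  have "(\<lambda>n. I n q) \<longlonglongrightarrow> J q"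
  proof (rule metric_LIMSEQ_I)
    fix r :: real assume r: "0 < r"
    \<comment> \<open>Replacing q by a polynomial costs at most e\<phi>(1) in the approximants and
      again in the limit, and the convergence of the moments contributes a third such term; with
      this e each of them is r/3.\<close>
    define e where "e = r / (3 * \<phi> 1)"
    have e: "0 < e" using r phi_1_pos by (simp add: e_def)
    obtain p where p: "real_polynomial_function p" "\<And>y. y \<in> {0..1} \<Longrightarrow> \<bar>q y - p y\<bar> < e"
      using Stone_Weierstrass_real_polynomial_function[OF compact_Icc continuous_on_subset[OF q] e] by (metis top_greatest)
    obtain a N where a: "p = (\<lambda>y. \<Sum>i\<le>N. a i * y ^ i)" using p(1) by (auto simp: real_polynomial_function_iff_sum)
    have cp: "continuous_on UNIV p" unfolding a by (intro continuous_intros)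
    have m: "(\<lambda>y. q y - p y) \<in> borel_measurable borel"
      by (intro borel_measurable_continuous_onI continuous_intros q cp)
    have "(\<lambda>n. I n p) \<longlonglongrightarrow> J p"
      unfolding a sums using moment_tendsto by (intro tendsto_intros) (simp add: I_def J_def)
    then obtain M where M: "\<And>n. n \<ge> M \<Longrightarrow> dist (I n p) (J p) < e * \<phi> 1"
      using metric_LIMSEQ_D[of "\<lambda>n. I n p" "J p" "e * \<phi> 1"] e phi_1_pos by auto
    have "\<bar>I n q - I n p\<bar> \<le> e * \<phi> 1" "\<bar>J q - J p\<bar> \<le> e * \<phi> 1" for n
      unfolding diff(1)[OF q cp, symmetric] diff(2)[OF q cp, symmetric]
      using moment_mu_bounds(3,4)[OF m, of e] p(2) by (auto simp: I_def J_def less_imp_le)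
    then have "dist (I n q) (J q) < r" if "n \<ge> M" for n
    proof -
      have "e * \<phi> 1 = r / 3" using phi_1_pos by (simp add: e_def)
      then show ?thesis
        using M[OF that] \<open>\<And>n. \<bar>I n q - I n p\<bar> \<le> e * \<phi> 1\<close>[of n] \<open>\<bar>J q - J p\<bar> \<le> e * \<phi> 1\<close>
        unfolding dist_real_def by linarith
    qed
    then show "\<exists>M. \<forall>n\<ge>M. dist (I n q) (J q) < r" by blast
  qed
  then show ?thesis by (simp add: I_def J_def)
qed

section \<open>Tails of the Levy measure and their approximation at points without atom\<close>

lemma tail_left_cont:
  assumes "0 < v" "\<And>n. c n \<le> v" "c \<longlonglongrightarrow> v"
  shows "(\<lambda>n. tail (c n)) \<longlonglongrightarrow> tail v"
proof (rule order_tendstoI)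
  fix e assume "e < tail v"
  have "eventually (\<lambda>n. 0 < c n) sequentially" using order_tendstoD(1)[OF assms(3,1)] .
  then show "eventually (\<lambda>n. e < tail (c n)) sequentially"
  proof eventually_elim
    case (elim n)
    then show ?case using \<open>e < tail v\<close> assms(2)[of n] tail_antimono[of "c n" v] by simp
  qed
next
  fix e assume e: "tail v < e"
  \<comment> \<open>The factor keeps every \<open>a k\<close> strictly below v and positive, where
    tails are finite; k + 2 in place of k + 1 excludes the value 0 at k = 0.\<close>
  define a where "a k = v * (1 - 1 / real (k + 2))" for k :: nat
  have a: "0 < a k" "a k < v" for k using assms(1) by (auto simp: a_def field_simps intro!: add_pos_nonneg)
  have lima: "a \<longlonglongrightarrow> v"
  proof -
    have "(\<lambda>k. v * (1 - 1 / real (k + 2))) \<longlonglongrightarrow> v * (1 - 0)"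
      by (intro tendsto_intros LIMSEQ_ignore_initial_segment[where k=2, OF lim_1_over_n])
    then show ?thesis by (simp add: a_def[abs_def])
  qed
  have "(\<lambda>k. measure \<nu> {a k..}) \<longlonglongrightarrow> measure \<nu> (\<Inter>k. {a k..})"
  proof (rule Lim_measure_decseq)
    have "a m \<le> a n" if "m \<le> n" for m n
      unfolding a_def using assms(1) that by (intro mult_left_mono diff_mono frac_le) auto
    then show "decseq (\<lambda>k. {a k..})" by (simp add: decseq_def)
    show "emeasure \<nu> {a k..} \<noteq> \<infinity>" for k using nu_tail_finite[OF a(1), of k] by simp
  qed auto
  also have "(\<Inter>k. {a k..}) = {v..}"
  proof (intro equalityI subsetI INT_I)
    fix x assume "x \<in> (\<Inter>k. {a k..})"
    then show "x \<in> {v..}" using LIMSEQ_le_const2[OF lima, of x] by auto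
  next
    fix x k assume "x \<in> {v..}"
    then show "x \<in> {a k..}" using a(2)[of k] by auto
  qed
  finally have "eventually (\<lambda>k. tail (a k) < e) sequentially" using e by (intro order_tendstoD) (auto simp: tail_def)
  then obtain k where k: "tail (a k) < e" by (auto simp: eventually_sequentially)
  have "eventually (\<lambda>n. a k < c n) sequentially" using order_tendstoD(1)[OF assms(3) a(2)] .
  then show "eventually (\<lambda>n. tail (c n) < e) sequentially"
  proof eventually_elim
    case (elim n)
    then show ?case using k a(1)[of k] tail_antimono[of "a k" "c n"] by simp
  qed
qed

text \<open>Without an atom at v the half-lines [v,\<infinity>) and (v,\<infinity>) have the same
  mass, and the latter is the increasing union of the half-lines starting at v + 1/(k+1).\<close>

lemma tail_right_cont:
  assumes "0 < v" "emeasure \<nu> {v} = 0" "e < tail v"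
  shows "\<exists>w>v. e < tail w"
proof -
  have "(\<lambda>k. measure \<nu> {v + 1 / real (Suc k)..}) \<longlonglongrightarrow> measure \<nu> (\<Union>k. {v + 1 / real (Suc k)..})"
  proof (rule Lim_measure_incseq)
    show "incseq (\<lambda>k. {v + 1 / real (Suc k)..})"
      by (simp add: incseq_def frac_le)
    have "{v + 1 / real (Suc k)..} \<subseteq> {v..}" for k by simp
    then have "(\<Union>k. {v + 1 / real (Suc k)..}) \<subseteq> {v..}" by (intro UN_least)
    then have "emeasure \<nu> (\<Union>k. {v + 1 / real (Suc k)..}) \<le> emeasure \<nu> {v..}" by (intro emeasure_mono) auto
    then show "emeasure \<nu> (\<Union>k. {v + 1 / real (Suc k)..}) \<noteq> \<infinity>"
      using nu_tail_finite[OF assms(1)] by (auto simp: top_unique)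
  qed auto
  also have "(\<Union>k. {v + 1 / real (Suc k)..}) = {v<..}"
  proof safe
    fix x assume "v < x"
    then obtain n where "inverse (real (Suc n)) < x - v" using reals_Archimedean[of "x - v"] by auto
    then show "x \<in> (\<Union>k. {v + 1 / real (Suc k)..})" by (auto simp: inverse_eq_divide algebra_simps intro!: exI[of _ n])
  next
    fix x k assume "v + 1 / real (Suc k) \<le> x"
    moreover have "0 < 1 / real (Suc k)" by simp
    ultimately show "v < x" by linarith
  qed
  also have "measure \<nu> {v<..} = tail v"
  proof -
    have "{v..} = {v} \<union> {v<..}" by auto
    moreover have "emeasure \<nu> ({v} \<union> {v<..}) = emeasure \<nu> {v<..}"
      using assms(2) emeasure_Un_null_set[of "{v<..}" \<nu> "{v}"] by (auto simp: null_sets_def Un_commute)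
    ultimately show ?thesis unfolding tail_def measure_def by simp
  qed
  finally have "eventually (\<lambda>k. e < tail (v + 1 / real (Suc k))) sequentially"
    using assms by (intro order_tendstoD) (auto simp: tail_def)
  then obtain k where "e < tail (v + 1 / real (Suc k))" by (auto simp: eventually_sequentially)
  then show ?thesis by (intro exI[of _ "v + 1 / real (Suc k)"]) auto
qed

text \<open>A ramp in w between a1 and a2 lies between the two indicators, and its integrals
  converge by \<open>vague_tendsto\<close> once it is written as (1-y) q(y) with y = e^(-w). This is
  possible because the ramp vanishes for w \<le> a1, hence near y = 1; for the same reason the drift
  term b q(1) disappears.\<close>

lemma ramp_tendsto:
  assumes "0 < a1" "a1 < a2"
  shows "\<exists>I J. I \<longlonglongrightarrow> J \<and> (\<forall>n. tail_n n a2 \<le> I n \<and> I n \<le> tail_n n a1) \<and> tail a2 \<le> J \<and> J \<le> tail a1"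
proof -
  define \<alpha> \<beta> where "\<alpha> = exp (- a1)" and "\<beta> = exp (- a2)"
  have ab: "0 < \<beta>" "\<beta> < \<alpha>" "\<alpha> < 1" using assms by (auto simp: \<alpha>_def \<beta>_def)
  define r where "r y = max 0 (min 1 ((\<alpha> - y) / (\<alpha> - \<beta>)))" for y
  \<comment> \<open>The maximum keeps the denominator away from 0, so q is continuous everywhere;
    where r is nonzero one has y < \<alpha> and the maximum equals 1 - y.\<close>
  define q where "q y = r y / max (1 - \<alpha>) (1 - y)" for y
  have r: "0 \<le> r y" "r y \<le> 1" "y \<le> \<beta> \<Longrightarrow> r y = 1" "\<alpha> \<le> y \<Longrightarrow> r y = 0" for y
    using ab by (auto simp: r_def min_def max_def field_simps)
  have [measurable]: "r \<in> borel_measurable borel" unfolding r_def[abs_def] by measurable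
  have q: "(1 - y) * q y = r y" for y
  proof (cases "\<alpha> \<le> y")
    case False
    then show ?thesis using ab by (auto simp: q_def max_def)
  qed (simp add: q_def r)
  have cq: "continuous_on UNIV q"
    unfolding q_def[abs_def] r_def using ab by (intro continuous_intros) (auto simp: max_def)
  have b1: "indicator {a2..} w \<le> r (exp (- w))" "r (exp (- w)) \<le> indicator {a1..} w" for w
    using r[of "exp (- w)"] by (auto simp: indicator_def \<alpha>_def \<beta>_def)
  have lim: "(\<lambda>n. real (Suc n) * (\<integral>w. r (exp (- w)) \<partial>\<mu> (1 / real (Suc n)))) \<longlonglongrightarrow> (\<integral>w. r (exp (- w)) \<partial>\<nu>)"
    using vague_tendsto[OF cq] r(4)[of 1] ab unfolding q by (simp add: q_def)
  have n1: "tail_n n a2 \<le> real (Suc n) * (\<integral>w. r (exp (- w)) \<partial>\<mu> (1 / real (Suc n)))"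
    "real (Suc n) * (\<integral>w. r (exp (- w)) \<partial>\<mu> (1 / real (Suc n))) \<le> tail_n n a1" for n
  proof -
    define h where "h = 1 / real (Suc n)"
    have h: "0 \<le> h" by (simp add: h_def)
    interpret prob_space "\<mu> h" by (rule prob_mu[OF h])
    have m: "measure (\<mu> h) {a..} = (\<integral>w. indicator {a..} w \<partial>\<mu> h)" for a using space_mu[OF h] by simp
    have i: "integrable (\<mu> h) (\<lambda>w. indicator {a..} w :: real)" "integrable (\<mu> h) (\<lambda>w. r (exp (- w)))" for a
      using r by (auto intro!: integrable_mu[OF h, where C=1] simp: abs_le_iff)
    show "tail_n n a2 \<le> real (Suc n) * (\<integral>w. r (exp (- w)) \<partial>\<mu> (1 / real (Suc n)))"
      "real (Suc n) * (\<integral>w. r (exp (- w)) \<partial>\<mu> (1 / real (Suc n))) \<le> tail_n n a1"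
      unfolding tail_n_def h_def[symmetric] m by (intro mult_left_mono integral_mono i b1; simp)+
  qed
  have i: "integrable \<nu> (\<lambda>w. indicator {a..} w :: real)" if "0 < a" for a
    using nu_tail_finite[OF that] by (intro integrable_real_indicator) auto
  have i2: "integrable \<nu> (\<lambda>w. r (exp (- w)))"
    using i[OF assms(1)] by (rule Bochner_Integration.integrable_bound) (use b1 r in \<open>auto simp: abs_le_iff\<close>)
  have m: "tail a = (\<integral>w. indicator {a..} w \<partial>\<nu>)" for a by (simp add: tail_def)
  have n2: "tail a2 \<le> (\<integral>w. r (exp (- w)) \<partial>\<nu>)" "(\<integral>w. r (exp (- w)) \<partial>\<nu>) \<le> tail a1"
    unfolding m using assms by (intro integral_mono i i2 b1; simp)+
  from lim n1 n2 show ?thesis by blast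
qed

text \<open>The levels \<open>u n\<close> move with n, so convergence at the single level v would
  not suffice. By monotonicity they are caught between fixed levels on either side of v, to which
  the ramps apply, and the gap closes because \<open>tail\<close> is continuous at a point without
  atom.\<close>

lemma tail_n_tendsto:
  assumes v: "0 < v" "emeasure \<nu> {v} = 0" "u \<longlonglongrightarrow> v"
  shows "(\<lambda>n. tail_n n (u n)) \<longlonglongrightarrow> tail v"
proof (rule order_tendstoI)
  have mono: "tail_n n w \<le> tail_n n w'" if "w' \<le> w" for n w w'
  proof -
    interpret prob_space "\<mu> (1 / real (Suc n))" by (rule prob_mu) simp
    show ?thesis unfolding tail_n_def using that by (intro mult_left_mono finite_measure_mono) (auto simp: sets_mu)
  qed
  fix e
  {
    assume "e < tail v"
    then obtain w where w: "w > v" "e < tail w" using tail_right_cont v by blast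
    obtain I J where I: "I \<longlonglongrightarrow> J" "\<forall>n. I n \<le> tail_n n ((v + w) / 2)" "tail w \<le> J"
      using ramp_tendsto[of "(v + w) / 2" w] v w by auto
    have "eventually (\<lambda>n. e < I n) sequentially" using order_tendstoD(1)[OF I(1), of e] I w by auto
    moreover have "eventually (\<lambda>n. u n < (v + w) / 2) sequentially" using order_tendstoD(2)[OF v(3), of "(v + w) / 2"] w by auto
    ultimately show "eventually (\<lambda>n. e < tail_n n (u n)) sequentially"
    proof eventually_elim
      case (elim n)
      then show ?case using I(2)[rule_format, of n] mono[of "u n" "(v + w) / 2" n] by linarith
    qed
  }
  {
    assume "tail v < e"
    have "(\<lambda>n. v - v / real (n + 2)) \<longlonglongrightarrow> v - 0"
      by (intro tendsto_intros LIMSEQ_ignore_initial_segment[where k=2, OF lim_const_over_n])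
    then have "(\<lambda>n. tail (v - v / real (n + 2))) \<longlonglongrightarrow> tail v"
      using v(1) by (intro tail_left_cont) auto
    then have "eventually (\<lambda>n. tail (v - v / real (n + 2)) < e) sequentially"
      using \<open>tail v < e\<close> by (intro order_tendstoD)
    then obtain k :: nat where k: "tail (v - v / real (k + 2)) < e" by (auto simp: eventually_sequentially)
    define w where "w = v - v / real (k + 2)"
    have "v / real (k + 2) < v" using v(1) by (simp add: divide_less_eq add_pos_nonneg)
    then have w: "0 < w" "w < v" "tail w < e" using k v(1) by (auto simp: w_def)
    obtain I J where I: "I \<longlonglongrightarrow> J" "\<forall>n. tail_n n ((v + w) / 2) \<le> I n" "J \<le> tail w"
      using ramp_tendsto[of w "(v + w) / 2"] v w by auto
    have "eventually (\<lambda>n. I n < e) sequentially" using order_tendstoD(2)[OF I(1), of e] I w by auto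
    moreover have "eventually (\<lambda>n. (v + w) / 2 < u n) sequentially" using order_tendstoD(1)[OF v(3), of "(v + w) / 2"] w by auto
    ultimately show "eventually (\<lambda>n. tail_n n (u n) < e) sequentially"
    proof eventually_elim
      case (elim n)
      then show ?case using I(2)[rule_format, of n] mono[of "(v + w) / 2" "u n" n] by linarith
    qed
  }
qed

text \<open>\<nu> can have infinite mass near 0, so the claim is read off from the finite measure
  min(1,s)\<nu>(ds), which has the same atoms on (0,\<infinity>).\<close>

lemma countable_atoms: "countable {v. 0 < v \<and> emeasure \<nu> {v} \<noteq> 0}"
proof -
  define m where "m = density \<nu> (\<lambda>s. indicator {0<..} s * ennreal (min 1 s))"
  have "emeasure m (space m) = (\<integral>\<^sup>+ s\<in>{0<..}. ennreal (min 1 s) \<partial>\<nu>)"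
    by (simp add: m_def emeasure_density mult.commute)
  then interpret m: finite_measure m
    using nu_int by (intro finite_measureI) auto
  have "{v. 0 < v \<and> emeasure \<nu> {v} \<noteq> 0} \<subseteq> {x. measure m {x} \<noteq> 0}"
  proof safe
    fix v assume v: "0 < v" "emeasure \<nu> {v} \<noteq> 0" "measure m {v} = 0"
    have "emeasure m {v} = (\<integral>\<^sup>+ s. ennreal (min 1 v) * indicator {v} s \<partial>\<nu>)"
      unfolding m_def using v(1) by (subst emeasure_density) (auto intro!: nn_integral_cong simp: indicator_def)
    also have "\<dots> = ennreal (min 1 v) * emeasure \<nu> {v}" by (simp add: nn_integral_cmult_indicator)
    finally show False using v by (simp add: m.emeasure_eq_measure)
  qed
  then show ?thesis using m.countable_support countable_subset by blast
qed

end

section \<open>Increasing paths and their inverses\<close>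

text \<open>Left limits come for free from monotonicity. Membership in \<open>extensional\<close>
  makes these paths points of the product space indexed by [0,\<infinity>), and unboundedness makes
  every first passage time finite.\<close>

definition good_paths :: "(real \<Rightarrow> real) set" where
  "good_paths = {\<omega> \<in> extensional {0..}. \<omega> 0 = 0 \<and> strict_mono_on {0..} \<omega> \<and>
     (\<forall>t\<ge>0. (\<omega> \<longlongrightarrow> \<omega> t) (at_right t)) \<and> (\<forall>c. \<exists>t\<ge>0. c < \<omega> t)}"

definition good_space :: "(real \<Rightarrow> real) measure" where
  "good_space = restrict_space (Pi\<^sub>M {0..} (\<lambda>_. borel)) good_paths"

definition below :: "real \<Rightarrow> (real \<Rightarrow> real) \<Rightarrow> real set" where
  "below t \<omega> = {s. 0 \<le> s \<and> \<omega> s < t}"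

text \<open>On strictly increasing paths this supremum of the times strictly below t equals the
  infimum of the times strictly above t. The supremum form is visibly left-continuous in t and uses
  the same set as \<open>undershoot\<close>. For t \<le> 0 that set is empty and its supremum
  unspecified, hence the case distinction.\<close>

definition inverse_at :: "real \<Rightarrow> (real \<Rightarrow> real) \<Rightarrow> real" where
  "inverse_at t \<omega> = (if t \<le> 0 then 0 else Sup (below t \<omega>))"

definition undershoot :: "real \<Rightarrow> (real \<Rightarrow> real) \<Rightarrow> real" where
  "undershoot t \<omega> = (if t \<le> 0 then 0 else Sup (\<omega> ` below t \<omega>))"

definition left_lim :: "real \<Rightarrow> (real \<Rightarrow> real) \<Rightarrow> real" where
  "left_lim u \<omega> = (if u \<le> 0 then 0 else Sup (\<omega> ` {0..<u}))"

definition paste :: "real \<Rightarrow> (real \<Rightarrow> real) \<Rightarrow> (real \<Rightarrow> real) \<Rightarrow> real \<Rightarrow> real" where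
  "paste a \<omega> \<eta> = (\<lambda>s\<in>{0..}. if s \<le> a then \<omega> s else \<omega> a + \<eta> (s - a))"

lemma space_good_space: "space good_space = good_paths"
  by (auto simp: good_space_def space_restrict_space space_PiM good_paths_def extensional_def)

section \<open>Order and continuity properties of a single increasing path\<close>

context
  fixes \<omega> assumes \<omega>: "\<omega> \<in> good_paths"
begin

lemma good_0: "\<omega> 0 = 0"
  and good_less: "0 \<le> s \<Longrightarrow> s < t \<Longrightarrow> \<omega> s < \<omega> t"
  and good_right: "0 \<le> t \<Longrightarrow> (\<omega> \<longlongrightarrow> \<omega> t) (at_right t)"
  and good_unbounded: "\<exists>t\<ge>0. c < \<omega> t"
  using \<omega> by (auto simp: good_paths_def strict_mono_on_def)

lemma good_le: "0 \<le> s \<Longrightarrow> s \<le> t \<Longrightarrow> \<omega> s \<le> \<omega> t"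
  using good_less[of s t] by (cases "s = t") auto

lemma good_less_iff: "0 \<le> s \<Longrightarrow> 0 \<le> t \<Longrightarrow> \<omega> s < \<omega> t \<longleftrightarrow> s < t"
  using good_less[of s t] good_le[of t s] by force

lemma good_nonneg: "0 \<le> t \<Longrightarrow> 0 \<le> \<omega> t"
  using good_le[of 0 t] good_0 by simp

lemma good_right_less:
  assumes "0 \<le> s" "\<omega> s < t" "s < u"
  shows "\<exists>r. s < r \<and> r < u \<and> \<omega> r < t"
proof -
  have "eventually (\<lambda>r. \<omega> r < t) (at_right s)"
    using order_tendstoD(2)[OF good_right[OF assms(1)] assms(2)] .
  moreover have "eventually (\<lambda>r. r < u) (at_right s)"
    using assms(3) by (auto simp: eventually_at_right intro!: exI[of _ u])
  moreover have "eventually (\<lambda>r. s < r) (at_right s)" by (simp add: eventually_at_right_less)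
  ultimately have "eventually (\<lambda>r. s < r \<and> r < u \<and> \<omega> r < t) (at_right s)" by eventually_elim simp
  then show ?thesis using eventually_happens[of _ "at_right s"] by (auto simp: trivial_limit_at_right_real)
qed

lemma below_bdd: "bdd_above (below t \<omega>)" "bdd_above (\<omega> ` below t \<omega>)"
proof -
  obtain c where c: "0 \<le> c" "t < \<omega> c" using good_unbounded by blast
  show "bdd_above (below t \<omega>)"
  proof (rule bdd_aboveI)
    fix s assume "s \<in> below t \<omega>"
    then show "s \<le> c" using c good_less_iff[of s c] by (auto simp: below_def)
  qed
  show "bdd_above (\<omega> ` below t \<omega>)" by (rule bdd_aboveI[of _ t]) (auto simp: below_def)
qed

lemma zero_below: "0 < t \<Longrightarrow> 0 \<in> below t \<omega>"
  by (simp add: below_def good_0)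

text \<open>The Galois relation behind most properties of the inverse. One direction uses that the
  path increases, the other that it is right-continuous: a value strictly below t leaves room for a
  later time whose value is still below t.\<close>

lemma less_inverse_iff:
  assumes "0 < t" "0 \<le> s" shows "s < inverse_at t \<omega> \<longleftrightarrow> \<omega> s < t"
proof
  assume "s < inverse_at t \<omega>"
  then obtain r where "r \<in> below t \<omega>" "s < r"
    using assms zero_below[of t] less_cSup_iff[OF _ below_bdd(1), of t s] by (auto simp: inverse_at_def)
  then show "\<omega> s < t" using good_less[of s r] assms by (auto simp: below_def)
next
  assume "\<omega> s < t"
  then obtain r where "s < r" "\<omega> r < t" using good_right_less[OF assms(2), of t "s + 1"] by auto
  then have "r \<le> inverse_at t \<omega>"
    using assms by (auto simp: inverse_at_def below_def intro!: cSup_upper below_bdd(1)[unfolded below_def])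
  then show "s < inverse_at t \<omega>" using \<open>s < r\<close> by simp
qed

lemma inverse_nonneg: "0 \<le> inverse_at t \<omega>"
  using less_inverse_iff[of t 0] good_0 by (cases "t \<le> 0") (auto simp: inverse_at_def)

lemma inverse_pos: "0 < t \<Longrightarrow> 0 < inverse_at t \<omega>"
  using less_inverse_iff[of t 0] good_0 by auto

lemma inverse_le_iff: "0 < t \<Longrightarrow> 0 \<le> s \<Longrightarrow> inverse_at t \<omega> \<le> s \<longleftrightarrow> t \<le> \<omega> s"
  using less_inverse_iff[of t s] by auto

lemma overshoot_ge: "0 < t \<Longrightarrow> t \<le> \<omega> (inverse_at t \<omega>)"
  using inverse_le_iff[of t "inverse_at t \<omega>"] inverse_nonneg by auto

lemma inverse_mono: "t \<le> t' \<Longrightarrow> inverse_at t \<omega> \<le> inverse_at t' \<omega>"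
  using inverse_le_iff[of t "inverse_at t' \<omega>"] overshoot_ge[of t'] inverse_nonneg[of t']
  by (cases "t \<le> 0") (auto simp: inverse_at_def)

lemma below_eq: "0 < t \<Longrightarrow> below t \<omega> = {0..<inverse_at t \<omega>}"
  using less_inverse_iff[of t] by (auto simp: below_def)

lemma undershoot_eq: "0 < t \<Longrightarrow> undershoot t \<omega> = left_lim (inverse_at t \<omega>) \<omega>"
  using below_eq[of t] inverse_pos[of t] by (simp add: undershoot_def left_lim_def)

lemma bdd_left: "bdd_above (\<omega> ` {0..<u})"
  by (rule bdd_aboveI[of _ "\<omega> u"]) (auto intro: good_le)

lemma le_left_lim: "0 \<le> s \<Longrightarrow> s < u \<Longrightarrow> \<omega> s \<le> left_lim u \<omega>"
  by (auto simp: left_lim_def intro!: cSUP_upper bdd_left)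

lemma less_left_lim: "0 \<le> s \<Longrightarrow> s < u \<Longrightarrow> \<omega> s < left_lim u \<omega>"
  using good_less[of s "(s + u) / 2"] le_left_lim[of "(s + u) / 2" u] by auto

lemma left_lim_le: "0 \<le> u \<Longrightarrow> left_lim u \<omega> \<le> \<omega> u"
  by (auto simp: left_lim_def good_0 intro!: cSUP_least good_le)

lemma left_lim_strict_mono: "0 \<le> u \<Longrightarrow> u < v \<Longrightarrow> left_lim u \<omega> < left_lim v \<omega>"
  using left_lim_le[of u] less_left_lim[of u v] by simp

lemma left_lim_tendsto:
  assumes u: "0 < u" and f: "\<And>n. f n < u" "f \<longlonglongrightarrow> u" "\<And>n. 0 \<le> f n"
  shows "(\<lambda>n. \<omega> (f n)) \<longlonglongrightarrow> left_lim u \<omega>"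
proof (rule order_tendstoI)
  fix c assume "c < left_lim u \<omega>"
  then obtain s where s: "0 \<le> s" "s < u" "c < \<omega> s"
    using u less_cSup_iff[OF _ bdd_left, of u c] by (auto simp: left_lim_def)
  from order_tendstoD(1)[OF f(2) s(2)] show "eventually (\<lambda>n. c < \<omega> (f n)) sequentially"
    by eventually_elim (use s good_less less_trans in blast)
next
  fix c assume "left_lim u \<omega> < c"
  then show "eventually (\<lambda>n. \<omega> (f n) < c) sequentially"
    using le_left_lim[OF f(3) f(1)] by (intro always_eventually allI) (auto intro: le_less_trans)
qed

lemma right_tendsto:
  assumes "0 \<le> u" "\<And>n. u \<le> f n" "f \<longlonglongrightarrow> u"
  shows "(\<lambda>n. \<omega> (f n)) \<longlonglongrightarrow> \<omega> u"
proof -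
  have "continuous (at_right u) \<omega>" using good_right[OF assms(1)] by (simp add: continuous_within)
  then have "continuous (at u within {u..}) \<omega>"
    by (simp add: continuous_within at_within_Ici_at_right)
  then show ?thesis
    using assms(2,3) by (auto simp: continuous_within_sequentially o_def)
qed

lemma undershoot_le: "0 \<le> t \<Longrightarrow> undershoot t \<omega> \<le> t"
  using zero_below[of t] by (auto simp: undershoot_def below_def intro!: cSUP_least)

lemma undershoot_nonneg: "0 \<le> undershoot t \<omega>"
  using zero_below[of t] good_0 cSUP_upper[OF zero_below below_bdd(2), of t] by (auto simp: undershoot_def)

lemma undershoot_mono: "t \<le> t' \<Longrightarrow> undershoot t \<omega> \<le> undershoot t' \<omega>"
proof (cases "t \<le> 0")
  case True then show ?thesis using undershoot_nonneg by (simp add: undershoot_def)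
next
  case False
  assume "t \<le> t'"
  then show ?thesis using False zero_below[of t] below_bdd(2)[of t']
    by (auto simp: undershoot_def below_def intro!: cSup_subset_mono)
qed

text \<open>Left-continuity comes from the strict inequality in \<open>below\<close>: a time whose
  value is below t has value below \<open>f n\<close> for all large n. On the other side
  monotonicity in t suffices.\<close>

lemma inverse_left_tendsto:
  assumes "0 < t" "\<And>n. f n \<le> t" "f \<longlonglongrightarrow> t"
  shows "(\<lambda>n. inverse_at (f n) \<omega>) \<longlonglongrightarrow> inverse_at t \<omega>"
    and "(\<lambda>n. undershoot (f n) \<omega>) \<longlonglongrightarrow> undershoot t \<omega>"
proof -
  have *: "eventually (\<lambda>n. s < inverse_at (f n) \<omega> \<and> \<omega> s \<le> undershoot (f n) \<omega>) sequentially"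
    if s: "0 \<le> s" "\<omega> s < t" for s
    using order_tendstoD(1)[OF assms(3) s(2)]
  proof eventually_elim
    case (elim n)
    then have "0 < f n" using good_nonneg[OF s(1)] by simp
    then show ?case using elim s(1) less_inverse_iff[of "f n" s] below_bdd(2)[of "f n"]
      by (auto simp: undershoot_def below_def intro!: cSUP_upper)
  qed
  show "(\<lambda>n. inverse_at (f n) \<omega>) \<longlonglongrightarrow> inverse_at t \<omega>"
  proof (rule order_tendstoI)
    fix c assume c: "c < inverse_at t \<omega>"
    then have "\<omega> (max 0 c) < t" using less_inverse_iff[of t "max 0 c"] inverse_pos[of t] assms(1) by auto
    from *[OF _ this] show "eventually (\<lambda>n. c < inverse_at (f n) \<omega>) sequentially"
      by (auto elim!: eventually_mono)
  next
    fix c assume "inverse_at t \<omega> < c"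
    then show "eventually (\<lambda>n. inverse_at (f n) \<omega> < c) sequentially"
      using inverse_mono[OF assms(2)] by (intro always_eventually allI) (auto intro: le_less_trans)
  qed
  show "(\<lambda>n. undershoot (f n) \<omega>) \<longlonglongrightarrow> undershoot t \<omega>"
  proof (rule order_tendstoI)
    fix c assume c: "c < undershoot t \<omega>"
    then obtain s where s: "0 \<le> s" "\<omega> s < t" "c < \<omega> s"
      using assms(1) zero_below[of t] less_cSup_iff[OF _ below_bdd(2), of t c]
      by (auto simp: undershoot_def below_def)
    from *[OF s(1,2)] show "eventually (\<lambda>n. c < undershoot (f n) \<omega>) sequentially"
      by eventually_elim (use s in auto)
  next
    fix c assume "undershoot t \<omega> < c"
    then show "eventually (\<lambda>n. undershoot (f n) \<omega> < c) sequentially"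
      using undershoot_mono[OF assms(2)] by (intro always_eventually allI) (auto intro: le_less_trans)
  qed
qed

end

section \<open>Inverse and undershoot of a pasted path\<close>

lemma below_paste:
  assumes a: "0 \<le> a" and \<omega>: "\<omega> \<in> good_paths" and \<eta>: "\<eta> \<in> good_paths"
  shows "t \<le> \<omega> a \<Longrightarrow> below t (paste a \<omega> \<eta>) = below t \<omega>"
    and "\<omega> a < t \<Longrightarrow> below t (paste a \<omega> \<eta>) = {0..a} \<union> (+) a ` below (t - \<omega> a) \<eta>"
proof -
  show "below t (paste a \<omega> \<eta>) = below t \<omega>" if "t \<le> \<omega> a"
    using that good_nonneg[OF \<eta>] good_le[OF \<omega> a]
    by (auto simp: below_def paste_def split: if_splits) (smt (verit))+
  show "below t (paste a \<omega> \<eta>) = {0..a} \<union> (+) a ` below (t - \<omega> a) \<eta>" if "\<omega> a < t"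
  proof (intro equalityI subsetI)
    fix s assume "s \<in> below t (paste a \<omega> \<eta>)"
    then show "s \<in> {0..a} \<union> (+) a ` below (t - \<omega> a) \<eta>"
      by (auto simp: below_def paste_def image_iff split: if_splits intro!: exI[of _ "s - a"])
  next
    fix s assume "s \<in> {0..a} \<union> (+) a ` below (t - \<omega> a) \<eta>"
    then show "s \<in> below t (paste a \<omega> \<eta>)"
      using a that good_le[OF \<omega>, of s a] good_0[OF \<eta>]
      by (auto simp: below_def paste_def)
  qed
qed

lemma paste_simps:
  "0 \<le> s \<Longrightarrow> s \<le> a \<Longrightarrow> paste a \<omega> \<eta> s = \<omega> s"
  "0 \<le> a \<Longrightarrow> a < s \<Longrightarrow> paste a \<omega> \<eta> s = \<omega> a + \<eta> (s - a)"
  by (auto simp: paste_def)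

lemma paste_before:
  assumes "0 \<le> a" "\<omega> \<in> good_paths" "\<eta> \<in> good_paths" "t \<le> \<omega> a"
  shows "inverse_at t (paste a \<omega> \<eta>) = inverse_at t \<omega>" "undershoot t (paste a \<omega> \<eta>) = undershoot t \<omega>"
proof -
  have "paste a \<omega> \<eta> ` below t \<omega> = \<omega> ` below t \<omega>"
  proof (intro image_cong refl)
    fix x assume x: "x \<in> below t \<omega>"
    then have "x \<le> a" using good_le[OF assms(2,1), of x] assms(4) by (force simp: below_def)
    then show "paste a \<omega> \<eta> x = \<omega> x" using x by (simp add: below_def paste_def)
  qed
  then show "inverse_at t (paste a \<omega> \<eta>) = inverse_at t \<omega>" "undershoot t (paste a \<omega> \<eta>) = undershoot t \<omega>"
    using below_paste(1)[OF assms] by (simp_all add: inverse_at_def undershoot_def)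
qed

text \<open>When the first piece ends below t, its whole time interval [0,a] belongs to
  \<open>below\<close>, and the second piece has to climb the remaining height t - \<omega>(a). The
  suprema over the two pieces combine to a maximum, in which the second piece dominates.\<close>

lemma paste_after:
  assumes "0 \<le> a" "\<omega> \<in> good_paths" "\<eta> \<in> good_paths" "\<omega> a < t"
  shows "inverse_at t (paste a \<omega> \<eta>) = a + inverse_at (t - \<omega> a) \<eta>"
    and "undershoot t (paste a \<omega> \<eta>) = \<omega> a + undershoot (t - \<omega> a) \<eta>"
proof -
  have t: "0 < t - \<omega> a" "0 < t" using assms good_nonneg[of \<omega> a] by auto
  note z = zero_below[OF assms(3) t(1)] and bd = below_bdd[OF assms(3), of "t - \<omega> a"]
  have 1: "Sup ((+) a ` below (t - \<omega> a) \<eta>) = a + Sup (below (t - \<omega> a) \<eta>)"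
  proof -
    have "Sup ((\<lambda>x. a + x) ` below (t - \<omega> a) \<eta>) = a + Sup ((\<lambda>x. x) ` below (t - \<omega> a) \<eta>)"
      using z bd by (intro Sup_add_eq) auto
    then show ?thesis by simp
  qed
  have "Sup ({0..a} \<union> (+) a ` below (t - \<omega> a) \<eta>) = max (Sup {0..a}) (Sup ((+) a ` below (t - \<omega> a) \<eta>))"
    using assms(1) z bd(1) by (subst cSup_union_distrib) (auto simp: sup_max intro!: bdd_above_image_mono monoI)
  then show "inverse_at t (paste a \<omega> \<eta>) = a + inverse_at (t - \<omega> a) \<eta>"
    using t assms(1) inverse_nonneg[OF assms(3), of "t - \<omega> a"]
    by (simp add: inverse_at_def below_paste(2)[OF assms] 1 max_def)
  have im: "paste a \<omega> \<eta> ` below t (paste a \<omega> \<eta>) = \<omega> ` {0..a} \<union> (\<lambda>x. \<omega> a + \<eta> x) ` below (t - \<omega> a) \<eta>"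
  proof -
    have "paste a \<omega> \<eta> (a + x) = \<omega> a + \<eta> x" if "x \<in> below (t - \<omega> a) \<eta>" for x
      using that assms good_0[OF assms(3)] by (cases "x = 0") (auto simp: paste_def below_def)
    then show ?thesis unfolding below_paste(2)[OF assms] image_Un image_image
      by (intro arg_cong2[where f="(\<union>)"] image_cong) (auto simp: paste_def)
  qed
  have 2: "Sup ((\<lambda>x. \<omega> a + \<eta> x) ` below (t - \<omega> a) \<eta>) = \<omega> a + Sup (\<eta> ` below (t - \<omega> a) \<eta>)"
    using z bd by (intro Sup_add_eq) auto
  have 3: "Sup (\<omega> ` {0..a}) = \<omega> a"
    using assms by (intro cSup_eq_maximum) (auto intro: good_le[OF assms(2)])
  have "bdd_above (\<omega> ` {0..a})" by (rule bdd_aboveI[of _ "\<omega> a"]) (auto intro: good_le[OF assms(2)])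
  moreover have "bdd_above ((\<lambda>x. \<omega> a + \<eta> x) ` below (t - \<omega> a) \<eta>)"
    by (rule bdd_aboveI[of _ t]) (auto simp: below_def)
  ultimately have "Sup (\<omega> ` {0..a} \<union> (\<lambda>x. \<omega> a + \<eta> x) ` below (t - \<omega> a) \<eta>)
    = max (\<omega> a) (\<omega> a + Sup (\<eta> ` below (t - \<omega> a) \<eta>))"
    using assms(1) z by (subst cSup_union_distrib) (auto simp: sup_max 2 3)
  then show "undershoot t (paste a \<omega> \<eta>) = \<omega> a + undershoot (t - \<omega> a) \<eta>"
    using t undershoot_nonneg[OF assms(3), of "t - \<omega> a"]
    by (simp add: undershoot_def im max_def)
qed

section \<open>Measurability of path functionals\<close>

lemma good_space_component [measurable]: "(\<lambda>\<omega>. \<omega> s) \<in> borel_measurable good_space"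
proof (cases "0 \<le> s")
  case True
  then show ?thesis unfolding good_space_def
    by (intro measurable_restrict_space1 measurable_component_singleton) auto
next
  case False
  then have "\<omega> s = undefined" if "\<omega> \<in> good_paths" for \<omega>
    using that by (auto simp: good_paths_def extensional_def)
  then show ?thesis
    by (subst measurable_cong[where g="\<lambda>_. undefined"]) (auto simp: space_good_space)
qed

lemma good_space_componentD: "f \<in> M \<rightarrow>\<^sub>M good_space \<Longrightarrow> (\<lambda>x. f x s) \<in> borel_measurable M"
  by measurable

lemma measurable_good: "g \<in> M \<rightarrow>\<^sub>M good_space \<Longrightarrow> x \<in> space M \<Longrightarrow> g x \<in> good_paths"
  using measurable_space[of g M good_space x] by (simp add: space_good_space)

lemma rat_between: "s < r \<Longrightarrow> \<exists>q::rat. s < real_of_rat q \<and> real_of_rat q < r"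
  using of_rat_dense by blast

text \<open>By right-continuity and monotonicity the value at a random time is below c iff the value
  at some later rational time is, which leaves countably many coordinates.\<close>

lemma eval_measurable:
  assumes f[measurable]: "f \<in> borel_measurable M" and g[measurable]: "g \<in> M \<rightarrow>\<^sub>M good_space"
    and pos: "\<And>x. x \<in> space M \<Longrightarrow> 0 \<le> f x"
  shows "(\<lambda>x. g x (f x)) \<in> borel_measurable M"
proof (subst borel_measurable_iff_less, safe)
  fix c
  note [measurable] = good_space_componentD[OF g]
  have "{x \<in> space M. g x (f x) < c} = {x \<in> space M. \<exists>q::rat. f x < real_of_rat q \<and> g x (real_of_rat q) < c}"
  proof (intro Collect_cong conj_cong refl)
    fix x assume x: "x \<in> space M"
    note G = measurable_good[OF g x]
    show "g x (f x) < c \<longleftrightarrow> (\<exists>q::rat. f x < real_of_rat q \<and> g x (real_of_rat q) < c)"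
    proof
      assume "g x (f x) < c"
      from good_right_less[OF G pos[OF x] this, of "f x + 1"] obtain r where r: "f x < r" "g x r < c" by auto
      obtain q where "f x < real_of_rat q" "real_of_rat q < r" using rat_between[OF r(1)] by blast
      then show "\<exists>q::rat. f x < real_of_rat q \<and> g x (real_of_rat q) < c"
        using good_less[OF G, of "real_of_rat q" r] order_trans[OF pos[OF x], of "real_of_rat q"] r
        by (intro exI[of _ q]) auto
    next
      assume "\<exists>q::rat. f x < real_of_rat q \<and> g x (real_of_rat q) < c"
      then obtain q where "f x < real_of_rat q" "g x (real_of_rat q) < c" by blast
      then show "g x (f x) < c" using good_less[OF G pos[OF x], of "real_of_rat q"] by simp
    qed
  qed
  also have "\<dots> \<in> sets M" by measurable
  finally show "{x \<in> space M. g x (f x) < c} \<in> sets M" .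
qed

lemma inverse_at_measurable [measurable (raw)]:
  assumes f[measurable]: "f \<in> borel_measurable M" and g[measurable]: "g \<in> M \<rightarrow>\<^sub>M good_space"
  shows "(\<lambda>x. inverse_at (f x) (g x)) \<in> borel_measurable M"
proof (subst borel_measurable_iff_le, safe)
  fix c
  note [measurable] = good_space_componentD[OF g]
  have "{x \<in> space M. inverse_at (f x) (g x) \<le> c} = {x \<in> space M. 0 \<le> c \<and> (0 < f x \<longrightarrow> f x \<le> g x c)}"
  proof (intro Collect_cong conj_cong refl)
    fix x assume x: "x \<in> space M"
    note G = measurable_good[OF g x]
    show "inverse_at (f x) (g x) \<le> c \<longleftrightarrow> 0 \<le> c \<and> (0 < f x \<longrightarrow> f x \<le> g x c)"
      using inverse_le_iff[OF G, of "f x" c] inverse_nonneg[OF G, of "f x"]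
      by (cases "0 < f x") (auto simp: inverse_at_def)
  qed
  also have "\<dots> \<in> sets M" by measurable
  finally show "{x \<in> space M. inverse_at (f x) (g x) \<le> c} \<in> sets M" .
qed

text \<open>Right-continuity allows a time in the supremum to be moved slightly to the right, to a
  rational, while its value stays below the level.\<close>

lemma undershoot_measurable [measurable (raw)]:
  assumes f[measurable]: "f \<in> borel_measurable M" and g[measurable]: "g \<in> M \<rightarrow>\<^sub>M good_space"
  shows "(\<lambda>x. undershoot (f x) (g x)) \<in> borel_measurable M"
proof (subst borel_measurable_iff_greater, safe)
  fix c
  note [measurable] = good_space_componentD[OF g]
  let ?P = "\<lambda>x. \<exists>q::rat. 0 \<le> q \<and> c < g x (real_of_rat q) \<and> g x (real_of_rat q) < f x"
  have "{x \<in> space M. c < undershoot (f x) (g x)} = {x \<in> space M. if f x \<le> 0 then c < 0 else ?P x}"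
  proof (intro Collect_cong conj_cong refl)
    fix x assume x: "x \<in> space M"
    note G = measurable_good[OF g x]
    have "c < undershoot (f x) (g x) \<longleftrightarrow> ?P x" if "0 < f x"
    proof -
      have "c < undershoot (f x) (g x) \<longleftrightarrow> (\<exists>s\<ge>0. g x s < f x \<and> c < g x s)"
        using that zero_below[OF G that] less_cSup_iff[OF _ below_bdd(2)[OF G], of "f x" c]
        by (auto simp: undershoot_def below_def)
      also have "\<dots> \<longleftrightarrow> ?P x"
      proof
        assume "\<exists>s\<ge>0. g x s < f x \<and> c < g x s"
        then obtain s where s: "0 \<le> s" "g x s < f x" "c < g x s" by blast
        from good_right_less[OF G s(1,2), of "s + 1"] obtain r where r: "s < r" "g x r < f x" by auto
        obtain q where q: "s < real_of_rat q" "real_of_rat q < r" using rat_between[OF r(1)] by blast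
        have "0 \<le> real_of_rat q" using q s by linarith
        then show "?P x"
          using good_less[OF G, of "real_of_rat q" r] good_less[OF G, of s "real_of_rat q"] s r q
          by (intro exI[of _ q]) auto
      next
        assume "?P x"
        then obtain q where "0 \<le> q" "c < g x (real_of_rat q) \<and> g x (real_of_rat q) < f x" by blast
        then show "\<exists>s\<ge>0. g x s < f x \<and> c < g x s" by (intro exI[of _ "real_of_rat q"]) simp
      qed
      finally show ?thesis .
    qed
    then show "c < undershoot (f x) (g x) \<longleftrightarrow> (if f x \<le> 0 then c < 0 else ?P x)"
      by (auto simp: undershoot_def)
  qed
  also have "\<dots> \<in> sets M" by measurable
  finally show "{x \<in> space M. c < undershoot (f x) (g x)} \<in> sets M" .
qed

lemma left_lim_measurable [measurable (raw)]:
  assumes f[measurable]: "f \<in> borel_measurable M" and g[measurable]: "g \<in> M \<rightarrow>\<^sub>M good_space"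
  shows "(\<lambda>x. left_lim (f x) (g x)) \<in> borel_measurable M"
proof (subst borel_measurable_iff_greater, safe)
  fix c
  note [measurable] = good_space_componentD[OF g]
  let ?P = "\<lambda>x. \<exists>q::rat. 0 \<le> q \<and> c < g x (real_of_rat q) \<and> real_of_rat q < f x"
  have "{x \<in> space M. c < left_lim (f x) (g x)} = {x \<in> space M. if f x \<le> 0 then c < 0 else ?P x}"
  proof (intro Collect_cong conj_cong refl)
    fix x assume x: "x \<in> space M"
    note G = measurable_good[OF g x]
    have "c < left_lim (f x) (g x) \<longleftrightarrow> ?P x" if "0 < f x"
    proof -
      have "c < left_lim (f x) (g x) \<longleftrightarrow> (\<exists>s\<ge>0. s < f x \<and> c < g x s)"
        using that less_cSup_iff[OF _ bdd_left[OF G], of "f x" c] by (auto simp: left_lim_def)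
      also have "\<dots> \<longleftrightarrow> ?P x"
      proof
        assume "\<exists>s\<ge>0. s < f x \<and> c < g x s"
        then obtain s where s: "0 \<le> s" "s < f x" "c < g x s" by blast
        obtain q where q: "s < real_of_rat q" "real_of_rat q < f x" using rat_between[OF s(2)] by blast
        have "0 \<le> real_of_rat q" using q s by linarith
        then show "?P x" using good_less[OF G, of s "real_of_rat q"] s q by (intro exI[of _ q]) auto
      next
        assume "?P x"
        then obtain q where "0 \<le> q" "c < g x (real_of_rat q) \<and> real_of_rat q < f x" by blast
        then show "\<exists>s\<ge>0. s < f x \<and> c < g x s" by (intro exI[of _ "real_of_rat q"]) simp
      qed
      finally show ?thesis .
    qed
    then show "c < left_lim (f x) (g x) \<longleftrightarrow> (if f x \<le> 0 then c < 0 else ?P x)"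
      by (auto simp: left_lim_def)
  qed
  also have "\<dots> \<in> sets M" by measurable
  finally show "{x \<in> space M. c < left_lim (f x) (g x)} \<in> sets M" .
qed

lemma paste_good:
  assumes a: "0 \<le> a" and \<omega>: "\<omega> \<in> good_paths" and \<eta>: "\<eta> \<in> good_paths"
  shows "paste a \<omega> \<eta> \<in> good_paths"
  unfolding good_paths_def
proof (safe)
  show "paste a \<omega> \<eta> \<in> extensional {0..}" by (simp add: paste_def)
  show "paste a \<omega> \<eta> 0 = 0" using a good_0[OF \<omega>] by (simp add: paste_def)
  show "strict_mono_on {0..} (paste a \<omega> \<eta>)"
  proof (rule strict_mono_onI)
    fix r s :: real assume "r \<in> {0..}" "s \<in> {0..}" "r < s"
    then show "paste a \<omega> \<eta> r < paste a \<omega> \<eta> s"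
      using a good_less[OF \<omega>, of r s] good_less[OF \<eta>, of "r - a" "s - a"] good_le[OF \<omega>, of r a]
        good_less[OF \<eta>, of 0 "s - a"] good_0[OF \<eta>]
      by (auto simp: paste_def)
  qed
  fix t :: real assume t: "0 \<le> t"
  show "(paste a \<omega> \<eta> \<longlongrightarrow> paste a \<omega> \<eta> t) (at_right t)"
  proof (cases "t < a")
    case True
    have "eventually (\<lambda>s. s < a) (at_right t)" using True by (auto simp: eventually_at_right intro!: exI[of _ a])
    moreover have "eventually (\<lambda>s. t < s) (at_right t)" by (simp add: eventually_at_right_less)
    ultimately have "eventually (\<lambda>s. \<omega> s = paste a \<omega> \<eta> s) (at_right t)"
      by eventually_elim (use t in \<open>auto simp: paste_def\<close>)
    then have "(paste a \<omega> \<eta> \<longlongrightarrow> \<omega> t) (at_right t)"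
      by (rule Lim_transform_eventually[OF good_right[OF \<omega> t]])
    then show ?thesis using True t by (simp add: paste_def)
  next
    case False
    have "eventually (\<lambda>s. t < s) (at_right t)" by (simp add: eventually_at_right_less)
    then have ev: "eventually (\<lambda>s. \<omega> a + \<eta> (s - a) = paste a \<omega> \<eta> s) (at_right t)"
      by eventually_elim (use t False in \<open>auto simp: paste_def\<close>)
    have "filterlim (\<lambda>s. s - a) (at_right (t - a)) (at_right t)"
      by (auto simp: filterlim_at eventually_at_filter intro!: tendsto_eq_intros)
    then have "((\<lambda>s. \<eta> (s - a)) \<longlongrightarrow> \<eta> (t - a)) (at_right t)"
      using False by (intro filterlim_compose[OF good_right[OF \<eta>]]) auto
    then have "((\<lambda>s. \<omega> a + \<eta> (s - a)) \<longlongrightarrow> \<omega> a + \<eta> (t - a)) (at_right t)" by (intro tendsto_intros)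
    then have "(paste a \<omega> \<eta> \<longlongrightarrow> \<omega> a + \<eta> (t - a)) (at_right t)" by (rule Lim_transform_eventually[OF _ ev])
    then show ?thesis using False t good_0[OF \<eta>] by (cases "t = a") (auto simp: paste_def)
  qed
next
  fix c
  obtain t where t: "0 \<le> t" "c - \<omega> a < \<eta> t" using good_unbounded[OF \<eta>] by blast
  then show "\<exists>t\<ge>0. c < paste a \<omega> \<eta> t"
    using a good_0[OF \<eta>] by (intro exI[of _ "a + t"]) (cases "t = 0"; auto simp: paste_def)
qed

lemma paste_measurable:
  assumes "0 \<le> a"
  shows "(\<lambda>(\<omega>, \<eta>). paste a \<omega> \<eta>) \<in> good_space \<Otimes>\<^sub>M good_space \<rightarrow>\<^sub>M good_space"
proof -
  have "(\<lambda>z. paste a (fst z) (snd z)) \<in> good_space \<Otimes>\<^sub>M good_space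
    \<rightarrow>\<^sub>M restrict_space (Pi\<^sub>M {0..} (\<lambda>_. borel)) good_paths"
  proof (rule measurable_restrict_space2)
    show "(\<lambda>z. paste a (fst z) (snd z)) \<in> good_space \<Otimes>\<^sub>M good_space \<rightarrow>\<^sub>M Pi\<^sub>M {0..} (\<lambda>_. borel)"
      unfolding paste_def by (rule measurable_restrict) measurable
  qed (auto simp: space_pair_measure space_good_space paste_good assms)
  then show ?thesis by (simp add: good_space_def[symmetric] split_beta')
qed

section \<open>The simple Markov property as pasting\<close>

definition cyl :: "real set \<Rightarrow> (real \<Rightarrow> 'a set) \<Rightarrow> (real \<Rightarrow> 'a) \<Rightarrow> ennreal" where
  "cyl J A \<omega> = indicator {\<omega>. \<forall>r\<in>J. \<omega> r \<in> A r} \<omega>"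

lemma cyl_prod: "finite J \<Longrightarrow> cyl J A \<omega> = (\<Prod>r\<in>J. indicator (A r) (\<omega> r))"
  by (induction J rule: finite_induct) (auto simp: cyl_def indicator_def)

lemma cyl_measurable:
  assumes "finite J" "\<And>r. r \<in> J \<Longrightarrow> A r \<in> sets borel"
  shows "cyl J A \<in> borel_measurable good_space"
proof -
  have "(\<lambda>\<omega>. \<Prod>r\<in>J. indicator (A r) (\<omega> r) :: ennreal) \<in> borel_measurable good_space"
    using assms by (intro borel_measurable_prod_ennreal measurable_compose[OF good_space_component] borel_measurable_indicator) auto
  then show ?thesis by (subst measurable_cong[OF cyl_prod[OF assms(1)]])
qed

context subordinator
begin

definition transition :: "real \<Rightarrow> real \<Rightarrow> real set \<Rightarrow> ennreal" where
  "transition t x B = emeasure (\<mu> t) {w. x + w \<in> B}"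

lemma transition_measurable [measurable]:
  assumes t: "0 \<le> t" and B[measurable]: "B \<in> sets borel"
  shows "(\<lambda>x. transition t x B) \<in> borel_measurable borel"
proof -
  interpret prob_space "\<mu> t" by (rule prob_mu[OF t])
  note [measurable_cong] = sets_mu[OF t]
  have "{z \<in> space (borel \<Otimes>\<^sub>M \<mu> t). fst z + snd z \<in> B} \<in> sets (borel \<Otimes>\<^sub>M \<mu> t)"
    by measurable
  then have "(\<lambda>x. emeasure (\<mu> t) (Pair x -` {z \<in> space (borel \<Otimes>\<^sub>M \<mu> t). fst z + snd z \<in> B})) \<in> borel_measurable borel"
    by (rule measurable_emeasure_Pair)
  moreover have "Pair x -` {z \<in> space (borel \<Otimes>\<^sub>M \<mu> t). fst z + snd z \<in> B} = {w. x + w \<in> B}" for x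
    using space_mu[OF t] by (auto simp: space_pair_measure)
  ultimately show ?thesis by (simp add: transition_def)
qed

text \<open>The simple Markov property at s, tested on cylinders with times up to s. In this form it
  can be integrated directly, without conditional expectations on path space.\<close>

definition markov_step :: "(real \<Rightarrow> real) measure \<Rightarrow> real \<Rightarrow> real \<Rightarrow> bool" where
  "markov_step M s t \<longleftrightarrow> (\<forall>J A B. finite J \<longrightarrow> J \<subseteq> {0..s} \<longrightarrow> (\<forall>r\<in>J. A r \<in> sets borel) \<longrightarrow> B \<in> sets borel \<longrightarrow>
     (\<integral>\<^sup>+\<omega>. cyl J A \<omega> * indicator B (\<omega> t) \<partial>M) = (\<integral>\<^sup>+\<omega>. cyl J A \<omega> * transition (t - s) (\<omega> s) B \<partial>M))"

definition sub_law :: "(real \<Rightarrow> real) measure \<Rightarrow> bool" where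
  "sub_law M \<longleftrightarrow> prob_space M \<and> sets M = sets good_space \<and> (\<forall>s t. 0 \<le> s \<longrightarrow> s \<le> t \<longrightarrow> markov_step M s t)"

text \<open>Finite-dimensional laws are compared by induction on the largest time; each new
  coordinate is integrated out by one Markov step. For a pasted law the steps across the pasting
  time a are not at hand, so only steps on one side of a are assumed, and a itself is included among
  the times whenever one of them exceeds it.\<close>

lemma good_measure_eqI:
  assumes M: "prob_space M1" "sets M1 = sets good_space" "prob_space M2" "sets M2 = sets good_space"
    and a: "0 \<le> a"
    and step: "\<And>s t. 0 \<le> s \<Longrightarrow> s \<le> t \<Longrightarrow> a \<le> s \<or> t \<le> a \<Longrightarrow> markov_step M1 s t \<and> markov_step M2 s t"
  shows "M1 = M2"
proof -
  interpret M1: prob_space M1 by fact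
  interpret M2: prob_space M2 by fact
  note [measurable_cong] = M(2,4)
  have sp: "space M1 = good_paths" "space M2 = good_paths"
    using M(2,4)[THEN sets_eq_imp_space_eq] by (simp_all add: space_good_space)
  have res: "(\<lambda>\<omega>. restrict \<omega> J) \<in> good_space \<rightarrow>\<^sub>M Pi\<^sub>M J (\<lambda>_. borel)" for J
    by (intro measurable_restrict) measurable
  then have res1[measurable]: "(\<lambda>\<omega>. restrict \<omega> J) \<in> M1 \<rightarrow>\<^sub>M Pi\<^sub>M J (\<lambda>_. borel)"
    "(\<lambda>\<omega>. restrict \<omega> J) \<in> M2 \<rightarrow>\<^sub>M Pi\<^sub>M J (\<lambda>_. borel)" for J by measurable
  have fdd: "distr M1 (Pi\<^sub>M J (\<lambda>_. borel)) (\<lambda>\<omega>. restrict \<omega> J) = distr M2 (Pi\<^sub>M J (\<lambda>_. borel)) (\<lambda>\<omega>. restrict \<omega> J)"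
    if "finite J" "J \<subseteq> {0..}" "a \<in> J \<or> (\<forall>r\<in>J. r \<le> a)" for J
    using that
  proof (induction J rule: finite_linorder_max_induct)
    case empty
    show ?case
      by (simp add: M1.distr_const M2.distr_const space_PiM del: PiM_empty)
  next
    case (insert b J)
    \<comment> \<open>The predecessor of b among the times; if there is none, 0 takes its place,
      where every path has value 0.\<close>
    define s where "s = (if J = {} then 0 else Max J)"
    have s: "0 \<le> s" "s \<le> b" "J \<subseteq> {0..s}" "J \<noteq> {} \<Longrightarrow> s \<in> J"
      using insert.prems(1) insert.hyps Max_in[of J] by (auto simp: s_def subset_iff intro: less_imp_le)
    have ab: "a \<le> s \<or> b \<le> a" using insert.prems(2) s insert.hyps by (cases "J = {}") auto
    have IH: "distr M1 (Pi\<^sub>M J (\<lambda>_. borel)) (\<lambda>\<omega>. restrict \<omega> J) = distr M2 (Pi\<^sub>M J (\<lambda>_. borel)) (\<lambda>\<omega>. restrict \<omega> J)"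
      using insert.prems insert.hyps by (intro insert.IH) auto
    note bs = diff_ge_0_iff_ge[THEN iffD2, OF s(2)]
    show ?case
    proof (rule measure_eqI_PiM_finite[where I="insert b J" and M="\<lambda>_. borel" and A="\<lambda>_. Pi\<^sub>E (insert b J) (\<lambda>_. UNIV)"])
      fix A :: "real \<Rightarrow> real set" assume A: "\<And>i. i \<in> insert b J \<Longrightarrow> A i \<in> sets borel"
      have E: "emeasure (distr M (Pi\<^sub>M (insert b J) (\<lambda>_. borel)) (\<lambda>\<omega>. restrict \<omega> (insert b J))) (Pi\<^sub>E (insert b J) A)
        = (\<integral>\<^sup>+y. indicator (Pi\<^sub>E J A) y * transition (b - s) (if J = {} then 0 else y s) (A b)
            \<partial>distr M (Pi\<^sub>M J (\<lambda>_. borel)) (\<lambda>\<omega>. restrict \<omega> J))"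
        if M: "sets M = sets good_space" "markov_step M s b" for M
      proof -
        note [measurable_cong] = M(1)
        have sp: "space M = good_paths"
          using M(1)[THEN sets_eq_imp_space_eq] by (simp add: space_good_space)
        note [measurable] = res
        have Pm: "Pi\<^sub>E (insert b J) A \<in> sets (Pi\<^sub>M (insert b J) (\<lambda>_. borel))"
          "Pi\<^sub>E J A \<in> sets (Pi\<^sub>M J (\<lambda>_. borel))"
          using A insert.hyps by (auto intro!: sets_PiM_I_finite)
        have "emeasure (distr M (Pi\<^sub>M (insert b J) (\<lambda>_. borel)) (\<lambda>\<omega>. restrict \<omega> (insert b J))) (Pi\<^sub>E (insert b J) A)
          = (\<integral>\<^sup>+\<omega>. indicator (Pi\<^sub>E (insert b J) A) (restrict \<omega> (insert b J)) \<partial>M)"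
          using Pm by (subst nn_integral_distr[symmetric, where M'="Pi\<^sub>M (insert b J) (\<lambda>_. borel)"]) auto
        also have "\<dots> = (\<integral>\<^sup>+\<omega>. cyl J A \<omega> * indicator (A b) (\<omega> b) \<partial>M)"
          by (intro nn_integral_cong) (auto simp: cyl_def indicator_def PiE_iff extensional_def)
        also have "\<dots> = (\<integral>\<^sup>+\<omega>. cyl J A \<omega> * transition (b - s) (\<omega> s) (A b) \<partial>M)"
          using M(2) s insert.hyps A unfolding markov_step_def by auto
        also have "\<dots> = (\<integral>\<^sup>+\<omega>. indicator (Pi\<^sub>E J A) (restrict \<omega> J) * transition (b - s) (if J = {} then 0 else restrict \<omega> J s) (A b) \<partial>M)"
          using s(4) by (intro nn_integral_cong) (auto simp: cyl_def indicator_def PiE_iff extensional_def sp good_0 s_def)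
        also have "\<dots> = (\<integral>\<^sup>+y. indicator (Pi\<^sub>E J A) y * transition (b - s) (if J = {} then 0 else y s) (A b)
            \<partial>distr M (Pi\<^sub>M J (\<lambda>_. borel)) (\<lambda>\<omega>. restrict \<omega> J))"
        proof (subst nn_integral_distr)
          have "(\<lambda>y. if J = {} then 0 else y s) \<in> Pi\<^sub>M J (\<lambda>_. borel :: real measure) \<rightarrow>\<^sub>M borel"
            using s(4) by (cases "J = {}") (auto intro: measurable_component_singleton)
          from measurable_compose[OF this transition_measurable[OF bs, of "A b"]] A Pm
          show "(\<lambda>y. indicator (Pi\<^sub>E J A) y * transition (b - s) (if J = {} then 0 else y s) (A b))
            \<in> borel_measurable (distr M (Pi\<^sub>M J (\<lambda>_. borel)) (\<lambda>\<omega>. restrict \<omega> J))"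
            by (auto intro!: borel_measurable_times_ennreal)
        qed auto
        finally show ?thesis .
      qed
      from step[OF s(1,2) ab] show "emeasure (distr M1 (Pi\<^sub>M (insert b J) (\<lambda>_. borel)) (\<lambda>\<omega>. restrict \<omega> (insert b J))) (Pi\<^sub>E (insert b J) A)
        = emeasure (distr M2 (Pi\<^sub>M (insert b J) (\<lambda>_. borel)) (\<lambda>\<omega>. restrict \<omega> (insert b J))) (Pi\<^sub>E (insert b J) A)"
        using E[of M1] E[of M2] M IH by simp
    next
      show "range (\<lambda>_::nat. Pi\<^sub>E (insert b J) (\<lambda>_. UNIV)) \<subseteq> prod_algebra (insert b J) (\<lambda>_. borel)"
        using insert.hyps by (auto intro!: prod_algebraI_finite)
      show "emeasure (distr M1 (Pi\<^sub>M (insert b J) (\<lambda>_. borel)) (\<lambda>\<omega>. restrict \<omega> (insert b J))) (Pi\<^sub>E (insert b J) (\<lambda>_. UNIV)) \<noteq> \<infinity>"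
        using finite_measure.emeasure_finite[OF prob_space.finite_measure[OF M1.prob_space_distr[OF res1(1)]]] by simp
    qed (use insert.hyps in \<open>auto simp: space_PiM\<close>)
  qed
  have id[measurable]: "(\<lambda>x. x) \<in> good_space \<rightarrow>\<^sub>M Pi\<^sub>M {0..} (\<lambda>_. borel)"
    unfolding good_space_def by (rule measurable_restrict_space1) simp
  have "distr M1 (Pi\<^sub>M {0..} (\<lambda>_. borel)) (\<lambda>x. x) = distr M2 (Pi\<^sub>M {0..} (\<lambda>_. borel)) (\<lambda>x. x)"
  proof (rule measure_eqI_PiM_infinite)
    fix A :: "real \<Rightarrow> real set" and J assume J: "finite J" "J \<subseteq> {0..}" and A: "\<And>i. i \<in> J \<Longrightarrow> A i \<in> sets borel"
    \<comment> \<open>The time a is added without a constraint, so that consecutive times do not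
      straddle it.\<close>
    define A' where "A' r = (if r \<in> J then A r else UNIV)" for r
    have A': "Pi\<^sub>E (insert a J) A' \<in> sets (Pi\<^sub>M (insert a J) (\<lambda>_. borel))"
      using J A by (intro sets_PiM_I_finite) (auto simp: A'_def)
    have e: "prod_emb {0..} (\<lambda>_. borel) J (Pi\<^sub>E J A) \<in> sets (Pi\<^sub>M {0..} (\<lambda>_. borel))"
      using J A by (intro sets_PiM_I) auto
    have "prod_emb {0..} (\<lambda>_. borel) J (Pi\<^sub>E J A) \<inter> good_paths
      = (\<lambda>\<omega>. restrict \<omega> (insert a J)) -` (Pi\<^sub>E (insert a J) A') \<inter> good_paths"
      by (auto simp: prod_emb_def PiE_iff A'_def good_paths_def extensional_def)
    then have "emeasure (distr M (Pi\<^sub>M {0..} (\<lambda>_. borel)) (\<lambda>x. x)) (prod_emb {0..} (\<lambda>_. borel) J (Pi\<^sub>E J A))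
      = emeasure (distr M (Pi\<^sub>M (insert a J) (\<lambda>_. borel)) (\<lambda>\<omega>. restrict \<omega> (insert a J))) (Pi\<^sub>E (insert a J) A')"
      if [measurable_cong]: "sets M = sets good_space" for M
      using e A' sets_eq_imp_space_eq[OF that] res[of "insert a J"] by (simp add: emeasure_distr space_good_space)
    from this[OF M(2)] this[OF M(4)] show "emeasure (distr M1 (Pi\<^sub>M {0..} (\<lambda>_. borel)) (\<lambda>x. x)) (prod_emb {0..} (\<lambda>_. borel) J (Pi\<^sub>E J A))
      = emeasure (distr M2 (Pi\<^sub>M {0..} (\<lambda>_. borel)) (\<lambda>x. x)) (prod_emb {0..} (\<lambda>_. borel) J (Pi\<^sub>E J A))"
      using fdd[of "insert a J"] J a by simp
  qed (auto intro!: prob_space.finite_measure M1.prob_space_distr)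
  then have eq: "emeasure M1 (Y \<inter> good_paths) = emeasure M2 (Y \<inter> good_paths)" if "Y \<in> sets (Pi\<^sub>M {0..} (\<lambda>_. borel))" for Y
    using emeasure_distr[of "\<lambda>x. x" M1 "Pi\<^sub>M {0..} (\<lambda>_. borel)" Y] emeasure_distr[of "\<lambda>x. x" M2 "Pi\<^sub>M {0..} (\<lambda>_. borel)" Y] that
    by (simp add: sp)
  show ?thesis
  proof (rule measure_eqI)
    fix X assume "X \<in> sets M1"
    then have "X \<in> (\<inter>) good_paths ` sets (Pi\<^sub>M {0..} (\<lambda>_. borel))"
      using M(2) by (simp add: good_space_def sets_restrict_space)
    then show "emeasure M1 X = emeasure M2 X" using eq by (auto simp: Int_commute)
  qed (simp add: M)
qed

text \<open>For a fixed first piece, a step beyond a is a Markov step of the second piece; a step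
  before a sees the first piece only. The pasted law and \<open>Q\<close> thus share all steps that
  do not cross a, and these determine a law on \<open>good_space\<close>.\<close>

lemma paste_law:
  assumes Q: "sub_law Q" and a: "0 \<le> a"
  shows "distr (Q \<Otimes>\<^sub>M Q) good_space (\<lambda>(\<omega>, \<eta>). paste a \<omega> \<eta>) = Q"
proof -
  from Q have pQ: "prob_space Q" and sQ[measurable_cong]: "sets Q = sets good_space"
    and step: "\<And>s t. 0 \<le> s \<Longrightarrow> s \<le> t \<Longrightarrow> markov_step Q s t" by (auto simp: sub_law_def)
  interpret Q: prob_space Q by fact
  interpret QQ: pair_prob_space Q Q ..
  have sp: "space Q = good_paths" using sets_eq_imp_space_eq[OF sQ] by (simp add: space_good_space)
  note pm[measurable] = paste_measurable[OF a]
  have pm': "(\<lambda>(\<omega>, \<eta>). paste a \<omega> \<eta>) \<in> Q \<Otimes>\<^sub>M Q \<rightarrow>\<^sub>M good_space" by measurable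
  have iter: "(\<integral>\<^sup>+\<omega>. f \<omega> \<partial>distr (Q \<Otimes>\<^sub>M Q) good_space (\<lambda>(\<omega>, \<eta>). paste a \<omega> \<eta>))
    = (\<integral>\<^sup>+\<omega>. \<integral>\<^sup>+\<eta>. f (paste a \<omega> \<eta>) \<partial>Q \<partial>Q)" if "f \<in> borel_measurable good_space" for f
    using measurable_compose[OF pm' that] that pm'
    by (subst nn_integral_distr) (auto simp: Q.nn_integral_fst[symmetric] case_prod_beta')
  show ?thesis
  proof (rule good_measure_eqI[where a=a])
    show "prob_space (distr (Q \<Otimes>\<^sub>M Q) good_space (\<lambda>(\<omega>, \<eta>). paste a \<omega> \<eta>))"
      by (intro QQ.prob_space_distr pm')
    fix s t assume st: "0 \<le> s" "s \<le> t" "a \<le> s \<or> t \<le> a"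
    have "markov_step (distr (Q \<Otimes>\<^sub>M Q) good_space (\<lambda>(\<omega>, \<eta>). paste a \<omega> \<eta>)) s t"
      unfolding markov_step_def
    proof (intro allI impI)
      fix J and A :: "real \<Rightarrow> real set" and B :: "real set" assume J: "finite J" "J \<subseteq> {0..s}" and A: "\<forall>r\<in>J. A r \<in> sets borel" and B[measurable]: "B \<in> sets borel"
      have [measurable]: "cyl J A \<in> borel_measurable good_space" using J A by (intro cyl_measurable) auto
      have [measurable]: "(\<lambda>x. transition (t - s) x B) \<in> borel_measurable borel"
        using st by (intro transition_measurable B) simp
      have "(\<integral>\<^sup>+\<eta>. cyl J A (paste a \<omega> \<eta>) * indicator B (paste a \<omega> \<eta> t) \<partial>Q)
        = (\<integral>\<^sup>+\<eta>. cyl J A (paste a \<omega> \<eta>) * transition (t - s) (paste a \<omega> \<eta> s) B \<partial>Q)"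
        if "a \<le> s" and \<omega>: "\<omega> \<in> good_paths" for \<omega>
      proof -
        \<comment> \<open>The cylinder factorises. For a fixed first piece the times up to a give
          the constant c; the later ones give a cylinder of the second piece, with times moved back
          by a and sets translated by \<omega>(a).\<close>
        define J' where "J' = (\<lambda>r. r - a) ` {r\<in>J. a < r}"
        define A' where "A' r = {y. \<omega> a + y \<in> A (r + a)}" for r
        define B' where "B' = {y. \<omega> a + y \<in> B}"
        define c where "c = cyl {r\<in>J. r \<le> a} A \<omega>"
        have cy: "cyl J A (paste a \<omega> \<eta>) = c * cyl J' A' \<eta>" for \<eta>
        proof -
          have "cyl J A (paste a \<omega> \<eta>) = cyl {r\<in>J. r \<le> a} A (paste a \<omega> \<eta>) * cyl {r\<in>J. a < r} A (paste a \<omega> \<eta>)"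
          proof -
            have "(\<forall>r\<in>J. P r) \<longleftrightarrow> (\<forall>r\<in>{r\<in>J. r \<le> a}. P r) \<and> (\<forall>r\<in>{r\<in>J. a < r}. P r)" for P
              by (auto simp: not_le[symmetric])
            then show ?thesis unfolding cyl_def indicator_def by simp
          qed
          also have "cyl {r\<in>J. r \<le> a} A (paste a \<omega> \<eta>) = c"
            using J a by (auto simp: cyl_def c_def indicator_def paste_def subset_iff)
          also have "cyl {r\<in>J. a < r} A (paste a \<omega> \<eta>) = cyl J' A' \<eta>"
            using J a by (auto simp: cyl_def indicator_def paste_def J'_def A'_def)
          finally show ?thesis .
        qed
        have ps: "paste a \<omega> \<eta> u = \<omega> a + \<eta> (u - a)" if "\<eta> \<in> good_paths" "a \<le> u" for \<eta> u
          using that a good_0[OF that(1)] by (auto simp: paste_def)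
        have J'f: "finite J'" "J' \<subseteq> {0..s - a}" "\<forall>r\<in>J'. A' r \<in> sets borel"
          using J A by (auto simp: J'_def A'_def)
        have B': "B' \<in> sets borel" unfolding B'_def by measurable
        have cm: "cyl J' A' \<in> borel_measurable Q" using J'f by (auto simp: measurable_cong_sets[OF sQ refl] intro!: cyl_measurable)
        have co: "(\<lambda>\<eta>. \<eta> u) \<in> borel_measurable Q" for u by measurable
        have "(\<integral>\<^sup>+\<eta>. cyl J A (paste a \<omega> \<eta>) * indicator B (paste a \<omega> \<eta> t) \<partial>Q)
          = (\<integral>\<^sup>+\<eta>. c * (cyl J' A' \<eta> * indicator B' (\<eta> (t - a))) \<partial>Q)"
          using ps[of _ t] st that(1)
          by (intro nn_integral_cong) (auto simp: sp cy B'_def indicator_def mult.assoc)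
        also have "\<dots> = c * (\<integral>\<^sup>+\<eta>. cyl J' A' \<eta> * indicator B' (\<eta> (t - a)) \<partial>Q)"
          by (intro nn_integral_cmult borel_measurable_times_ennreal cm measurable_compose[OF co borel_measurable_indicator[OF B']])
        also have "(\<integral>\<^sup>+\<eta>. cyl J' A' \<eta> * indicator B' (\<eta> (t - a)) \<partial>Q)
          = (\<integral>\<^sup>+\<eta>. cyl J' A' \<eta> * transition ((t - a) - (s - a)) (\<eta> (s - a)) B' \<partial>Q)"
          using step[of "s - a" "t - a"] st that(1) J'f B' unfolding markov_step_def by auto
        also have "c * \<dots> = (\<integral>\<^sup>+\<eta>. c * (cyl J' A' \<eta> * transition ((t - a) - (s - a)) (\<eta> (s - a)) B') \<partial>Q)"
        proof -
          have "0 \<le> (t - a) - (s - a)" using st by simp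
          then show ?thesis
            by (intro nn_integral_cmult[symmetric] borel_measurable_times_ennreal cm measurable_compose[OF co transition_measurable[OF _ B']])
        qed
        also have "\<dots> = (\<integral>\<^sup>+\<eta>. cyl J A (paste a \<omega> \<eta>) * transition (t - s) (paste a \<omega> \<eta> s) B \<partial>Q)"
          using ps[of _ s] that(1)
          by (intro nn_integral_cong) (auto simp: sp cy transition_def B'_def mult.assoc add.assoc)
        finally show ?thesis .
      qed
      then have "(\<integral>\<^sup>+\<omega>. \<integral>\<^sup>+\<eta>. cyl J A (paste a \<omega> \<eta>) * indicator B (paste a \<omega> \<eta> t) \<partial>Q \<partial>Q)
        = (\<integral>\<^sup>+\<omega>. \<integral>\<^sup>+\<eta>. cyl J A (paste a \<omega> \<eta>) * transition (t - s) (paste a \<omega> \<eta> s) B \<partial>Q \<partial>Q)" if "a \<le> s"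
        by (rule nn_integral_cong) (use that in \<open>simp_all add: sp\<close>)
      moreover have "(\<integral>\<^sup>+\<omega>. \<integral>\<^sup>+\<eta>. cyl J A (paste a \<omega> \<eta>) * indicator B (paste a \<omega> \<eta> t) \<partial>Q \<partial>Q)
        = (\<integral>\<^sup>+\<omega>. \<integral>\<^sup>+\<eta>. cyl J A (paste a \<omega> \<eta>) * transition (t - s) (paste a \<omega> \<eta> s) B \<partial>Q \<partial>Q)" if "t \<le> a"
      proof -
        have p: "paste a \<omega> \<eta> s = \<omega> s" "paste a \<omega> \<eta> t = \<omega> t" "cyl J A (paste a \<omega> \<eta>) = cyl J A \<omega>" for \<omega> \<eta>
          using st that J by (auto simp: paste_def cyl_def indicator_def subset_iff; force)+
        have "(\<integral>\<^sup>+\<omega>. cyl J A \<omega> * indicator B (\<omega> t) \<partial>Q) = (\<integral>\<^sup>+\<omega>. cyl J A \<omega> * transition (t - s) (\<omega> s) B \<partial>Q)"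
          using step[OF st(1,2)] J A B unfolding markov_step_def by auto
        then show ?thesis by (simp add: p Q.emeasure_space_1)
      qed
      ultimately show "(\<integral>\<^sup>+\<omega>. cyl J A \<omega> * indicator B (\<omega> t) \<partial>distr (Q \<Otimes>\<^sub>M Q) good_space (\<lambda>(\<omega>, \<eta>). paste a \<omega> \<eta>))
        = (\<integral>\<^sup>+\<omega>. cyl J A \<omega> * transition (t - s) (\<omega> s) B \<partial>distr (Q \<Otimes>\<^sub>M Q) good_space (\<lambda>(\<omega>, \<eta>). paste a \<omega> \<eta>))"
        using st(3) by (subst (1 2) iter) (measurable, auto)
    qed
    then show "markov_step (distr (Q \<Otimes>\<^sub>M Q) good_space (\<lambda>(\<omega>, \<eta>). paste a \<omega> \<eta>)) s t \<and> markov_step Q s t"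
      using step st by blast
  qed (use pQ sQ a in auto)
qed

lemma law_at:
  assumes Q: "sub_law Q" and t: "0 \<le> t" and B: "B \<in> sets borel"
  shows "(\<integral>\<^sup>+\<omega>. indicator B (\<omega> t) \<partial>Q) = emeasure (\<mu> t) B"
proof -
  from Q interpret Q: prob_space Q by (simp add: sub_law_def)
  have sp: "space Q = good_paths" using Q sets_eq_imp_space_eq[of Q good_space] by (simp add: sub_law_def space_good_space)
  have "(\<integral>\<^sup>+\<omega>. cyl {} (\<lambda>_. {}) \<omega> * indicator B (\<omega> t) \<partial>Q) = (\<integral>\<^sup>+\<omega>. cyl {} (\<lambda>_. {}) \<omega> * transition (t - 0) (\<omega> 0) B \<partial>Q)"
  proof -
    have "markov_step Q 0 t" using Q t by (simp add: sub_law_def)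
    from this[unfolded markov_step_def, rule_format, of "{}" "\<lambda>_. {}" B] B show ?thesis by simp
  qed
  also have "\<dots> = (\<integral>\<^sup>+\<omega>. emeasure (\<mu> t) B \<partial>Q)"
    by (intro nn_integral_cong) (auto simp: sp good_0 transition_def cyl_def)
  finally show ?thesis by (simp add: cyl_def Q.emeasure_space_1)
qed

end

section \<open>Renewal at the first passage time\<close>

definition age_at :: "real \<Rightarrow> (real \<Rightarrow> real) \<Rightarrow> real \<times> real" where
  "age_at r \<omega> = (inverse_at r \<omega>, r - undershoot r \<omega>)"

definition overshoot :: "real \<Rightarrow> (real \<Rightarrow> real) \<Rightarrow> real" where
  "overshoot s \<omega> = \<omega> (inverse_at s \<omega>)"

text \<open>Both coordinates are capped so that, when y is the path value at u, the result depends
  on the path up to u only. If the caps are the inverse and the undershoot at a level s \<ge> r,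
  they have no effect.\<close>

definition age_stopped :: "real \<Rightarrow> real \<Rightarrow> real \<Rightarrow> (real \<Rightarrow> real) \<Rightarrow> real \<times> real" where
  "age_stopped u y r \<omega> = (min u (inverse_at r \<omega>), r - min y (undershoot r \<omega>))"

lemma age_at_measurable [measurable (raw)]:
  assumes [measurable]: "f \<in> borel_measurable M" "g \<in> M \<rightarrow>\<^sub>M good_space"
  shows "(\<lambda>x. age_at (f x) (g x)) \<in> borel_measurable M"
  unfolding age_at_def
  by (intro borel_measurable_Pair inverse_at_measurable borel_measurable_diff undershoot_measurable assms)

lemma overshoot_measurable [measurable (raw)]:
  assumes [measurable]: "f \<in> borel_measurable M" "g \<in> M \<rightarrow>\<^sub>M good_space"
  shows "(\<lambda>x. overshoot (f x) (g x)) \<in> borel_measurable M"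
  unfolding overshoot_def
  by (rule eval_measurable[OF inverse_at_measurable[OF assms] assms(2) inverse_nonneg[OF measurable_good[OF assms(2)]]])

lemma age_stopped_measurable [measurable (raw)]:
  assumes [measurable]: "u \<in> borel_measurable M" "y \<in> borel_measurable M" "f \<in> borel_measurable M" "g \<in> M \<rightarrow>\<^sub>M good_space"
  shows "(\<lambda>x. age_stopped (u x) (y x) (f x) (g x)) \<in> borel_measurable M"
  unfolding age_stopped_def
  by (intro borel_measurable_Pair inverse_at_measurable borel_measurable_diff borel_measurable_min undershoot_measurable assms)

definition mesh :: "nat \<Rightarrow> real" where "mesh n = 1 / real (Suc n)"

lemma mesh_pos: "0 < mesh n" and mesh_le_1: "mesh n \<le> 1"
  by (simp_all add: mesh_def)

lemma mesh_tendsto: "mesh \<longlonglongrightarrow> 0"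
  unfolding mesh_def[abs_def] using LIMSEQ_inverse_real_of_nat by (simp only: inverse_eq_divide)

text \<open>The grid point strictly before \<open>u\<close>, so that left limits appear without exceptional times.\<close>

definition grid :: "nat \<Rightarrow> real \<Rightarrow> nat" where
  "grid n u = nat (\<lceil>u / mesh n\<rceil> - 1)"

lemma grid_iff: "0 < u \<Longrightarrow> grid n u = k \<longleftrightarrow> real k * mesh n < u \<and> u \<le> real (Suc k) * mesh n"
proof -
  assume u: "0 < u"
  have "0 < u / mesh n" using u mesh_pos by simp
  then have "0 < \<lceil>u / mesh n\<rceil>" by simp
  then have "grid n u = k \<longleftrightarrow> \<lceil>u / mesh n\<rceil> = int k + 1" by (auto simp: grid_def)
  also have "\<dots> \<longleftrightarrow> real k < u / mesh n \<and> u / mesh n \<le> real k + 1" by (simp add: ceiling_eq_iff)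
  also have "\<dots> \<longleftrightarrow> real k * mesh n < u \<and> u \<le> real (Suc k) * mesh n"
    using mesh_pos[of n] by (simp add: field_simps)
  finally show ?thesis .
qed

lemma grid_bounds:
  assumes "0 < u"
  shows "real (grid n u) * mesh n < u" "u \<le> real (Suc (grid n u)) * mesh n"
  using grid_iff[OF assms, of n "grid n u"] by auto

lemma grid_tendsto:
  assumes "0 < u"
  shows "(\<lambda>n. real (grid n u) * mesh n) \<longlonglongrightarrow> u" "(\<lambda>n. real (Suc (grid n u)) * mesh n) \<longlonglongrightarrow> u"
proof -
  have 1: "u - mesh n \<le> real (grid n u) * mesh n" for n
    using grid_bounds(2)[OF assms, of n] by (simp add: algebra_simps)
  have 2: "(\<lambda>n. u - mesh n) \<longlonglongrightarrow> u - 0" "(\<lambda>n. u + mesh n) \<longlonglongrightarrow> u + 0" by (intro tendsto_intros mesh_tendsto)+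
  show "(\<lambda>n. real (grid n u) * mesh n) \<longlonglongrightarrow> u"
    by (rule tendsto_sandwich[OF _ _ 2(1)[simplified] tendsto_const])
       (use 1 grid_bounds(1)[OF assms] in \<open>auto intro!: always_eventually less_imp_le\<close>)
  have 3: "real (Suc (grid n u)) * mesh n \<le> u + mesh n" for n
    using grid_bounds(1)[OF assms, of n] by (simp add: algebra_simps)
  show "(\<lambda>n. real (Suc (grid n u)) * mesh n) \<longlonglongrightarrow> u"
    by (rule tendsto_sandwich[OF _ _ tendsto_const 2(2)[simplified]])
       (use 3 grid_bounds(2)[OF assms] in \<open>auto intro!: always_eventually simp del: of_nat_Suc\<close>)
qed

lemma grid_measurable [measurable]: "grid n \<in> borel \<rightarrow>\<^sub>M count_space UNIV"
  unfolding grid_def[abs_def] by measurable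

locale subordinator_law = subordinator +
  fixes Q :: "(real \<Rightarrow> real) measure"
  assumes Q: "sub_law Q"
begin

sublocale Q: prob_space Q using Q by (simp add: sub_law_def)

lemma sets_Q [measurable_cong]: "sets Q = sets good_space"
  using Q by (simp add: sub_law_def)

lemma space_Q: "space Q = good_paths"
  using sets_eq_imp_space_eq[OF sets_Q] by (simp add: space_good_space)

lemma age_at_measurable_Q: "age_at r \<in> borel_measurable Q"
  using age_at_measurable[OF borel_measurable_const, of "\<lambda>\<omega>. \<omega>" good_space r]
  by (simp add: measurable_cong_sets[OF sets_Q refl])

lemma nn_integral_paste:
  assumes f: "f \<in> borel_measurable good_space" and a: "0 \<le> a"
  shows "(\<integral>\<^sup>+\<omega>. f \<omega> \<partial>Q) = (\<integral>\<^sup>+\<omega>. \<integral>\<^sup>+\<eta>. f (paste a \<omega> \<eta>) \<partial>Q \<partial>Q)"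
proof -
  note [measurable] = paste_measurable[OF a]
  have pm: "(\<lambda>(\<omega>, \<eta>). paste a \<omega> \<eta>) \<in> Q \<Otimes>\<^sub>M Q \<rightarrow>\<^sub>M good_space" by measurable
  have "(\<integral>\<^sup>+\<omega>. f \<omega> \<partial>Q) = (\<integral>\<^sup>+\<omega>. f \<omega> \<partial>distr (Q \<Otimes>\<^sub>M Q) good_space (\<lambda>(\<omega>, \<eta>). paste a \<omega> \<eta>))"
    by (simp add: paste_law[OF Q a])
  also have "\<dots> = (\<integral>\<^sup>+\<omega>. \<integral>\<^sup>+\<eta>. f (paste a \<omega> \<eta>) \<partial>Q \<partial>Q)"
    using measurable_compose[OF pm f] f pm
    by (subst nn_integral_distr) (auto simp: Q.nn_integral_fst[symmetric] case_prod_beta')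
  finally show ?thesis .
qed

text \<open>By the Galois relation the cell containing the first passage is identified by the path
  values at its two ends. A random grid index is thus replaced by a sum over deterministic ones,
  where pasting is available.\<close>

lemma nn_integral_grid:
  assumes s: "0 < s" and [measurable]: "\<And>k. G k \<in> borel_measurable good_space"
  shows "(\<integral>\<^sup>+\<omega>. G (grid n (inverse_at s \<omega>)) \<omega> \<partial>Q)
    = (\<Sum>k. \<integral>\<^sup>+\<omega>. indicator {\<omega>. \<omega> (real k * mesh n) < s \<and> s \<le> \<omega> (real (Suc k) * mesh n)} \<omega> * G k \<omega> \<partial>Q)"
proof -
  have "(\<Sum>k. indicator {\<omega>. \<omega> (real k * mesh n) < s \<and> s \<le> \<omega> (real (Suc k) * mesh n)} \<omega> * G k \<omega>)
    = G (grid n (inverse_at s \<omega>)) \<omega>" if "\<omega> \<in> space Q" for \<omega>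
  proof -
    have \<omega>: "\<omega> \<in> good_paths" using that by (simp add: space_Q)
    have iff: "\<omega> (real k * mesh n) < s \<and> s \<le> \<omega> (real (Suc k) * mesh n) \<longleftrightarrow> grid n (inverse_at s \<omega>) = k" for k
      using less_inverse_iff[OF \<omega> s, of "real k * mesh n"] inverse_le_iff[OF \<omega> s, of "real (Suc k) * mesh n"]
        mesh_pos[of n] grid_iff[OF inverse_pos[OF \<omega> s], of n k] by (simp del: of_nat_Suc)
    have "(\<Sum>k. indicator {\<omega>. \<omega> (real k * mesh n) < s \<and> s \<le> \<omega> (real (Suc k) * mesh n)} \<omega> * G k \<omega>)
      = (\<Sum>k. if k = grid n (inverse_at s \<omega>) then G k \<omega> else 0)"
      using iff by (intro suminf_cong) (auto simp: indicator_def)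
    also have "\<dots> = G (grid n (inverse_at s \<omega>)) \<omega>" by (subst suminf_finite[where N="{grid n (inverse_at s \<omega>)}"]) auto
    finally show ?thesis .
  qed
  then have "(\<integral>\<^sup>+\<omega>. G (grid n (inverse_at s \<omega>)) \<omega> \<partial>Q)
    = (\<integral>\<^sup>+\<omega>. (\<Sum>k. indicator {\<omega>. \<omega> (real k * mesh n) < s \<and> s \<le> \<omega> (real (Suc k) * mesh n)} \<omega> * G k \<omega>) \<partial>Q)"
    by (intro nn_integral_cong) simp
  also have "\<dots> = (\<Sum>k. \<integral>\<^sup>+\<omega>. indicator {\<omega>. \<omega> (real k * mesh n) < s \<and> s \<le> \<omega> (real (Suc k) * mesh n)} \<omega> * G k \<omega> \<partial>Q)"
    by (intro nn_integral_suminf) measurable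
  finally show ?thesis .
qed

text \<open>Mean of g at the state reached r time units after a restart at which the first
  coordinate is l and the age is 0.\<close>

definition fresh :: "(real \<times> real \<Rightarrow> real) \<Rightarrow> real \<Rightarrow> real \<Rightarrow> real" where
  "fresh g r l = (\<integral>\<eta>. g (l + inverse_at r \<eta>, r - undershoot r \<eta>) \<partial>Q)"

lemma fresh_measurable [measurable (raw)]:
  assumes [measurable]: "g \<in> borel_measurable borel" "r \<in> borel_measurable M" "l \<in> borel_measurable M"
  shows "(\<lambda>x. fresh g (r x) (l x)) \<in> borel_measurable M"
  unfolding fresh_def by (rule Q.borel_measurable_lebesgue_integral) measurable

lemma fresh_eq:
  assumes [measurable]: "g \<in> borel_measurable borel" and g: "\<And>z. 0 \<le> g z" "\<And>z. g z \<le> 1"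
  shows "(\<integral>\<^sup>+\<eta>. ennreal (g (l + inverse_at r \<eta>, r - undershoot r \<eta>)) \<partial>Q) = ennreal (fresh g r l)"
  unfolding fresh_def using g
  by (intro nn_integral_eq_integral Q.integrable_const_bound[where B=1]) auto

lemma fresh_bounds:
  assumes [measurable]: "g \<in> borel_measurable borel" and g: "\<And>z. 0 \<le> g z" "\<And>z. g z \<le> 1"
  shows "0 \<le> fresh g r l" "fresh g r l \<le> 1"
proof -
  show "0 \<le> fresh g r l" unfolding fresh_def using g by (intro integral_nonneg_AE) auto
  have "fresh g r l \<le> (\<integral>\<eta>. 1 \<partial>Q)" unfolding fresh_def using g
    by (intro integral_mono Q.integrable_const_bound[where B=1]) auto
  then show "fresh g r l \<le> 1" by (simp add: Q.prob_space)
qed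

text \<open>The remaining times approach r from below because inverse and undershoot are
  left-continuous in the level. This is the side that occurs: at a grid point after the passage the
  path is at least at the overshoot and leaves no more time than the overshoot does.\<close>

lemma fresh_tendsto:
  assumes g: "continuous_on UNIV g" "\<And>z. 0 \<le> g z" "\<And>z. g z \<le> 1"
    and r: "0 < r" "\<And>n. r' n \<le> r" "r' \<longlonglongrightarrow> r" and l: "l' \<longlonglongrightarrow> l"
  shows "(\<lambda>n. fresh g (r' n) (l' n)) \<longlonglongrightarrow> fresh g r l"
  unfolding fresh_def
proof (rule integral_dominated_convergence[where w="\<lambda>_. 1"])
  have [measurable]: "g \<in> borel_measurable borel" by (rule borel_measurable_continuous_onI[OF g(1)])
  show "(\<lambda>x. g (l + inverse_at r x, r - undershoot r x)) \<in> borel_measurable Q" by measurable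
  show "(\<lambda>x. g (l' n + inverse_at (r' n) x, r' n - undershoot (r' n) x)) \<in> borel_measurable Q" for n by measurable
  show "AE x in Q. (\<lambda>n. g (l' n + inverse_at (r' n) x, r' n - undershoot (r' n) x))
    \<longlonglongrightarrow> g (l + inverse_at r x, r - undershoot r x)"
  proof (rule AE_I2)
    fix x assume "x \<in> space Q"
    then have x: "x \<in> good_paths" by (simp add: space_Q)
    have "(\<lambda>n. (l' n + inverse_at (r' n) x, r' n - undershoot (r' n) x)) \<longlonglongrightarrow> (l + inverse_at r x, r - undershoot r x)"
      by (intro tendsto_intros l r inverse_left_tendsto[OF x])
    then show "(\<lambda>n. g (l' n + inverse_at (r' n) x, r' n - undershoot (r' n) x))
      \<longlonglongrightarrow> g (l + inverse_at r x, r - undershoot r x)"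
      by (rule continuous_on_tendsto_compose[OF g(1)]) auto
  qed
qed (use g in auto)

end

text \<open>The past up to s is tested by finite products of continuous functions of age states with
  values in [0,1]: continuity survives the passage to the limit in the mesh, and the bound 1 is an
  integrable majorant. At s = 0 the past is deterministic and is treated apart.\<close>

locale age_tests = subordinator_law +
  fixes s :: real and J :: "real set" and f :: "real \<Rightarrow> real \<times> real \<Rightarrow> real"
  assumes s: "0 < s" and J: "finite J" "J \<subseteq> {0..s}"
    and f: "\<And>r. r \<in> J \<Longrightarrow> continuous_on UNIV (f r)" "\<And>r z. 0 \<le> f r z" "\<And>r z. f r z \<le> 1"
begin

definition F :: "(real \<Rightarrow> real) \<Rightarrow> real" where
  "F \<omega> = (\<Prod>r\<in>J. f r (age_at r \<omega>))"

definition F_stopped :: "real \<Rightarrow> real \<Rightarrow> (real \<Rightarrow> real) \<Rightarrow> real" where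
  "F_stopped u y \<omega> = (\<Prod>r\<in>J. f r (age_stopped u y r \<omega>))"

lemma F_bounds: "0 \<le> F \<omega>" "F \<omega> \<le> 1" "0 \<le> F_stopped u y \<omega>" "F_stopped u y \<omega> \<le> 1"
  unfolding F_def F_stopped_def by (intro prod_nonneg prod_le_1 conjI f)+

lemma f_measurable: "r \<in> J \<Longrightarrow> f r \<in> borel_measurable borel"
  by (intro borel_measurable_continuous_onI f)

lemma F_measurable [measurable (raw)]: "g \<in> M \<rightarrow>\<^sub>M good_space \<Longrightarrow> (\<lambda>x. F (g x)) \<in> borel_measurable M"
  unfolding F_def by (intro borel_measurable_prod measurable_compose[OF _ f_measurable] age_at_measurable) auto

lemma F_stopped_measurable [measurable (raw)]:
  "u \<in> borel_measurable M \<Longrightarrow> y \<in> borel_measurable M \<Longrightarrow> g \<in> M \<rightarrow>\<^sub>M good_space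
    \<Longrightarrow> (\<lambda>x. F_stopped (u x) (y x) (g x)) \<in> borel_measurable M"
  unfolding F_stopped_def by (intro borel_measurable_prod measurable_compose[OF _ f_measurable] age_stopped_measurable) auto

lemma F_paste:
  assumes "0 \<le> a" "\<omega> \<in> good_paths" "\<eta> \<in> good_paths" "s \<le> \<omega> a"
  shows "F (paste a \<omega> \<eta>) = F \<omega>"
  unfolding F_def
proof (intro prod.cong refl)
  fix r assume "r \<in> J"
  then have "r \<le> \<omega> a" using J assms(4) by auto
  then show "f r (age_at r (paste a \<omega> \<eta>)) = f r (age_at r \<omega>)"
    using paste_before[OF assms(1-3)] by (simp add: age_at_def)
qed

text \<open>On the event that the passage lies in cell k, the right end a of the cell is
  deterministic, and replacing the path after a by an independent copy preserves the law. The tests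
  only look at levels up to s \<le> \<omega>(a) and do not change, while the state at s + t >
  \<omega>(a) is that of the copy at the remaining level.\<close>

lemma renewal_grid:
  assumes t: "0 < t" and g: "continuous_on UNIV g" "\<And>z. 0 \<le> g z" "\<And>z. g z \<le> 1"
  defines "c \<equiv> \<lambda>n \<omega>. real (Suc (grid n (inverse_at s \<omega>))) * mesh n"
  shows "(\<integral>\<^sup>+\<omega>. indicator {\<omega>. \<omega> (c n \<omega>) < s + t} \<omega> * ennreal (F \<omega> * g (age_at (s + t) \<omega>)) \<partial>Q)
    = (\<integral>\<^sup>+\<omega>. indicator {\<omega>. \<omega> (c n \<omega>) < s + t} \<omega> * ennreal (F \<omega> * fresh g (s + t - \<omega> (c n \<omega>)) (c n \<omega>)) \<partial>Q)"
proof -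
  have [measurable]: "g \<in> borel_measurable borel" by (rule borel_measurable_continuous_onI[OF g(1)])
  define G where "G k \<omega> = indicator {\<omega>. \<omega> (real (Suc k) * mesh n) < s + t} \<omega> * ennreal (F \<omega> * g (age_at (s + t) \<omega>))" for k and \<omega> :: "real \<Rightarrow> real"
  define G' where "G' k \<omega> = indicator {\<omega>. \<omega> (real (Suc k) * mesh n) < s + t} \<omega>
    * ennreal (F \<omega> * fresh g (s + t - \<omega> (real (Suc k) * mesh n)) (real (Suc k) * mesh n))" for k and \<omega> :: "real \<Rightarrow> real"
  have [measurable]: "G k \<in> borel_measurable good_space" "G' k \<in> borel_measurable good_space" for k
    unfolding G_def G'_def by measurable
  have "(\<integral>\<^sup>+\<omega>. indicator {\<omega>. \<omega> (real k * mesh n) < s \<and> s \<le> \<omega> (real (Suc k) * mesh n)} \<omega> * G k \<omega> \<partial>Q)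
    = (\<integral>\<^sup>+\<omega>. indicator {\<omega>. \<omega> (real k * mesh n) < s \<and> s \<le> \<omega> (real (Suc k) * mesh n)} \<omega> * G' k \<omega> \<partial>Q)" for k
  proof -
    define a where "a = real (Suc k) * mesh n"
    define I where "I \<omega> = (indicator {\<omega>. \<omega> (real k * mesh n) < s \<and> s \<le> \<omega> a} \<omega> * indicator {\<omega>. \<omega> a < s + t} \<omega> :: ennreal)" for \<omega> :: "real \<Rightarrow> real"
    have a: "0 \<le> a" "real k * mesh n \<le> a" "0 \<le> real k * mesh n" using mesh_pos[of n] by (auto simp: a_def)
    have "(\<integral>\<^sup>+\<omega>. indicator {\<omega>. \<omega> (real k * mesh n) < s \<and> s \<le> \<omega> a} \<omega> * G k \<omega> \<partial>Q)
      = (\<integral>\<^sup>+\<omega>. \<integral>\<^sup>+\<eta>. indicator {\<omega>. \<omega> (real k * mesh n) < s \<and> s \<le> \<omega> a} (paste a \<omega> \<eta>) * G k (paste a \<omega> \<eta>) \<partial>Q \<partial>Q)"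
      using a by (intro nn_integral_paste) measurable
    also have "\<dots> = (\<integral>\<^sup>+\<omega>. \<integral>\<^sup>+\<eta>. I \<omega> * ennreal (F \<omega>) * ennreal (g (a + inverse_at (s + t - \<omega> a) \<eta>, s + t - \<omega> a - undershoot (s + t - \<omega> a) \<eta>)) \<partial>Q \<partial>Q)"
    proof (intro nn_integral_cong)
      fix \<omega> \<eta> assume "\<omega> \<in> space Q" "\<eta> \<in> space Q"
      then have G: "\<omega> \<in> good_paths" "\<eta> \<in> good_paths" by (auto simp: space_Q)
      show "indicator {\<omega>. \<omega> (real k * mesh n) < s \<and> s \<le> \<omega> a} (paste a \<omega> \<eta>) * G k (paste a \<omega> \<eta>)
        = I \<omega> * ennreal (F \<omega>) * ennreal (g (a + inverse_at (s + t - \<omega> a) \<eta>, s + t - \<omega> a - undershoot (s + t - \<omega> a) \<eta>))"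
      proof (cases "\<omega> (real k * mesh n) < s \<and> s \<le> \<omega> a \<and> \<omega> a < s + t")
        case True
        then show ?thesis
          using F_paste[OF a(1) G] paste_after[OF a(1) G, of "s + t"] F_bounds g(2) a
          by (simp add: G_def I_def a_def[symmetric] paste_simps age_at_def ennreal_mult' diff_diff_eq del: of_nat_Suc)
      next
        case False
        then show ?thesis using a by (auto simp: G_def I_def a_def[symmetric] paste_simps indicator_def simp del: of_nat_Suc)
      qed
    qed
    also have "\<dots> = (\<integral>\<^sup>+\<omega>. I \<omega> * ennreal (F \<omega>) * ennreal (fresh g (s + t - \<omega> a) a) \<partial>Q)"
      using g by (intro nn_integral_cong) (simp add: nn_integral_cmult fresh_eq)
    also have "\<dots> = (\<integral>\<^sup>+\<omega>. indicator {\<omega>. \<omega> (real k * mesh n) < s \<and> s \<le> \<omega> a} \<omega> * G' k \<omega> \<partial>Q)"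
      by (intro nn_integral_cong) (simp add: G'_def I_def a_def ennreal_mult' F_bounds mult.assoc del: of_nat_Suc)
    finally show ?thesis by (simp add: a_def del: of_nat_Suc)
  qed
  then have "(\<integral>\<^sup>+\<omega>. G (grid n (inverse_at s \<omega>)) \<omega> \<partial>Q) = (\<integral>\<^sup>+\<omega>. G' (grid n (inverse_at s \<omega>)) \<omega> \<partial>Q)"
    by (simp add: nn_integral_grid[OF s] del: of_nat_Suc)
  then show ?thesis unfolding G_def G'_def c_def indicator_def mem_Collect_eq .
qed

text \<open>The grid points tend to the passage time from the right, so the path values there tend
  to the overshoot. The indicators converge without exceptional cases because these values are never
  below the overshoot and the inequality with s + t is strict.\<close>

lemma renewal:
  assumes t: "0 < t" and g: "continuous_on UNIV g" "\<And>z. 0 \<le> g z" "\<And>z. g z \<le> 1"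
  shows "(\<integral>\<^sup>+\<omega>. indicator {\<omega>. overshoot s \<omega> < s + t} \<omega> * ennreal (F \<omega> * g (age_at (s + t) \<omega>)) \<partial>Q)
    = (\<integral>\<^sup>+\<omega>. indicator {\<omega>. overshoot s \<omega> < s + t} \<omega> * ennreal (F \<omega> * fresh g (s + t - overshoot s \<omega>) (inverse_at s \<omega>)) \<partial>Q)"
proof -
  have [measurable]: "g \<in> borel_measurable borel" by (rule borel_measurable_continuous_onI[OF g(1)])
  define c where "c n \<omega> = real (Suc (grid n (inverse_at s \<omega>))) * mesh n" for n \<omega>
  have c_ge: "inverse_at s \<omega> \<le> c n \<omega>" "c n \<omega> \<ge> 0" and c_lim: "(\<lambda>n. c n \<omega>) \<longlonglongrightarrow> inverse_at s \<omega>"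
    and ov: "(\<lambda>n. \<omega> (c n \<omega>)) \<longlonglongrightarrow> overshoot s \<omega>" "overshoot s \<omega> \<le> \<omega> (c n \<omega>)"
    if \<omega>: "\<omega> \<in> good_paths" for n \<omega>
  proof -
    show 1: "inverse_at s \<omega> \<le> c n \<omega>" for n
      unfolding c_def using grid_bounds(2)[OF inverse_pos[OF \<omega> s]] by simp
    then show "c n \<omega> \<ge> 0" using inverse_nonneg[OF \<omega>, of s] order_trans by blast
    show 2: "(\<lambda>n. c n \<omega>) \<longlonglongrightarrow> inverse_at s \<omega>"
      unfolding c_def by (rule grid_tendsto(2)[OF inverse_pos[OF \<omega> s]])
    show "(\<lambda>n. \<omega> (c n \<omega>)) \<longlonglongrightarrow> overshoot s \<omega>"
      unfolding overshoot_def by (rule right_tendsto[OF \<omega> inverse_nonneg[OF \<omega>] 1 2])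
    show "overshoot s \<omega> \<le> \<omega> (c n \<omega>)"
      unfolding overshoot_def by (rule good_le[OF \<omega> inverse_nonneg[OF \<omega>] 1])
  qed
  have idQ: "(\<lambda>\<omega>. \<omega>) \<in> Q \<rightarrow>\<^sub>M good_space" by (simp add: measurable_ident_sets sets_Q)
  have cm[measurable]: "(\<lambda>\<omega>. c n \<omega>) \<in> borel_measurable Q" for n
    unfolding c_def
    by (rule measurable_compose[OF measurable_compose[OF inverse_at_measurable[OF measurable_const idQ] grid_measurable],
          where g="\<lambda>k. real (Suc k) * mesh n"]) auto
  have [measurable]: "(\<lambda>\<omega>. \<omega> (c n \<omega>)) \<in> borel_measurable Q" for n
    by (rule eval_measurable[OF cm idQ]) (simp add: space_Q c_ge)
  define R where "R n \<omega> = F \<omega> * fresh g (s + t - \<omega> (c n \<omega>)) (c n \<omega>)" for n \<omega>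
  define R' where "R' \<omega> = F \<omega> * fresh g (s + t - overshoot s \<omega>) (inverse_at s \<omega>)" for \<omega>
  have [measurable]: "R n \<in> borel_measurable Q" "R' \<in> borel_measurable Q" for n unfolding R_def R'_def by measurable
  have bd: "ennreal (F \<omega> * z) \<le> 1" if "0 \<le> z" "z \<le> 1" for \<omega> z
    using F_bounds that by (auto simp: ennreal_le_1 intro!: mult_le_one)
  have ind: "(\<lambda>n. indicator {\<omega>. \<omega> (c n \<omega>) < s + t} \<omega> * ennreal (V n)) \<longlonglongrightarrow> indicator {\<omega>. overshoot s \<omega> < s + t} \<omega> * ennreal V'"
    if \<omega>: "\<omega> \<in> good_paths" and V: "overshoot s \<omega> < s + t \<Longrightarrow> V \<longlonglongrightarrow> V'" for \<omega> V V'
  proof (cases "overshoot s \<omega> < s + t")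
    case True
    from order_tendstoD(2)[OF ov(1)[OF \<omega>] True]
    have "eventually (\<lambda>n. ennreal (V n) = indicator {\<omega>. \<omega> (c n \<omega>) < s + t} \<omega> * ennreal (V n)) sequentially"
      by eventually_elim auto
    then have "(\<lambda>n. indicator {\<omega>. \<omega> (c n \<omega>) < s + t} \<omega> * ennreal (V n)) \<longlonglongrightarrow> ennreal V'"
      by (rule Lim_transform_eventually[OF tendsto_ennrealI[OF V[OF True]]])
    then show ?thesis using True by simp
  next
    case False
    then have "\<not> \<omega> (c n \<omega>) < s + t" for n using ov(2)[OF \<omega>, of n] by simp
    then show ?thesis using False by simp
  qed
  have L1: "(\<lambda>n. \<integral>\<^sup>+\<omega>. indicator {\<omega>. \<omega> (c n \<omega>) < s + t} \<omega> * ennreal (F \<omega> * g (age_at (s + t) \<omega>)) \<partial>Q)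
    \<longlonglongrightarrow> (\<integral>\<^sup>+\<omega>. indicator {\<omega>. overshoot s \<omega> < s + t} \<omega> * ennreal (F \<omega> * g (age_at (s + t) \<omega>)) \<partial>Q)"
  proof (rule nn_integral_dominated_convergence[where w="\<lambda>_. 1"])
    show "AE \<omega> in Q. indicator {\<omega>. \<omega> (c n \<omega>) < s + t} \<omega> * ennreal (F \<omega> * g (age_at (s + t) \<omega>)) \<le> 1" for n
      using bd[OF g(2,3)] by (intro AE_I2) (simp add: indicator_def)
    show "AE \<omega> in Q. (\<lambda>n. indicator {\<omega>. \<omega> (c n \<omega>) < s + t} \<omega> * ennreal (F \<omega> * g (age_at (s + t) \<omega>)))
      \<longlonglongrightarrow> indicator {\<omega>. overshoot s \<omega> < s + t} \<omega> * ennreal (F \<omega> * g (age_at (s + t) \<omega>))"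
      by (intro AE_I2 ind tendsto_const) (simp add: space_Q)
  qed (auto simp: Q.emeasure_space_1)
  have L2: "(\<lambda>n. \<integral>\<^sup>+\<omega>. indicator {\<omega>. \<omega> (c n \<omega>) < s + t} \<omega> * ennreal (R n \<omega>) \<partial>Q)
    \<longlonglongrightarrow> (\<integral>\<^sup>+\<omega>. indicator {\<omega>. overshoot s \<omega> < s + t} \<omega> * ennreal (R' \<omega>) \<partial>Q)"
  proof (rule nn_integral_dominated_convergence[where w="\<lambda>_. 1"])
    show "AE \<omega> in Q. indicator {\<omega>. \<omega> (c n \<omega>) < s + t} \<omega> * ennreal (R n \<omega>) \<le> 1" for n
      using bd[OF fresh_bounds[OF _ g(2,3)]] by (intro AE_I2) (simp add: R_def indicator_def)
    show "AE \<omega> in Q. (\<lambda>n. indicator {\<omega>. \<omega> (c n \<omega>) < s + t} \<omega> * ennreal (R n \<omega>))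
      \<longlonglongrightarrow> indicator {\<omega>. overshoot s \<omega> < s + t} \<omega> * ennreal (R' \<omega>)"
    proof (intro AE_I2 ind)
      fix \<omega> assume "\<omega> \<in> space Q" and D: "overshoot s \<omega> < s + t"
      then have \<omega>: "\<omega> \<in> good_paths" by (simp add: space_Q)
      show "(\<lambda>n. R n \<omega>) \<longlonglongrightarrow> R' \<omega>"
        unfolding R_def R'_def using D ov[OF \<omega>] c_lim[OF \<omega>]
        by (intro tendsto_intros fresh_tendsto g) auto
    qed (simp add: space_Q)
  qed (auto simp: Q.emeasure_space_1)
  have eq: "(\<integral>\<^sup>+\<omega>. indicator {\<omega>. \<omega> (c n \<omega>) < s + t} \<omega> * ennreal (F \<omega> * g (age_at (s + t) \<omega>)) \<partial>Q)
    = (\<integral>\<^sup>+\<omega>. indicator {\<omega>. \<omega> (c n \<omega>) < s + t} \<omega> * ennreal (R n \<omega>) \<partial>Q)" for n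
    unfolding R_def c_def by (rule renewal_grid[OF t g])
  show ?thesis using LIMSEQ_unique[OF L1[unfolded eq] L2] unfolding R'_def .
qed

end

section \<open>The compensation formula\<close>

text \<open>The Riemann sum over grid points is the Lebesgue integral of a step function, a form in
  which dominated convergence applies to it.\<close>

lemma nn_integral_lborel_grid:
  "(\<integral>\<^sup>+u. indicator {0<..} u * G (real (grid n u) * mesh n) \<partial>lborel) = (\<Sum>k. ennreal (mesh n) * G (real k * mesh n))"
proof -
  have "indicator {0<..} u * G (real (grid n u) * mesh n)
    = (\<Sum>k. G (real k * mesh n) * indicator {real k * mesh n<..real (Suc k) * mesh n} u)" for u
  proof (cases "0 < u")
    case True
    have "(\<Sum>k. G (real k * mesh n) * indicator {real k * mesh n<..real (Suc k) * mesh n} u)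
      = (\<Sum>k. if k = grid n u then G (real k * mesh n) else 0)"
      using grid_iff[OF True, of n] by (intro suminf_cong) (auto simp: indicator_def eq_commute[of _ "grid n u"] simp del: of_nat_Suc)
    also have "\<dots> = G (real (grid n u) * mesh n)"
      by (subst suminf_finite[where N="{grid n u}"]) auto
    finally show ?thesis using True by simp
  next
    case False
    have "indicator {real k * mesh n<..real (Suc k) * mesh n} u = (0::ennreal)" for k
    proof -
      have "0 \<le> real k * mesh n" using mesh_pos[of n] by simp
      then show ?thesis using False by (auto simp: indicator_def)
    qed
    then show ?thesis using False by simp
  qed
  then have "(\<integral>\<^sup>+u. indicator {0<..} u * G (real (grid n u) * mesh n) \<partial>lborel)
    = (\<Sum>k. \<integral>\<^sup>+u. G (real k * mesh n) * indicator {real k * mesh n<..real (Suc k) * mesh n} u \<partial>lborel)"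
    by (simp add: nn_integral_suminf)
  also have "\<dots> = (\<Sum>k. ennreal (mesh n) * G (real k * mesh n))"
    using mesh_pos[of n]
    by (intro suminf_cong) (simp add: nn_integral_cmult_indicator mult.commute algebra_simps)
  finally show ?thesis .
qed

context subordinator
begin

lemma tail_n_antimono: "w \<le> v \<Longrightarrow> tail_n n v \<le> tail_n n w"
proof -
  assume "w \<le> v"
  interpret prob_space "\<mu> (1 / real (Suc n))" by (rule prob_mu) simp
  show ?thesis
    unfolding tail_n_def using \<open>w \<le> v\<close> by (intro mult_left_mono finite_measure_mono) (auto simp: sets_mu)
qed

lemma tail_n_measurable [measurable]: "tail_n n \<in> borel_measurable borel"
proof -
  have "(\<lambda>v. - tail_n n v) \<in> borel_measurable borel"
    using tail_n_antimono by (intro borel_measurable_mono monoI) simp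
  from borel_measurable_uminus[OF this] show ?thesis by simp
qed

lemma tail_measurable: "0 < c \<Longrightarrow> (\<lambda>v. tail (max c v)) \<in> borel_measurable borel"
proof -
  assume "0 < c"
  then have "(\<lambda>v. - tail (max c v)) \<in> borel_measurable borel"
    by (intro borel_measurable_mono monoI) (auto intro!: tail_antimono)
  from borel_measurable_uminus[OF this] show ?thesis by simp
qed

end

context age_tests
begin

text \<open>For r \<le> \<omega>(a) the state at r is determined by the first piece. For larger r
  both coordinates have reached their caps a and \<omega>(a), whatever follows after a.\<close>

lemma F_stopped_paste:
  assumes a: "0 \<le> a" and \<omega>: "\<omega> \<in> good_paths" and \<eta>: "\<eta> \<in> good_paths"
  shows "F_stopped a (\<omega> a) (paste a \<omega> \<eta>) = F_stopped a (\<omega> a) \<omega>"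
proof -
  have "age_stopped a (\<omega> a) r (paste a \<omega> \<eta>) = age_stopped a (\<omega> a) r \<omega>" for r
  proof (cases "r \<le> \<omega> a")
    case True
    then show ?thesis by (simp add: age_stopped_def paste_before[OF assms])
  next
    case False
    then have r: "\<omega> a < r" "0 < r" using good_nonneg[OF \<omega> a] by auto
    have "a < inverse_at r \<omega>" using less_inverse_iff[OF \<omega> r(2) a] r(1) by simp
    moreover have "\<omega> a \<le> undershoot r \<omega>"
      using le_left_lim[OF \<omega> a calculation] undershoot_eq[OF \<omega> r(2)] by simp
    ultimately show ?thesis
      using inverse_nonneg[OF \<eta>, of "r - \<omega> a"] undershoot_nonneg[OF \<eta>, of "r - \<omega> a"]
      by (simp add: age_stopped_def paste_after[OF assms r(1)] min_def)
  qed
  then show ?thesis by (simp add: F_stopped_def)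
qed

lemma F_stopped_tendsto:
  assumes "u \<longlonglongrightarrow> u'" "y \<longlonglongrightarrow> y'"
  shows "(\<lambda>n. F_stopped (u n) (y n) \<omega>) \<longlonglongrightarrow> F_stopped u' y' \<omega>"
  unfolding F_stopped_def age_stopped_def
proof (rule tendsto_prod)
  fix r assume r: "r \<in> J"
  have "(\<lambda>n. (min (u n) (inverse_at r \<omega>), r - min (y n) (undershoot r \<omega>))) \<longlonglongrightarrow> (min u' (inverse_at r \<omega>), r - min y' (undershoot r \<omega>))"
    by (intro tendsto_intros assms)
  then show "(\<lambda>n. f r (min (u n) (inverse_at r \<omega>), r - min (y n) (undershoot r \<omega>)))
    \<longlonglongrightarrow> f r (min u' (inverse_at r \<omega>), r - min y' (undershoot r \<omega>))"
    by (rule continuous_on_tendsto_compose[OF f(1)[OF r]]) auto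
qed

lemma F_stopped_at:
  assumes "\<omega> \<in> good_paths"
  shows "F_stopped (inverse_at s \<omega>) (undershoot s \<omega>) \<omega> = F \<omega>"
proof -
  have "age_stopped (inverse_at s \<omega>) (undershoot s \<omega>) r \<omega> = age_at r \<omega>" if "r \<in> J" for r
    using inverse_mono[OF assms, of r s] undershoot_mono[OF assms, of r s] J that
    by (auto simp: age_stopped_def age_at_def min_def)
  then show ?thesis by (simp add: F_stopped_def F_def)
qed

text \<open>Given the path up to the grid point a, this is the rate per unit time at which the next
  cell passes s with an increment of at least c, multiplied by the tests: starting from \<omega>(a)
  < s the increment has to be at least max c (s - \<omega>(a)).\<close>

definition pre_density :: "real \<Rightarrow> (real \<times> real \<Rightarrow> real) \<Rightarrow> nat \<Rightarrow> real \<Rightarrow> (real \<Rightarrow> real) \<Rightarrow> ennreal" where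
  "pre_density c f0 n a \<omega> = indicator {..<s} (\<omega> a)
     * ennreal (F_stopped a (\<omega> a) \<omega> * f0 (a, s - \<omega> a) * tail_n n (max c (s - \<omega> a)))"

text \<open>The limit of \<open>pre_density\<close> up to the factor \<open>f0\<close>. The strict
  bound on \<omega>(a) becomes a weak bound on the left limit at u, because \<omega>(a) is strictly
  below that limit for a < u.\<close>

definition jump_density :: "real \<Rightarrow> real \<Rightarrow> (real \<Rightarrow> real) \<Rightarrow> real" where
  "jump_density c u \<omega> = indicator {..s} (left_lim u \<omega>) * F_stopped u (left_lim u \<omega>) \<omega> * tail (max c (s - left_lim u \<omega>))"

text \<open>In a fixed cell the tests are stopped at the left end and hence unchanged by pasting
  there, while the increment belongs to the pasted copy and has law \<open>\<mu> (mesh n)\<close>.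
  The factor \<open>mesh n\<close> extracted from this law is the width in the Riemann sum.\<close>

lemma compensation_grid:
  assumes c: "0 < c" and f0: "continuous_on UNIV f0" "\<And>z. 0 \<le> f0 z"
  defines "a \<equiv> \<lambda>n \<omega>. real (grid n (inverse_at s \<omega>)) * mesh n"
  shows "(\<integral>\<^sup>+\<omega>. ennreal (F_stopped (a n \<omega>) (\<omega> (a n \<omega>)) \<omega> * f0 (a n \<omega>, s - \<omega> (a n \<omega>)))
      * indicator {c..} (\<omega> (a n \<omega> + mesh n) - \<omega> (a n \<omega>)) \<partial>Q)
    = (\<integral>\<^sup>+\<omega>. \<integral>\<^sup>+u. indicator {0<..} u * pre_density c f0 n (real (grid n u) * mesh n) \<omega> \<partial>lborel \<partial>Q)"
proof -
  have [measurable]: "f0 \<in> borel_measurable borel" by (rule borel_measurable_continuous_onI[OF f0(1)])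
  have [measurable]: "pre_density c f0 n (real k * mesh n) \<in> borel_measurable Q" for k
    unfolding pre_density_def by measurable
  define G where "G k \<omega> = ennreal (F_stopped (real k * mesh n) (\<omega> (real k * mesh n)) \<omega> * f0 (real k * mesh n, s - \<omega> (real k * mesh n)))
      * indicator {c..} (\<omega> (real k * mesh n + mesh n) - \<omega> (real k * mesh n))" for k \<omega>
  have [measurable]: "G k \<in> borel_measurable good_space" for k unfolding G_def by measurable
  have "(\<integral>\<^sup>+\<omega>. indicator {\<omega>. \<omega> (real k * mesh n) < s \<and> s \<le> \<omega> (real (Suc k) * mesh n)} \<omega> * G k \<omega> \<partial>Q)
    = (\<integral>\<^sup>+\<omega>. ennreal (mesh n) * pre_density c f0 n (real k * mesh n) \<omega> \<partial>Q)" for k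
  proof -
    define a where "a = real k * mesh n"
    have a: "0 \<le> a" "real (Suc k) * mesh n = a + mesh n" using mesh_pos[of n] by (auto simp: a_def algebra_simps)
    define I where "I \<omega> = indicator {..<s} (\<omega> a) * ennreal (F_stopped a (\<omega> a) \<omega> * f0 (a, s - \<omega> a))" for \<omega> :: "real \<Rightarrow> real"
    have "(\<integral>\<^sup>+\<omega>. indicator {\<omega>. \<omega> a < s \<and> s \<le> \<omega> (a + mesh n)} \<omega> * G k \<omega> \<partial>Q)
      = (\<integral>\<^sup>+\<omega>. \<integral>\<^sup>+\<eta>. indicator {\<omega>. \<omega> a < s \<and> s \<le> \<omega> (a + mesh n)} (paste a \<omega> \<eta>) * G k (paste a \<omega> \<eta>) \<partial>Q \<partial>Q)"
      by (intro nn_integral_paste a) measurable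
    also have "\<dots> = (\<integral>\<^sup>+\<omega>. \<integral>\<^sup>+\<eta>. I \<omega> * indicator {max c (s - \<omega> a)..} (\<eta> (mesh n)) \<partial>Q \<partial>Q)"
    proof (intro nn_integral_cong)
      fix \<omega> \<eta> assume "\<omega> \<in> space Q" "\<eta> \<in> space Q"
      then have G: "\<omega> \<in> good_paths" "\<eta> \<in> good_paths" by (auto simp: space_Q)
      have p: "paste a \<omega> \<eta> a = \<omega> a" "paste a \<omega> \<eta> (a + mesh n) = \<omega> a + \<eta> (mesh n)"
        using a mesh_pos[of n] by (auto simp: paste_simps)
      show "indicator {\<omega>. \<omega> a < s \<and> s \<le> \<omega> (a + mesh n)} (paste a \<omega> \<eta>) * G k (paste a \<omega> \<eta>)
        = I \<omega> * indicator {max c (s - \<omega> a)..} (\<eta> (mesh n))"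
        using F_stopped_paste[OF a(1) G] p
        by (auto simp: G_def I_def a_def[symmetric] indicator_def)
    qed
    also have "\<dots> = (\<integral>\<^sup>+\<omega>. I \<omega> * emeasure (\<mu> (mesh n)) {max c (s - \<omega> a)..} \<partial>Q)"
      using mesh_pos[of n] by (intro nn_integral_cong) (simp add: nn_integral_cmult law_at[OF Q])
    also have "\<dots> = (\<integral>\<^sup>+\<omega>. ennreal (mesh n) * pre_density c f0 n a \<omega> \<partial>Q)"
    proof (intro nn_integral_cong)
      fix \<omega>
      interpret mu: prob_space "\<mu> (mesh n)" using mesh_pos[of n] by (intro prob_mu) simp
      have "emeasure (\<mu> (mesh n)) {max c (s - \<omega> a)..} = ennreal (mesh n) * ennreal (tail_n n (max c (s - \<omega> a)))"
      proof -
        have "measure (\<mu> (mesh n)) {max c (s - \<omega> a)..} = mesh n * tail_n n (max c (s - \<omega> a))"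
          by (simp add: tail_n_def mesh_def)
        then show ?thesis unfolding mu.emeasure_eq_measure using mesh_pos[of n] by (simp add: ennreal_mult')
      qed
      then show "I \<omega> * emeasure (\<mu> (mesh n)) {max c (s - \<omega> a)..} = ennreal (mesh n) * pre_density c f0 n a \<omega>"
        using F_bounds f0 tail_n_nonneg by (simp add: I_def pre_density_def ennreal_mult' ac_simps)
    qed
    finally show ?thesis unfolding a(2) a_def[symmetric] .
  qed
  then have "(\<integral>\<^sup>+\<omega>. G (grid n (inverse_at s \<omega>)) \<omega> \<partial>Q) = (\<Sum>k. \<integral>\<^sup>+\<omega>. ennreal (mesh n) * pre_density c f0 n (real k * mesh n) \<omega> \<partial>Q)"
    by (simp add: nn_integral_grid[OF s] del: of_nat_Suc)
  also have "\<dots> = (\<integral>\<^sup>+\<omega>. (\<Sum>k. ennreal (mesh n) * pre_density c f0 n (real k * mesh n) \<omega>) \<partial>Q)"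
    by (intro nn_integral_suminf[symmetric]) measurable
  finally show ?thesis
    unfolding nn_integral_lborel_grid[where G="\<lambda>a. pre_density c f0 n a \<omega>" for \<omega>]
    by (simp add: G_def a_def)
qed

lemma jump_density_measurable:
  assumes c: "0 < c"
  shows "(\<lambda>(\<omega>, u). jump_density c u \<omega>) \<in> borel_measurable (good_space \<Otimes>\<^sub>M borel)"
  unfolding jump_density_def case_prod_beta'
  by (intro borel_measurable_times borel_measurable_indicator F_stopped_measurable measurable_compose[OF _ tail_measurable[OF c]]
      measurable_compose[OF _ borel_measurable_indicator[of "{..s}"]] borel_measurable_diff left_lim_measurable) measurable

lemma jump_density_nonneg: "0 \<le> jump_density c u \<omega>"
  by (simp add: jump_density_def F_bounds tail_nonneg)

lemma ident_measurable: "(\<lambda>\<omega>. \<omega>) \<in> Q \<rightarrow>\<^sub>M good_space"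
  by (simp add: measurable_ident_sets sets_Q)

lemma grid_point_measurable:
  "(\<lambda>\<omega>. real (grid n (inverse_at s \<omega>)) * mesh n) \<in> borel_measurable Q"
  by (rule measurable_compose[OF measurable_compose[OF inverse_at_measurable[OF measurable_const ident_measurable] grid_measurable],
        where g="\<lambda>k. real k * mesh n"]) auto

lemma pre_density_measurable:
  assumes [measurable]: "f0 \<in> borel_measurable borel"
  shows "(\<lambda>(\<omega>, u). pre_density c f0 n (real (grid n u) * mesh n) \<omega>) \<in> borel_measurable (Q \<Otimes>\<^sub>M lborel)"
proof -
  have "snd \<in> borel_measurable (Q \<Otimes>\<^sub>M lborel)" by simp
  then have g[measurable]: "(\<lambda>z. real (grid n (snd z)) * mesh n) \<in> borel_measurable (Q \<Otimes>\<^sub>M lborel)"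
    by (rule measurable_compose[OF measurable_compose[OF _ grid_measurable], where g="\<lambda>k. real k * mesh n"]) auto
  have f[measurable]: "fst \<in> Q \<Otimes>\<^sub>M lborel \<rightarrow>\<^sub>M good_space"
    using measurable_fst[of Q lborel] by (simp add: measurable_cong_sets[OF refl sets_Q])
  have [measurable]: "(\<lambda>z. fst z (real (grid n (snd z)) * mesh n)) \<in> borel_measurable (Q \<Otimes>\<^sub>M lborel)"
    using mesh_pos[of n] by (intro eval_measurable[OF g f]) simp
  show ?thesis unfolding pre_density_def case_prod_beta' by measurable
qed

text \<open>The tests are at most 1 and \<open>tail_n\<close> is bounded on [c,\<infinity>). The
  cut-off of \<open>f0\<close> at T restricts u to values up to T + 1, since the grid point lies at
  most one mesh, hence at most 1, before u.\<close>

lemma pre_density_le: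
  assumes c: "0 < c" and f0: "\<And>z. 0 \<le> f0 z" "\<And>z. f0 z \<le> 1" "\<And>l v. T \<le> l \<Longrightarrow> f0 (l, v) = 0"
  shows "indicator {0<..} u * pre_density c f0 n (real (grid n u) * mesh n) \<omega>
    \<le> ennreal (\<phi> 1 / (1 - exp (- c))) * indicator {0<..T + 1} u"
proof (cases "0 < u \<and> u \<le> T + 1")
  case True
  have "tail_n n v \<le> \<phi> 1 / (1 - exp (- c))" if "c \<le> v" for v
    using order_trans[OF tail_n_antimono[OF that] tail_n_le[OF c]] .
  then have "F_stopped a y \<omega> * f0 (a, s - y) * tail_n n (max c (s - y)) \<le> 1 * 1 * (\<phi> 1 / (1 - exp (- c)))" for a y
    using F_bounds f0 tail_n_nonneg by (intro mult_mono) auto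
  then have "pre_density c f0 n a \<omega> \<le> ennreal (\<phi> 1 / (1 - exp (- c)))" for a
    unfolding pre_density_def by (auto simp: indicator_def intro!: ennreal_leI)
  then show ?thesis using True by simp
next
  case False
  show ?thesis
  proof (cases "0 < u")
    case True
    then have "T \<le> real (grid n u) * mesh n"
      using False grid_bounds(2)[OF True, of n] mesh_le_1[of n] by (simp add: algebra_simps)
    then show ?thesis by (simp add: pre_density_def f0)
  qed simp
qed

lemma pre_density_tendsto:
  assumes c: "0 < c" "emeasure \<nu> {c} = 0" and f0: "continuous_on UNIV f0"
    and \<omega>: "\<omega> \<in> good_paths" and u: "0 < u" and v: "0 < s - left_lim u \<omega> \<Longrightarrow> emeasure \<nu> {s - left_lim u \<omega>} = 0"
  shows "(\<lambda>n. pre_density c f0 n (real (grid n u) * mesh n) \<omega>)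
    \<longlonglongrightarrow> ennreal (jump_density c u \<omega> * f0 (u, s - left_lim u \<omega>))"
proof -
  define a where "a n = real (grid n u) * mesh n" for n
  define y where "y = left_lim u \<omega>"
  have a: "a n < u" "0 \<le> a n" for n using grid_bounds(1)[OF u] mesh_pos[of n] by (auto simp: a_def)
  have al: "a \<longlonglongrightarrow> u" unfolding a_def[abs_def] by (rule grid_tendsto(1)[OF u])
  have yl: "(\<lambda>n. \<omega> (a n)) \<longlonglongrightarrow> y" unfolding y_def by (rule left_lim_tendsto[OF \<omega> u a(1) al a(2)])
  have lt: "\<omega> (a n) < y" for n unfolding y_def by (rule less_left_lim[OF \<omega> a(2) a(1)])
  \<comment> \<open>Both c and, if positive, s - y are assumed free of atoms; so is the larger of
    the two, as \<open>tail_n_tendsto\<close> requires.\<close>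
  have "max c (s - y) = c \<or> max c (s - y) = s - y \<and> 0 < s - y" using c by (auto simp: max_def)
  then have m: "emeasure \<nu> {max c (s - y)} = 0" "0 < max c (s - y)" using c v by (auto simp: y_def)
  have "(\<lambda>n. max c (s - \<omega> (a n))) \<longlonglongrightarrow> max c (s - y)" by (intro tendsto_intros yl)
  from tail_n_tendsto[OF m(2,1) this]
  have t: "(\<lambda>n. tail_n n (max c (s - \<omega> (a n)))) \<longlonglongrightarrow> tail (max c (s - y))" .
  have "(\<lambda>n. (a n, s - \<omega> (a n))) \<longlonglongrightarrow> (u, s - y)" by (intro tendsto_intros al yl)
  then have f0l: "(\<lambda>n. f0 (a n, s - \<omega> (a n))) \<longlonglongrightarrow> f0 (u, s - y)"
    by (rule continuous_on_tendsto_compose[OF f0]) auto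
  show ?thesis
  proof (cases "y \<le> s")
    case True
    then have "\<omega> (a n) < s" for n using lt[of n] by simp
    then have p: "pre_density c f0 n (a n) \<omega>
      = ennreal (F_stopped (a n) (\<omega> (a n)) \<omega> * f0 (a n, s - \<omega> (a n)) * tail_n n (max c (s - \<omega> (a n))))" for n
      by (simp add: pre_density_def)
    have j: "jump_density c u \<omega> * f0 (u, s - y) = F_stopped u y \<omega> * f0 (u, s - y) * tail (max c (s - y))"
      using True by (simp add: jump_density_def y_def)
    have "(\<lambda>n. ennreal (F_stopped (a n) (\<omega> (a n)) \<omega> * f0 (a n, s - \<omega> (a n)) * tail_n n (max c (s - \<omega> (a n)))))
      \<longlonglongrightarrow> ennreal (F_stopped u y \<omega> * f0 (u, s - y) * tail (max c (s - y)))"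
      by (intro tendsto_ennrealI tendsto_intros F_stopped_tendsto al yl t f0l)
    then show ?thesis unfolding a_def[symmetric] y_def[symmetric] p j .
  next
    case False
    then have "eventually (\<lambda>n. s < \<omega> (a n)) sequentially" using order_tendstoD(1)[OF yl, of s] by simp
    then have "eventually (\<lambda>n. pre_density c f0 n (a n) \<omega> = 0) sequentially"
      by eventually_elim (simp add: pre_density_def)
    then show ?thesis
      using False by (simp add: jump_density_def a_def[symmetric] y_def[symmetric] tendsto_eventually)
  qed
qed

text \<open>Left limits increase strictly with u, so each of the countably many atoms is met for at
  most one u.\<close>

lemma AE_no_atom:
  assumes \<omega>: "\<omega> \<in> good_paths"
  shows "AE u in lborel. 0 < u \<longrightarrow> 0 < s - left_lim u \<omega> \<longrightarrow> emeasure \<nu> {s - left_lim u \<omega>} = 0"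
proof -
  define N where "N = {u. 0 < u \<and> 0 < s - left_lim u \<omega> \<and> emeasure \<nu> {s - left_lim u \<omega>} \<noteq> 0}"
  have "inj_on (\<lambda>u. s - left_lim u \<omega>) N"
  proof (rule inj_onI)
    fix x y assume "x \<in> N" "y \<in> N" "s - left_lim x \<omega> = s - left_lim y \<omega>"
    then show "x = y"
      using left_lim_strict_mono[OF \<omega>, of x y] left_lim_strict_mono[OF \<omega>, of y x]
      by (cases x y rule: linorder_cases) (auto simp: N_def)
  qed
  moreover have "countable ((\<lambda>u. s - left_lim u \<omega>) ` N)"
    by (rule countable_subset[OF _ countable_atoms]) (auto simp: N_def)
  ultimately have "countable N" by (rule countable_image_inj_on[rotated])
  then have "AE u in lborel. u \<notin> N" by (intro AE_not_in countable_imp_null_set_lborel)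
  then show ?thesis by eventually_elim (auto simp: N_def)
qed

text \<open>Both sides are limits of one discretised quantity. On the left the increment over the
  passage cell shrinks to the jump across s; on the right the sum over cells becomes an integral
  over candidate jump times u, weighted by the tail of \<nu> beyond both c and the distance to
  s.\<close>

lemma compensation:
  assumes c: "0 < c" "emeasure \<nu> {c} = 0" and T: "0 \<le> T"
    and f0: "continuous_on UNIV f0" "\<And>z. 0 \<le> f0 z" "\<And>z. f0 z \<le> 1" "\<And>l v. T \<le> l \<Longrightarrow> f0 (l, v) = 0"
  shows "(\<integral>\<^sup>+\<omega>. ennreal (F \<omega> * f0 (age_at s \<omega>)) * indicator {c..} (overshoot s \<omega> - undershoot s \<omega>) \<partial>Q)
    = (\<integral>\<^sup>+\<omega>. \<integral>\<^sup>+u. indicator {0<..} u * ennreal (jump_density c u \<omega> * f0 (u, s - left_lim u \<omega>)) \<partial>lborel \<partial>Q)"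
proof -
  have [measurable]: "f0 \<in> borel_measurable borel" by (rule borel_measurable_continuous_onI[OF f0(1)])
  have jm: "(\<lambda>(\<omega>, u). indicator {0<..} u * ennreal (jump_density c u \<omega> * f0 (u, s - left_lim u \<omega>))) \<in> borel_measurable (Q \<Otimes>\<^sub>M lborel)"
  proof -
    have f[measurable]: "fst \<in> Q \<Otimes>\<^sub>M lborel \<rightarrow>\<^sub>M good_space"
      using measurable_fst[of Q lborel] by (simp add: measurable_cong_sets[OF refl sets_Q])
    have "(\<lambda>z. (fst z, snd z)) \<in> Q \<Otimes>\<^sub>M lborel \<rightarrow>\<^sub>M good_space \<Otimes>\<^sub>M borel" by measurable
    from measurable_compose[OF this jump_density_measurable[OF c(1)]]
    have [measurable]: "(\<lambda>z. jump_density c (snd z) (fst z)) \<in> borel_measurable (Q \<Otimes>\<^sub>M lborel)" by simp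
    show ?thesis unfolding case_prod_beta' by measurable
  qed
  have sec: "(\<lambda>u. g (\<omega>, u)) \<in> borel_measurable lborel" if "g \<in> borel_measurable (Q \<Otimes>\<^sub>M lborel)" "\<omega> \<in> space Q" for g :: "_ \<Rightarrow> ennreal" and \<omega>
    using that by measurable
  define a where "a n \<omega> = real (grid n (inverse_at s \<omega>)) * mesh n" for n \<omega>
  have am[measurable]: "a n \<in> borel_measurable Q" for n
    unfolding a_def[abs_def] by (rule grid_point_measurable)
  have a0: "0 \<le> a n \<omega>" for n \<omega> using mesh_pos[of n] by (simp add: a_def)
  have [measurable]: "(\<lambda>\<omega>. \<omega> (a n \<omega>)) \<in> borel_measurable Q" "(\<lambda>\<omega>. \<omega> (a n \<omega> + mesh n)) \<in> borel_measurable Q" for n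
    using a0 mesh_pos[of n] eval_measurable[OF am ident_measurable, of n]
      eval_measurable[OF borel_measurable_add[OF am borel_measurable_const] ident_measurable, of n "mesh n"]
    by (auto simp: add_nonneg_nonneg less_imp_le)
  have "(\<lambda>n. \<integral>\<^sup>+\<omega>. ennreal (F_stopped (a n \<omega>) (\<omega> (a n \<omega>)) \<omega> * f0 (a n \<omega>, s - \<omega> (a n \<omega>)))
      * indicator {c..} (\<omega> (a n \<omega> + mesh n) - \<omega> (a n \<omega>)) \<partial>Q)
    \<longlonglongrightarrow> (\<integral>\<^sup>+\<omega>. ennreal (F \<omega> * f0 (age_at s \<omega>)) * indicator {c..} (overshoot s \<omega> - undershoot s \<omega>) \<partial>Q)"
  proof (rule nn_integral_dominated_convergence[where w="\<lambda>_. 1"])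
    show "AE \<omega> in Q. ennreal (F_stopped (a n \<omega>) (\<omega> (a n \<omega>)) \<omega> * f0 (a n \<omega>, s - \<omega> (a n \<omega>)))
      * indicator {c..} (\<omega> (a n \<omega> + mesh n) - \<omega> (a n \<omega>)) \<le> 1" for n
      using F_bounds f0(2,3) by (intro AE_I2) (auto simp: indicator_def ennreal_le_1 intro!: mult_le_one)
    show "AE \<omega> in Q. (\<lambda>n. ennreal (F_stopped (a n \<omega>) (\<omega> (a n \<omega>)) \<omega> * f0 (a n \<omega>, s - \<omega> (a n \<omega>)))
      * indicator {c..} (\<omega> (a n \<omega> + mesh n) - \<omega> (a n \<omega>)))
      \<longlonglongrightarrow> ennreal (F \<omega> * f0 (age_at s \<omega>)) * indicator {c..} (overshoot s \<omega> - undershoot s \<omega>)"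
    proof (rule AE_I2)
      fix \<omega> assume "\<omega> \<in> space Q"
      then have \<omega>: "\<omega> \<in> good_paths" by (simp add: space_Q)
      note L = inverse_pos[OF \<omega> s]
      have al: "(\<lambda>n. a n \<omega>) \<longlonglongrightarrow> inverse_at s \<omega>" unfolding a_def by (rule grid_tendsto(1)[OF L])
      have lt: "a n \<omega> < inverse_at s \<omega>" for n unfolding a_def by (rule grid_bounds(1)[OF L])
      have yl: "(\<lambda>n. \<omega> (a n \<omega>)) \<longlonglongrightarrow> undershoot s \<omega>"
        unfolding undershoot_eq[OF \<omega> s] by (rule left_lim_tendsto[OF \<omega> L lt al a0])
      have ge: "inverse_at s \<omega> \<le> a n \<omega> + mesh n" for n
        using grid_bounds(2)[OF L, of n] by (simp add: a_def algebra_simps)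
      have "(\<lambda>n. a n \<omega> + mesh n) \<longlonglongrightarrow> inverse_at s \<omega> + 0" by (intro tendsto_intros al mesh_tendsto)
      then have ol: "(\<lambda>n. \<omega> (a n \<omega> + mesh n)) \<longlonglongrightarrow> overshoot s \<omega>"
        unfolding overshoot_def using ge by (intro right_tendsto[OF \<omega> inverse_nonneg[OF \<omega>]]) auto
      have dl: "(\<lambda>n. \<omega> (a n \<omega> + mesh n) - \<omega> (a n \<omega>)) \<longlonglongrightarrow> overshoot s \<omega> - undershoot s \<omega>"
        by (intro tendsto_intros ol yl)
      \<comment> \<open>The increment over a cell contains the jump and so approaches it from above;
        this makes the indicators of the closed half-line [c,\<infinity>) converge even when the
        jump equals c.\<close>
      have dge: "overshoot s \<omega> - undershoot s \<omega> \<le> \<omega> (a n \<omega> + mesh n) - \<omega> (a n \<omega>)" for n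
        unfolding overshoot_def undershoot_eq[OF \<omega> s]
        using good_le[OF \<omega> inverse_nonneg[OF \<omega>] ge[of n]] le_left_lim[OF \<omega> a0 lt[of n]] by (intro diff_mono)
      have il: "(\<lambda>n. indicator {c..} (\<omega> (a n \<omega> + mesh n) - \<omega> (a n \<omega>)) :: ennreal) \<longlonglongrightarrow> indicator {c..} (overshoot s \<omega> - undershoot s \<omega>)"
      proof (cases "c \<le> overshoot s \<omega> - undershoot s \<omega>")
        case True
        then have "c \<le> \<omega> (a n \<omega> + mesh n) - \<omega> (a n \<omega>)" for n using dge[of n] by simp
        then show ?thesis using True by simp
      next
        case False
        then have "eventually (\<lambda>n. \<omega> (a n \<omega> + mesh n) - \<omega> (a n \<omega>) < c) sequentially"
          using order_tendstoD(2)[OF dl, of c] by simp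
        then have "eventually (\<lambda>n. indicator {c..} (\<omega> (a n \<omega> + mesh n) - \<omega> (a n \<omega>)) = (0::ennreal)) sequentially"
          by eventually_elim auto
        then show ?thesis using False by (simp add: tendsto_eventually)
      qed
      have "(\<lambda>n. (a n \<omega>, s - \<omega> (a n \<omega>))) \<longlonglongrightarrow> age_at s \<omega>" unfolding age_at_def by (intro tendsto_intros al yl)
      then have f0l: "(\<lambda>n. f0 (a n \<omega>, s - \<omega> (a n \<omega>))) \<longlonglongrightarrow> f0 (age_at s \<omega>)"
        by (rule continuous_on_tendsto_compose[OF f0(1)]) auto
      have "(\<lambda>n. F_stopped (a n \<omega>) (\<omega> (a n \<omega>)) \<omega>) \<longlonglongrightarrow> F \<omega>"
        using F_stopped_tendsto[OF al yl, of \<omega>] by (simp add: F_stopped_at[OF \<omega>])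
      from tendsto_mult[OF this f0l]
      show "(\<lambda>n. ennreal (F_stopped (a n \<omega>) (\<omega> (a n \<omega>)) \<omega> * f0 (a n \<omega>, s - \<omega> (a n \<omega>)))
        * indicator {c..} (\<omega> (a n \<omega> + mesh n) - \<omega> (a n \<omega>)))
        \<longlonglongrightarrow> ennreal (F \<omega> * f0 (age_at s \<omega>)) * indicator {c..} (overshoot s \<omega> - undershoot s \<omega>)"
        by (intro tendsto_mult_ennreal tendsto_ennrealI il) (auto simp: indicator_def)
    qed
    have [measurable]: "(\<lambda>\<omega>. F_stopped (a n \<omega>) (\<omega> (a n \<omega>)) \<omega>) \<in> borel_measurable Q" for n
      by (intro F_stopped_measurable ident_measurable) measurable
    show "(\<lambda>\<omega>. ennreal (F_stopped (a n \<omega>) (\<omega> (a n \<omega>)) \<omega> * f0 (a n \<omega>, s - \<omega> (a n \<omega>)))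
      * indicator {c..} (\<omega> (a n \<omega> + mesh n) - \<omega> (a n \<omega>))) \<in> borel_measurable Q" for n by measurable
  qed (auto simp: Q.emeasure_space_1)
  then have L1: "(\<lambda>n. \<integral>\<^sup>+\<omega>. \<integral>\<^sup>+u. indicator {0<..} u * pre_density c f0 n (real (grid n u) * mesh n) \<omega> \<partial>lborel \<partial>Q)
    \<longlonglongrightarrow> (\<integral>\<^sup>+\<omega>. ennreal (F \<omega> * f0 (age_at s \<omega>)) * indicator {c..} (overshoot s \<omega> - undershoot s \<omega>) \<partial>Q)"
    unfolding a_def compensation_grid[OF c(1) f0(1,2)] .
  define C where "C = ennreal (\<phi> 1 / (1 - exp (- c)))"
  have le: "indicator {0<..} u * pre_density c f0 n (real (grid n u) * mesh n) \<omega> \<le> C * indicator {0<..T + 1} u" for u n \<omega>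
    unfolding C_def using c(1) f0 by (intro pre_density_le) auto
  have pm: "(\<lambda>(\<omega>, u). indicator {0<..} u * pre_density c f0 n (real (grid n u) * mesh n) \<omega>) \<in> borel_measurable (Q \<Otimes>\<^sub>M lborel)" for n
  proof -
    have "f0 \<in> borel_measurable borel" by measurable
    from pre_density_measurable[OF this, of c n]
    have p: "(\<lambda>z. pre_density c f0 n (real (grid n (snd z)) * mesh n) (fst z)) \<in> borel_measurable (Q \<Otimes>\<^sub>M lborel)"
      by (simp add: case_prod_beta')
    have "(\<lambda>z. indicator {0::real<..} (snd z) :: ennreal) \<in> borel_measurable (Q \<Otimes>\<^sub>M lborel)" by measurable
    from borel_measurable_times_ennreal[OF this p] show ?thesis by (simp add: case_prod_beta')
  qed
  have CT: "(\<integral>\<^sup>+u. C * indicator {0<..T + 1} u \<partial>lborel) = C * ennreal (T + 1)"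
    using T by (simp add: nn_integral_cmult)
  have L2: "(\<lambda>n. \<integral>\<^sup>+\<omega>. \<integral>\<^sup>+u. indicator {0<..} u * pre_density c f0 n (real (grid n u) * mesh n) \<omega> \<partial>lborel \<partial>Q)
    \<longlonglongrightarrow> (\<integral>\<^sup>+\<omega>. \<integral>\<^sup>+u. indicator {0<..} u * ennreal (jump_density c u \<omega> * f0 (u, s - left_lim u \<omega>)) \<partial>lborel \<partial>Q)"
  proof (rule nn_integral_dominated_convergence[where w="\<lambda>_. C * ennreal (T + 1)"])
    show "(\<lambda>\<omega>. \<integral>\<^sup>+u. indicator {0<..} u * pre_density c f0 n (real (grid n u) * mesh n) \<omega> \<partial>lborel) \<in> borel_measurable Q" for n
      using lborel.borel_measurable_nn_integral[OF pm] .
    show "(\<lambda>\<omega>. \<integral>\<^sup>+u. indicator {0<..} u * ennreal (jump_density c u \<omega> * f0 (u, s - left_lim u \<omega>)) \<partial>lborel) \<in> borel_measurable Q"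
      using lborel.borel_measurable_nn_integral[OF jm] .
    show "AE \<omega> in Q. (\<integral>\<^sup>+u. indicator {0<..} u * pre_density c f0 n (real (grid n u) * mesh n) \<omega> \<partial>lborel) \<le> C * ennreal (T + 1)" for n
      unfolding CT[symmetric] by (intro AE_I2 nn_integral_mono le)
    show "AE \<omega> in Q. (\<lambda>n. \<integral>\<^sup>+u. indicator {0<..} u * pre_density c f0 n (real (grid n u) * mesh n) \<omega> \<partial>lborel)
      \<longlonglongrightarrow> (\<integral>\<^sup>+u. indicator {0<..} u * ennreal (jump_density c u \<omega> * f0 (u, s - left_lim u \<omega>)) \<partial>lborel)"
    proof (rule AE_I2)
      fix \<omega> assume \<omega>': "\<omega> \<in> space Q"
      then have \<omega>: "\<omega> \<in> good_paths" by (simp add: space_Q)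
      show "(\<lambda>n. \<integral>\<^sup>+u. indicator {0<..} u * pre_density c f0 n (real (grid n u) * mesh n) \<omega> \<partial>lborel)
        \<longlonglongrightarrow> (\<integral>\<^sup>+u. indicator {0<..} u * ennreal (jump_density c u \<omega> * f0 (u, s - left_lim u \<omega>)) \<partial>lborel)"
      proof (rule nn_integral_dominated_convergence[where w="\<lambda>u. C * indicator {0<..T + 1} u"])
        show "AE u in lborel. (\<lambda>n. indicator {0<..} u * pre_density c f0 n (real (grid n u) * mesh n) \<omega>)
          \<longlonglongrightarrow> indicator {0<..} u * ennreal (jump_density c u \<omega> * f0 (u, s - left_lim u \<omega>))"
          using AE_no_atom[OF \<omega>]
        proof eventually_elim
          case (elim u)
          then show ?case using pre_density_tendsto[OF c f0(1) \<omega>, of u] by (cases "0 < u") auto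
        qed
        show "(\<integral>\<^sup>+u. C * indicator {0<..T + 1} u \<partial>lborel) < \<infinity>"
          unfolding CT by (simp add: C_def ennreal_mult_less_top)
        show "(\<lambda>u. indicator {0<..} u * pre_density c f0 n (real (grid n u) * mesh n) \<omega>) \<in> borel_measurable lborel" for n
          using sec[OF pm \<omega>'] by simp
        show "(\<lambda>u. indicator {0<..} u * ennreal (jump_density c u \<omega> * f0 (u, s - left_lim u \<omega>))) \<in> borel_measurable lborel"
          using sec[OF jm \<omega>'] by simp
      qed (use le in auto)
    qed
  qed (auto simp: C_def Q.emeasure_space_1 ennreal_mult_less_top)
  show ?thesis by (rule LIMSEQ_unique[OF L1 L2])
qed

end

section \<open>The conditional law of a jump given that it exceeds the age\<close>

context subordinator
begin

lemma no_atom_between: "0 \<le> a \<Longrightarrow> a < c \<Longrightarrow> \<exists>x. a < x \<and> x < c \<and> emeasure \<nu> {x} = 0"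
proof (rule ccontr)
  assume *: "0 \<le> a" "a < c" "\<not> (\<exists>x. a < x \<and> x < c \<and> emeasure \<nu> {x} = 0)"
  then have "{a<..<c} \<subseteq> {v. 0 < v \<and> emeasure \<nu> {v} \<noteq> 0}" by auto
  then have "countable {a<..<c}" using countable_atoms countable_subset by blast
  then show False using uncountable_open_interval[of a c] *(2) by simp
qed

text \<open>The truncated tails are monotone on the whole line, hence measurable, and for v > 0 they
  are eventually equal to \<open>tail v\<close>.\<close>

lemma pos_tail_measurable [measurable]: "(\<lambda>v. if 0 < v then tail v else 0) \<in> borel_measurable borel"
proof (rule borel_measurable_LIMSEQ_real)
  show "(\<lambda>n. if 0 < v then tail (max (mesh n) v) else 0) \<longlonglongrightarrow> (if 0 < v then tail v else 0)" for v
  proof (cases "0 < v")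
    case True
    from order_tendstoD(2)[OF mesh_tendsto True]
    have "eventually (\<lambda>n. tail (max (mesh n) v) = tail v) sequentially"
      by eventually_elim (simp add: max_def)
    then show ?thesis using True by (simp add: tendsto_eventually)
  qed simp
  have [measurable]: "(\<lambda>v. tail (max (mesh n) v)) \<in> borel_measurable borel" for n
    by (rule tail_measurable[OF mesh_pos])
  show "(\<lambda>v. if 0 < v then tail (max (mesh n) v) else 0) \<in> borel_measurable borel" for n
    by measurable
qed

text \<open>The value outside the support of \<open>\<nu>\<close> makes the age process restart at once.\<close>

definition jump_kernel :: "real \<Rightarrow> real measure" where
  "jump_kernel v = (if 0 < v \<and> 0 < tail v then uniform_measure \<nu> {v..} else return borel v)"

lemma sets_jump_kernel [simp, measurable_cong]: "sets (jump_kernel v) = sets borel"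
  by (simp add: jump_kernel_def)

lemma prob_jump_kernel: "prob_space (jump_kernel v)"
  unfolding jump_kernel_def
  by (auto intro!: prob_space_uniform_measure prob_space_return simp: emeasure_tail)

lemma emeasure_jump_kernel:
  "emeasure (jump_kernel v) {c..} = (if 0 < v \<and> 0 < tail v then ennreal (tail (max c v) / tail v) else indicator {c..} v)"
proof (cases "0 < v \<and> 0 < tail v")
  case True
  have "{v..} \<inter> {c..} = {max c v..}" by auto
  then show ?thesis
    using True tail_nonneg emeasure_tail[of "max c v"]
    by (simp add: jump_kernel_def emeasure_tail divide_ennreal less_max_iff_disj)
qed (auto simp: jump_kernel_def)

lemma sigma_sets_atLeast: "sigma_sets UNIV (range (\<lambda>c::real. {c..})) = sets borel"
  unfolding borel_Ici by simp

lemma Int_stable_atLeast: "Int_stable (range (\<lambda>c::real. {c..}))"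
proof (rule Int_stableI_image)
  show "\<exists>k\<in>UNIV. {i..} \<inter> {j..} = {k..}" for i j :: real
    by (rule bexI[of _ "max i j"]) auto
qed

lemma jump_kernel_measurable [measurable]: "jump_kernel \<in> borel \<rightarrow>\<^sub>M prob_algebra borel"
proof (rule measurable_prob_algebra_generated[where \<Omega>=UNIV and G="range (\<lambda>c::real. {c..})"])
  show "sets borel = sigma_sets UNIV (range (\<lambda>c::real. {c..}))" by (simp add: sigma_sets_atLeast)
  show "Int_stable (range (\<lambda>c::real. {c..}))" by (rule Int_stable_atLeast)
  fix A assume "A \<in> range (\<lambda>c::real. {c..})"
  then obtain c where A: "A = {c..}" by auto
  define T where "T v = (if 0 < v then tail v else 0)" for v
  have T[measurable]: "T \<in> borel_measurable borel" unfolding T_def[abs_def] by measurable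
  have "emeasure (jump_kernel v) A = (if 0 < T v then ennreal (T (max c v) / T v) else indicator {c..} v)" for v
    unfolding A emeasure_jump_kernel by (auto simp: T_def max_def)
  moreover have "(\<lambda>v. if 0 < T v then ennreal (T (max c v) / T v) else indicator {c..} v) \<in> borel_measurable borel"
    by measurable
  ultimately show "(\<lambda>v. emeasure (jump_kernel v) A) \<in> borel_measurable borel" by simp
qed (auto simp: prob_jump_kernel)

end

section \<open>The compensation formula for Borel tests, and the quotient of two such
  formulas\<close>

context age_tests
begin

definition jump_size :: "(real \<Rightarrow> real) \<Rightarrow> real" where
  "jump_size \<omega> = overshoot s \<omega> - undershoot s \<omega>"

lemma jump_size_measurable [measurable]: "jump_size \<in> borel_measurable good_space"
  unfolding jump_size_def[abs_def] by measurable

lemma age_nonneg: "\<omega> \<in> good_paths \<Longrightarrow> 0 \<le> snd (age_at s \<omega>)"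
  using undershoot_le[of \<omega> s] s by (simp add: age_at_def)

lemma age_le_jump: "\<omega> \<in> good_paths \<Longrightarrow> snd (age_at s \<omega>) \<le> jump_size \<omega>"
  using overshoot_ge[of \<omega> s] s by (simp add: age_at_def jump_size_def overshoot_def)

text \<open>With \<open>pair_state\<close>, this writes the right-hand side of the compensation
  formula as an integral over \<open>Q \<Otimes>\<^sub>M lborel\<close>; the time u plays the role
  of the inverse at s, and s minus the left limit at u that of the age.\<close>

definition pair_density :: "real \<Rightarrow> (real \<Rightarrow> real) \<times> real \<Rightarrow> ennreal" where
  "pair_density c z = indicator {0<..} (snd z) * ennreal (jump_density c (snd z) (fst z))"

definition pair_state :: "(real \<Rightarrow> real) \<times> real \<Rightarrow> real \<times> real" where
  "pair_state z = (snd z, s - left_lim (snd z) (fst z))"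

lemma fst_good: "fst \<in> Q \<Otimes>\<^sub>M lborel \<rightarrow>\<^sub>M good_space"
  using measurable_fst[of Q lborel] by (simp add: measurable_cong_sets[OF refl sets_Q])

lemma pair_density_measurable: "0 < c \<Longrightarrow> pair_density c \<in> borel_measurable (Q \<Otimes>\<^sub>M lborel)"
proof -
  assume c: "0 < c"
  note [measurable] = fst_good
  have "(\<lambda>z. (fst z, snd z)) \<in> Q \<Otimes>\<^sub>M lborel \<rightarrow>\<^sub>M good_space \<Otimes>\<^sub>M borel" by measurable
  from measurable_compose[OF this jump_density_measurable[OF c]]
  have [measurable]: "(\<lambda>z. jump_density c (snd z) (fst z)) \<in> borel_measurable (Q \<Otimes>\<^sub>M lborel)" by simp
  have "(\<lambda>z. indicator {0::real<..} (snd z) :: ennreal) \<in> borel_measurable (Q \<Otimes>\<^sub>M lborel)" by measurable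
  then show ?thesis unfolding pair_density_def[abs_def] by measurable
qed

lemma pair_state_measurable: "pair_state \<in> borel_measurable (Q \<Otimes>\<^sub>M lborel)"
proof -
  have "snd \<in> borel_measurable (Q \<Otimes>\<^sub>M lborel)" by simp
  then show ?thesis unfolding pair_state_def[abs_def]
    by (intro borel_measurable_Pair borel_measurable_diff left_lim_measurable fst_good) auto
qed

text \<open>Both sides are integrals of q against image measures on the plane. By
  \<open>compensation\<close> these agree on continuous functions with compact support, and the left
  one is finite, so they coincide.\<close>

lemma jump_formula_no_atom:
  assumes c: "0 < c" "emeasure \<nu> {c} = 0" and q[measurable]: "q \<in> borel_measurable borel"
  shows "(\<integral>\<^sup>+\<omega>. ennreal (F \<omega>) * indicator {c..} (jump_size \<omega>) * q (age_at s \<omega>) \<partial>Q)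
    = (\<integral>\<^sup>+z. pair_density c z * q (pair_state z) \<partial>(Q \<Otimes>\<^sub>M lborel))"
proof -
  note [measurable] = pair_density_measurable[OF c(1)] pair_state_measurable
  define m where "m = distr (density Q (\<lambda>\<omega>. ennreal (F \<omega>) * indicator {c..} (jump_size \<omega>))) borel (age_at s)"
  define m' where "m' = distr (density (Q \<Otimes>\<^sub>M lborel) (pair_density c)) borel pair_state"
  have m: "(\<integral>\<^sup>+x. g x \<partial>m) = (\<integral>\<^sup>+\<omega>. ennreal (F \<omega>) * indicator {c..} (jump_size \<omega>) * g (age_at s \<omega>) \<partial>Q)"
    if [measurable]: "g \<in> borel_measurable borel" for g
    unfolding m_def by (subst nn_integral_distr; (subst nn_integral_density)?) measurable
  have m': "(\<integral>\<^sup>+x. g x \<partial>m') = (\<integral>\<^sup>+z. pair_density c z * g (pair_state z) \<partial>(Q \<Otimes>\<^sub>M lborel))"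
    if [measurable]: "g \<in> borel_measurable borel" for g
    unfolding m'_def by (subst nn_integral_distr; (subst nn_integral_density)?) measurable
  have "m = m'"
  proof (rule measure_eqI_compact_support)
    show "sets m = sets borel" "sets m' = sets borel" by (simp_all add: m_def m'_def)
    have "emeasure m UNIV = (\<integral>\<^sup>+x. 1 \<partial>m)" by (simp add: m_def)
    also have "\<dots> \<le> (\<integral>\<^sup>+\<omega>. 1 \<partial>Q)"
      unfolding m[OF borel_measurable_const] using F_bounds
      by (intro nn_integral_mono) (auto simp: indicator_def ennreal_le_1)
    finally show "emeasure m UNIV \<noteq> \<infinity>" by (auto simp: Q.emeasure_space_1 top_unique)
    fix f0 :: "real \<times> real \<Rightarrow> real"
    assume f0: "continuous_on UNIV f0" "\<And>x. 0 \<le> f0 x" "\<And>x. f0 x \<le> 1" and "\<exists>R. \<forall>x. R \<le> norm x \<longrightarrow> f0 x = 0"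
    then obtain R where R: "\<And>x. R \<le> norm x \<Longrightarrow> f0 x = 0" by blast
    \<comment> \<open>Compact support bounds the first coordinate and so supplies the horizon
      T.\<close>
    have T: "f0 (l, v) = 0" if "max 0 R \<le> l" for l v
      using that norm_fst_le[of l v] by (intro R) auto
    have f0m[measurable]: "f0 \<in> borel_measurable borel" by (rule borel_measurable_continuous_onI[OF f0(1)])
    have "(\<integral>\<^sup>+x. ennreal (f0 x) \<partial>m) = (\<integral>\<^sup>+\<omega>. ennreal (F \<omega> * f0 (age_at s \<omega>)) * indicator {c..} (overshoot s \<omega> - undershoot s \<omega>) \<partial>Q)"
      using F_bounds f0 by (subst m) (auto simp: jump_size_def ennreal_mult' ac_simps)
    also have "\<dots> = (\<integral>\<^sup>+\<omega>. \<integral>\<^sup>+u. indicator {0<..} u * ennreal (jump_density c u \<omega> * f0 (u, s - left_lim u \<omega>)) \<partial>lborel \<partial>Q)"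
      using f0 T by (intro compensation[OF c, where T="max 0 R"]) auto
    also have "\<dots> = (\<integral>\<^sup>+\<omega>. \<integral>\<^sup>+u. pair_density c (\<omega>, u) * ennreal (f0 (pair_state (\<omega>, u))) \<partial>lborel \<partial>Q)"
      by (simp add: pair_density_def pair_state_def ennreal_mult' jump_density_nonneg mult.assoc)
    also have "\<dots> = (\<integral>\<^sup>+z. pair_density c z * ennreal (f0 (pair_state z)) \<partial>(Q \<Otimes>\<^sub>M lborel))"
      by (subst lborel.nn_integral_fst) measurable
    also have "\<dots> = (\<integral>\<^sup>+x. ennreal (f0 x) \<partial>m')" by (subst m') measurable
    finally show "(\<integral>\<^sup>+x. ennreal (f0 x) \<partial>m) = (\<integral>\<^sup>+x. ennreal (f0 x) \<partial>m')" .
  qed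
  then show ?thesis using m[OF q] m'[OF q] by simp
qed

text \<open>A level c with an atom is approached from below by levels \<open>d n\<close> without
  one: the closed half-lines [d n,\<infinity>) shrink to [c,\<infinity>), and \<open>tail\<close> is
  left-continuous. The majorant is the density at a level c' below all \<open>d n\<close>; it is
  integrable because, with q \<le> 1, the left-hand side at c' is at most 1.\<close>

lemma jump_formula_le_1:
  assumes c: "0 < c" and q[measurable]: "q \<in> borel_measurable borel" and q1: "\<And>x. q x \<le> 1"
  shows "(\<integral>\<^sup>+\<omega>. ennreal (F \<omega>) * indicator {c..} (jump_size \<omega>) * q (age_at s \<omega>) \<partial>Q)
    = (\<integral>\<^sup>+z. pair_density c z * q (pair_state z) \<partial>(Q \<Otimes>\<^sub>M lborel))"
proof -
  note [measurable] = pair_density_measurable[OF c(1)] pair_state_measurable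
  obtain c' where c': "0 < c'" "c' < c" "emeasure \<nu> {c'} = 0" using no_atom_between[of 0 c] c by auto
  have "\<exists>x. max c' (c - mesh n) < x \<and> x < c \<and> emeasure \<nu> {x} = 0" for n
    using c' mesh_pos[of n] by (intro no_atom_between) auto
  then obtain d where d: "\<And>n. max c' (c - mesh n) < d n" "\<And>n. d n < c" "\<And>n. emeasure \<nu> {d n} = 0" by metis
  have d0: "0 < d n" "c' \<le> d n" for n using d(1)[of n] c' by auto
  have "(\<lambda>n. c - mesh n) \<longlonglongrightarrow> c - 0" by (intro tendsto_intros mesh_tendsto)
  then have dl: "d \<longlonglongrightarrow> c"
    by (intro tendsto_sandwich[of "\<lambda>n. c - mesh n" d _ "\<lambda>_. c"]) (use d(1,2) in \<open>auto intro!: always_eventually less_imp_le\<close>)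
  note [measurable] = pair_density_measurable[OF d0(1)] pair_density_measurable[OF c'(1)]
  have FQ: "ennreal (F \<omega>) * indicator A x * q y \<le> 1" for \<omega> y and A :: "real set" and x
  proof -
    have "ennreal (F \<omega>) * indicator A x * q y \<le> 1 * 1 * 1"
      using F_bounds q1 by (intro mult_mono) (auto simp: indicator_def ennreal_le_1)
    then show ?thesis by simp
  qed
  have L1: "(\<lambda>n. \<integral>\<^sup>+\<omega>. ennreal (F \<omega>) * indicator {d n..} (jump_size \<omega>) * q (age_at s \<omega>) \<partial>Q)
    \<longlonglongrightarrow> (\<integral>\<^sup>+\<omega>. ennreal (F \<omega>) * indicator {c..} (jump_size \<omega>) * q (age_at s \<omega>) \<partial>Q)"
  proof (rule nn_integral_dominated_convergence[where w="\<lambda>_. 1"])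
    show "AE \<omega> in Q. (\<lambda>n. ennreal (F \<omega>) * indicator {d n..} (jump_size \<omega>) * q (age_at s \<omega>))
      \<longlonglongrightarrow> ennreal (F \<omega>) * indicator {c..} (jump_size \<omega>) * q (age_at s \<omega>)"
    proof (rule AE_I2)
      fix \<omega>
      have "eventually (\<lambda>n. indicator {d n..} (jump_size \<omega>) = (indicator {c..} (jump_size \<omega>) :: ennreal)) sequentially"
      proof (cases "c \<le> jump_size \<omega>")
        case True
        then have "d n \<le> jump_size \<omega>" for n using d(2)[of n] by simp
        then show ?thesis using True by simp
      next
        case False
        then show ?thesis using order_tendstoD(1)[OF dl, of "jump_size \<omega>"] by (auto elim!: eventually_mono)
      qed
      then show "(\<lambda>n. ennreal (F \<omega>) * indicator {d n..} (jump_size \<omega>) * q (age_at s \<omega>))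
        \<longlonglongrightarrow> ennreal (F \<omega>) * indicator {c..} (jump_size \<omega>) * q (age_at s \<omega>)"
        by (intro tendsto_eventually) (auto elim!: eventually_mono)
    qed
  qed (use FQ in \<open>auto simp: Q.emeasure_space_1\<close>)
  have L2: "(\<lambda>n. \<integral>\<^sup>+z. pair_density (d n) z * q (pair_state z) \<partial>(Q \<Otimes>\<^sub>M lborel))
    \<longlonglongrightarrow> (\<integral>\<^sup>+z. pair_density c z * q (pair_state z) \<partial>(Q \<Otimes>\<^sub>M lborel))"
  proof (rule nn_integral_dominated_convergence[where w="\<lambda>z. pair_density c' z * q (pair_state z)"])
    have "(\<integral>\<^sup>+z. pair_density c' z * q (pair_state z) \<partial>(Q \<Otimes>\<^sub>M lborel))
      = (\<integral>\<^sup>+\<omega>. ennreal (F \<omega>) * indicator {c'..} (jump_size \<omega>) * q (age_at s \<omega>) \<partial>Q)"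
      using jump_formula_no_atom[OF c'(1,3) q] by simp
    also have "\<dots> \<le> (\<integral>\<^sup>+\<omega>. 1 \<partial>Q)" by (intro nn_integral_mono FQ)
    finally show "(\<integral>\<^sup>+z. pair_density c' z * q (pair_state z) \<partial>(Q \<Otimes>\<^sub>M lborel)) < \<infinity>"
      by (auto simp: Q.emeasure_space_1 intro: le_less_trans)
    have "jump_density (d n) u \<omega> \<le> jump_density c' u \<omega>" for n u \<omega>
      unfolding jump_density_def using d0(2)[of n] c'(1) F_bounds
      by (intro mult_left_mono tail_antimono) (auto simp: indicator_def)
    then show "AE z in Q \<Otimes>\<^sub>M lborel. pair_density (d n) z * q (pair_state z) \<le> pair_density c' z * q (pair_state z)" for n
      unfolding pair_density_def by (intro AE_I2 mult_mono ennreal_leI) auto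
    show "AE z in Q \<Otimes>\<^sub>M lborel. (\<lambda>n. pair_density (d n) z * q (pair_state z)) \<longlonglongrightarrow> pair_density c z * q (pair_state z)"
    proof (rule AE_I2)
      fix z
      define v where "v = s - left_lim (snd z) (fst z)"
      have "(\<lambda>n. max (d n) v) \<longlonglongrightarrow> max c v" by (intro tendsto_intros dl)
      then have "(\<lambda>n. tail (max (d n) v)) \<longlonglongrightarrow> tail (max c v)"
        using less_imp_le[OF d(2)] c by (intro tail_left_cont max.mono) auto
      then have "(\<lambda>n. jump_density (d n) (snd z) (fst z)) \<longlonglongrightarrow> jump_density c (snd z) (fst z)"
        unfolding jump_density_def v_def by (intro tendsto_intros)
      then have "(\<lambda>n. pair_density (d n) z) \<longlonglongrightarrow> pair_density c z"
        unfolding pair_density_def by (intro tendsto_mult_ennreal tendsto_ennrealI tendsto_const) (auto simp: indicator_def)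
      moreover have "q (pair_state z) \<noteq> \<top>" using q1[of "pair_state z"] by (auto simp: top_unique)
      ultimately show "(\<lambda>n. pair_density (d n) z * q (pair_state z)) \<longlonglongrightarrow> pair_density c z * q (pair_state z)"
        by (intro tendsto_mult_ennreal tendsto_const) (auto simp: pair_density_def indicator_def split: if_splits)
    qed
  qed auto
  show ?thesis
    using LIMSEQ_unique[OF L1[unfolded jump_formula_no_atom[OF d0(1) d(3) q]] L2] .
qed

text \<open>The formula is applied at level c to the test q1 and at level e to q1 multiplied by the
  ratio of tails. The two right-hand integrands are equal, so the left-hand sides are, and the law
  of the age never appears. At level e the restriction on the jump is automatic because the jump is
  at least the age.\<close>

lemma jump_given_age_ge:
  assumes e: "0 < e" "e \<le> c" and B[measurable]: "B \<in> sets borel"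
  shows "(\<integral>\<^sup>+\<omega>. ennreal (F \<omega>) * indicator {c..} (jump_size \<omega>) * (indicator B (age_at s \<omega>) * indicator {e..} (snd (age_at s \<omega>))) \<partial>Q)
    = (\<integral>\<^sup>+\<omega>. ennreal (F \<omega>) * (indicator B (age_at s \<omega>) * indicator {e..} (snd (age_at s \<omega>))
        * ennreal (tail (max c (snd (age_at s \<omega>))) / tail (snd (age_at s \<omega>)))) \<partial>Q)"
proof -
  have c: "0 < c" using e by simp
  define q1 :: "real \<times> real \<Rightarrow> ennreal" where "q1 x = indicator B x * indicator {e..} (snd x)" for x
  define q2 where "q2 x = q1 x * ennreal (tail (max c (snd x)) / tail (max e (snd x)))" for x
  note tail_measurable[OF c, measurable] tail_measurable[OF e(1), measurable]
  have [measurable]: "snd \<in> borel_measurable (borel :: (real \<times> real) measure)"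
    by (intro borel_measurable_continuous_onI continuous_intros)
  have q1[measurable]: "q1 \<in> borel_measurable borel" unfolding q1_def[abs_def] by measurable
  have q2[measurable]: "q2 \<in> borel_measurable borel" unfolding q2_def[abs_def] by measurable
  have r: "tail (max c v) / tail (max e v) \<le> 1" for v
    using tail_antimono[of "max e v" "max c v"] e tail_nonneg[of "max e v"] by (auto simp: divide_le_eq_1 max_def)
  have "q1 x \<le> 1" "q2 x \<le> 1" for x
    using r[of "snd x"] by (auto simp: q1_def q2_def indicator_def ennreal_le_1)
  note J = jump_formula_le_1[OF c q1 this(1)] jump_formula_le_1[OF e(1) q2 this(2)]
  have "pair_density c z * q1 (pair_state z) = pair_density e z * q2 (pair_state z)" for z
  proof (cases "snd (pair_state z) < e")
    case False
    define v where "v = snd (pair_state z)"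
    have v: "max e v = v" "e \<le> v" using False by (auto simp: v_def)
    \<comment> \<open>Division by 0 yields 0, which is consistent here: a tail that vanishes at v
      also vanishes further out.\<close>
    have "tail (max c v) = 0" if "tail v = 0"
      using tail_antimono[of v "max c v"] tail_nonneg[of "max c v"] v e that by simp
    then have "tail (max c v) = tail (max e v) * (tail (max c v) / tail (max e v))" by (simp add: v)
    then have "jump_density c (snd z) (fst z) = jump_density e (snd z) (fst z) * (tail (max c v) / tail (max e v))"
      unfolding jump_density_def v_def pair_state_def snd_conv by (simp only: mult.assoc)
    then have "ennreal (jump_density c (snd z) (fst z)) = ennreal (jump_density e (snd z) (fst z)) * ennreal (tail (max c v) / tail (max e v))"
      by (simp only: ennreal_mult'[OF jump_density_nonneg])
    then show ?thesis by (simp add: pair_density_def q2_def v_def ac_simps)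
  qed (simp add: q1_def q2_def)
  then have "(\<integral>\<^sup>+\<omega>. ennreal (F \<omega>) * indicator {c..} (jump_size \<omega>) * q1 (age_at s \<omega>) \<partial>Q)
    = (\<integral>\<^sup>+\<omega>. ennreal (F \<omega>) * indicator {e..} (jump_size \<omega>) * q2 (age_at s \<omega>) \<partial>Q)"
    unfolding J by simp
  also have "\<dots> = (\<integral>\<^sup>+\<omega>. ennreal (F \<omega>) * (indicator B (age_at s \<omega>) * indicator {e..} (snd (age_at s \<omega>))
        * ennreal (tail (max c (snd (age_at s \<omega>))) / tail (snd (age_at s \<omega>)))) \<partial>Q)"
  proof (intro nn_integral_cong)
    fix \<omega> assume "\<omega> \<in> space Q"
    then have "snd (age_at s \<omega>) \<le> jump_size \<omega>" using age_le_jump by (simp add: space_Q)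
    then show "ennreal (F \<omega>) * indicator {e..} (jump_size \<omega>) * q2 (age_at s \<omega>)
      = ennreal (F \<omega>) * (indicator B (age_at s \<omega>) * indicator {e..} (snd (age_at s \<omega>))
        * ennreal (tail (max c (snd (age_at s \<omega>))) / tail (snd (age_at s \<omega>))))"
      by (auto simp: q2_def q1_def indicator_def max_def)
  qed
  finally show ?thesis by (simp add: q1_def)
qed

end

context subordinator_law
begin

text \<open>Age 0 together with a positive jump would force the left limit at u to equal s, which
  happens for at most one u > 0 and is invisible to Lebesgue measure. The second part uses the
  quotient formula with c = e: its ratio is 1 where the tail is positive and, as 0/0 = 0, vanishes
  elsewhere, while the other side is the full probability that the age is at least e.\<close>

lemma AE_age_jump:
  assumes s: "0 < s"
  shows "AE \<omega> in Q. (undershoot s \<omega> = s \<longrightarrow> overshoot s \<omega> = s)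
    \<and> (undershoot s \<omega> < s \<longrightarrow> 0 < tail (s - undershoot s \<omega>))"
proof -
  \<comment> \<open>With no test times the product of tests is 1, so the formulas hold without
    conditioning on the past.\<close>
  interpret T: age_tests b \<nu> \<mu> Q s "{}" "\<lambda>_ _. 0" by standard (use s in auto)
  have F1: "T.F \<omega> = 1" for \<omega> by (simp add: T.F_def)
  have sndm[measurable]: "snd \<in> borel_measurable (borel :: (real \<times> real) measure)"
    by (intro borel_measurable_continuous_onI continuous_intros)
  have 1: "AE \<omega> in Q. \<not> (undershoot s \<omega> = s \<and> mesh n \<le> T.jump_size \<omega>)" for n
  proof -
    note [measurable] = T.pair_density_measurable[OF mesh_pos] T.pair_state_measurable
    have [measurable]: "(\<lambda>x::real \<times> real. indicator {0} (snd x) :: ennreal) \<in> borel_measurable borel" by measurable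
    have "(\<integral>\<^sup>+\<omega>. ennreal (T.F \<omega>) * indicator {mesh n..} (T.jump_size \<omega>) * indicator {0} (snd (age_at s \<omega>)) \<partial>Q)
      = (\<integral>\<^sup>+z. T.pair_density (mesh n) z * indicator {0} (snd (T.pair_state z)) \<partial>(Q \<Otimes>\<^sub>M lborel))"
      by (intro T.jump_formula_le_1 mesh_pos) (auto simp: indicator_def)
    also have "\<dots> = (\<integral>\<^sup>+\<omega>. \<integral>\<^sup>+u. T.pair_density (mesh n) (\<omega>, u) * indicator {0} (snd (T.pair_state (\<omega>, u))) \<partial>lborel \<partial>Q)"
      by (subst lborel.nn_integral_fst) measurable
    also have "\<dots> = (\<integral>\<^sup>+\<omega>. 0 \<partial>Q)"
    proof (intro nn_integral_cong)
      fix \<omega> assume "\<omega> \<in> space Q"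
      then have \<omega>: "\<omega> \<in> good_paths" by (simp add: space_Q)
      have "u = v" if "0 < u" "left_lim u \<omega> = s" "0 < v" "left_lim v \<omega> = s" for u v
        using left_lim_strict_mono[OF \<omega>, of u v] left_lim_strict_mono[OF \<omega>, of v u] that
        by (cases u v rule: linorder_cases) auto
      then obtain w where "{u. 0 < u \<and> left_lim u \<omega> = s} \<subseteq> {w}" by blast
      then have "{u. 0 < u \<and> left_lim u \<omega> = s} \<in> null_sets lborel"
        by (intro countable_imp_null_set_lborel) (meson countable_empty countable_insert countable_subset)
      from AE_not_in[OF this] show "(\<integral>\<^sup>+u. T.pair_density (mesh n) (\<omega>, u) * indicator {0} (snd (T.pair_state (\<omega>, u))) \<partial>lborel) = 0"
        by (intro nn_integral_0_iff_AE[THEN iffD2] nn_integral_zero' ) (auto elim!: eventually_mono simp: T.pair_density_def T.pair_state_def indicator_def)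
    qed
    finally have "(\<integral>\<^sup>+\<omega>. indicator {mesh n..} (T.jump_size \<omega>) * indicator {0} (snd (age_at s \<omega>)) \<partial>Q) = 0"
      by (simp add: F1)
    then have "AE \<omega> in Q. indicator {mesh n..} (T.jump_size \<omega>) * indicator {0} (snd (age_at s \<omega>)) = (0::ennreal)"
      by (subst (asm) nn_integral_0_iff_AE) measurable
    then show ?thesis by eventually_elim (auto simp: age_at_def indicator_def split: if_splits)
  qed
  have 2: "AE \<omega> in Q. \<not> (mesh n \<le> snd (age_at s \<omega>) \<and> tail (snd (age_at s \<omega>)) = 0)" for n
  proof -
    let ?v = "\<lambda>\<omega>. snd (age_at s \<omega>)"
    note [measurable] = tail_measurable[OF mesh_pos]
    have "(\<integral>\<^sup>+\<omega>. ennreal (T.F \<omega>) * indicator {mesh n..} (T.jump_size \<omega>) * (indicator UNIV (age_at s \<omega>) * indicator {mesh n..} (?v \<omega>)) \<partial>Q)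
      = (\<integral>\<^sup>+\<omega>. ennreal (T.F \<omega>) * (indicator UNIV (age_at s \<omega>) * indicator {mesh n..} (?v \<omega>)
        * ennreal (tail (max (mesh n) (?v \<omega>)) / tail (?v \<omega>))) \<partial>Q)"
      by (intro T.jump_given_age_ge mesh_pos) auto
    also have "\<dots> = (\<integral>\<^sup>+\<omega>. indicator {mesh n..} (?v \<omega>) * indicator {0<..} (tail (max (mesh n) (?v \<omega>))) \<partial>Q)"
      using tail_nonneg by (intro nn_integral_cong) (auto simp: F1 indicator_def max_def less_le)
    also have "(\<integral>\<^sup>+\<omega>. ennreal (T.F \<omega>) * indicator {mesh n..} (T.jump_size \<omega>) * (indicator UNIV (age_at s \<omega>) * indicator {mesh n..} (?v \<omega>)) \<partial>Q)
      = (\<integral>\<^sup>+\<omega>. indicator {mesh n..} (?v \<omega>) \<partial>Q)"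
      using T.age_le_jump by (intro nn_integral_cong) (force simp: F1 indicator_def space_Q)
    finally have e: "(\<integral>\<^sup>+\<omega>. indicator {mesh n..} (?v \<omega>) \<partial>Q) = (\<integral>\<^sup>+\<omega>. indicator {mesh n..} (?v \<omega>) * indicator {0<..} (tail (max (mesh n) (?v \<omega>))) \<partial>Q)" .
    have "(\<integral>\<^sup>+\<omega>. indicator {mesh n..} (?v \<omega>) * indicator {..0} (tail (max (mesh n) (?v \<omega>))) \<partial>Q) = 0"
    proof -
      have "(\<integral>\<^sup>+\<omega>. indicator {mesh n..} (?v \<omega>) \<partial>Q)
        = (\<integral>\<^sup>+\<omega>. indicator {mesh n..} (?v \<omega>) * indicator {0<..} (tail (max (mesh n) (?v \<omega>)))
          + indicator {mesh n..} (?v \<omega>) * indicator {..0} (tail (max (mesh n) (?v \<omega>))) \<partial>Q)"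
        by (intro nn_integral_cong) (auto simp: indicator_def)
      also have "\<dots> = (\<integral>\<^sup>+\<omega>. indicator {mesh n..} (?v \<omega>) * indicator {0<..} (tail (max (mesh n) (?v \<omega>))) \<partial>Q)
          + (\<integral>\<^sup>+\<omega>. indicator {mesh n..} (?v \<omega>) * indicator {..0} (tail (max (mesh n) (?v \<omega>))) \<partial>Q)"
        by (intro nn_integral_add) measurable
      finally have "(\<integral>\<^sup>+\<omega>. indicator {mesh n..} (?v \<omega>) \<partial>Q) + 0 = (\<integral>\<^sup>+\<omega>. indicator {mesh n..} (?v \<omega>) \<partial>Q)
          + (\<integral>\<^sup>+\<omega>. indicator {mesh n..} (?v \<omega>) * indicator {..0} (tail (max (mesh n) (?v \<omega>))) \<partial>Q)"
        unfolding e[symmetric] by simp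
      moreover have "(\<integral>\<^sup>+\<omega>. indicator {mesh n..} (?v \<omega>) \<partial>Q) \<le> (\<integral>\<^sup>+\<omega>. 1 \<partial>Q)"
        by (intro nn_integral_mono) (auto simp: indicator_def)
      then have "(\<integral>\<^sup>+\<omega>. indicator {mesh n..} (?v \<omega>) \<partial>Q) \<noteq> \<top>" by (auto simp: Q.emeasure_space_1 top_unique)
      ultimately show ?thesis by (simp only: ennreal_add_left_cancel) auto
    qed
    then have "AE \<omega> in Q. indicator {mesh n..} (?v \<omega>) * indicator {..0} (tail (max (mesh n) (?v \<omega>))) = (0::ennreal)"
      by (subst (asm) nn_integral_0_iff_AE) measurable
    then show ?thesis by eventually_elim (auto simp: indicator_def max_def split: if_splits)
  qed
  have "AE \<omega> in Q. \<forall>n. \<not> (undershoot s \<omega> = s \<and> mesh n \<le> T.jump_size \<omega>)" by (subst AE_all_countable) (intro allI 1)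
  moreover have "AE \<omega> in Q. \<forall>n. \<not> (mesh n \<le> snd (age_at s \<omega>) \<and> tail (snd (age_at s \<omega>)) = 0)" by (subst AE_all_countable) (intro allI 2)
  moreover have "AE \<omega> in Q. \<omega> \<in> good_paths" by (rule AE_I2) (simp add: space_Q)
  ultimately show ?thesis
  proof eventually_elim
    case (elim \<omega>)
    have small: "\<exists>n. mesh n \<le> x" if "0 < x" for x
      using order_tendstoD(2)[OF mesh_tendsto that] by (auto simp: eventually_sequentially intro: less_imp_le)
    show ?case
    proof (intro conjI impI)
      assume u: "undershoot s \<omega> = s"
      then have "\<not> 0 < T.jump_size \<omega>" using elim(1) small by blast
      then show "overshoot s \<omega> = s"
        using u overshoot_ge[OF elim(3) s] by (simp add: T.jump_size_def overshoot_def)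
    next
      assume "undershoot s \<omega> < s"
      then obtain n where "mesh n \<le> s - undershoot s \<omega>" using small[of "s - undershoot s \<omega>"] by auto
      then show "0 < tail (s - undershoot s \<omega>)"
        using elim(2) tail_nonneg[of "s - undershoot s \<omega>"] by (auto simp: age_at_def less_le)
    qed
  qed
qed

end

section \<open>The law of the straddling jump and of what follows it\<close>

context age_tests
begin

lemma snd_borel: "snd \<in> borel_measurable (borel :: (real \<times> real) measure)"
  by (intro borel_measurable_continuous_onI continuous_intros)

lemma emeasure_jump_kernel_measurable: "(\<lambda>v. emeasure (jump_kernel v) {c..}) \<in> borel_measurable borel"
  using measurable_emeasure_kernel[OF measurable_prob_algebraD[OF jump_kernel_measurable], of "{c..}"] by simp

text \<open>The integral is split according to the age. At age 0 the jump is almost surely 0, in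
  accordance with the Dirac mass in \<open>jump_kernel\<close>; for ages of at least
  \<open>mesh n\<close> the quotient formula applies; then n tends to infinity.\<close>

lemma jump_law_atLeast:
  assumes B[measurable]: "B \<in> sets borel"
  shows "(\<integral>\<^sup>+\<omega>. ennreal (F \<omega>) * indicator B (age_at s \<omega>) * indicator {c..} (jump_size \<omega>) \<partial>Q)
    = (\<integral>\<^sup>+\<omega>. ennreal (F \<omega>) * indicator B (age_at s \<omega>) * emeasure (jump_kernel (snd (age_at s \<omega>))) {c..} \<partial>Q)"
proof -
  note [measurable] = age_at_measurable_Q snd_borel emeasure_jump_kernel_measurable
  define v where "v \<omega> = snd (age_at s \<omega>)" for \<omega>
  have [measurable]: "v \<in> borel_measurable Q" unfolding v_def[abs_def] by measurable
  define U1 where "U1 \<omega> = ennreal (F \<omega>) * indicator B (age_at s \<omega>) * indicator {c..} (jump_size \<omega>)" for \<omega>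
  define U2 where "U2 \<omega> = ennreal (F \<omega>) * indicator B (age_at s \<omega>) * emeasure (jump_kernel (v \<omega>)) {c..}" for \<omega>
  have [measurable]: "U1 \<in> borel_measurable Q" "U2 \<in> borel_measurable Q"
    unfolding U1_def[abs_def] U2_def[abs_def] by measurable
  have le1: "U1 \<omega> \<le> 1" "U2 \<omega> \<le> 1" for \<omega>
  proof -
    have "ennreal (F \<omega>) * indicator B (age_at s \<omega>) * y \<le> 1 * 1 * 1" if "y \<le> 1" for y
      using that F_bounds by (intro mult_mono) (auto simp: indicator_def ennreal_le_1)
    then show "U1 \<omega> \<le> 1" "U2 \<omega> \<le> 1"
      using prob_space.emeasure_le_1[OF prob_jump_kernel] by (auto simp: U1_def U2_def indicator_def)
  qed
  have AEv: "AE \<omega> in Q. (v \<omega> = 0 \<longrightarrow> jump_size \<omega> = 0) \<and> (0 < v \<omega> \<longrightarrow> 0 < tail (v \<omega>)) \<and> 0 \<le> v \<omega> \<and> v \<omega> \<le> jump_size \<omega>"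
    using AE_age_jump[OF s] AE_space
  proof eventually_elim
    case (elim \<omega>)
    then have \<omega>: "\<omega> \<in> good_paths" by (simp add: space_Q)
    then show ?case using elim age_nonneg[OF \<omega>] age_le_jump[OF \<omega>]
      by (auto simp: v_def age_at_def jump_size_def)
  qed
  have 0: "(\<integral>\<^sup>+\<omega>. U1 \<omega> * indicator {..0} (v \<omega>) \<partial>Q) = (\<integral>\<^sup>+\<omega>. U2 \<omega> * indicator {..0} (v \<omega>) \<partial>Q)"
    using AEv
  proof (intro nn_integral_cong_AE, eventually_elim)
    case (elim \<omega>)
    then show ?case by (cases "v \<omega> = 0") (auto simp: U1_def U2_def emeasure_jump_kernel)
  qed
  have 1: "(\<integral>\<^sup>+\<omega>. U1 \<omega> * indicator {mesh n..} (v \<omega>) \<partial>Q) = (\<integral>\<^sup>+\<omega>. U2 \<omega> * indicator {mesh n..} (v \<omega>) \<partial>Q)" for n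
  proof -
    \<comment> \<open>The quotient formula asks for a level of at least \<open>mesh n\<close>.
      Raising c to it changes nothing here, since the jump is at least the age.\<close>
    define c' where "c' = max c (mesh n)"
    have "(\<integral>\<^sup>+\<omega>. U1 \<omega> * indicator {mesh n..} (v \<omega>) \<partial>Q)
      = (\<integral>\<^sup>+\<omega>. ennreal (F \<omega>) * indicator {c'..} (jump_size \<omega>) * (indicator B (age_at s \<omega>) * indicator {mesh n..} (snd (age_at s \<omega>))) \<partial>Q)"
      using AEv
      by (intro nn_integral_cong_AE, eventually_elim) (auto simp: U1_def v_def[symmetric] c'_def indicator_def)
    also have "\<dots> = (\<integral>\<^sup>+\<omega>. ennreal (F \<omega>) * (indicator B (age_at s \<omega>) * indicator {mesh n..} (snd (age_at s \<omega>))
        * ennreal (tail (max c' (snd (age_at s \<omega>))) / tail (snd (age_at s \<omega>)))) \<partial>Q)"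
      by (intro jump_given_age_ge mesh_pos B) (simp add: c'_def)
    also have "\<dots> = (\<integral>\<^sup>+\<omega>. U2 \<omega> * indicator {mesh n..} (v \<omega>) \<partial>Q)"
      using AEv
    proof (intro nn_integral_cong_AE, eventually_elim)
      case (elim \<omega>)
      show ?case
      proof (cases "mesh n \<le> v \<omega>")
        case True
        then have "max c' (v \<omega>) = max c (v \<omega>)" "0 < v \<omega>" using mesh_pos[of n] by (auto simp: c'_def max_def)
        then show ?thesis using elim True by (simp add: U2_def v_def[symmetric] emeasure_jump_kernel ac_simps)
      qed (simp add: v_def)
    qed
    finally show ?thesis .
  qed
  have lim: "(\<lambda>n. \<integral>\<^sup>+\<omega>. U \<omega> * indicator {..0} (v \<omega>) \<partial>Q + \<integral>\<^sup>+\<omega>. U \<omega> * indicator {mesh n..} (v \<omega>) \<partial>Q) \<longlonglongrightarrow> (\<integral>\<^sup>+\<omega>. U \<omega> \<partial>Q)"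
    if [measurable]: "U \<in> borel_measurable Q" and U: "\<And>\<omega>. U \<omega> \<le> 1" for U
  proof -
    have "(\<lambda>n. \<integral>\<^sup>+\<omega>. U \<omega> * indicator {..0} (v \<omega>) + U \<omega> * indicator {mesh n..} (v \<omega>) \<partial>Q) \<longlonglongrightarrow> (\<integral>\<^sup>+\<omega>. U \<omega> \<partial>Q)"
    proof (rule nn_integral_dominated_convergence[where w="\<lambda>_. 1"])
      show "AE \<omega> in Q. U \<omega> * indicator {..0} (v \<omega>) + U \<omega> * indicator {mesh n..} (v \<omega>) \<le> 1" for n
        using mesh_pos[of n] U by (intro AE_I2) (auto simp: indicator_def)
      show "AE \<omega> in Q. (\<lambda>n. U \<omega> * indicator {..0} (v \<omega>) + U \<omega> * indicator {mesh n..} (v \<omega>)) \<longlonglongrightarrow> U \<omega>"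
      proof (rule AE_I2)
        fix \<omega>
        show "(\<lambda>n. U \<omega> * indicator {..0} (v \<omega>) + U \<omega> * indicator {mesh n..} (v \<omega>)) \<longlonglongrightarrow> U \<omega>"
        proof (cases "v \<omega> \<le> 0")
          case True
          then have "\<not> mesh n \<le> v \<omega>" for n using mesh_pos[of n] by simp
          then show ?thesis using True by simp
        next
          case False
          then have "eventually (\<lambda>n. mesh n < v \<omega>) sequentially"
            using order_tendstoD(2)[OF mesh_tendsto, of "v \<omega>"] by simp
          then have "eventually (\<lambda>n. U \<omega> * indicator {..0} (v \<omega>) + U \<omega> * indicator {mesh n..} (v \<omega>) = U \<omega>) sequentially"
            by eventually_elim (use False in auto)
          then show ?thesis by (rule tendsto_eventually)
        qed
      qed
    qed (auto simp: Q.emeasure_space_1)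
    then show ?thesis by (subst (asm) nn_integral_add) measurable
  qed
  have "(\<integral>\<^sup>+\<omega>. U1 \<omega> \<partial>Q) = (\<integral>\<^sup>+\<omega>. U2 \<omega> \<partial>Q)"
    using LIMSEQ_unique[OF lim[of U1, unfolded 0 1] lim[of U2]] le1 by simp
  then show ?thesis by (simp add: U1_def U2_def v_def)
qed

text \<open>Both sides integrate \<Psi> against a finite measure on pairs of state and jump. For
  each Borel set of states the two resulting measures of the jump agree on half-lines, hence
  everywhere, and rectangles determine the joint measures.\<close>

lemma jump_law:
  assumes \<Psi>[measurable]: "\<Psi> \<in> borel_measurable ((borel :: (real \<times> real) measure) \<Otimes>\<^sub>M (borel :: real measure))"
  shows "(\<integral>\<^sup>+\<omega>. ennreal (F \<omega>) * \<Psi> (age_at s \<omega>, jump_size \<omega>) \<partial>Q)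
    = (\<integral>\<^sup>+\<omega>. ennreal (F \<omega>) * (\<integral>\<^sup>+w. \<Psi> (age_at s \<omega>, w) \<partial>jump_kernel (snd (age_at s \<omega>))) \<partial>Q)"
proof -
  note [measurable] = age_at_measurable_Q snd_borel
  have kQ[measurable]: "(\<lambda>\<omega>. jump_kernel (snd (age_at s \<omega>))) \<in> Q \<rightarrow>\<^sub>M prob_algebra borel"
    by (rule measurable_compose[OF _ jump_kernel_measurable]) measurable
  define N where "N = (borel :: (real \<times> real) measure) \<Otimes>\<^sub>M (borel :: real measure)"
  define K where "K \<omega> = distr (jump_kernel (snd (age_at s \<omega>))) N (\<lambda>w. (age_at s \<omega>, w))" for \<omega>
  have K: "K \<in> Q \<rightarrow>\<^sub>M subprob_algebra N"
    unfolding K_def[abs_def] N_def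
    by (intro measurable_prob_algebraD measurable_distr_prob_space2[OF kQ]) measurable
  define m1 where "m1 = distr (density Q (\<lambda>\<omega>. ennreal (F \<omega>))) N (\<lambda>\<omega>. (age_at s \<omega>, jump_size \<omega>))"
  define m2 where "m2 = density Q (\<lambda>\<omega>. ennreal (F \<omega>)) \<bind> K"
  have Kd: "K \<in> density Q (\<lambda>\<omega>. ennreal (F \<omega>)) \<rightarrow>\<^sub>M subprob_algebra N" using K by simp
  have ne: "space (density Q (\<lambda>\<omega>. ennreal (F \<omega>))) \<noteq> {}" using Q.not_empty by simp
  have m1: "(\<integral>\<^sup>+x. g x \<partial>m1) = (\<integral>\<^sup>+\<omega>. ennreal (F \<omega>) * g (age_at s \<omega>, jump_size \<omega>) \<partial>Q)"
    if [measurable]: "g \<in> borel_measurable N" for g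
    unfolding m1_def using that by (subst nn_integral_distr; (subst nn_integral_density)?) (auto simp: N_def)
  have m2: "(\<integral>\<^sup>+x. g x \<partial>m2) = (\<integral>\<^sup>+\<omega>. ennreal (F \<omega>) * (\<integral>\<^sup>+w. g (age_at s \<omega>, w) \<partial>jump_kernel (snd (age_at s \<omega>))) \<partial>Q)"
    if g[measurable]: "g \<in> borel_measurable N" for g
  proof -
    have [measurable]: "(\<lambda>\<omega>. \<integral>\<^sup>+x. g x \<partial>K \<omega>) \<in> borel_measurable Q"
      by (rule measurable_compose[OF K nn_integral_measurable_subprob_algebra[OF g]])
    have 1: "(\<integral>\<^sup>+x. g x \<partial>m2) = (\<integral>\<^sup>+\<omega>. ennreal (F \<omega>) * (\<integral>\<^sup>+x. g x \<partial>K \<omega>) \<partial>Q)"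
      unfolding m2_def using g Kd by (subst nn_integral_bind; (subst nn_integral_density)?) auto
    have 2: "(\<integral>\<^sup>+x. g x \<partial>K \<omega>) = (\<integral>\<^sup>+w. g (age_at s \<omega>, w) \<partial>jump_kernel (snd (age_at s \<omega>)))" for \<omega>
      unfolding K_def using g
      by (subst nn_integral_distr) (auto simp: N_def measurable_cong_sets[OF sets_jump_kernel refl] measurable_Pair1')
    show ?thesis unfolding 1 2 ..
  qed
  have fin: "(\<integral>\<^sup>+x. g x \<partial>m1) \<noteq> \<infinity>" if "g \<in> borel_measurable N" "\<And>x. g x \<le> 1" for g
  proof -
    have "ennreal (F \<omega>) * g x \<le> 1 * 1" for \<omega> x
      using F_bounds that by (intro mult_mono) (auto simp: ennreal_le_1)
    then have "(\<integral>\<^sup>+x. g x \<partial>m1) \<le> (\<integral>\<^sup>+\<omega>. 1 \<partial>Q)" unfolding m1[OF that(1)] by (intro nn_integral_mono) simp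
    then show ?thesis by (auto simp: Q.emeasure_space_1 top_unique)
  qed
  have "sets m2 = sets N" unfolding m2_def by (rule sets_bind[OF sets_kernel[OF Kd] ne])
  then have sets: "sets m1 = sets N" "sets m2 = sets N" by (simp_all add: m1_def)
  have em: "emeasure m X = (\<integral>\<^sup>+x. indicator X x \<partial>m)" if "X \<in> sets m" for m :: "((real \<times> real) \<times> real) measure" and X
    using that by simp
  have rect: "B \<times> Y \<in> sets N" if "B \<in> sets borel" "Y \<in> sets borel" for B :: "(real \<times> real) set" and Y :: "real set"
    using that by (simp add: N_def)
  have "m1 = m2"
  proof (rule measure_eqI_rectangles)
    show "sets m1 = sets (borel \<Otimes>\<^sub>M borel)" "sets m2 = sets (borel \<Otimes>\<^sub>M borel)" using sets by (simp_all add: N_def)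
    have "space borel \<times> space borel \<in> sets N" by (intro rect) auto
    then have "emeasure m1 (space borel \<times> space borel) = (\<integral>\<^sup>+x. indicator (space borel \<times> space borel) x \<partial>m1)"
      using sets by (intro em) simp
    then show "emeasure m1 (space borel \<times> space borel) \<noteq> \<infinity>"
      using fin[of "indicator (space borel \<times> space borel)"] \<open>space borel \<times> space borel \<in> sets N\<close>
      by (simp add: indicator_def)
    fix B :: "(real \<times> real) set" and Y :: "real set" assume B[measurable]: "B \<in> sets borel" and Y: "Y \<in> sets borel"
    define proj where "proj m = distr (density m (indicator (B \<times> UNIV))) borel snd" for m :: "((real \<times> real) \<times> real) measure"
    have pe: "emeasure (proj m) Z = emeasure m (B \<times> Z)" if m: "sets m = sets N" and Z: "Z \<in> sets borel" for m Z
    proof -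
      have [measurable_cong]: "sets m = sets (borel \<Otimes>\<^sub>M borel)" using m by (simp add: N_def)
      have "emeasure (proj m) Z = emeasure (density m (indicator (B \<times> UNIV))) (UNIV \<times> Z)"
        unfolding proj_def using Z sets_eq_imp_space_eq[OF m] measurable_snd[of borel borel]
        by (subst emeasure_distr) (auto simp: N_def space_pair_measure vimage_def intro!: arg_cong2[where f=emeasure])
      also have "\<dots> = (\<integral>\<^sup>+x. indicator (B \<times> UNIV) x * indicator (UNIV \<times> Z) x \<partial>m)"
        using m Z rect by (subst emeasure_density) (auto intro!: borel_measurable_indicator)
      also have "\<dots> = (\<integral>\<^sup>+x. indicator (B \<times> Z) x \<partial>m)"
        by (intro nn_integral_cong) (auto simp: indicator_def)
      also have "\<dots> = emeasure m (B \<times> Z)" using m Z rect by simp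
      finally show ?thesis .
    qed
    have "proj m1 = proj m2"
    proof (rule measure_eqI_generator_eq[where \<Omega>=UNIV and E="range (\<lambda>c::real. {c..})" and A="\<lambda>n. {- real n..}"])
      show "Int_stable (range (\<lambda>c::real. {c..}))" by (rule Int_stable_atLeast)
      show "sets (proj m1) = sigma_sets UNIV (range (\<lambda>c::real. {c..}))" "sets (proj m2) = sigma_sets UNIV (range (\<lambda>c::real. {c..}))"
        by (simp_all add: proj_def sigma_sets_atLeast)
      show "(\<Union>n. {- real n..}) = UNIV"
      proof (intro equalityI subsetI)
        fix x :: real
        obtain n where "- x \<le> real n" using real_arch_simple by blast
        then show "x \<in> (\<Union>n. {- real n..})" by (auto intro!: exI[of _ n])
      qed simp
      show "emeasure (proj m1) {- real n..} \<noteq> \<infinity>" for n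
        using fin[of "indicator (B \<times> {- real n..})"] rect sets by (simp add: pe[OF sets(1)] em indicator_def)
      fix X assume "X \<in> range (\<lambda>c::real. {c..})"
      then obtain c where X: "X = {c..}" by auto
      have i: "indicator (B \<times> {c..}) \<in> borel_measurable N" using rect by simp
      have "emeasure (proj m1) X = (\<integral>\<^sup>+\<omega>. ennreal (F \<omega>) * indicator B (age_at s \<omega>) * indicator {c..} (jump_size \<omega>) \<partial>Q)"
      proof -
        have "B \<times> {c..} \<in> sets m1" using rect sets by simp
        then show ?thesis
          unfolding X pe[OF sets(1) atLeast_borel] em[OF \<open>B \<times> {c..} \<in> sets m1\<close>] m1[OF i]
          by (simp add: indicator_times mult.assoc)
      qed
      also have "\<dots> = (\<integral>\<^sup>+\<omega>. ennreal (F \<omega>) * indicator B (age_at s \<omega>) * emeasure (jump_kernel (snd (age_at s \<omega>))) {c..} \<partial>Q)"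
        by (rule jump_law_atLeast[OF B])
      also have "\<dots> = (\<integral>\<^sup>+x. indicator (B \<times> {c..}) x \<partial>m2)"
        unfolding m2[OF i] by (intro nn_integral_cong) (simp add: indicator_times nn_integral_cmult_indicator mult.assoc)
      also have "\<dots> = emeasure (proj m2) X"
        unfolding X using rect sets by (simp add: pe)
      finally show "emeasure (proj m1) X = emeasure (proj m2) X" .
    qed auto
    then show "emeasure m1 (B \<times> Y) = emeasure m2 (B \<times> Y)" using pe[OF sets(1) Y] pe[OF sets(2) Y] by simp
  qed
  then show ?thesis using m1[of \<Psi>] m2[of \<Psi>] by (simp add: N_def)
qed

text \<open>A jump across s that also reaches s + t makes the passage times over s and s + t
  coincide, and with them the left limits.\<close>

lemma overshoot_beyond:
  assumes \<omega>: "\<omega> \<in> good_paths" and t: "0 < t" and D: "s + t \<le> overshoot s \<omega>"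
  shows "age_at (s + t) \<omega> = (inverse_at s \<omega>, s + t - undershoot s \<omega>)"
proof -
  have st: "0 < s + t" using s t by simp
  have "inverse_at (s + t) \<omega> \<le> inverse_at s \<omega>"
    using inverse_le_iff[OF \<omega> st inverse_nonneg[OF \<omega>]] D by (simp add: overshoot_def)
  then have L: "inverse_at (s + t) \<omega> = inverse_at s \<omega>"
    using inverse_mono[OF \<omega>, of s "s + t"] t by simp
  then have "undershoot (s + t) \<omega> = undershoot s \<omega>" by (simp add: undershoot_eq[OF \<omega> st] undershoot_eq[OF \<omega> s])
  then show ?thesis using L by (simp add: age_at_def)
qed

text \<open>A jump of size w that straddles s at age v overshoots s by w - v. If w \<ge> v + t, the
  age has simply grown to v + t by time s + t; otherwise the renewal leaves the time v + t - w. The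
  jump law and the renewal property are joined along these two events.\<close>

lemma markov_jump:
  assumes t: "0 < t" and g: "continuous_on UNIV g" "\<And>z. 0 \<le> g z" "\<And>z. g z \<le> 1"
  defines "\<Psi> \<equiv> \<lambda>z. if snd (fst z) + t \<le> snd z then ennreal (g (fst (fst z), snd (fst z) + t))
    else ennreal (fresh g (snd (fst z) + t - snd z) (fst (fst z)))"
  shows "(\<integral>\<^sup>+\<omega>. ennreal (F \<omega>) * ennreal (g (age_at (s + t) \<omega>)) \<partial>Q)
    = (\<integral>\<^sup>+\<omega>. ennreal (F \<omega>) * (\<integral>\<^sup>+w. \<Psi> (age_at s \<omega>, w) \<partial>jump_kernel (snd (age_at s \<omega>))) \<partial>Q)"
proof -
  have gm: "g \<in> borel_measurable borel" by (rule borel_measurable_continuous_onI[OF g(1)])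
  have [measurable]: "(\<lambda>z. fst (fst z)) \<in> borel_measurable ((borel :: (real \<times> real) measure) \<Otimes>\<^sub>M (borel :: real measure))"
    "(\<lambda>z. snd (fst z)) \<in> borel_measurable ((borel :: (real \<times> real) measure) \<Otimes>\<^sub>M (borel :: real measure))"
    by (auto intro!: measurable_compose[OF measurable_fst] borel_measurable_continuous_onI continuous_intros)
  have [measurable]: "(\<lambda>z. g (fst (fst z), snd (fst z) + t)) \<in> borel_measurable ((borel :: (real \<times> real) measure) \<Otimes>\<^sub>M (borel :: real measure))"
    by (rule measurable_compose[OF _ gm]) measurable
  have [measurable]: "(\<lambda>z. fresh g (snd (fst z) + t - snd z) (fst (fst z))) \<in> borel_measurable ((borel :: (real \<times> real) measure) \<Otimes>\<^sub>M (borel :: real measure))"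
    by (rule fresh_measurable[OF gm]) measurable
  have \<Psi>: "\<Psi> \<in> borel_measurable ((borel :: (real \<times> real) measure) \<Otimes>\<^sub>M (borel :: real measure))"
    unfolding \<Psi>_def by measurable
  note [measurable] = gm
  have [measurable]: "(\<lambda>\<omega>. overshoot s \<omega>) \<in> borel_measurable Q"
    by (intro overshoot_measurable ident_measurable) simp
  have split: "(\<integral>\<^sup>+\<omega>. U \<omega> \<partial>Q) = (\<integral>\<^sup>+\<omega>. indicator {\<omega>. overshoot s \<omega> < s + t} \<omega> * U \<omega> \<partial>Q)
      + (\<integral>\<^sup>+\<omega>. indicator {\<omega>. s + t \<le> overshoot s \<omega>} \<omega> * U \<omega> \<partial>Q)"
    if [measurable]: "U \<in> borel_measurable Q" for U
    by (subst nn_integral_add[symmetric]) (measurable, auto intro!: nn_integral_cong simp: indicator_def)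
  have ge: "s + t \<le> overshoot s \<omega> \<longleftrightarrow> snd (age_at s \<omega>) + t \<le> jump_size \<omega>" for \<omega>
    by (auto simp: age_at_def jump_size_def)
  have [measurable]: "(\<lambda>\<omega>. ennreal (F \<omega>) * \<Psi> (age_at s \<omega>, jump_size \<omega>)) \<in> borel_measurable Q"
    by (intro borel_measurable_times_ennreal measurable_compose[OF _ \<Psi>]) (use age_at_measurable_Q in measurable)
  have "(\<integral>\<^sup>+\<omega>. ennreal (F \<omega>) * ennreal (g (age_at (s + t) \<omega>)) \<partial>Q)
    = (\<integral>\<^sup>+\<omega>. indicator {\<omega>. overshoot s \<omega> < s + t} \<omega> * ennreal (F \<omega> * g (age_at (s + t) \<omega>)) \<partial>Q)
      + (\<integral>\<^sup>+\<omega>. indicator {\<omega>. s + t \<le> overshoot s \<omega>} \<omega> * (ennreal (F \<omega>) * ennreal (g (age_at (s + t) \<omega>))) \<partial>Q)"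
    using F_bounds g age_at_measurable_Q by (subst split) (auto simp: ennreal_mult')
  also have "(\<integral>\<^sup>+\<omega>. indicator {\<omega>. overshoot s \<omega> < s + t} \<omega> * ennreal (F \<omega> * g (age_at (s + t) \<omega>)) \<partial>Q)
    = (\<integral>\<^sup>+\<omega>. indicator {\<omega>. overshoot s \<omega> < s + t} \<omega> * (ennreal (F \<omega>) * \<Psi> (age_at s \<omega>, jump_size \<omega>)) \<partial>Q)"
    unfolding renewal[OF t g]
    using F_bounds ge
    by (intro nn_integral_cong) (auto simp: \<Psi>_def indicator_def ennreal_mult' age_at_def jump_size_def algebra_simps)
  also have "(\<integral>\<^sup>+\<omega>. indicator {\<omega>. s + t \<le> overshoot s \<omega>} \<omega> * (ennreal (F \<omega>) * ennreal (g (age_at (s + t) \<omega>))) \<partial>Q)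
    = (\<integral>\<^sup>+\<omega>. indicator {\<omega>. s + t \<le> overshoot s \<omega>} \<omega> * (ennreal (F \<omega>) * \<Psi> (age_at s \<omega>, jump_size \<omega>)) \<partial>Q)"
  proof (intro nn_integral_cong)
    fix \<omega> assume "\<omega> \<in> space Q"
    then have "s + t \<le> overshoot s \<omega> \<Longrightarrow> ennreal (g (age_at (s + t) \<omega>)) = \<Psi> (age_at s \<omega>, jump_size \<omega>)"
      using overshoot_beyond[OF _ t, of \<omega>] ge[of \<omega>] by (simp add: space_Q \<Psi>_def) (simp add: age_at_def algebra_simps)
    then show "indicator {\<omega>. s + t \<le> overshoot s \<omega>} \<omega> * (ennreal (F \<omega>) * ennreal (g (age_at (s + t) \<omega>)))
      = indicator {\<omega>. s + t \<le> overshoot s \<omega>} \<omega> * (ennreal (F \<omega>) * \<Psi> (age_at s \<omega>, jump_size \<omega>))"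
      by (auto simp: indicator_def)
  qed
  also have "(\<integral>\<^sup>+\<omega>. indicator {\<omega>. overshoot s \<omega> < s + t} \<omega> * (ennreal (F \<omega>) * \<Psi> (age_at s \<omega>, jump_size \<omega>)) \<partial>Q)
      + (\<integral>\<^sup>+\<omega>. indicator {\<omega>. s + t \<le> overshoot s \<omega>} \<omega> * (ennreal (F \<omega>) * \<Psi> (age_at s \<omega>, jump_size \<omega>)) \<partial>Q)
    = (\<integral>\<^sup>+\<omega>. ennreal (F \<omega>) * \<Psi> (age_at s \<omega>, jump_size \<omega>) \<partial>Q)"
    by (rule split[symmetric]) measurable
  also have "\<dots> = (\<integral>\<^sup>+\<omega>. ennreal (F \<omega>) * (\<integral>\<^sup>+w. \<Psi> (age_at s \<omega>, w) \<partial>jump_kernel (snd (age_at s \<omega>))) \<partial>Q)"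
    by (rule jump_law[OF \<Psi>])
  finally show ?thesis .
qed

end

section \<open>The transition kernel of the age process\<close>

context subordinator_law
begin

text \<open>One sample of the future: y consists of a jump size and an independent fresh path, and
  the path comes into play only if the jump is smaller than the initial age plus the elapsed
  time.\<close>

definition age_step :: "real \<Rightarrow> real \<times> real \<Rightarrow> real \<times> (real \<Rightarrow> real) \<Rightarrow> real \<times> real" where
  "age_step t z y = (let r = snd z + t - fst y in
     if r \<le> 0 then (fst z, snd z + t) else (fst z + inverse_at r (snd y), r - undershoot r (snd y)))"

definition age_kernel :: "real \<Rightarrow> real \<times> real \<Rightarrow> (real \<times> real) measure" where
  "age_kernel t z = distr (jump_kernel (snd z) \<Otimes>\<^sub>M Q) borel (age_step t z)"

definition restart :: "(real \<times> real \<Rightarrow> ennreal) \<Rightarrow> real \<Rightarrow> real \<Rightarrow> ennreal" where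
  "restart h x r = (\<integral>\<^sup>+\<eta>. h (x + inverse_at r \<eta>, r - undershoot r \<eta>) \<partial>Q)"

definition step_value :: "(real \<times> real \<Rightarrow> ennreal) \<Rightarrow> real \<Rightarrow> real \<Rightarrow> real \<Rightarrow> ennreal" where
  "step_value h x a w = (if a \<le> w then h (x, a) else restart h x (a - w))"

lemma age_step_measurable:
  assumes f: "f \<in> borel_measurable M" "g \<in> borel_measurable M" "w \<in> borel_measurable M" "\<eta> \<in> M \<rightarrow>\<^sub>M good_space"
  shows "(\<lambda>x. age_step (f x) (g x) (w x, \<eta> x)) \<in> borel_measurable M"
proof -
  have [measurable]: "(\<lambda>x. fst (g x)) \<in> borel_measurable M" "(\<lambda>x. snd (g x)) \<in> borel_measurable M"
    by (auto intro!: measurable_compose[OF f(2)] borel_measurable_continuous_onI continuous_intros)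
  note [measurable] = f
  show ?thesis unfolding age_step_def Let_def fst_conv snd_conv by measurable
qed

lemma age_step_section: "age_step t z \<in> borel_measurable (jump_kernel v \<Otimes>\<^sub>M Q)"
proof -
  have "snd \<in> jump_kernel v \<Otimes>\<^sub>M Q \<rightarrow>\<^sub>M good_space"
    using measurable_snd[of "jump_kernel v" Q] by (simp add: measurable_cong_sets[OF refl sets_Q])
  moreover have "fst \<in> borel_measurable (jump_kernel v \<Otimes>\<^sub>M Q)"
    using measurable_fst[of "jump_kernel v" Q] by (simp add: measurable_cong_sets[OF refl sets_jump_kernel])
  ultimately show ?thesis
    using age_step_measurable[of "\<lambda>_. t" _ "\<lambda>_. z" fst snd] by simp
qed

lemma restart_measurable:
  assumes [measurable]: "h \<in> borel_measurable borel" "x \<in> borel_measurable M" "r \<in> borel_measurable M"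
  shows "(\<lambda>z. restart h (x z) (r z)) \<in> borel_measurable M"
  unfolding restart_def by (rule Q.borel_measurable_nn_integral) measurable

lemma step_value_measurable:
  assumes h[measurable]: "h \<in> borel_measurable borel" and [measurable]: "x \<in> borel_measurable M" "a \<in> borel_measurable M" "w \<in> borel_measurable M"
  shows "(\<lambda>z. step_value h (x z) (a z) (w z)) \<in> borel_measurable M"
proof -
  have [measurable]: "(\<lambda>z. restart h (x z) (a z - w z)) \<in> borel_measurable M" by (rule restart_measurable) measurable
  show ?thesis unfolding step_value_def by measurable
qed

lemma step_value_section: "h \<in> borel_measurable borel \<Longrightarrow> step_value h x a \<in> borel_measurable borel"
  by (rule step_value_measurable[where x="\<lambda>_. x" and a="\<lambda>_. a" and w="\<lambda>w. w"]) auto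

lemma nn_integral_age_kernel:
  assumes h: "h \<in> borel_measurable borel"
  shows "(\<integral>\<^sup>+y. h y \<partial>age_kernel t z) = (\<integral>\<^sup>+w. step_value h (fst z) (snd z + t) w \<partial>jump_kernel (snd z))"
proof -
  have "(\<integral>\<^sup>+y. h y \<partial>age_kernel t z) = (\<integral>\<^sup>+y. h (age_step t z y) \<partial>(jump_kernel (snd z) \<Otimes>\<^sub>M Q))"
    unfolding age_kernel_def using h by (subst nn_integral_distr[OF age_step_section]) auto
  also have "\<dots> = (\<integral>\<^sup>+w. \<integral>\<^sup>+\<eta>. h (age_step t z (w, \<eta>)) \<partial>Q \<partial>jump_kernel (snd z))"
    by (subst Q.nn_integral_fst[symmetric]) (auto intro!: measurable_compose[OF age_step_section h])
  also have "\<dots> = (\<integral>\<^sup>+w. step_value h (fst z) (snd z + t) w \<partial>jump_kernel (snd z))"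
    by (intro nn_integral_cong) (auto simp: age_step_def Let_def step_value_def restart_def Q.emeasure_space_1)
  finally show ?thesis .
qed

lemma age_kernel_measurable:
  assumes f: "f \<in> borel_measurable M" "g \<in> borel_measurable M"
  shows "(\<lambda>x. age_kernel (f x) (g x)) \<in> M \<rightarrow>\<^sub>M prob_algebra borel"
  unfolding age_kernel_def
proof (rule measurable_distr_prob_space2[where M="borel \<Otimes>\<^sub>M good_space"])
  have "(\<lambda>x. snd (g x)) \<in> borel_measurable M"
    by (auto intro!: measurable_compose[OF f(2)] borel_measurable_continuous_onI continuous_intros)
  then have 1: "(\<lambda>x. jump_kernel (snd (g x))) \<in> M \<rightarrow>\<^sub>M prob_algebra borel"
    by (rule measurable_compose[OF _ jump_kernel_measurable])
  have "Q \<in> space (prob_algebra good_space)"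
    using sets_Q Q.prob_space_axioms by (simp add: space_prob_algebra)
  then have 2: "(\<lambda>x. Q) \<in> M \<rightarrow>\<^sub>M prob_algebra good_space" by simp
  show "(\<lambda>x. jump_kernel (snd (g x)) \<Otimes>\<^sub>M Q) \<in> M \<rightarrow>\<^sub>M prob_algebra (borel \<Otimes>\<^sub>M good_space)"
    by (rule measurable_pair_prob[OF 1 2])
  have "(\<lambda>y. age_step (f (fst y)) (g (fst y)) (fst (snd y), snd (snd y))) \<in> M \<Otimes>\<^sub>M (borel \<Otimes>\<^sub>M good_space) \<rightarrow>\<^sub>M borel"
    by (intro age_step_measurable measurable_compose[OF measurable_fst f(1)] measurable_compose[OF measurable_fst f(2)]) measurable
  then show "(\<lambda>(x, y). age_step (f x) (g x) y) \<in> M \<Otimes>\<^sub>M (borel \<Otimes>\<^sub>M good_space) \<rightarrow>\<^sub>M borel"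
    by (simp add: case_prod_beta')
qed

lemma prob_space_age_kernel: "prob_space (age_kernel t z)"
proof -
  interpret J: prob_space "jump_kernel (snd z)" by (rule prob_jump_kernel)
  interpret P: pair_prob_space "jump_kernel (snd z)" Q ..
  show ?thesis unfolding age_kernel_def by (rule P.prob_space_distr[OF age_step_section])
qed

lemma AE_jump_kernel: "AE w in jump_kernel v. v \<le> w"
proof -
  interpret J: prob_space "jump_kernel v" by (rule prob_jump_kernel)
  have "emeasure (jump_kernel v) {v..} = 1" by (simp add: emeasure_jump_kernel)
  then have "AE w in jump_kernel v. w \<in> {v..}"
    by (subst J.AE_in_set_eq_1) (auto simp: J.emeasure_eq_measure)
  then show ?thesis by simp
qed

text \<open>The sampled jump is almost surely at least the age, so at time 0 no restart has taken
  place.\<close>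

lemma nn_integral_age_kernel_0:
  assumes h: "h \<in> borel_measurable borel"
  shows "(\<integral>\<^sup>+y. h y \<partial>age_kernel 0 z) = h z"
proof -
  interpret J: prob_space "jump_kernel (snd z)" by (rule prob_jump_kernel)
  have "(\<integral>\<^sup>+y. h y \<partial>age_kernel 0 z) = (\<integral>\<^sup>+w. h z \<partial>jump_kernel (snd z))"
    unfolding nn_integral_age_kernel[OF h]
    using AE_jump_kernel[of "snd z"] by (intro nn_integral_cong_AE, eventually_elim) (simp add: step_value_def)
  then show ?thesis by (simp add: J.emeasure_space_1[simplified])
qed

text \<open>At age 0 the sampled jump is 0 and the fresh path starts at once.\<close>

lemma nn_integral_age_kernel_fresh:
  assumes h: "h \<in> borel_measurable borel" and t: "0 < t"
  shows "(\<integral>\<^sup>+y. h y \<partial>age_kernel t (x, 0)) = restart h x t"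
proof -
  have m: "step_value h x t \<in> borel_measurable borel" by (rule step_value_section[OF h])
  show ?thesis
    unfolding nn_integral_age_kernel[OF h] using t m by (simp add: jump_kernel_def nn_integral_return step_value_def)
qed

lemma restart_shift: "restart (\<lambda>z. h (x + fst z, snd z)) y r = restart h (x + y) r"
  by (simp add: restart_def add.assoc)

text \<open>Restarts only add to the first coordinate, so the kernel commutes with translations of
  it. This is how a general starting position is reduced to 0.\<close>

lemma age_kernel_shift:
  assumes h: "h \<in> borel_measurable borel"
  shows "(\<integral>\<^sup>+y. h (x + fst y, snd y) \<partial>age_kernel t z) = (\<integral>\<^sup>+y. h y \<partial>age_kernel t (x + fst z, snd z))"
proof -
  have "(\<lambda>y. (x + fst y, snd y)) \<in> borel_measurable (borel :: (real \<times> real) measure)"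
    by (intro borel_measurable_continuous_onI continuous_intros)
  from measurable_compose[OF this h] show ?thesis
    by (simp add: nn_integral_age_kernel h step_value_def restart_shift cong: if_cong)
qed

end

context age_tests
begin

text \<open>Both sides integrate h against finite measures, so the continuous functions covered by
  \<open>markov_jump\<close> suffice to identify them.\<close>

lemma markov_test:
  assumes t: "0 < t" and h: "h \<in> borel_measurable borel"
  shows "(\<integral>\<^sup>+\<omega>. ennreal (F \<omega>) * h (age_at (s + t) \<omega>) \<partial>Q)
    = (\<integral>\<^sup>+\<omega>. ennreal (F \<omega>) * (\<integral>\<^sup>+y. h y \<partial>age_kernel t (age_at s \<omega>)) \<partial>Q)"
proof -
  note [measurable] = age_at_measurable_Q
  have K: "(\<lambda>\<omega>. age_kernel t (age_at s \<omega>)) \<in> Q \<rightarrow>\<^sub>M subprob_algebra borel"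
    by (intro measurable_prob_algebraD age_kernel_measurable age_at_measurable_Q) simp
  define m1 where "m1 = distr (density Q (\<lambda>\<omega>. ennreal (F \<omega>))) borel (age_at (s + t))"
  define m2 where "m2 = density Q (\<lambda>\<omega>. ennreal (F \<omega>)) \<bind> (\<lambda>\<omega>. age_kernel t (age_at s \<omega>))"
  have Kd: "(\<lambda>\<omega>. age_kernel t (age_at s \<omega>)) \<in> density Q (\<lambda>\<omega>. ennreal (F \<omega>)) \<rightarrow>\<^sub>M subprob_algebra borel" using K by simp
  have ne: "space (density Q (\<lambda>\<omega>. ennreal (F \<omega>))) \<noteq> {}" using Q.not_empty by simp
  have m1: "(\<integral>\<^sup>+x. g x \<partial>m1) = (\<integral>\<^sup>+\<omega>. ennreal (F \<omega>) * g (age_at (s + t) \<omega>) \<partial>Q)"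
    if [measurable]: "g \<in> borel_measurable borel" for g
    unfolding m1_def using that by (subst nn_integral_distr; (subst nn_integral_density)?) auto
  have m2: "(\<integral>\<^sup>+x. g x \<partial>m2) = (\<integral>\<^sup>+\<omega>. ennreal (F \<omega>) * (\<integral>\<^sup>+y. g y \<partial>age_kernel t (age_at s \<omega>)) \<partial>Q)"
    if g[measurable]: "g \<in> borel_measurable borel" for g
  proof -
    have [measurable]: "(\<lambda>\<omega>. \<integral>\<^sup>+x. g x \<partial>age_kernel t (age_at s \<omega>)) \<in> borel_measurable Q"
      by (rule measurable_compose[OF K nn_integral_measurable_subprob_algebra[OF g]])
    show ?thesis
      unfolding m2_def using g Kd by (subst nn_integral_bind; (subst nn_integral_density)?) auto
  qed
  have "m1 = m2"
  proof (rule measure_eqI_compact_support)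
    show "sets m1 = sets borel" by (simp add: m1_def)
    show "sets m2 = sets borel" unfolding m2_def by (rule sets_bind[OF sets_kernel[OF Kd] ne])
    have "emeasure m1 UNIV = (\<integral>\<^sup>+x. 1 \<partial>m1)" by (simp add: m1_def)
    also have "\<dots> \<le> (\<integral>\<^sup>+\<omega>. 1 \<partial>Q)"
      unfolding m1[OF borel_measurable_const] using F_bounds by (intro nn_integral_mono) (auto simp: ennreal_le_1)
    finally show "emeasure m1 UNIV \<noteq> \<infinity>" by (auto simp: Q.emeasure_space_1 top_unique)
    fix g :: "real \<times> real \<Rightarrow> real" assume g: "continuous_on UNIV g" "\<And>x. 0 \<le> g x" "\<And>x. g x \<le> 1"
    have gm: "g \<in> borel_measurable borel" by (rule borel_measurable_continuous_onI[OF g(1)])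
    then have gm': "(\<lambda>x. ennreal (g x)) \<in> borel_measurable borel" by simp
    have sv: "step_value (\<lambda>x. ennreal (g x)) (fst z) (snd z + t)
      = (\<lambda>w. if snd z + t \<le> w then ennreal (g (fst z, snd z + t)) else ennreal (fresh g (snd z + t - w) (fst z)))" for z
      by (rule ext) (simp add: step_value_def restart_def fresh_eq[OF gm g(2,3)])
    show "(\<integral>\<^sup>+x. ennreal (g x) \<partial>m1) = (\<integral>\<^sup>+x. ennreal (g x) \<partial>m2)"
      unfolding m1[OF gm'] m2[OF gm'] nn_integral_age_kernel[OF gm'] sv
      using markov_jump[OF t g] by (simp only: fst_conv snd_conv)
  qed
  then show ?thesis using m1[OF h] m2[OF h] by simp
qed

end

section \<open>The Markov property on cylinders and the Chapman-Kolmogorov equations\<close>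

context subordinator_law
begin

definition age_cyl :: "real set \<Rightarrow> (real \<Rightarrow> (real \<times> real) set) \<Rightarrow> (real \<Rightarrow> real) \<Rightarrow> ennreal" where
  "age_cyl J K \<omega> = indicator {\<omega>. \<forall>r\<in>J. age_at r \<omega> \<in> K r} \<omega>"

lemma age_at_0: "age_at 0 \<omega> = (0, 0)"
  by (simp add: age_at_def inverse_at_def undershoot_def)

lemma nn_integral_age_kernel_measurable:
  assumes h: "h \<in> borel_measurable borel" and t: "t \<in> borel_measurable M" and z: "z \<in> borel_measurable M"
  shows "(\<lambda>x. \<integral>\<^sup>+y. h y \<partial>age_kernel (t x) (z x)) \<in> borel_measurable M"
  using measurable_compose[OF measurable_prob_algebraD[OF age_kernel_measurable[OF t z]] nn_integral_measurable_subprob_algebra[OF h]] .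

text \<open>Bumps decrease to the indicators of the closed sets, and both sides pass to the limit.
  Treated apart are s = 0 and t = 0, which the tests exclude, and an empty set among the
  \<open>K r\<close>, whose bumps are constantly 1 instead of tending to its indicator.\<close>

lemma markov_cyl:
  assumes s: "0 \<le> s" and t: "0 \<le> t" and J: "finite J" "J \<subseteq> {0..s}" and K: "\<And>r. r \<in> J \<Longrightarrow> closed (K r)"
    and h: "h \<in> borel_measurable borel" and h1: "\<And>x. h x \<le> 1"
  shows "(\<integral>\<^sup>+\<omega>. age_cyl J K \<omega> * h (age_at (s + t) \<omega>) \<partial>Q)
    = (\<integral>\<^sup>+\<omega>. age_cyl J K \<omega> * (\<integral>\<^sup>+y. h y \<partial>age_kernel t (age_at s \<omega>)) \<partial>Q)"
proof -
  consider "t = 0" | "s = 0" "0 < t" | "\<exists>r\<in>J. K r = {}" | "0 < s" "0 < t" "\<forall>r\<in>J. K r \<noteq> {}"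
    using s t by force
  then show ?thesis
  proof cases
    case 1
    then show ?thesis by (simp add: nn_integral_age_kernel_0[OF h])
  next
    case 2
    then have "J \<subseteq> {0}" using J by auto
    then have c: "age_cyl J K \<omega> = age_cyl J K \<omega>'" for \<omega> \<omega>'
    proof -
      have "age_at r \<omega> = age_at r \<omega>'" if "r \<in> J" for r using that \<open>J \<subseteq> {0}\<close> by (auto simp: age_at_0)
      then show ?thesis by (simp add: age_cyl_def indicator_def)
    qed
    \<comment> \<open>At s = 0 every tested state is (0,0) whatever the path, so the indicator is a
      constant, named here by its value at an arbitrary function.\<close>
    define \<omega>0 :: "real \<Rightarrow> real" where "\<omega>0 = (\<lambda>_. 0)"
    have c0: "age_cyl J K \<omega> * U = age_cyl J K \<omega>0 * U" for \<omega> U by (simp only: c[of \<omega> \<omega>0])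
    have m: "(\<lambda>\<omega>. h (age_at t \<omega>)) \<in> borel_measurable Q" by (rule measurable_compose[OF age_at_measurable_Q h])
    have "(\<integral>\<^sup>+\<omega>. age_cyl J K \<omega> * h (age_at (s + t) \<omega>) \<partial>Q) = (\<integral>\<^sup>+\<omega>. age_cyl J K \<omega>0 * h (age_at t \<omega>) \<partial>Q)"
      using 2 by (subst c0) simp
    also have "\<dots> = age_cyl J K \<omega>0 * restart h 0 t"
      using m by (simp add: nn_integral_cmult restart_def age_at_def)
    also have "\<dots> = (\<integral>\<^sup>+\<omega>. age_cyl J K \<omega>0 * (\<integral>\<^sup>+y. h y \<partial>age_kernel t (age_at 0 \<omega>)) \<partial>Q)"
      unfolding age_at_0 nn_integral_age_kernel_fresh[OF h 2(2)] by (simp add: Q.emeasure_space_1)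
    also have "\<dots> = (\<integral>\<^sup>+\<omega>. age_cyl J K \<omega> * (\<integral>\<^sup>+y. h y \<partial>age_kernel t (age_at s \<omega>)) \<partial>Q)"
      using 2 by (subst c0) simp
    finally show ?thesis .
  next
    case 3
    then have "age_cyl J K \<omega> = 0" for \<omega> by (auto simp: age_cyl_def indicator_def)
    then show ?thesis by simp
  next
    case 4
    have tests: "age_tests b \<nu> \<mu> Q s J (\<lambda>r. bump (K r) n)" for n
      by standard (use 4 J in \<open>auto intro: continuous_on_bump bump_bounds\<close>)
    define Fn where "Fn n \<omega> = (\<Prod>r\<in>J. bump (K r) n (age_at r \<omega>))" for n \<omega>
    have Fn: "age_tests.F J (\<lambda>r. bump (K r) n) \<omega> = Fn n \<omega>" for n \<omega>
      by (simp add: age_tests.F_def[OF tests] Fn_def)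
    have eq: "(\<integral>\<^sup>+\<omega>. ennreal (Fn n \<omega>) * h (age_at (s + t) \<omega>) \<partial>Q)
      = (\<integral>\<^sup>+\<omega>. ennreal (Fn n \<omega>) * (\<integral>\<^sup>+y. h y \<partial>age_kernel t (age_at s \<omega>)) \<partial>Q)" for n
      using age_tests.markov_test[OF tests 4(2) h] by (simp add: Fn)
    have Fm[measurable]: "Fn n \<in> borel_measurable Q" for n
      unfolding Fn_def[abs_def] by (intro borel_measurable_prod measurable_compose[OF age_at_measurable_Q borel_measurable_bump])
    have Flim: "(\<lambda>n. ennreal (Fn n \<omega>)) \<longlonglongrightarrow> age_cyl J K \<omega>" for \<omega>
    proof -
      have l: "(\<lambda>n. Fn n \<omega>) \<longlonglongrightarrow> (\<Prod>r\<in>J. indicator (K r) (age_at r \<omega>))"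
        unfolding Fn_def using K 4(3) by (intro tendsto_prod bump_tendsto) auto
      have "ennreal (\<Prod>r\<in>J. indicator (K r) (age_at r \<omega>)) = age_cyl J K \<omega>"
      proof (cases "\<forall>r\<in>J. age_at r \<omega> \<in> K r")
        case True
        then show ?thesis by (simp add: age_cyl_def)
      next
        case False
        then obtain r where "r \<in> J" "age_at r \<omega> \<notin> K r" by blast
        then have "(\<Prod>r\<in>J. indicator (K r) (age_at r \<omega>)) = (0::real)" using J(1) by (intro prod_zero) (auto intro!: bexI[of _ r])
        then show ?thesis using False by (simp add: age_cyl_def)
      qed
      then show ?thesis using tendsto_ennrealI[OF l] by simp
    qed
    have cm[measurable]: "age_cyl J K \<in> borel_measurable Q"
      by (rule borel_measurable_LIMSEQ_order[OF Flim]) measurable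
    have F1: "Fn n \<omega> \<le> 1" for n \<omega> unfolding Fn_def by (intro prod_le_1) (auto simp: bump_bounds)
    have lim: "(\<lambda>n. \<integral>\<^sup>+\<omega>. ennreal (Fn n \<omega>) * U \<omega> \<partial>Q) \<longlonglongrightarrow> (\<integral>\<^sup>+\<omega>. age_cyl J K \<omega> * U \<omega> \<partial>Q)"
      if [measurable]: "U \<in> borel_measurable Q" and U: "\<And>\<omega>. U \<omega> \<le> 1" for U
    proof (rule nn_integral_dominated_convergence[where w="\<lambda>_. 1"])
      show "AE \<omega> in Q. ennreal (Fn n \<omega>) * U \<omega> \<le> 1" for n
      proof (rule AE_I2)
        fix \<omega>
        have "ennreal (Fn n \<omega>) * U \<omega> \<le> 1 * 1" using F1 U by (intro mult_mono) (auto simp: ennreal_le_1)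
        then show "ennreal (Fn n \<omega>) * U \<omega> \<le> 1" by simp
      qed
      show "AE \<omega> in Q. (\<lambda>n. ennreal (Fn n \<omega>) * U \<omega>) \<longlonglongrightarrow> age_cyl J K \<omega> * U \<omega>"
      proof (rule AE_I2)
        fix \<omega>
        have "U \<omega> \<noteq> \<top>" using U[of \<omega>] by (auto simp: top_unique)
        then show "(\<lambda>n. ennreal (Fn n \<omega>) * U \<omega>) \<longlonglongrightarrow> age_cyl J K \<omega> * U \<omega>"
          by (intro tendsto_mult_ennreal Flim tendsto_const) (auto simp: age_cyl_def indicator_def)
      qed
    qed (auto simp: Q.emeasure_space_1)
    have U2: "(\<integral>\<^sup>+y. h y \<partial>age_kernel t z) \<le> 1" for z
    proof -
      interpret A: prob_space "age_kernel t z" by (rule prob_space_age_kernel)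
      have "(\<integral>\<^sup>+y. h y \<partial>age_kernel t z) \<le> (\<integral>\<^sup>+y. 1 \<partial>age_kernel t z)" by (intro nn_integral_mono h1)
      then show ?thesis by (simp add: A.emeasure_space_1)
    qed
    show ?thesis
      using LIMSEQ_unique[OF lim[of "\<lambda>\<omega>. h (age_at (s + t) \<omega>)", unfolded eq] lim[of "\<lambda>\<omega>. \<integral>\<^sup>+y. h y \<partial>age_kernel t (age_at s \<omega>)"]]
        h1 U2 measurable_compose[OF age_at_measurable_Q h] nn_integral_age_kernel_measurable[OF h borel_measurable_const age_at_measurable_Q]
      by simp
  qed
qed

text \<open>Without tests of the past the Markov property at level r is the semigroup relation for a
  process that starts afresh; the translation by x is absorbed into h.\<close>

lemma restart_Chapman_Kolmogorov:
  assumes r: "0 < r" and t: "0 \<le> t" and h: "h \<in> borel_measurable borel"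
  shows "restart h x (r + t) = restart (\<lambda>z. \<integral>\<^sup>+y. h y \<partial>age_kernel t z) x r"
proof (cases "t = 0")
  case True
  then show ?thesis by (simp add: nn_integral_age_kernel_0[OF h])
next
  case False
  interpret T: age_tests b \<nu> \<mu> Q r "{}" "\<lambda>_ _. 0" by standard (use r in auto)
  have F1: "T.F \<omega> = 1" for \<omega> by (simp add: T.F_def)
  have "(\<lambda>y. (x + fst y, snd y)) \<in> borel_measurable (borel :: (real \<times> real) measure)"
    by (intro borel_measurable_continuous_onI continuous_intros)
  then have h': "(\<lambda>y. h (x + fst y, snd y)) \<in> borel_measurable borel" by (rule measurable_compose[OF _ h])
  show ?thesis
    using T.markov_test[OF _ h', where t=t] False t age_kernel_shift[OF h, where x=x and t=t]
    by (simp add: F1 restart_def age_at_def)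
qed

text \<open>Conditioning \<nu> to [v,\<infinity>) and then to [v',\<infinity>) is conditioning to
  the smaller half-line. The degenerate cases fit: if the tail vanishes at v' but not at v, both
  sides are 0, and a Dirac mass at v gives nothing to [v',\<infinity>) unless v' = v.\<close>

lemma jump_kernel_restart:
  assumes v: "0 \<le> v" "v \<le> v'" and G[measurable]: "G \<in> borel_measurable borel"
  shows "(\<integral>\<^sup>+w. indicator {v'..} w * G w \<partial>jump_kernel v) = emeasure (jump_kernel v) {v'..} * (\<integral>\<^sup>+w. G w \<partial>jump_kernel v')"
proof (cases "0 < v \<and> 0 < tail v")
  case True
  then have v': "0 < v'" using v by simp
  have Gn: "G \<in> borel_measurable \<nu>" using G by (simp add: measurable_cong_sets[OF sets_nu refl])
  have ind: "indicator {v'..} w * G w * indicator {v..} w = G w * indicator {v'..} w" for w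
    using v by (auto simp: indicator_def)
  have L: "(\<integral>\<^sup>+w. indicator {v'..} w * G w \<partial>jump_kernel v) = (\<integral>\<^sup>+w. G w * indicator {v'..} w \<partial>\<nu>) / ennreal (tail v)"
  proof -
    have "(\<lambda>w. indicator {v'..} w * G w) \<in> borel_measurable \<nu>"
      by (intro borel_measurable_times_ennreal borel_measurable_indicator Gn) simp
    then show ?thesis
      using True by (simp add: jump_kernel_def nn_integral_uniform_measure ind emeasure_tail)
  qed
  show ?thesis
  proof (cases "tail v' = 0")
    case True
    then have "emeasure \<nu> {v'..} = 0" using v' by (simp add: emeasure_tail)
    then have "AE w in \<nu>. w \<notin> {v'..}" by (intro AE_not_in) (auto simp: null_sets_def)
    then have "(\<integral>\<^sup>+w. G w * indicator {v'..} w \<partial>\<nu>) = 0"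
      by (subst nn_integral_0_iff_AE)
         (auto elim!: eventually_mono intro!: borel_measurable_times_ennreal borel_measurable_indicator Gn)
    moreover have "emeasure (jump_kernel v) {v'..} = 0"
      using \<open>0 < v \<and> 0 < tail v\<close> True v by (simp add: emeasure_jump_kernel max_def)
    ultimately show ?thesis unfolding L by simp
  next
    case False
    then have p: "0 < tail v'" using tail_nonneg[of v'] by simp
    have R: "(\<integral>\<^sup>+w. G w \<partial>jump_kernel v') = (\<integral>\<^sup>+w. G w * indicator {v'..} w \<partial>\<nu>) / ennreal (tail v')"
      using p v' Gn by (simp add: jump_kernel_def nn_integral_uniform_measure emeasure_tail)
    have E: "emeasure (jump_kernel v) {v'..} = ennreal (tail v') / ennreal (tail v)"
      using True p v by (simp add: emeasure_jump_kernel max_def divide_ennreal)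
    define I where "I = (\<integral>\<^sup>+w. G w * indicator {v'..} w \<partial>\<nu>)"
    have "ennreal (tail v') \<noteq> 0" "ennreal (tail v') \<noteq> \<top>" using p by auto
    then have "ennreal (tail v') * (I / ennreal (tail v')) = I"
      by (simp add: ennreal_times_divide mult.commute mult_divide_eq_ennreal)
    then show ?thesis
      unfolding L R E I_def[symmetric] by (metis ennreal_times_divide mult.commute)
  qed
next
  case False
  then have k: "jump_kernel v = return borel v" unfolding jump_kernel_def by (rule if_not_P)
  have [measurable]: "(\<lambda>w. indicator {v'..} w * G w) \<in> borel_measurable borel" by measurable
  show ?thesis
  proof (cases "v' = v")
    case True
    then show ?thesis by (simp add: k nn_integral_return)
  next
    case False
    then show ?thesis using v by (simp add: k nn_integral_return)
  qed
qed

text \<open>The jump w sampled at the start decides. If w \<ge> v + s, the age at time s is v + s,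
  and sampling the jump anew there has the same effect as keeping w. If w < v + s, a fresh path is
  already running at time s, and the semigroup relation for restarts applies.\<close>

lemma Chapman_Kolmogorov:
  assumes s: "0 \<le> s" and t: "0 \<le> t" and v: "0 \<le> snd z" and h: "h \<in> borel_measurable borel"
  shows "(\<integral>\<^sup>+y. h y \<partial>age_kernel (s + t) z) = (\<integral>\<^sup>+y. (\<integral>\<^sup>+y'. h y' \<partial>age_kernel t y) \<partial>age_kernel s z)"
proof -
  define x v where "x = fst z" and "v = snd z"
  define G where "G = step_value h x (v + s + t)"
  define h' where "h' y = (\<integral>\<^sup>+y'. h y' \<partial>age_kernel t y)" for y
  have h': "h' \<in> borel_measurable borel"
    unfolding h'_def[abs_def] by (rule nn_integral_age_kernel_measurable[OF h]) auto
  have G: "G \<in> borel_measurable borel" unfolding G_def by (rule step_value_section[OF h])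
  have G': "step_value h' x (v + s) \<in> borel_measurable borel" by (rule step_value_section[OF h'])
  have split: "(\<integral>\<^sup>+w. U w \<partial>jump_kernel v) = (\<integral>\<^sup>+w. indicator {v + s..} w * U w \<partial>jump_kernel v) + (\<integral>\<^sup>+w. indicator {..<v + s} w * U w \<partial>jump_kernel v)"
    if U: "U \<in> borel_measurable borel" for U
  proof -
    have Um: "U \<in> borel_measurable (jump_kernel v)"
      using U by (simp add: measurable_cong_sets[OF sets_jump_kernel refl])
    have im: "indicator A \<in> borel_measurable (jump_kernel v)" if "A \<in> sets borel" for A :: "real set"
      by (intro borel_measurable_indicator) (simp add: that)
    have "(\<integral>\<^sup>+w. U w \<partial>jump_kernel v) = (\<integral>\<^sup>+w. indicator {v + s..} w * U w + indicator {..<v + s} w * U w \<partial>jump_kernel v)"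
      by (intro nn_integral_cong) (auto simp: indicator_def)
    also have "\<dots> = (\<integral>\<^sup>+w. indicator {v + s..} w * U w \<partial>jump_kernel v) + (\<integral>\<^sup>+w. indicator {..<v + s} w * U w \<partial>jump_kernel v)"
      by (intro nn_integral_add borel_measurable_times_ennreal Um im) auto
    finally show ?thesis .
  qed
  have "(\<integral>\<^sup>+w. indicator {v + s..} w * step_value h' x (v + s) w \<partial>jump_kernel v)
    = (\<integral>\<^sup>+w. h' (x, v + s) * indicator {v + s..} w \<partial>jump_kernel v)"
    by (intro nn_integral_cong) (auto simp: step_value_def indicator_def)
  also have "\<dots> = emeasure (jump_kernel v) {v + s..} * h' (x, v + s)"
    by (subst nn_integral_cmult_indicator) (simp_all add: mult.commute)
  also have "h' (x, v + s) = (\<integral>\<^sup>+w. G w \<partial>jump_kernel (v + s))"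
    by (simp add: h'_def nn_integral_age_kernel[OF h] G_def)
  also have "emeasure (jump_kernel v) {v + s..} * \<dots> = (\<integral>\<^sup>+w. indicator {v + s..} w * G w \<partial>jump_kernel v)"
    using s v by (intro jump_kernel_restart[symmetric] G) (auto simp: v_def)
  finally have A: "(\<integral>\<^sup>+w. indicator {v + s..} w * step_value h' x (v + s) w \<partial>jump_kernel v)
    = (\<integral>\<^sup>+w. indicator {v + s..} w * G w \<partial>jump_kernel v)" .
  have B: "(\<integral>\<^sup>+w. indicator {..<v + s} w * step_value h' x (v + s) w \<partial>jump_kernel v)
    = (\<integral>\<^sup>+w. indicator {..<v + s} w * G w \<partial>jump_kernel v)"
  proof (intro nn_integral_cong)
    fix w
    show "indicator {..<v + s} w * step_value h' x (v + s) w = indicator {..<v + s} w * G w"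
    proof (cases "w < v + s")
      case True
      have e: "v + s + t - w = (v + s - w) + t" by simp
      show ?thesis
        using True t restart_Chapman_Kolmogorov[OF _ t h, of "v + s - w" x]
        unfolding G_def step_value_def h'_def[symmetric] e by auto
    qed simp
  qed
  have "(\<integral>\<^sup>+y. h y \<partial>age_kernel (s + t) z) = (\<integral>\<^sup>+w. G w \<partial>jump_kernel v)"
    by (simp add: nn_integral_age_kernel[OF h] G_def x_def v_def add.assoc)
  also have "\<dots> = (\<integral>\<^sup>+w. step_value h' x (v + s) w \<partial>jump_kernel v)"
    by (simp only: split[OF G] split[OF G'] A B)
  also have "\<dots> = (\<integral>\<^sup>+y. h' y \<partial>age_kernel s z)"
    by (simp add: nn_integral_age_kernel[OF h'] x_def v_def)
  finally show ?thesis by (simp add: h'_def)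
qed

end

section \<open>The canonical process\<close>

lemma space_path_space: "space path_space = cadlag_paths"
  by (auto simp: path_space_def space_restrict_space space_PiM cadlag_paths_def extensional_def)

lemma path_component: "(\<lambda>\<omega>. \<omega> s) \<in> borel_measurable path_space"
proof (cases "0 \<le> s")
  case True
  then show ?thesis unfolding path_space_def
    by (intro measurable_restrict_space1 measurable_component_singleton) auto
next
  case False
  then have "\<omega> s = undefined" if "\<omega> \<in> cadlag_paths" for \<omega>
    using that by (auto simp: cadlag_paths_def extensional_def)
  then show ?thesis
    by (subst measurable_cong[where g="\<lambda>_. undefined"]) (auto simp: space_path_space)
qed

text \<open>A default value for the exceptional null set, which turns an almost surely increasing
  clock into a map with values in \<open>good_paths\<close>.\<close>

definition identity_path :: "real \<Rightarrow> real" where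
  "identity_path = (\<lambda>s\<in>{0..}. s)"

lemma identity_path_good: "identity_path \<in> good_paths"
  unfolding good_paths_def
proof safe
  show "identity_path \<in> extensional {0..}" "identity_path 0 = 0" by (simp_all add: identity_path_def)
  show "strict_mono_on {0..} identity_path" by (auto simp: identity_path_def strict_mono_on_def)
  show "(identity_path \<longlongrightarrow> identity_path t) (at_right t)" if "0 \<le> t" for t
  proof -
    have "eventually (\<lambda>s. t < s) (at_right t)" by (simp add: eventually_at_right_less)
    then have "eventually (\<lambda>s. s = identity_path s) (at_right t)"
      by eventually_elim (use that in \<open>simp add: identity_path_def\<close>)
    then have "(identity_path \<longlongrightarrow> t) (at_right t)" by (rule Lim_transform_eventually[OF tendsto_ident_at])
    then show ?thesis using that by (simp add: identity_path_def)
  qed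
  show "\<exists>t\<ge>0. c < identity_path t" for c
    by (rule exI[of _ "max 0 c + 1"]) (simp add: identity_path_def)
qed

text \<open>The value at t is a limit of values at rational times to the right of t, so a closed
  condition known there is inherited. This turns almost sure statements for countably many times
  into statements for all times.\<close>

lemma right_limit_on_rationals:
  fixes f :: "real \<Rightarrow> 'a::metric_space"
  assumes f: "(f \<longlongrightarrow> f t) (at_right t)" and S: "closed S" and t: "t < u"
    and q: "\<And>q::rat. t < of_rat q \<Longrightarrow> of_rat q < u \<Longrightarrow> f (of_rat q) \<in> S"
  shows "f t \<in> S"
proof (rule ccontr)
  assume "f t \<notin> S"
  then have "eventually (\<lambda>s. f s \<in> - S) (at_right t)"
    using topological_tendstoD[OF f, of "- S"] S by auto
  then obtain b where b: "t < b" "\<forall>s>t. s < b \<longrightarrow> f s \<in> - S"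
    unfolding eventually_at_right_field by blast
  obtain q :: rat where "t < of_rat q" "of_rat q < min b u" using rat_between[of t "min b u"] b t by auto
  then show False using b(2) q[of q] by auto
qed

section \<open>Path properties of the canonical process\<close>

locale canonical_subordinator = subordinator +
  fixes P :: "real \<times> real \<Rightarrow> (real \<Rightarrow> real \<times> real) measure"
  assumes canonical: "canonical_process (conv_semigroup \<mu>) P"
begin

lemma prob_P: "prob_space (P z)" and sets_P: "sets (P z) = sets path_space"
  and start_P: "measure (P z) {\<omega> \<in> space (P z). \<omega> 0 = z} = 1"
  and cond_P: "u \<in> C0_functions \<Longrightarrow> 0 \<le> s \<Longrightarrow> 0 \<le> t \<Longrightarrow> AE \<omega> in P z.
    real_cond_exp (P z) (natural_filtration (P z) (\<lambda>r \<omega>. \<omega> r) s) (\<lambda>\<omega>. u (\<omega> (s + t))) \<omega> = conv_semigroup \<mu> t u (\<omega> s)"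
  using canonical unfolding canonical_process_def by blast+

lemma space_P: "space (P z) = cadlag_paths"
  using sets_eq_imp_space_eq[OF sets_P] by (simp add: space_path_space)

lemma component_P: "(\<lambda>\<omega>. \<omega> s) \<in> borel_measurable (P z)"
  using path_component by (simp add: measurable_cong_sets[OF sets_P refl])

lemma AE_start: "AE \<omega> in P z. \<omega> 0 = z"
proof -
  interpret prob_space "P z" by (rule prob_P)
  have "{\<omega> \<in> space (P z). \<omega> 0 = z} \<in> sets (P z)"
    using measurable_sets[OF component_P, of "{z}"] by (simp add: vimage_def Int_def conj_commute)
  then show ?thesis using start_P[of z] by (subst (asm) prob_Collect_eq_1) auto
qed

lemma conv_semigroup_eq:
  assumes t: "0 \<le> t" and u: "continuous_on UNIV u" and "\<And>x. \<bar>u x\<bar> \<le> 1"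
  shows "conv_semigroup \<mu> t u z = (\<integral>w. u (fst z + t, snd z + w) \<partial>\<mu> t)"
proof -
  interpret mu: prob_space "\<mu> t" by (rule prob_mu[OF t])
  interpret r: prob_space "return borel t" by (rule prob_space_return) simp
  interpret p: pair_prob_space "return borel t" "\<mu> t" ..
  have um: "u \<in> borel_measurable borel" by (rule borel_measurable_continuous_onI[OF u])
  have c0: "(\<lambda>y. (fst z + fst y, snd z + snd y)) \<in> borel_measurable (borel \<Otimes>\<^sub>M borel)" by measurable
  have "sets (return borel t \<Otimes>\<^sub>M \<mu> t) = sets (borel \<Otimes>\<^sub>M borel)" "sets (borel \<Otimes>\<^sub>M \<mu> t) = sets (borel \<Otimes>\<^sub>M borel)"
    by (intro sets_pair_measure_cong; simp add: sets_mu[OF t])+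
  then have c: "(\<lambda>y. (fst z + fst y, snd z + snd y)) \<in> borel_measurable (return borel t \<Otimes>\<^sub>M \<mu> t)"
    and c': "(\<lambda>y. (fst z + fst y, snd z + snd y)) \<in> borel_measurable (borel \<Otimes>\<^sub>M \<mu> t)"
    using c0 measurable_cong_sets by blast+
  have int: "integrable (return borel t \<Otimes>\<^sub>M \<mu> t) (\<lambda>y. u (fst z + fst y, snd z + snd y))"
    using assms(3) by (intro p.integrable_const_bound[where B=1] measurable_compose[OF c um]) auto
  have "conv_semigroup \<mu> t u z = (\<integral>y. u (fst z + fst y, snd z + snd y) \<partial>(return borel t \<Otimes>\<^sub>M \<mu> t))"
    by (cases z) (simp add: conv_semigroup_def case_prod_beta')
  also have "\<dots> = (\<integral>y. \<integral>w. u (fst z + y, snd z + w) \<partial>\<mu> t \<partial>return borel t)"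
    using p.integral_fst'[OF int] by simp
  also have "\<dots> = (\<integral>w. u (fst z + t, snd z + w) \<partial>\<mu> t)"
  proof (rule integral_return)
    from measurable_compose[OF c' um]
    show "(\<lambda>y. \<integral>w. u (fst z + y, snd z + w) \<partial>\<mu> t) \<in> borel_measurable borel"
      by (intro mu.borel_measurable_lebesgue_integral) (simp add: case_prod_beta')
  qed simp
  finally show ?thesis .
qed

lemma natural_filtration_sets:
  "sets (natural_filtration M X s) = sigma_sets (space M) {X r -` B \<inter> space M | r B. 0 \<le> r \<and> r \<le> s \<and> B \<in> sets borel}"
  "space (natural_filtration M X s) = space M"
  unfolding natural_filtration_def by (auto intro!: sets_measure_of space_measure_of)

lemma subalgebra_natural_filtration:
  assumes "\<And>r. 0 \<le> r \<Longrightarrow> X r \<in> borel_measurable M"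
  shows "subalgebra M (natural_filtration M X s)"
  unfolding subalgebra_def natural_filtration_sets
  using assms by (auto intro!: sets.sigma_sets_subset)

lemma natural_filtration_measurable:
  assumes "0 \<le> r" "r \<le> s"
  shows "X r \<in> borel_measurable (natural_filtration M X s)"
  using assms by (intro measurableI) (auto simp: natural_filtration_sets intro!: sigma_sets.Basic)

text \<open>The canonical process is specified through conditional expectations of
  \<open>C0_functions\<close>. For a fixed event A both sides are integrals of h against finite
  measures on the plane, and continuous functions with compact support lie in that class, so the
  identity extends to Borel h.\<close>

lemma kernel_step:
  assumes s: "0 \<le> s" and t: "0 \<le> t" and A: "A \<in> sets (natural_filtration (P z) (\<lambda>r \<omega>. \<omega> r) s)"
    and h: "h \<in> borel_measurable borel"
  shows "(\<integral>\<^sup>+\<omega>. indicator A \<omega> * h (\<omega> (s + t)) \<partial>P z)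
    = (\<integral>\<^sup>+\<omega>. indicator A \<omega> * (\<integral>\<^sup>+w. h (fst (\<omega> s) + t, snd (\<omega> s) + w) \<partial>\<mu> t) \<partial>P z)"
proof -
  define M where "M = P z"
  interpret M: prob_space M unfolding M_def by (rule prob_P)
  interpret mu: prob_space "\<mu> t" by (rule prob_mu[OF t])
  let ?F = "natural_filtration M (\<lambda>r \<omega>. \<omega> r) s"
  have comp: "(\<lambda>\<omega>. \<omega> r) \<in> borel_measurable M" for r unfolding M_def by (rule component_P)
  have sub: "subalgebra M ?F" by (rule subalgebra_natural_filtration[OF comp])
  have AM: "A \<in> sets M" using A sub by (auto simp: subalgebra_def M_def)
  interpret F: finite_measure_subalgebra M ?F by unfold_locales (rule sub)
  define D where "D = density M (indicator A :: _ \<Rightarrow> ennreal)"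
  have sD: "sets D = sets M" by (simp add: D_def)
  define shift where "shift y = (fst (fst y s) + t, snd (fst y s) + snd y)" for y :: "(real \<Rightarrow> real \<times> real) \<times> real"
  have shm: "shift \<in> borel_measurable (M \<Otimes>\<^sub>M \<mu> t)"
  proof -
    have 1: "(\<lambda>y. fst y s) \<in> borel_measurable (M \<Otimes>\<^sub>M \<mu> t)" by (rule measurable_compose[OF measurable_fst comp])
    have 2: "snd \<in> borel_measurable (M \<Otimes>\<^sub>M \<mu> t)"
      using measurable_snd[of M "\<mu> t"] by (simp add: measurable_cong_sets[OF refl sets_mu[OF t]])
    have 3: "(\<lambda>y. fst (fst y s)) \<in> borel_measurable (M \<Otimes>\<^sub>M \<mu> t)" "(\<lambda>y. snd (fst y s)) \<in> borel_measurable (M \<Otimes>\<^sub>M \<mu> t)"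
      by (rule measurable_compose[OF 1], intro borel_measurable_continuous_onI continuous_intros)+
    show ?thesis unfolding shift_def[abs_def] by (intro borel_measurable_Pair borel_measurable_add 2 3 borel_measurable_const)
  qed
  have shD: "shift \<in> borel_measurable (D \<Otimes>\<^sub>M \<mu> t)"
    using shm by (simp add: measurable_cong_sets[OF sets_pair_measure_cong[OF sD refl] refl])
  define m1 where "m1 = distr D borel (\<lambda>\<omega>. \<omega> (s + t))"
  define m2 where "m2 = distr (D \<Otimes>\<^sub>M \<mu> t) borel shift"
  have inner: "(\<lambda>\<omega>. \<integral>\<^sup>+w. g (shift (\<omega>, w)) \<partial>\<mu> t) \<in> borel_measurable M" if "g \<in> borel_measurable borel" for g :: "real \<times> real \<Rightarrow> ennreal"
    using mu.borel_measurable_nn_integral_fst[OF measurable_compose[OF shm that]] .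
  have m1: "(\<integral>\<^sup>+y. g y \<partial>m1) = (\<integral>\<^sup>+\<omega>. indicator A \<omega> * g (\<omega> (s + t)) \<partial>M)" if g: "g \<in> borel_measurable borel" for g
  proof -
    have "(\<integral>\<^sup>+y. g y \<partial>m1) = (\<integral>\<^sup>+\<omega>. g (\<omega> (s + t)) \<partial>D)"
      unfolding m1_def using g comp by (intro nn_integral_distr) (simp_all add: D_def)
    also have "\<dots> = (\<integral>\<^sup>+\<omega>. indicator A \<omega> * g (\<omega> (s + t)) \<partial>M)"
      unfolding D_def using AM by (intro nn_integral_density measurable_compose[OF comp g]) auto
    finally show ?thesis .
  qed
  have m2: "(\<integral>\<^sup>+y. g y \<partial>m2) = (\<integral>\<^sup>+\<omega>. indicator A \<omega> * (\<integral>\<^sup>+w. g (shift (\<omega>, w)) \<partial>\<mu> t) \<partial>M)" if g: "g \<in> borel_measurable borel" for g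
  proof -
    have "(\<integral>\<^sup>+y. g y \<partial>m2) = (\<integral>\<^sup>+y. g (shift y) \<partial>(D \<Otimes>\<^sub>M \<mu> t))"
      unfolding m2_def using g shD by (intro nn_integral_distr) simp_all
    also have "\<dots> = (\<integral>\<^sup>+\<omega>. \<integral>\<^sup>+w. g (shift (\<omega>, w)) \<partial>\<mu> t \<partial>D)"
      by (rule mu.nn_integral_fst[symmetric]) (rule measurable_compose[OF shD g])
    also have "\<dots> = (\<integral>\<^sup>+\<omega>. indicator A \<omega> * (\<integral>\<^sup>+w. g (shift (\<omega>, w)) \<partial>\<mu> t) \<partial>M)"
      unfolding D_def using AM by (intro nn_integral_density inner g) auto
    finally show ?thesis .
  qed
  have "m1 = m2"
  proof (rule measure_eqI_compact_support)
    show "sets m1 = sets borel" "sets m2 = sets borel" by (simp_all add: m1_def m2_def)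
    have "emeasure m1 UNIV = (\<integral>\<^sup>+x. 1 \<partial>m1)" by (simp add: m1_def)
    also have "\<dots> \<le> (\<integral>\<^sup>+\<omega>. 1 \<partial>M)"
      unfolding m1[OF borel_measurable_const] by (intro nn_integral_mono) (auto simp: indicator_def)
    finally show "emeasure m1 UNIV \<noteq> \<infinity>" by (auto simp: M.emeasure_space_1 top_unique)
    fix u :: "real \<times> real \<Rightarrow> real"
    assume u: "continuous_on UNIV u" "\<And>x. 0 \<le> u x" "\<And>x. u x \<le> 1" and "\<exists>R. \<forall>x. R \<le> norm x \<longrightarrow> u x = 0"
    then obtain R where R: "\<And>x. R \<le> norm x \<Longrightarrow> u x = 0" by blast
    have um: "u \<in> borel_measurable borel" by (rule borel_measurable_continuous_onI[OF u(1)])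
    then have um': "(\<lambda>x. ennreal (u x)) \<in> borel_measurable borel" by simp
    have u1: "\<bar>u x\<bar> \<le> 1" for x using u(2,3)[of x] by simp
    have "eventually (\<lambda>x. u x = 0) at_infinity" unfolding eventually_at_infinity using R by blast
    then have C0: "u \<in> C0_functions" using u(1) by (simp add: C0_functions_def tendsto_eventually)
    define T where "T \<omega> = (\<integral>w. u (shift (\<omega>, w)) \<partial>\<mu> t)" for \<omega> :: "real \<Rightarrow> real \<times> real"
    have Tm: "T \<in> borel_measurable M"
      unfolding T_def[abs_def] using mu.borel_measurable_lebesgue_integral[of "\<lambda>\<omega> w. u (shift (\<omega>, w))" M] measurable_compose[OF shm um]
      by (simp add: case_prod_beta')
    have wm: "(\<lambda>w. u (shift (\<omega>, w))) \<in> borel_measurable (\<mu> t)" for \<omega>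
    proof -
      have "(\<lambda>w. shift (\<omega>, w)) \<in> borel_measurable (\<mu> t)"
        unfolding shift_def fst_conv snd_conv
        by (simp add: measurable_cong_sets[OF sets_mu[OF t] refl])
      then show ?thesis by (rule measurable_compose[OF _ um])
    qed
    have T01: "0 \<le> T \<omega>" "T \<omega> \<le> 1" for \<omega>
    proof -
      show "0 \<le> T \<omega>" unfolding T_def using u by (intro integral_nonneg_AE) auto
      have "T \<omega> \<le> (\<integral>w. 1 \<partial>\<mu> t)" unfolding T_def using u u1
        by (intro integral_mono mu.integrable_const_bound[where B=1] wm) auto
      then show "T \<omega> \<le> 1" by (simp add: mu.prob_space)
    qed
    have Teq: "ennreal (T \<omega>) = (\<integral>\<^sup>+w. ennreal (u (shift (\<omega>, w))) \<partial>\<mu> t)" for \<omega>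
      unfolding T_def using u u1 by (intro nn_integral_eq_integral[symmetric] mu.integrable_const_bound[where B=1] wm) auto
    have iu: "integrable M (\<lambda>\<omega>. u (\<omega> (s + t)))"
      using u1 by (intro M.integrable_const_bound[where B=1] measurable_compose[OF comp um]) auto
    have "(\<integral>\<omega>\<in>A. u (\<omega> (s + t)) \<partial>M) = (\<integral>\<omega>\<in>A. real_cond_exp M ?F (\<lambda>\<omega>. u (\<omega> (s + t))) \<omega> \<partial>M)"
      using A by (intro F.real_cond_exp_intA iu) (simp add: M_def)
    also have "\<dots> = (\<integral>\<omega>\<in>A. T \<omega> \<partial>M)"
    proof (rule set_lebesgue_integral_cong_AE)
      have "conv_semigroup \<mu> t u (\<omega> s) = T \<omega>" for \<omega>
        unfolding conv_semigroup_eq[OF t u(1) u1] T_def shift_def by simp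
      then have "AE \<omega> in M. real_cond_exp M ?F (\<lambda>\<omega>. u (\<omega> (s + t))) \<omega> = T \<omega>"
        using cond_P[OF C0 s t, of z] unfolding M_def by simp
      then show "AE \<omega>\<in>A in M. real_cond_exp M ?F (\<lambda>\<omega>. u (\<omega> (s + t))) \<omega> = T \<omega>" by eventually_elim simp
    qed (use AM Tm in auto)
    finally have "(\<integral>\<omega>. indicator A \<omega> * u (\<omega> (s + t)) \<partial>M) = (\<integral>\<omega>. indicator A \<omega> * T \<omega> \<partial>M)"
      by (simp add: set_lebesgue_integral_def)
    moreover have "(\<integral>\<^sup>+\<omega>. indicator A \<omega> * ennreal (U \<omega>) \<partial>M) = ennreal (\<integral>\<omega>. indicator A \<omega> * U \<omega> \<partial>M)"
      if "U \<in> borel_measurable M" "\<And>\<omega>. 0 \<le> U \<omega>" "\<And>\<omega>. U \<omega> \<le> 1" for U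
    proof -
      have "(\<integral>\<^sup>+\<omega>. indicator A \<omega> * ennreal (U \<omega>) \<partial>M) = (\<integral>\<^sup>+\<omega>. ennreal (indicator A \<omega> * U \<omega>) \<partial>M)"
        by (intro nn_integral_cong) (auto simp: indicator_def)
      also have "\<dots> = ennreal (\<integral>\<omega>. indicator A \<omega> * U \<omega> \<partial>M)"
        using that AM by (intro nn_integral_eq_integral M.integrable_const_bound[where B=1]) (auto simp: indicator_def)
      finally show ?thesis .
    qed
    ultimately show "(\<integral>\<^sup>+x. ennreal (u x) \<partial>m1) = (\<integral>\<^sup>+x. ennreal (u x) \<partial>m2)"
      unfolding m1[OF um'] m2[OF um'] Teq[symmetric]
      using u T01 Tm measurable_compose[OF comp um, of "s + t"] by simp
  qed
  then show ?thesis using m1[OF h] m2[OF h] by (simp add: M_def shift_def)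
qed

lemma component_natural_filtration:
  assumes "0 \<le> r" "r \<le> s" "B \<in> sets borel"
  shows "{\<omega> \<in> space (P z). \<omega> r \<in> B} \<in> sets (natural_filtration (P z) (\<lambda>r \<omega>. \<omega> r) s)"
proof -
  have "{\<omega> \<in> space (P z). \<omega> r \<in> B} = (\<lambda>\<omega>. \<omega> r) -` B \<inter> space (P z)" by auto
  then show ?thesis unfolding natural_filtration_sets using assms by (intro sigma_sets.Basic) blast
qed

text \<open>The first coordinate moves by exactly t for each single t; rational times and
  right-continuity collect all t outside one null set.\<close>

lemma AE_drift: "AE \<omega> in P z. \<forall>t\<ge>0. fst (\<omega> t) = fst z + t"
proof -
  interpret M: prob_space "P z" by (rule prob_P)
  have 1: "AE \<omega> in P z. fst (\<omega> t) = fst z + t" if t: "0 \<le> t" for t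
  proof -
    interpret mu: prob_space "\<mu> t" by (rule prob_mu[OF t])
    define h :: "real \<times> real \<Rightarrow> ennreal" where "h y = indicator (- {fst z + t}) (fst y)" for y
    have "fst \<in> borel_measurable (borel :: (real \<times> real) measure)"
      by (intro borel_measurable_continuous_onI continuous_intros)
    then have hm: "h \<in> borel_measurable borel"
      unfolding h_def[abs_def] by (rule measurable_compose) simp
    have "space (P z) \<in> sets (natural_filtration (P z) (\<lambda>r \<omega>. \<omega> r) 0)"
      using component_natural_filtration[of 0 0 UNIV z] by simp
    from kernel_step[OF order_refl t this hm]
    have "(\<integral>\<^sup>+\<omega>. indicator (space (P z)) \<omega> * h (\<omega> t) \<partial>P z) = (\<integral>\<^sup>+\<omega>. indicator (space (P z)) \<omega> * (\<integral>\<^sup>+w. h (fst (\<omega> 0) + t, snd (\<omega> 0) + w) \<partial>\<mu> t) \<partial>P z)"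
      by simp
    also have "\<dots> = (\<integral>\<^sup>+\<omega>. 0 \<partial>P z)"
      using AE_start[of z] by (intro nn_integral_cong_AE, eventually_elim) (simp add: h_def)
    finally have "(\<integral>\<^sup>+\<omega>. h (\<omega> t) \<partial>P z) = 0"
      by (simp cong: nn_integral_cong)
    then have "AE \<omega> in P z. h (\<omega> t) = 0"
      by (subst (asm) nn_integral_0_iff_AE) (auto intro: measurable_compose[OF component_P hm])
    then show ?thesis by eventually_elim (auto simp: h_def indicator_def split: if_splits)
  qed
  have "AE \<omega> in P z. \<forall>q::rat. 0 \<le> real_of_rat q \<longrightarrow> fst (\<omega> (of_rat q)) = fst z + of_rat q"
    using 1 by (subst AE_all_countable) auto
  then show ?thesis using AE_space
  proof eventually_elim
    case (elim \<omega>)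
    show ?case
    proof (intro allI impI)
      fix t :: real assume t: "0 \<le> t"
      have "(\<omega> \<longlongrightarrow> \<omega> t) (at_right t)" using elim(2) t by (simp add: space_P cadlag_paths_def)
      then have "((\<lambda>r. fst (\<omega> r) - r) \<longlongrightarrow> fst (\<omega> t) - t) (at_right t)" by (intro tendsto_intros)
      then have "fst (\<omega> t) - t \<in> {fst z}"
      proof (rule right_limit_on_rationals[where u="t + 1"])
        fix q :: rat assume "t < of_rat q"
        then have "0 \<le> real_of_rat q" using t by linarith
        then show "fst (\<omega> (of_rat q)) - of_rat q \<in> {fst z}" using elim(1) by simp
      qed auto
      then show "fst (\<omega> t) = fst z + t" by simp
    qed
  qed
qed

text \<open>The event that \<omega>(s) lies in X is an event of the past, so
  \<open>kernel_step\<close> treats rectangles, and these determine the joint law of two path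
  values.\<close>

lemma joint_step:
  assumes s: "0 \<le> s" and t: "0 \<le> t" and h: "h \<in> borel_measurable (borel \<Otimes>\<^sub>M borel)"
  shows "(\<integral>\<^sup>+\<omega>. h (\<omega> s, \<omega> (s + t)) \<partial>P z) = (\<integral>\<^sup>+\<omega>. \<integral>\<^sup>+w. h (\<omega> s, fst (\<omega> s) + t, snd (\<omega> s) + w) \<partial>\<mu> t \<partial>P z)"
proof -
  define M where "M = P z"
  interpret M: prob_space M unfolding M_def by (rule prob_P)
  interpret mu: prob_space "\<mu> t" by (rule prob_mu[OF t])
  interpret pp: pair_prob_space M "\<mu> t" ..
  have comp: "(\<lambda>\<omega>. \<omega> r) \<in> borel_measurable M" for r unfolding M_def by (rule component_P)
  define B2 where "B2 = (borel :: (real \<times> real) measure) \<Otimes>\<^sub>M (borel :: (real \<times> real) measure)"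
  define shift where "shift y = (fst y s, fst (fst y s) + t, snd (fst y s) + snd y)" for y :: "(real \<Rightarrow> real \<times> real) \<times> real"
  have shm: "shift \<in> M \<Otimes>\<^sub>M \<mu> t \<rightarrow>\<^sub>M B2"
  proof -
    have 1: "(\<lambda>y. fst y s) \<in> borel_measurable (M \<Otimes>\<^sub>M \<mu> t)" by (rule measurable_compose[OF measurable_fst comp])
    have 2: "snd \<in> borel_measurable (M \<Otimes>\<^sub>M \<mu> t)"
      using measurable_snd[of M "\<mu> t"] by (simp add: measurable_cong_sets[OF refl sets_mu[OF t]])
    have 3: "(\<lambda>y. fst (fst y s)) \<in> borel_measurable (M \<Otimes>\<^sub>M \<mu> t)" "(\<lambda>y. snd (fst y s)) \<in> borel_measurable (M \<Otimes>\<^sub>M \<mu> t)"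
      by (rule measurable_compose[OF 1], intro borel_measurable_continuous_onI continuous_intros)+
    show ?thesis unfolding shift_def[abs_def] B2_def
      by (intro measurable_Pair borel_measurable_Pair borel_measurable_add 1 2 3 borel_measurable_const)
  qed
  have pm: "(\<lambda>\<omega>. (\<omega> s, \<omega> (s + t))) \<in> M \<rightarrow>\<^sub>M B2" unfolding B2_def by (intro measurable_Pair comp)
  define m1 where "m1 = distr M B2 (\<lambda>\<omega>. (\<omega> s, \<omega> (s + t)))"
  define m2 where "m2 = distr (M \<Otimes>\<^sub>M \<mu> t) B2 shift"
  have m1: "(\<integral>\<^sup>+y. g y \<partial>m1) = (\<integral>\<^sup>+\<omega>. g (\<omega> s, \<omega> (s + t)) \<partial>M)" if "g \<in> borel_measurable B2" for g
    unfolding m1_def using that by (subst nn_integral_distr[OF pm]) auto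
  have m2: "(\<integral>\<^sup>+y. g y \<partial>m2) = (\<integral>\<^sup>+\<omega>. \<integral>\<^sup>+w. g (shift (\<omega>, w)) \<partial>\<mu> t \<partial>M)" if "g \<in> borel_measurable B2" for g
    unfolding m2_def using that mu.nn_integral_fst[OF measurable_compose[OF shm that], symmetric]
    by (subst nn_integral_distr[OF shm]) auto
  have "m1 = m2"
  proof (rule measure_eqI_rectangles)
    show "sets m1 = sets (borel \<Otimes>\<^sub>M borel)" "sets m2 = sets (borel \<Otimes>\<^sub>M borel)" by (simp_all add: m1_def m2_def B2_def)
    interpret m1: prob_space m1 unfolding m1_def by (rule M.prob_space_distr[OF pm])
    show "emeasure m1 (space borel \<times> space borel) \<noteq> \<infinity>" using m1.emeasure_finite by simp
    fix X Y :: "(real \<times> real) set" assume XY: "X \<in> sets borel" "Y \<in> sets borel"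
    define A where "A = {\<omega> \<in> space M. \<omega> s \<in> X}"
    have A: "A \<in> sets (natural_filtration (P z) (\<lambda>r \<omega>. \<omega> r) s)"
      unfolding A_def M_def by (rule component_natural_filtration[OF s order_refl XY(1)])
    have r: "X \<times> Y \<in> sets B2" using XY by (simp add: B2_def)
    then have i: "indicator (X \<times> Y) \<in> borel_measurable B2" by simp
    have "emeasure m1 (X \<times> Y) = (\<integral>\<^sup>+y. indicator (X \<times> Y) y \<partial>m1)" using r by (simp add: m1_def)
    also have "\<dots> = (\<integral>\<^sup>+\<omega>. indicator A \<omega> * indicator Y (\<omega> (s + t)) \<partial>M)"
      unfolding m1[OF i] by (intro nn_integral_cong) (auto simp: A_def indicator_def)
    also have "\<dots> = (\<integral>\<^sup>+\<omega>. indicator A \<omega> * (\<integral>\<^sup>+w. indicator Y (fst (\<omega> s) + t, snd (\<omega> s) + w) \<partial>\<mu> t) \<partial>M)"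
      using kernel_step[OF s t A, of "indicator Y"] XY by (simp add: M_def)
    also have "\<dots> = (\<integral>\<^sup>+y. indicator (X \<times> Y) y \<partial>m2)"
      unfolding m2[OF i] by (intro nn_integral_cong) (auto simp: A_def indicator_def shift_def)
    also have "\<dots> = emeasure m2 (X \<times> Y)" using r by (simp add: m2_def)
    finally show "emeasure m1 (X \<times> Y) = emeasure m2 (X \<times> Y)" .
  qed
  then show ?thesis using m1[of h] m2[of h] h by (simp add: B2_def M_def shift_def)
qed

text \<open>The difference of the second coordinates at a' and a has law
  \<open>\<mu> (a' - a)\<close>, which does not charge (-\<infinity>,0].\<close>

lemma AE_increasing:
  assumes a: "0 \<le> a" "a < a'" shows "AE \<omega> in P z. snd (\<omega> a) < snd (\<omega> a')"
proof -
  interpret M: prob_space "P z" by (rule prob_P)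
  define t where "t = a' - a"
  have t: "0 < t" "a + t = a'" using a by (auto simp: t_def)
  interpret mu: prob_space "\<mu> t" by (rule prob_mu) (use t in simp)
  define h :: "(real \<times> real) \<times> real \<times> real \<Rightarrow> ennreal" where "h y = indicator {..0} (snd (snd y) - snd (fst y))" for y
  have sb: "snd \<in> borel_measurable (borel :: (real \<times> real) measure)"
    by (intro borel_measurable_continuous_onI continuous_intros)
  have h: "h \<in> borel_measurable (borel \<Otimes>\<^sub>M borel)"
  proof -
    have d: "(\<lambda>y. snd (snd y) - snd (fst y)) \<in> borel_measurable ((borel :: (real \<times> real) measure) \<Otimes>\<^sub>M (borel :: (real \<times> real) measure))"
      by (intro borel_measurable_diff measurable_compose[OF measurable_snd sb] measurable_compose[OF measurable_fst sb])
    show ?thesis unfolding h_def[abs_def] by (rule measurable_compose[OF d]) simp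
  qed
  have "(\<integral>\<^sup>+\<omega>. h (\<omega> a, \<omega> a') \<partial>P z) = (\<integral>\<^sup>+\<omega>. \<integral>\<^sup>+w. h (\<omega> a, fst (\<omega> a) + t, snd (\<omega> a) + w) \<partial>\<mu> t \<partial>P z)"
    using joint_step[OF a(1) less_imp_le[OF t(1)] h, of z] t(2) by simp
  also have "\<dots> = (\<integral>\<^sup>+\<omega>. \<integral>\<^sup>+w. indicator {..0} w \<partial>\<mu> t \<partial>P z)" by (simp add: h_def indicator_def)
  also have "\<dots> = 0" using mu_nonpos[OF t(1)] t(1) by (simp add: sets_mu)
  finally have "AE \<omega> in P z. h (\<omega> a, \<omega> a') = 0"
    by (subst (asm) nn_integral_0_iff_AE) (auto intro: measurable_compose[OF measurable_Pair[OF component_P component_P] h])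
  then show ?thesis by eventually_elim (auto simp: h_def indicator_def split: if_splits)
qed

text \<open>The Chernoff bound with \<theta> = 1 bounds the probability of staying at or below c up
  to time n by e^(c - n\<phi>(1)), which tends to 0.\<close>

lemma AE_unbounded: "AE \<omega> in P (x, 0). \<exists>n::nat. c < snd (\<omega> (real n))"
proof -
  interpret M: prob_space "P (x, 0)" by (rule prob_P)
  have comp2: "(\<lambda>\<omega>. snd (\<omega> r)) \<in> borel_measurable (P (x, 0))" for r
    by (rule measurable_compose[OF component_P]) (intro borel_measurable_continuous_onI continuous_intros)
  define E where "E = {\<omega> \<in> space (P (x, 0)). \<forall>n::nat. snd (\<omega> (real n)) \<le> c}"
  have E: "E \<in> sets (P (x, 0))" unfolding E_def using comp2 by measurable
  have le: "measure (P (x, 0)) E \<le> exp (c - real n * \<phi> 1)" for n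
  proof -
    interpret mu: prob_space "\<mu> (real n)" by (rule prob_mu) simp
    have hm: "(\<lambda>y. indicator {..c} (snd y) :: ennreal) \<in> borel_measurable (borel :: (real \<times> real) measure)"
      by (rule measurable_compose[where g="indicator {..c}" and N=borel])
         (auto intro!: borel_measurable_continuous_onI continuous_intros)
    have "space (P (x, 0)) \<in> sets (natural_filtration (P (x, 0)) (\<lambda>r \<omega>. \<omega> r) 0)"
      using component_natural_filtration[of 0 0 UNIV "(x, 0)"] by simp
    from kernel_step[OF order_refl _ this hm, of "real n"]
    have e: "(\<integral>\<^sup>+\<omega>. indicator (space (P (x, 0))) \<omega> * indicator {..c} (snd (\<omega> (real n))) \<partial>P (x, 0))
      = (\<integral>\<^sup>+\<omega>. indicator (space (P (x, 0))) \<omega> * (\<integral>\<^sup>+w. indicator {..c} (snd (\<omega> 0) + w) \<partial>\<mu> (real n)) \<partial>P (x, 0))"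
      by simp
    have "emeasure (P (x, 0)) E = (\<integral>\<^sup>+\<omega>. indicator E \<omega> \<partial>P (x, 0))" using E by simp
    also have "\<dots> \<le> (\<integral>\<^sup>+\<omega>. indicator (space (P (x, 0))) \<omega> * indicator {..c} (snd (\<omega> (real n))) \<partial>P (x, 0))"
      by (intro nn_integral_mono) (auto simp: E_def indicator_def)
    also note e
    also have "(\<integral>\<^sup>+\<omega>. indicator (space (P (x, 0))) \<omega> * (\<integral>\<^sup>+w. indicator {..c} (snd (\<omega> 0) + w) \<partial>\<mu> (real n)) \<partial>P (x, 0))
      = (\<integral>\<^sup>+\<omega>. emeasure (\<mu> (real n)) {..c} \<partial>P (x, 0))"
      using AE_start[of "(x, 0)"] AE_space
      by (intro nn_integral_cong_AE, eventually_elim) (simp add: sets_mu)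
    also have "\<dots> = ennreal (measure (\<mu> (real n)) {..c})" by (simp add: M.emeasure_space_1 mu.emeasure_eq_measure)
    also have "\<dots> \<le> ennreal (exp (c - real n * \<phi> 1))" using mu_le_exp[of "real n" 1 c] by (intro ennreal_leI) simp
    finally show ?thesis by (simp add: M.emeasure_eq_measure)
  qed
  have "(\<lambda>n. exp (c - real n * \<phi> 1)) \<longlonglongrightarrow> 0"
  proof -
    have e: "exp (c - real n * \<phi> 1) = exp c * exp (- \<phi> 1) ^ n" for n
      by (simp add: exp_diff exp_minus exp_of_nat_mult power_inverse divide_inverse)
    have "(\<lambda>n. exp (- \<phi> 1) ^ n) \<longlonglongrightarrow> 0" using phi_1_pos by (intro LIMSEQ_power_zero) simp
    then show ?thesis unfolding e by (rule tendsto_mult_right_zero)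
  qed
  from LIMSEQ_le_const[OF this, of "measure (P (x, 0)) E"] le have "measure (P (x, 0)) E \<le> 0" by blast
  then have "E \<in> null_sets (P (x, 0))" using E by (auto simp: null_sets_def M.emeasure_eq_measure measure_le_0_iff)
  then have "AE \<omega> in P (x, 0). \<omega> \<notin> E" by (rule AE_not_in)
  then show ?thesis using AE_space by eventually_elim (auto simp: E_def not_le)
qed

definition clock :: "(real \<Rightarrow> real \<times> real) \<Rightarrow> real \<Rightarrow> real" where
  "clock \<omega> = (\<lambda>s\<in>{0..}. snd (\<omega> s))"

lemma AE_clock_good: "AE \<omega> in P (x, 0). clock \<omega> \<in> good_paths"
proof -
  have "AE \<omega> in P (x, 0). \<forall>p q::rat. 0 \<le> p \<longrightarrow> p < q \<longrightarrow> snd (\<omega> (of_rat p)) < snd (\<omega> (of_rat q))"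
  proof (subst AE_all_countable, intro allI, subst AE_all_countable, intro allI)
    fix p q :: rat
    show "AE \<omega> in P (x, 0). 0 \<le> p \<longrightarrow> p < q \<longrightarrow> snd (\<omega> (of_rat p)) < snd (\<omega> (of_rat q))"
      using AE_increasing[of "of_rat p" "of_rat q" "(x, 0)"] by (cases "0 \<le> p \<and> p < q") (auto simp: of_rat_less)
  qed
  moreover have "AE \<omega> in P (x, 0). \<forall>k::nat. \<exists>n::nat. real k < snd (\<omega> (real n))"
    by (subst AE_all_countable) (intro allI AE_unbounded)
  ultimately show ?thesis using AE_start[of "(x, 0)"] AE_space
  proof eventually_elim
    case (elim \<omega>)
    have rc: "((\<lambda>s. snd (\<omega> s)) \<longlongrightarrow> snd (\<omega> t)) (at_right t)" if "0 \<le> t" for t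
      using elim(4) that by (intro tendsto_intros) (simp add: space_P cadlag_paths_def)
    have less: "snd (\<omega> a) < snd (\<omega> b)" if ab: "0 \<le> a" "a < b" for a b
    proof -
      \<comment> \<open>Two rationals are inserted between a and b: right limits only give weak
        inequalities at both ends, so the strict one has to come from the middle.\<close>
      obtain q1 where q1: "a < of_rat q1" "of_rat q1 < b" using rat_between[OF ab(2)] by blast
      obtain q2 where q2: "real_of_rat q1 < of_rat q2" "of_rat q2 < b" using rat_between[OF q1(2)] by blast
      have "0 \<le> real_of_rat q1" using q1(1) ab(1) by linarith
      then have q0: "0 \<le> q1" by simp
      have "snd (\<omega> a) \<in> {..snd (\<omega> (of_rat q1))}"
      proof (rule right_limit_on_rationals[OF rc[OF ab(1)] _ q1(1)])
        fix q :: rat assume q: "a < of_rat q" "real_of_rat q < of_rat q1"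
        then have "0 \<le> real_of_rat q" using ab(1) by linarith
        then show "snd (\<omega> (of_rat q)) \<in> {..snd (\<omega> (of_rat q1))}"
          using elim(1) q(2) by (simp add: of_rat_less less_imp_le)
      qed simp
      moreover have "snd (\<omega> b) \<in> {snd (\<omega> (of_rat q2))..}"
      proof (rule right_limit_on_rationals[OF rc, where u="b + 1"])
        fix q :: rat assume q: "b < of_rat q"
        have "real_of_rat q2 < real_of_rat q" using q2(2) q by linarith
        then have "q2 < q" by (simp add: of_rat_less)
        have "q1 < q2" using q2(1) by (simp add: of_rat_less)
        then have "0 \<le> q2" using q0 by simp
        then show "snd (\<omega> (of_rat q)) \<in> {snd (\<omega> (of_rat q2))..}" using elim(1) \<open>q2 < q\<close> by (simp add: less_imp_le)
      qed (use ab in auto)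
      moreover have "snd (\<omega> (of_rat q1)) < snd (\<omega> (of_rat q2))" using elim(1) q0 q2(1) by (simp add: of_rat_less)
      ultimately show ?thesis by simp
    qed
    show ?case unfolding good_paths_def
    proof safe
      show "clock \<omega> \<in> extensional {0..}" "clock \<omega> 0 = 0" using elim(3) by (simp_all add: clock_def)
      show "strict_mono_on {0..} (clock \<omega>)" using less by (auto simp: strict_mono_on_def clock_def)
      show "(clock \<omega> \<longlongrightarrow> clock \<omega> t) (at_right t)" if t: "0 \<le> t" for t
      proof -
        have "eventually (\<lambda>s. t < s) (at_right t)" by (simp add: eventually_at_right_less)
        then have "eventually (\<lambda>s. snd (\<omega> s) = clock \<omega> s) (at_right t)"
          by eventually_elim (use t in \<open>simp add: clock_def\<close>)
        then have "(clock \<omega> \<longlongrightarrow> snd (\<omega> t)) (at_right t)" by (rule Lim_transform_eventually[OF rc[OF t]])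
        then show ?thesis using t by (simp add: clock_def)
      qed
      show "\<exists>t\<ge>0. c < clock \<omega> t" for c
      proof -
        obtain k :: nat where "c \<le> real k" using real_arch_simple by blast
        moreover obtain n :: nat where "real k < snd (\<omega> (real n))" using elim(2) by blast
        ultimately show ?thesis by (intro exI[of _ "real n"]) (simp add: clock_def)
      qed
    qed
  qed
qed

end

section \<open>The kernel on the space of states\<close>

context subordinator_law
begin

text \<open>Negative ages are not states; clamping them keeps the kernel measurable on the whole plane.\<close>

definition age_trans :: "real \<Rightarrow> real \<times> real \<Rightarrow> (real \<times> real) measure" where
  "age_trans t z = distr (jump_kernel (max 0 (snd z)) \<Otimes>\<^sub>M Q) (restrict_space borel age_states) (age_step t (fst z, max 0 (snd z)))"

lemma age_states_borel [simp]: "age_states \<in> sets borel"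
  unfolding age_states_def by (intro borel_closed closed_Times) auto

lemma age_step_states:
  assumes "0 \<le> t" "0 \<le> snd z" "\<eta> \<in> good_paths"
  shows "age_step t z (w, \<eta>) \<in> age_states"
  using assms undershoot_le[OF assms(3), of "snd z + t - w"]
  by (auto simp: age_step_def Let_def age_states_def)

lemma age_step_states_section:
  assumes "0 \<le> t"
  shows "age_step t (fst z, max 0 (snd z)) \<in> jump_kernel v \<Otimes>\<^sub>M Q \<rightarrow>\<^sub>M restrict_space borel age_states"
  using assms by (intro measurable_restrict_space2 age_step_section)
    (auto simp: space_pair_measure space_Q intro!: age_step_states)

lemma sets_age_trans [simp]: "sets (age_trans t z) = sets (restrict_space borel age_states)"
  by (simp add: age_trans_def)

lemma space_age_trans [simp]: "space (age_trans t z) = age_states"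
  by (simp add: age_trans_def space_restrict_space)

lemma nn_integral_age_trans:
  assumes t: "0 \<le> t" and h: "h \<in> borel_measurable borel"
  shows "(\<integral>\<^sup>+y. h y \<partial>age_trans t z) = (\<integral>\<^sup>+y. h y \<partial>age_kernel t (fst z, max 0 (snd z)))"
proof -
  have "h \<in> borel_measurable (restrict_space borel age_states)" using h by (rule measurable_restrict_space1)
  then have "(\<integral>\<^sup>+y. h y \<partial>age_trans t z) = (\<integral>\<^sup>+y. h (age_step t (fst z, max 0 (snd z)) y) \<partial>(jump_kernel (max 0 (snd z)) \<Otimes>\<^sub>M Q))"
    unfolding age_trans_def by (intro nn_integral_distr[OF age_step_states_section[OF t]]) simp
  also have "\<dots> = (\<integral>\<^sup>+y. h y \<partial>age_kernel t (fst z, max 0 (snd z)))"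
    unfolding age_kernel_def using h by (subst nn_integral_distr[OF age_step_section]) auto
  finally show ?thesis .
qed

lemma emeasure_age_trans:
  assumes t: "0 \<le> t" and B: "B \<in> sets borel" "B \<subseteq> age_states"
  shows "emeasure (age_trans t z) B = (\<integral>\<^sup>+y. indicator B y \<partial>age_kernel t (fst z, max 0 (snd z)))"
proof -
  have "B \<in> sets (restrict_space borel age_states)" using B by (subst sets_restrict_space_iff) auto
  then have "emeasure (age_trans t z) B = (\<integral>\<^sup>+y. indicator B y \<partial>age_trans t z)" by simp
  then show ?thesis using nn_integral_age_trans[OF t, of "indicator B" z] B by simp
qed

lemma prob_space_age_trans: "0 \<le> t \<Longrightarrow> prob_space (age_trans t z)"
proof -
  assume t: "0 \<le> t"
  interpret J: prob_space "jump_kernel (max 0 (snd z))" by (rule prob_jump_kernel)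
  interpret P: pair_prob_space "jump_kernel (max 0 (snd z))" Q ..
  show ?thesis unfolding age_trans_def by (rule P.prob_space_distr[OF age_step_states_section[OF t]])
qed

lemma age_trans_measurable:
  "(\<lambda>(t, z). age_trans t z) \<in> restrict_space borel {0..} \<Otimes>\<^sub>M restrict_space borel age_states
     \<rightarrow>\<^sub>M prob_algebra (restrict_space borel age_states)"
proof -
  define L where "L = restrict_space (borel :: real measure) {0..} \<Otimes>\<^sub>M restrict_space (borel :: (real \<times> real) measure) age_states"
  have 1: "fst \<in> borel_measurable L" unfolding L_def
    by (rule measurable_compose[OF measurable_fst measurable_restrict_space1]) simp
  have 2: "snd \<in> borel_measurable L" unfolding L_def
    by (rule measurable_compose[OF measurable_snd measurable_restrict_space1]) simp
  have "(\<lambda>z. max 0 (snd z)) \<in> borel_measurable (borel :: (real \<times> real) measure)" "fst \<in> borel_measurable (borel :: (real \<times> real) measure)"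
    by (intro borel_measurable_continuous_onI continuous_intros)+
  from this[THEN measurable_compose[OF 2]]
  have 3: "(\<lambda>x. max 0 (snd (snd x))) \<in> borel_measurable L" "(\<lambda>x. fst (snd x)) \<in> borel_measurable L" by simp_all
  have "Q \<in> space (prob_algebra good_space)"
    using sets_Q Q.prob_space_axioms by (simp add: space_prob_algebra)
  then have 4: "(\<lambda>x. Q) \<in> L \<rightarrow>\<^sub>M prob_algebra good_space" by simp
  have "(\<lambda>x. age_trans (fst x) (snd x)) \<in> L \<rightarrow>\<^sub>M prob_algebra (restrict_space borel age_states)"
    unfolding age_trans_def
  proof (rule measurable_distr_prob_space2[where M="borel \<Otimes>\<^sub>M good_space"])
    show "(\<lambda>x. jump_kernel (max 0 (snd (snd x))) \<Otimes>\<^sub>M Q) \<in> L \<rightarrow>\<^sub>M prob_algebra (borel \<Otimes>\<^sub>M good_space)"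
      by (rule measurable_pair_prob[OF measurable_compose[OF 3(1) jump_kernel_measurable] 4])
    have "(\<lambda>y. age_step (fst (fst y)) (fst (snd (fst y)), max 0 (snd (snd (fst y)))) (fst (snd y), snd (snd y)))
      \<in> borel_measurable (L \<Otimes>\<^sub>M (borel \<Otimes>\<^sub>M good_space))"
      by (intro age_step_measurable borel_measurable_Pair measurable_compose[OF measurable_fst 1]
          measurable_compose[OF measurable_fst 3(1)] measurable_compose[OF measurable_fst 3(2)]) measurable
    then have "(\<lambda>y. age_step (fst (fst y)) (fst (snd (fst y)), max 0 (snd (snd (fst y)))) (fst (snd y), snd (snd y)))
      \<in> L \<Otimes>\<^sub>M (borel \<Otimes>\<^sub>M good_space) \<rightarrow>\<^sub>M restrict_space borel age_states"
      by (intro measurable_restrict_space2)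
         (auto simp: L_def space_pair_measure space_good_space space_restrict_space intro!: age_step_states)
    then show "(\<lambda>(x, y). age_step (fst x) (fst (snd x), max 0 (snd (snd x))) y)
      \<in> L \<Otimes>\<^sub>M (borel \<Otimes>\<^sub>M good_space) \<rightarrow>\<^sub>M restrict_space borel age_states"
      by (simp add: case_prod_beta')
  qed
  then show ?thesis by (simp add: L_def case_prod_beta')
qed

lemma transition_function_age_trans: "transition_function age_states age_trans"
  unfolding transition_function_def
proof (intro conjI ballI allI impI)
  show "(\<lambda>(t, z). age_trans t z) \<in> restrict_space borel {0..} \<Otimes>\<^sub>M restrict_space borel age_states
     \<rightarrow>\<^sub>M prob_algebra (restrict_space borel age_states)" by (rule age_trans_measurable)
  have Xb: "X \<in> sets borel" "X \<subseteq> age_states" if "X \<in> sets (restrict_space borel age_states)" for X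
    using that by (auto simp: sets_restrict_space_iff)
  fix z :: "real \<times> real" assume z: "z \<in> age_states"
  then have z': "(fst z, max 0 (snd z)) = z" "0 \<le> snd z" by (auto simp: age_states_def)
  show "age_trans 0 z = return (restrict_space borel age_states) z"
  proof (rule measure_eqI)
    fix X assume "X \<in> sets (age_trans 0 z)"
    then have X: "X \<in> sets (restrict_space borel age_states)" by simp
    then show "emeasure (age_trans 0 z) X = emeasure (return (restrict_space borel age_states) z) X"
      using emeasure_age_trans[OF order_refl Xb[OF X], of z] nn_integral_age_kernel_0[of "indicator X" z] Xb[OF X]
      by (simp add: z')
  qed simp
  fix s t :: real assume st: "0 \<le> s" "0 \<le> t"
  have pt: "age_trans t \<in> age_trans s z \<rightarrow>\<^sub>M subprob_algebra (restrict_space borel age_states)"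
  proof -
    have "(\<lambda>y. (t, y)) \<in> restrict_space borel age_states \<rightarrow>\<^sub>M restrict_space borel {0..} \<Otimes>\<^sub>M restrict_space borel age_states"
      using st by (intro measurable_Pair1') (simp add: space_restrict_space)
    from measurable_compose[OF this age_trans_measurable]
    have "age_trans t \<in> restrict_space borel age_states \<rightarrow>\<^sub>M prob_algebra (restrict_space borel age_states)" by simp
    then show ?thesis
      using measurable_prob_algebraD measurable_cong_sets[OF sets_age_trans refl] by blast
  qed
  have ne: "space (age_trans s z) \<noteq> {}" using z by auto
  show "age_trans (s + t) z = age_trans s z \<bind> age_trans t"
  proof (rule measure_eqI)
    show "sets (age_trans (s + t) z) = sets (age_trans s z \<bind> age_trans t)"
      using sets_bind[OF sets_kernel[OF pt] ne] by simp
    fix X assume "X \<in> sets (age_trans (s + t) z)"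
    then have X: "X \<in> sets (restrict_space borel age_states)" by simp
    note X' = Xb[OF X]
    have h: "indicator X \<in> borel_measurable borel" using X' by simp
    have "emeasure (age_trans s z \<bind> age_trans t) X = (\<integral>\<^sup>+y. emeasure (age_trans t y) X \<partial>age_trans s z)"
      by (rule emeasure_bind[OF ne pt X])
    also have "\<dots> = (\<integral>\<^sup>+y. (\<integral>\<^sup>+y'. indicator X y' \<partial>age_kernel t y) \<partial>age_trans s z)"
    proof (rule nn_integral_cong)
      fix y assume "y \<in> space (age_trans s z)"
      then have "(fst y, max 0 (snd y)) = y" by (auto simp: age_states_def)
      then show "emeasure (age_trans t y) X = (\<integral>\<^sup>+y'. indicator X y' \<partial>age_kernel t y)"
        using emeasure_age_trans[OF st(2) X', of y] by simp
    qed
    also have "\<dots> = (\<integral>\<^sup>+y. (\<integral>\<^sup>+y'. indicator X y' \<partial>age_kernel t y) \<partial>age_kernel s z)"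
      using nn_integral_age_trans[OF st(1) nn_integral_age_kernel_measurable[OF h borel_measurable_const measurable_ident_sets[OF refl]], of z]
      by (simp add: z')
    also have "\<dots> = (\<integral>\<^sup>+y. indicator X y \<partial>age_kernel (s + t) z)"
      by (rule Chapman_Kolmogorov[OF st z'(2) h, symmetric])
    also have "\<dots> = emeasure (age_trans (s + t) z) X"
      using emeasure_age_trans[OF _ X', of "s + t" z] st by (simp add: z')
    finally show "emeasure (age_trans (s + t) z) X = emeasure (age_trans s z \<bind> age_trans t) X" by simp
  qed
qed

lemma age_trans_fresh:
  assumes t: "0 \<le> t" and h: "h \<in> borel_measurable borel"
  shows "(\<integral>\<^sup>+y. h y \<partial>age_kernel t (x, 0)) = (\<integral>\<^sup>+\<eta>. h (x + fst (age_at t \<eta>), snd (age_at t \<eta>)) \<partial>Q)"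
proof (cases "t = 0")
  case True
  then show ?thesis by (simp add: nn_integral_age_kernel_0[OF h] age_at_0 Q.emeasure_space_1)
next
  case False
  then show ?thesis using nn_integral_age_kernel_fresh[OF h, of t x] t by (simp add: restart_def age_at_def)
qed

text \<open>Under \<nu> conditioned to [v,\<infinity>) the jump either reaches v + t, in which case
  x stays and the age becomes v + t, or it is some s in [v,v+t), after which a process of age 0 runs
  for the time v + t - s.\<close>

lemma age_trans_formula:
  assumes t: "0 \<le> t" and v: "0 < v" and pos: "emeasure \<nu> {v..} > 0" and B: "B \<in> sets borel" "B \<subseteq> age_states"
  shows "emeasure (age_trans t (x, v)) B = emeasure (return borel x \<Otimes>\<^sub>M return borel (v + t)) B * (emeasure \<nu> {v + t..} / emeasure \<nu> {v..})
    + (\<integral>\<^sup>+ s\<in>{v..<v + t}. emeasure (age_trans (v + t - s) (x, 0)) B \<partial>\<nu>) / emeasure \<nu> {v..}"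
proof -
  define G where "G = step_value (indicator B) x (v + t)"
  have h: "indicator B \<in> borel_measurable borel" using B by simp
  have "G \<in> borel_measurable borel" unfolding G_def by (rule step_value_section[OF h])
  then have Gn: "G \<in> borel_measurable \<nu>" by (simp add: measurable_cong_sets[OF sets_nu refl])
  have pos': "0 < tail v" using pos v by (simp add: emeasure_tail ennreal_less_zero_iff)
  have "emeasure (age_trans t (x, v)) B = (\<integral>\<^sup>+w. G w \<partial>jump_kernel v)"
    using emeasure_age_trans[OF t B, of "(x, v)"] v by (simp add: nn_integral_age_kernel[OF h] G_def max_def)
  also have "\<dots> = (\<integral>\<^sup>+w. G w * indicator {v..} w \<partial>\<nu>) / emeasure \<nu> {v..}"
    using pos' v Gn by (simp add: jump_kernel_def nn_integral_uniform_measure)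
  also have "(\<integral>\<^sup>+w. G w * indicator {v..} w \<partial>\<nu>)
    = (\<integral>\<^sup>+w. indicator B (x, v + t) * indicator {v + t..} w + emeasure (age_trans (v + t - w) (x, 0)) B * indicator {v..<v + t} w \<partial>\<nu>)"
  proof (intro nn_integral_cong)
    fix w
    have "emeasure (age_trans (v + t - w) (x, 0)) B = restart (indicator B) x (v + t - w)" if "w < v + t"
      using emeasure_age_trans[OF _ B, of "v + t - w" "(x, 0)"] nn_integral_age_kernel_fresh[OF h, of "v + t - w" x] that by simp
    then show "G w * indicator {v..} w = indicator B (x, v + t) * indicator {v + t..} w + emeasure (age_trans (v + t - w) (x, 0)) B * indicator {v..<v + t} w"
      using t by (auto simp: G_def step_value_def indicator_def)
  qed
  also have "\<dots> = (\<integral>\<^sup>+w. indicator B (x, v + t) * indicator {v + t..} w \<partial>\<nu>) + (\<integral>\<^sup>+ s\<in>{v..<v + t}. emeasure (age_trans (v + t - s) (x, 0)) B \<partial>\<nu>)"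
  proof (rule nn_integral_add)
    have "(\<lambda>w. restart (indicator B) x (v + t - w)) \<in> borel_measurable \<nu>"
      by (rule restart_measurable[OF h]) (auto simp: measurable_cong_sets[OF sets_nu refl])
    moreover have "emeasure (age_trans (v + t - w) (x, 0)) B * indicator {v..<v + t} w = restart (indicator B) x (v + t - w) * indicator {v..<v + t} w" for w
      using emeasure_age_trans[OF _ B, of "v + t - w" "(x, 0)"] nn_integral_age_kernel_fresh[OF h, of "v + t - w" x]
      by (auto simp: indicator_def)
    ultimately show "(\<lambda>w. emeasure (age_trans (v + t - w) (x, 0)) B * indicator {v..<v + t} w) \<in> borel_measurable \<nu>"
      by (simp only:) (intro borel_measurable_times_ennreal borel_measurable_indicator; simp)
  qed (intro borel_measurable_times_ennreal borel_measurable_const borel_measurable_indicator; simp)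
  also have "(\<integral>\<^sup>+w. indicator B (x, v + t) * indicator {v + t..} w \<partial>\<nu>) = indicator B (x, v + t) * emeasure \<nu> {v + t..}"
    by (rule nn_integral_cmult_indicator) simp
  also have "indicator B (x, v + t) = emeasure (return borel x \<Otimes>\<^sub>M return borel (v + t)) B"
  proof -
    interpret r: prob_space "return borel (v + t)" by (rule prob_space_return) simp
    have B': "B \<in> sets ((borel :: real measure) \<Otimes>\<^sub>M (borel :: real measure))"
      using B(1) unfolding borel_prod .
    then have m: "(\<lambda>z. indicator B z :: ennreal) \<in> borel_measurable (borel \<Otimes>\<^sub>M return borel (v + t))"
      by (intro borel_measurable_indicator) simp
    have "emeasure (return borel x \<Otimes>\<^sub>M return borel (v + t)) B
      = (\<integral>\<^sup>+a. \<integral>\<^sup>+c. indicator B (a, c) \<partial>return borel (v + t) \<partial>return borel x)"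
      using B' by (intro r.emeasure_pair_measure) simp
    also have "\<dots> = (\<integral>\<^sup>+c. indicator B (x, c) \<partial>return borel (v + t))"
      by (rule nn_integral_return) (auto intro: r.borel_measurable_nn_integral_fst m)
    also have "\<dots> = indicator B (x, v + t)"
      by (rule nn_integral_return) (auto intro!: measurable_compose[OF measurable_Pair1' borel_measurable_indicator[OF B']])
    finally show ?thesis by simp
  qed
  finally show ?thesis by (simp add: divide_ennreal_def distrib_right mult.assoc)
qed

end

section \<open>Measurability of the age process and its representation by the clock\<close>

context canonical_subordinator
begin

lemma cadlag_right: "\<omega> \<in> space (P z) \<Longrightarrow> 0 \<le> t \<Longrightarrow> (\<omega> \<longlongrightarrow> \<omega> t) (at_right t)"
  and cadlag_left: "\<omega> \<in> space (P z) \<Longrightarrow> 0 < t \<Longrightarrow> \<exists>l. (\<omega> \<longlongrightarrow> l) (at_left t)"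
  by (auto simp: space_P cadlag_paths_def)

lemma snd_component: "(\<lambda>\<omega>. snd (\<omega> r)) \<in> borel_measurable (P z)"
  by (rule measurable_compose[OF component_P]) (intro borel_measurable_continuous_onI continuous_intros)

text \<open>The random time is approximated strictly from the right by grid points, so
  right-continuity gives convergence of the values, and a random grid point takes only countably
  many values.\<close>

lemma evaluation_measurable:
  assumes \<tau>: "\<tau> \<in> borel_measurable (P z)" and nn: "\<And>\<omega>. 0 \<le> \<tau> \<omega>"
  shows "(\<lambda>\<omega>. \<omega> (\<tau> \<omega>)) \<in> borel_measurable (P z)"
proof (rule borel_measurable_LIMSEQ_metric)
  fix n
  have "(\<lambda>\<omega>. nat \<lfloor>\<tau> \<omega> * real (Suc n)\<rfloor>) \<in> P z \<rightarrow>\<^sub>M count_space UNIV" using \<tau> by measurable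
  then show "(\<lambda>\<omega>. \<omega> (real (Suc (nat \<lfloor>\<tau> \<omega> * real (Suc n)\<rfloor>)) * mesh n)) \<in> borel_measurable (P z)"
    by (rule measurable_compose_countable[where f="\<lambda>k \<omega>. \<omega> (real (Suc k) * mesh n)", OF component_P])
next
  fix \<omega> assume \<omega>: "\<omega> \<in> space (P z)"
  define u where "u = \<tau> \<omega>"
  define f where "f n = real (Suc (nat \<lfloor>u * real (Suc n)\<rfloor>)) * mesh n" for n
  have u: "0 \<le> u" using nn by (simp add: u_def)
  have b: "u < f n" "f n \<le> u + mesh n" for n
  proof -
    have "0 \<le> \<lfloor>u * real (Suc n)\<rfloor>" using u by simp
    then have k: "real (Suc (nat \<lfloor>u * real (Suc n)\<rfloor>)) = of_int \<lfloor>u * real (Suc n)\<rfloor> + 1" by simp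
    have "u * real (Suc n) < of_int \<lfloor>u * real (Suc n)\<rfloor> + 1" "of_int \<lfloor>u * real (Suc n)\<rfloor> + 1 \<le> u * real (Suc n) + 1"
      by linarith+
    then show "u < f n" "f n \<le> u + mesh n"
      unfolding f_def k mesh_def by (simp_all add: field_simps del: of_nat_Suc)
  qed
  have "(\<lambda>n. u + mesh n) \<longlonglongrightarrow> u + 0" by (intro tendsto_intros mesh_tendsto)
  then have "f \<longlonglongrightarrow> u"
    by (intro tendsto_sandwich[of "\<lambda>_. u" f _ "\<lambda>n. u + mesh n"]) (use b in \<open>auto intro!: always_eventually less_imp_le\<close>)
  then have "filterlim f (at_right u) sequentially"
    using b(1) by (auto simp: filterlim_at intro!: always_eventually)
  from filterlim_compose[OF cadlag_right[OF \<omega> u] this]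
  show "(\<lambda>n. \<omega> (real (Suc (nat \<lfloor>\<tau> \<omega> * real (Suc n)\<rfloor>)) * mesh n)) \<longlonglongrightarrow> \<omega> (\<tau> \<omega>)"
    by (simp add: f_def u_def)
qed

text \<open>Right-continuity lets rational times replace real ones in the infimum. Measurability is
  wanted on all paths; on those that never exceed t after time 0 the infimum is the constant
  \<open>Inf {}\<close>.\<close>

lemma proc_L_measurable: "proc_L t \<in> borel_measurable (P z)"
proof (subst borel_measurable_iff_less, safe)
  fix y
  note snd_component[measurable]
  define i0 :: real where "i0 = Inf {}"
  have "{\<omega> \<in> space (P z). proc_L t \<omega> < y} = {\<omega> \<in> space (P z).
    if \<exists>q::rat. 0 < q \<and> t < snd (\<omega> (of_rat q)) then \<exists>q::rat. 0 < q \<and> real_of_rat q < y \<and> t < snd (\<omega> (of_rat q)) else i0 < y}"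
  proof (intro Collect_cong conj_cong refl)
    fix \<omega> assume \<omega>: "\<omega> \<in> space (P z)"
    define S where "S = {s. 0 < s \<and> t < snd (\<omega> s)}"
    have rat: "\<exists>q::rat. 0 < q \<and> real_of_rat q < c \<and> t < snd (\<omega> (of_rat q))" if "s \<in> S" "s < c" for s c
    proof (rule ccontr)
      assume *: "\<nexists>q::rat. 0 < q \<and> real_of_rat q < c \<and> t < snd (\<omega> (of_rat q))"
      have s: "0 < s" "t < snd (\<omega> s)" using that by (auto simp: S_def)
      have "((\<lambda>s. snd (\<omega> s)) \<longlongrightarrow> snd (\<omega> s)) (at_right s)" using s by (intro tendsto_intros cadlag_right[OF \<omega>]) simp
      then have "snd (\<omega> s) \<in> {..t}"
      proof (rule right_limit_on_rationals[where u=c])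
        fix q :: rat assume q: "s < of_rat q" "of_rat q < c"
        then have "0 < real_of_rat q" using s by linarith
        have "\<not> (0 < q \<and> real_of_rat q < c \<and> t < snd (\<omega> (of_rat q)))" using * by blast
        then show "snd (\<omega> (of_rat q)) \<in> {..t}" using q \<open>0 < real_of_rat q\<close> by auto
      qed (use that in auto)
      then show False using s by simp
    qed
    have S_rat: "S \<noteq> {} \<longleftrightarrow> (\<exists>q::rat. 0 < q \<and> t < snd (\<omega> (of_rat q)))"
    proof
      assume "S \<noteq> {}"
      then obtain s where "s \<in> S" by blast
      from rat[OF this, of "s + 1"] show "\<exists>q::rat. 0 < q \<and> t < snd (\<omega> (of_rat q))" by auto
    next
      assume "\<exists>q::rat. 0 < q \<and> t < snd (\<omega> (of_rat q))"
      then obtain q :: rat where "0 < q" "t < snd (\<omega> (of_rat q))" by blast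
      then have "real_of_rat q \<in> S" by (simp add: S_def)
      then show "S \<noteq> {}" by blast
    qed
    have L: "proc_L t \<omega> = Inf S" by (simp add: proc_L_def proc_sigma_def S_def)
    have "Inf S < y \<longleftrightarrow> (\<exists>q::rat. 0 < q \<and> real_of_rat q < y \<and> t < snd (\<omega> (of_rat q)))" if "S \<noteq> {}"
    proof -
      have "bdd_below S" by (rule bdd_belowI[of _ 0]) (auto simp: S_def)
      then have "Inf S < y \<longleftrightarrow> (\<exists>s\<in>S. s < y)" by (rule cInf_less_iff[OF that])
      also have "\<dots> \<longleftrightarrow> (\<exists>q::rat. 0 < q \<and> real_of_rat q < y \<and> t < snd (\<omega> (of_rat q)))"
      proof
        assume "\<exists>q::rat. 0 < q \<and> real_of_rat q < y \<and> t < snd (\<omega> (of_rat q))"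
        then obtain q :: rat where "0 < q" "real_of_rat q < y" "t < snd (\<omega> (of_rat q))" by blast
        then show "\<exists>s\<in>S. s < y" by (intro bexI[of _ "of_rat q"]) (auto simp: S_def)
      qed (use rat in blast)
      finally show ?thesis .
    qed
    then show "proc_L t \<omega> < y \<longleftrightarrow> (if \<exists>q::rat. 0 < q \<and> t < snd (\<omega> (of_rat q))
      then \<exists>q::rat. 0 < q \<and> real_of_rat q < y \<and> t < snd (\<omega> (of_rat q)) else i0 < y)"
      unfolding L S_rat[symmetric] i0_def by auto
  qed
  also have "\<dots> \<in> sets (P z)" by measurable
  finally show "{\<omega> \<in> space (P z). proc_L t \<omega> < y} \<in> sets (P z)" .
qed

lemma age_process_measurable: "age_process t \<in> borel_measurable (P z)"
proof -
  note Lm[measurable] = proc_L_measurable[of t z]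
  have fm: "fst \<in> borel_measurable (borel :: (real \<times> real) measure)" and sm: "snd \<in> borel_measurable (borel :: (real \<times> real) measure)"
    by (intro borel_measurable_continuous_onI continuous_intros)+
  have ev: "(\<lambda>\<omega>. \<omega> (max 0 (proc_L t \<omega> - c))) \<in> borel_measurable (P z)" for c
  proof (rule evaluation_measurable[where \<tau>="\<lambda>\<omega>. max 0 (proc_L t \<omega> - c)"])
    show "(\<lambda>\<omega>. max 0 (proc_L t \<omega> - c)) \<in> borel_measurable (P z)"
      by (intro borel_measurable_max borel_measurable_const borel_measurable_diff Lm)
  qed simp
  \<comment> \<open>\<open>proc_L\<close> can be negative only as the unspecified constant
    \<open>Inf {}\<close>, and evaluating the path there is evaluation at a fixed time.\<close>
  have "proc_A (proc_L t \<omega>) \<omega> = (if 0 \<le> proc_L t \<omega> then fst (\<omega> (max 0 (proc_L t \<omega> - 0))) else fst (\<omega> (Inf {})))" for \<omega>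
  proof (cases "0 \<le> proc_L t \<omega>")
    case False
    have empty: "{s. 0 < s \<and> t < proc_sigma s \<omega>} = {}"
    proof (rule ccontr)
      assume "{s. 0 < s \<and> t < proc_sigma s \<omega>} \<noteq> {}"
      then have "0 \<le> proc_L t \<omega>" unfolding proc_L_def by (rule cInf_greatest) auto
      then show False using False by simp
    qed
    have "proc_L t \<omega> = Inf {}" unfolding proc_L_def empty ..
    then show ?thesis using False by (simp add: proc_A_def)
  qed (simp add: proc_A_def)
  moreover have "(\<lambda>\<omega>. if 0 \<le> proc_L t \<omega> then fst (\<omega> (max 0 (proc_L t \<omega> - 0))) else fst (\<omega> (Inf {}))) \<in> borel_measurable (P z)"
    by (intro measurable_If measurable_compose[OF ev fm] measurable_compose[OF component_P fm]) measurable
  ultimately have A: "(\<lambda>\<omega>. proc_A (proc_L t \<omega>) \<omega>) \<in> borel_measurable (P z)" by simp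
  have H: "proc_H t \<in> borel_measurable (P z)"
  proof (rule borel_measurable_LIMSEQ_real)
    show "(\<lambda>\<omega>. if proc_L t \<omega> \<le> 0 then snd (\<omega> 0) else snd (\<omega> (max 0 (proc_L t \<omega> - mesh n)))) \<in> borel_measurable (P z)" for n
      by (intro measurable_If measurable_compose[OF ev sm] snd_component) measurable
    fix \<omega> assume \<omega>: "\<omega> \<in> space (P z)"
    show "(\<lambda>n. if proc_L t \<omega> \<le> 0 then snd (\<omega> 0) else snd (\<omega> (max 0 (proc_L t \<omega> - mesh n)))) \<longlonglongrightarrow> proc_H t \<omega>"
    proof (cases "proc_L t \<omega> \<le> 0")
      case True
      then show ?thesis by (simp add: proc_H_def proc_sigma_def)
    next
      case False
      define u where "u = proc_L t \<omega>"
      have u: "0 < u" using False by (simp add: u_def)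
      obtain l where l: "(\<omega> \<longlongrightarrow> l) (at_left u)" using cadlag_left[OF \<omega> u] by blast
      have "filterlim (\<lambda>\<delta>. u - \<delta>) (at_left u) (at_right 0)"
        by (auto simp: filterlim_at eventually_at_filter intro!: tendsto_eq_intros)
      from filterlim_compose[OF l this] have "((\<lambda>\<delta>. snd (\<omega> (u - \<delta>))) \<longlongrightarrow> snd l) (at_right 0)" by (intro tendsto_intros)
      then have "proc_H t \<omega> = snd l"
        using False by (simp add: proc_H_def proc_sigma_def u_def tendsto_Lim)
      \<comment> \<open>The maximum keeps the time in [0,\<infinity>), and as u > 0 the approach to
        u is still strictly from the left.\<close>
      moreover have "filterlim (\<lambda>n. max 0 (u - mesh n)) (at_left u) sequentially"
      proof -
        have "(\<lambda>n. max 0 (u - mesh n)) \<longlonglongrightarrow> max 0 (u - 0)" by (intro tendsto_intros mesh_tendsto)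
        moreover have lt: "max 0 (u - mesh n) < u" for n using u mesh_pos[of n] by simp
        ultimately show ?thesis using u less_imp_neq[OF lt] by (simp add: filterlim_at)
      qed
      from filterlim_compose[OF l this] have "(\<lambda>n. snd (\<omega> (max 0 (u - mesh n)))) \<longlonglongrightarrow> snd l" by (intro tendsto_intros)
      ultimately show ?thesis using False by (simp add: u_def)
    qed
  qed
  have "(\<lambda>\<omega>. (proc_A (proc_L t \<omega>) \<omega>, t - proc_H t \<omega>)) \<in> borel_measurable (P z)"
    by (intro borel_measurable_Pair A borel_measurable_diff borel_measurable_const H)
  then show ?thesis by (simp add: age_process_def[abs_def] proc_gamma_def)
qed

lemma clock_version:
  "\<exists>c. c \<in> P (x, 0) \<rightarrow>\<^sub>M good_space \<and> (AE \<omega> in P (x, 0). c \<omega> = clock \<omega>)"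
proof -
  obtain N where N: "\<And>\<omega>. \<omega> \<in> space (P (x, 0)) - N \<Longrightarrow> clock \<omega> \<in> good_paths" "N \<in> null_sets (P (x, 0))"
    using AE_E3[OF AE_clock_good] by blast
  have Nm: "N \<in> sets (P (x, 0))" using N(2) by auto
  define c where "c \<omega> = (if \<omega> \<in> N then identity_path else clock \<omega>)" for \<omega>
  have "c \<in> P (x, 0) \<rightarrow>\<^sub>M restrict_space (Pi\<^sub>M {0..} (\<lambda>_. borel)) good_paths"
  proof (rule measurable_restrict_space2)
    show "c \<in> space (P (x, 0)) \<rightarrow> good_paths" using N(1) identity_path_good by (auto simp: c_def)
    have "clock \<in> P (x, 0) \<rightarrow>\<^sub>M Pi\<^sub>M {0..} (\<lambda>_. borel)"
      unfolding clock_def[abs_def] by (intro measurable_restrict snd_component)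
    moreover have "(\<lambda>_. identity_path) \<in> P (x, 0) \<rightarrow>\<^sub>M Pi\<^sub>M {0..} (\<lambda>_. borel)"
      by (rule measurable_const) (auto simp: space_PiM identity_path_def)
    ultimately show "c \<in> P (x, 0) \<rightarrow>\<^sub>M Pi\<^sub>M {0..} (\<lambda>_. borel)"
      unfolding c_def[abs_def] using Nm by (intro measurable_If) auto
  qed
  moreover have "AE \<omega> in P (x, 0). c \<omega> = clock \<omega>"
    using AE_not_in[OF N(2)] by eventually_elim (simp add: c_def)
  ultimately show ?thesis unfolding good_space_def by blast
qed

text \<open>A cylinder in past values of the second coordinate is an event of the natural
  filtration, so each Markov step of the clock is an instance of \<open>kernel_step\<close>.\<close>

lemma clock_law:
  assumes c: "c \<in> P (x, 0) \<rightarrow>\<^sub>M good_space" and cl: "AE \<omega> in P (x, 0). c \<omega> = clock \<omega>"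
  shows "sub_law (distr (P (x, 0)) good_space c)"
proof -
  define M where "M = P (x, 0)"
  interpret M: prob_space M unfolding M_def by (rule prob_P)
  have cM: "c \<in> M \<rightarrow>\<^sub>M good_space" using c by (simp add: M_def)
  have "markov_step (distr M good_space c) s t" if st: "0 \<le> s" "s \<le> t" for s t
    unfolding markov_step_def
  proof (intro allI impI)
    fix J and A :: "real \<Rightarrow> real set" and B :: "real set"
    assume J: "finite J" "J \<subseteq> {0..s}" and A: "\<forall>r\<in>J. A r \<in> sets borel" and B: "B \<in> sets borel"
    define E where "E = {\<omega> \<in> space M. \<forall>r\<in>J. snd (\<omega> r) \<in> A r}"
    have E: "E \<in> sets (natural_filtration (P (x, 0)) (\<lambda>r \<omega>. \<omega> r) s)"
    proof -
      have "snd -` A r \<in> sets (borel :: (real \<times> real) measure)" if "r \<in> J" for r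
      proof -
        have "snd \<in> borel_measurable (borel :: (real \<times> real) measure)"
          by (intro borel_measurable_continuous_onI continuous_intros)
        from measurable_sets[OF this, of "A r"] show ?thesis using A that by simp
      qed
      then have "{\<omega> \<in> space (P (x, 0)). \<omega> r \<in> snd -` A r} \<in> sets (natural_filtration (P (x, 0)) (\<lambda>r \<omega>. \<omega> r) s)" if "r \<in> J" for r
        using that J by (intro component_natural_filtration) auto
      then have "{\<omega> \<in> space (natural_filtration (P (x, 0)) (\<lambda>r \<omega>. \<omega> r) s). \<forall>r\<in>J. \<omega> r \<in> snd -` A r} \<in> sets (natural_filtration (P (x, 0)) (\<lambda>r \<omega>. \<omega> r) s)"
        using J by (intro sets.sets_Collect_finite_All) (auto simp: natural_filtration_sets(2))
      then show ?thesis by (simp add: E_def M_def natural_filtration_sets(2))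
    qed
    have cy: "cyl J A (clock \<omega>) = indicator E \<omega>" if "\<omega> \<in> space M" for \<omega>
      using that J by (auto simp: cyl_def E_def clock_def indicator_def subset_iff)
    define h where "h y = (indicator B (snd y) :: ennreal)" for y :: "real \<times> real"
    have hm: "h \<in> borel_measurable borel"
    proof -
      have "snd \<in> borel_measurable (borel :: (real \<times> real) measure)"
        by (intro borel_measurable_continuous_onI continuous_intros)
      from measurable_compose[OF this borel_measurable_indicator[OF B]] show ?thesis by (simp add: h_def[abs_def])
    qed
    have cm: "cyl J A \<in> borel_measurable good_space" using J A by (intro cyl_measurable) auto
    have bm: "(\<lambda>\<omega>. indicator B (\<omega> t) :: ennreal) \<in> borel_measurable good_space"
      using B by (intro measurable_compose[OF good_space_component]) simp
    have tm: "(\<lambda>\<omega>. transition (t - s) (\<omega> s) B) \<in> borel_measurable good_space"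
      using st by (intro measurable_compose[OF good_space_component] transition_measurable B) simp
    have "(\<integral>\<^sup>+\<omega>. cyl J A \<omega> * indicator B (\<omega> t) \<partial>distr M good_space c) = (\<integral>\<^sup>+\<omega>. cyl J A (c \<omega>) * indicator B (c \<omega> t) \<partial>M)"
      by (intro nn_integral_distr cM) (use cm bm in \<open>auto intro!: borel_measurable_times_ennreal\<close>)
    also have "\<dots> = (\<integral>\<^sup>+\<omega>. indicator E \<omega> * h (\<omega> (s + (t - s))) \<partial>M)"
      using cl[folded M_def] AE_space[of M]
      by (intro nn_integral_cong_AE, eventually_elim) (use st in \<open>simp add: cy h_def\<close>, simp add: clock_def)
    also have "\<dots> = (\<integral>\<^sup>+\<omega>. indicator E \<omega> * (\<integral>\<^sup>+w. h (fst (\<omega> s) + (t - s), snd (\<omega> s) + w) \<partial>\<mu> (t - s)) \<partial>M)"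
      using kernel_step[OF st(1) _ E hm, of "t - s"] st unfolding M_def by simp
    also have "\<dots> = (\<integral>\<^sup>+\<omega>. cyl J A (c \<omega>) * transition (t - s) (c \<omega> s) B \<partial>M)"
      using cl[folded M_def] AE_space[of M]
    proof (intro nn_integral_cong_AE, eventually_elim)
      case (elim \<omega>)
      have ts: "0 \<le> t - s" using st by simp
      have "{w. clock \<omega> s + w \<in> B} \<in> sets (\<mu> (t - s))"
      proof -
        have "(\<lambda>w. clock \<omega> s + w) \<in> borel_measurable borel" by measurable
        from measurable_sets[OF this B] show ?thesis by (simp add: sets_mu[OF ts] vimage_def)
      qed
      then have "(\<integral>\<^sup>+w. indicator {w. clock \<omega> s + w \<in> B} w \<partial>\<mu> (t - s)) = transition (t - s) (clock \<omega> s) B"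
        by (simp add: transition_def)
      moreover have "h (fst (\<omega> s) + (t - s), snd (\<omega> s) + w) = indicator {w. clock \<omega> s + w \<in> B} w" for w
        using st by (simp add: h_def clock_def indicator_def)
      ultimately show ?case using elim by (simp add: cy)
    qed
    also have "\<dots> = (\<integral>\<^sup>+\<omega>. cyl J A \<omega> * transition (t - s) (\<omega> s) B \<partial>distr M good_space c)"
      by (intro nn_integral_distr[symmetric] cM) (use cm tm in \<open>auto intro!: borel_measurable_times_ennreal\<close>)
    finally show "(\<integral>\<^sup>+\<omega>. cyl J A \<omega> * indicator B (\<omega> t) \<partial>distr M good_space c)
      = (\<integral>\<^sup>+\<omega>. cyl J A \<omega> * transition (t - s) (\<omega> s) B \<partial>distr M good_space c)" .
  qed
  then show ?thesis unfolding sub_law_def M_def[symmetric] using M.prob_space_distr[OF cM] by simp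
qed

text \<open>With a = 0 every step lies beyond a. Uniqueness makes the law of the clock the same for
  all starting points (x,0).\<close>

lemma sub_law_unique: "sub_law M1 \<Longrightarrow> sub_law M2 \<Longrightarrow> M1 = M2"
  by (rule good_measure_eqI[where a=0]) (auto simp: sub_law_def)

text \<open>On good paths the infimum of the times above t agrees with the supremum in
  \<open>inverse_at\<close>, and the limit in \<open>proc_H\<close> with the supremum of the earlier
  values. At t = 0 the conventions match: the passage is at 0, and the left limit is read as the
  initial value.\<close>

lemma age_process_eq:
  assumes good: "clock \<omega> \<in> good_paths" and drift: "\<forall>t\<ge>0. fst (\<omega> t) = x + t" and t: "0 \<le> t"
  shows "age_process t \<omega> = (x + fst (age_at t (clock \<omega>)), snd (age_at t (clock \<omega>)))"
proof -
  define \<eta> where "\<eta> = clock \<omega>"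
  have \<eta>: "\<eta> \<in> good_paths" using good by (simp add: \<eta>_def)
  have sig: "snd (\<omega> s) = \<eta> s" if "0 \<le> s" for s using that by (simp add: \<eta>_def clock_def)
  have S: "{s. 0 < s \<and> t < proc_sigma s \<omega>} = {s. 0 < s \<and> t < \<eta> s}"
    by (auto simp: proc_sigma_def sig)
  have L0: "0 \<le> inverse_at t \<eta>" by (rule inverse_nonneg[OF \<eta>])
  have ge: "t \<le> \<eta> (inverse_at t \<eta>)"
    using overshoot_ge[OF \<eta>, of t] t good_0[OF \<eta>] by (cases "t = 0") (auto simp: inverse_at_def)
  have L: "proc_L t \<omega> = inverse_at t \<eta>"
    unfolding proc_L_def S
  proof (rule cInf_eq)
    fix s assume "s \<in> {s. 0 < s \<and> t < \<eta> s}"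
    then show "inverse_at t \<eta> \<le> s"
      using inverse_le_iff[OF \<eta>, of t s] t by (cases "t = 0") (auto simp: inverse_at_def)
  next
    fix y assume y: "\<And>s. s \<in> {s. 0 < s \<and> t < \<eta> s} \<Longrightarrow> y \<le> s"
    show "y \<le> inverse_at t \<eta>"
    proof (rule field_le_epsilon)
      fix e :: real assume e: "0 < e"
      \<comment> \<open>The path may equal t at its passage time, but strict increase takes it above
        t immediately afterwards.\<close>
      have "t < \<eta> (inverse_at t \<eta> + e)" using ge good_less[OF \<eta> L0, of "inverse_at t \<eta> + e"] e by simp
      then show "y \<le> inverse_at t \<eta> + e" using y L0 e by simp
    qed
  qed
  have H: "proc_H t \<omega> = undershoot t \<eta>"
  proof (cases "t = 0")
    case True
    then have "proc_L t \<omega> = 0" using L by (simp add: inverse_at_def)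
    then show ?thesis using True sig[of 0] good_0[OF \<eta>] by (simp add: proc_H_def undershoot_def proc_sigma_def)
  next
    case False
    then have t0: "0 < t" using t by simp
    define u where "u = inverse_at t \<eta>"
    have u: "0 < u" unfolding u_def by (rule inverse_pos[OF \<eta> t0])
    have pos: "eventually (\<lambda>\<delta>. 0 < \<delta> \<and> \<delta> < c) (at_right 0)" if "0 < c" for c :: real
      using that by (auto simp: eventually_at_right intro!: exI[of _ c])
    have "((\<lambda>\<delta>. proc_sigma (u - \<delta>) \<omega>) \<longlongrightarrow> left_lim u \<eta>) (at_right 0)"
    proof (rule order_tendstoI)
      fix c assume "c < left_lim u \<eta>"
      then obtain s where s: "0 \<le> s" "s < u" "c < \<eta> s"
        using u less_cSup_iff[OF _ bdd_left[OF \<eta>], of u c] by (auto simp: left_lim_def)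
      have "0 < u - s" using s by simp
      from pos[OF this] show "eventually (\<lambda>\<delta>. c < proc_sigma (u - \<delta>) \<omega>) (at_right 0)"
      proof eventually_elim
        case (elim \<delta>)
        then show ?case using s good_le[OF \<eta> s(1), of "u - \<delta>"] by (simp add: proc_sigma_def sig)
      qed
    next
      fix c assume c: "left_lim u \<eta> < c"
      from pos[OF u] show "eventually (\<lambda>\<delta>. proc_sigma (u - \<delta>) \<omega> < c) (at_right 0)"
      proof eventually_elim
        case (elim \<delta>)
        then show ?case using c le_left_lim[OF \<eta>, of "u - \<delta>" u] by (simp add: proc_sigma_def sig)
      qed
    qed
    then have "Lim (at_right 0) (\<lambda>\<delta>. proc_sigma (u - \<delta>) \<omega>) = left_lim u \<eta>" by (simp add: tendsto_Lim)
    then show ?thesis using u undershoot_eq[OF \<eta> t0] by (simp add: proc_H_def L u_def)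
  qed
  show ?thesis
    using drift L0 by (simp add: age_process_def proc_gamma_def L H proc_A_def age_at_def \<eta>_def)
qed

end

section \<open>Closed cylinders as generator of the natural filtration\<close>

definition closed_cylinders :: "'w measure \<Rightarrow> (real \<Rightarrow> 'w \<Rightarrow> 'a::topological_space) \<Rightarrow> real \<Rightarrow> 'w set set" where
  "closed_cylinders M X s = {{\<omega> \<in> space M. \<forall>r\<in>J. X r \<omega> \<in> K r} |J K. finite J \<and> J \<subseteq> {0..s} \<and> (\<forall>r. closed (K r))}"

lemma Int_stable_closed_cylinders: "Int_stable (closed_cylinders M X s)"
proof (rule Int_stableI)
  fix a b assume "a \<in> closed_cylinders M X s" "b \<in> closed_cylinders M X s"
  then obtain J K J' K' where a: "a = {\<omega> \<in> space M. \<forall>r\<in>J. X r \<omega> \<in> K r}" "finite J" "J \<subseteq> {0..s}" "\<forall>r. closed (K r)"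
    and b: "b = {\<omega> \<in> space M. \<forall>r\<in>J'. X r \<omega> \<in> K' r}" "finite J'" "J' \<subseteq> {0..s}" "\<forall>r. closed (K' r)"
    unfolding closed_cylinders_def by blast
  define L where "L r = (if r \<in> J then K r else UNIV) \<inter> (if r \<in> J' then K' r else UNIV)" for r
  have "a \<inter> b = {\<omega> \<in> space M. \<forall>r\<in>J \<union> J'. X r \<omega> \<in> L r}"
    unfolding a b L_def by auto
  moreover have "finite (J \<union> J')" "J \<union> J' \<subseteq> {0..s}" "\<forall>r. closed (L r)"
    using a b by (auto simp: L_def)
  ultimately show "a \<inter> b \<in> closed_cylinders M X s" unfolding closed_cylinders_def by blast
qed

text \<open>Closed sets generate the Borel sets, and taking preimages commutes with generation.
  Closedness is imposed because the Markov property on cylinders is reached through bumps.\<close>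

lemma sets_natural_filtration_closed:
  assumes s: "0 \<le> s"
  shows "sets (natural_filtration M X s) = sigma_sets (space M) (closed_cylinders M X s)"
proof -
  define G where "G = {X r -` B \<inter> space M | r B. 0 \<le> r \<and> r \<le> s \<and> B \<in> sets borel}"
  have F: "sets (natural_filtration M X s) = sigma_sets (space M) G"
    unfolding natural_filtration_def G_def by (intro sets_measure_of) auto
  interpret F: sigma_algebra "space M" "sigma_sets (space M) G"
    by (rule sigma_algebra_sigma_sets) (auto simp: G_def)
  interpret C: sigma_algebra "space M" "sigma_sets (space M) (closed_cylinders M X s)"
    by (rule sigma_algebra_sigma_sets) (auto simp: closed_cylinders_def)
  have "closed_cylinders M X s \<subseteq> sigma_sets (space M) G"
  proof
    fix a assume "a \<in> closed_cylinders M X s"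
    then obtain J K where a: "a = {\<omega> \<in> space M. \<forall>r\<in>J. X r \<omega> \<in> K r}" "finite J" "J \<subseteq> {0..s}" "\<forall>r. closed (K r)"
      unfolding closed_cylinders_def by blast
    have "{\<omega> \<in> space M. X r \<omega> \<in> K r} \<in> sigma_sets (space M) G" if "r \<in> J" for r
    proof -
      have "{\<omega> \<in> space M. X r \<omega> \<in> K r} = X r -` K r \<inter> space M" by auto
      moreover have "K r \<in> sets borel" using a by auto
      ultimately have "{\<omega> \<in> space M. X r \<omega> \<in> K r} \<in> G"
        unfolding G_def using a(3) that by (intro CollectI exI[of _ r] exI[of _ "K r"]) auto
      then show ?thesis by (rule sigma_sets.Basic)
    qed
    then show "a \<in> sigma_sets (space M) G"
      unfolding a(1) using a(2) by (intro F.sets_Collect_finite_All) auto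
  qed
  moreover have "G \<subseteq> sigma_sets (space M) (closed_cylinders M X s)"
  proof
    fix g assume "g \<in> G"
    then obtain r B where g: "g = X r -` B \<inter> space M" "0 \<le> r" "r \<le> s" "B \<in> sets borel" unfolding G_def by blast
    have "X r \<in> space M \<rightarrow> UNIV" by simp
    from sigma_sets_vimage_commute[OF this, of "Collect closed"]
    have v: "{X r -` A \<inter> space M |A. A \<in> sigma_sets UNIV (Collect closed)}
        = sigma_sets (space M) {X r -` A \<inter> space M |A. closed A}" by simp
    have "sets (borel :: 'b measure) = sigma_sets UNIV (Collect closed)"
      by (subst borel_eq_closed) (rule sets_measure_of, simp)
    with g have "g \<in> {X r -` A \<inter> space M |A. A \<in> sigma_sets UNIV (Collect closed)}" by blast
    then have "g \<in> sigma_sets (space M) {X r -` A \<inter> space M |A. closed A}"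
      by (simp only: v)
    moreover have "{X r -` A \<inter> space M |A. closed A} \<subseteq> closed_cylinders M X s"
    proof safe
      fix A :: "'b set" assume "closed A"
      then show "X r -` A \<inter> space M \<in> closed_cylinders M X s"
        unfolding closed_cylinders_def using g
        by (intro CollectI exI[of _ "{r}"] exI[of _ "\<lambda>_. A"]) auto
    qed
    ultimately show "g \<in> sigma_sets (space M) (closed_cylinders M X s)"
      using sigma_sets_mono'[of "{X r -` A \<inter> space M |A. closed A}"] by (meson subsetD)
  qed
  ultimately show ?thesis unfolding F by (simp add: sigma_sets_mono subset_antisym)
qed

section \<open>Transfer of the Markov property to the canonical process\<close>

locale canonical_age = subordinator_law b \<nu> \<mu> Q + canonical_subordinator b \<nu> \<mu> P for b \<nu> \<mu> Q P
begin

definition shift :: "real \<Rightarrow> real \<times> real \<Rightarrow> real \<times> real" where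
  "shift x y = (x + fst y, snd y)"

lemma shift_measurable: "shift x \<in> borel_measurable borel"
  unfolding shift_def[abs_def] by (intro borel_measurable_continuous_onI continuous_intros)

text \<open>Almost surely the age process started at (x,0) is a translate of a fixed functional of
  the clock, and the clock has law \<open>Q\<close> whatever x is.\<close>

lemma age_transfer:
  "\<exists>c. c \<in> P (x, 0) \<rightarrow>\<^sub>M good_space \<and> distr (P (x, 0)) good_space c = Q
     \<and> (AE \<omega> in P (x, 0). \<forall>t\<ge>0. age_process t \<omega> = shift x (age_at t (c \<omega>)))"
proof -
  obtain c where c: "c \<in> P (x, 0) \<rightarrow>\<^sub>M good_space" "AE \<omega> in P (x, 0). c \<omega> = clock \<omega>"
    using clock_version by blast
  have "distr (P (x, 0)) good_space c = Q" by (rule sub_law_unique[OF clock_law[OF c] Q])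
  moreover have "AE \<omega> in P (x, 0). \<forall>t\<ge>0. age_process t \<omega> = shift x (age_at t (c \<omega>))"
    using c(2) AE_clock_good[of x] AE_drift[of "(x, 0)"]
    by eventually_elim (simp add: age_process_eq shift_def)
  ultimately show ?thesis using c(1) by blast
qed

lemma age_at_good_measurable: "age_at r \<in> borel_measurable good_space"
  using age_at_measurable[OF borel_measurable_const measurable_ident_sets[OF refl]] .

text \<open>The translation by x is moved into the closed sets and into the test of the future; what
  remains is \<open>markov_cyl\<close> under \<open>Q\<close>, carried back to the canonical
  space.\<close>

lemma markov_closed_cylinder:
  fixes x :: real
  assumes st: "0 \<le> s" "0 \<le> t" and J: "finite J" "J \<subseteq> {0..s}" and K: "\<forall>r. closed (K r)"
    and B: "B \<in> sets borel" "B \<subseteq> age_states"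
  defines "E \<equiv> {\<omega> \<in> space (P (x, 0)). \<forall>r\<in>J. age_process r \<omega> \<in> K r}"
  shows "(\<integral>\<^sup>+\<omega>. indicator B (age_process (s + t) \<omega>) * indicator E \<omega> \<partial>P (x, 0))
    = (\<integral>\<^sup>+\<omega>. emeasure (age_trans t (age_process s \<omega>)) B * indicator E \<omega> \<partial>P (x, 0))"
proof -
  obtain c where c: "c \<in> P (x, 0) \<rightarrow>\<^sub>M good_space" and d: "distr (P (x, 0)) good_space c = Q"
    and eq: "AE \<omega> in P (x, 0). \<forall>t\<ge>0. age_process t \<omega> = shift x (age_at t (c \<omega>))"
    using age_transfer[of x] by blast
  define K' where "K' r = shift x -` K r" for r
  define h where "h y = (indicator B (shift x y) :: ennreal)" for y
  have K': "closed (K' r)" for r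
    unfolding K'_def using K by (intro closed_vimage) (auto simp: shift_def[abs_def] intro!: continuous_intros)
  have h: "h \<in> borel_measurable borel"
    unfolding h_def[abs_def] by (rule measurable_compose[OF shift_measurable borel_measurable_indicator[OF B(1)]])
  have iB: "indicator B \<in> borel_measurable borel" using B by simp
  have cyl: "age_cyl J K' \<in> borel_measurable good_space"
  proof -
    have "{\<omega> \<in> space good_space. \<forall>r\<in>J. age_at r \<omega> \<in> K' r} \<in> sets good_space"
    proof (intro sets.sets_Collect_finite_All J)
      fix r
      have "age_at r -` K' r \<inter> space good_space \<in> sets good_space"
        using K' by (intro measurable_sets[OF age_at_good_measurable]) auto
      then show "{\<omega> \<in> space good_space. age_at r \<omega> \<in> K' r} \<in> sets good_space"
        by (simp add: vimage_def Int_def conj_commute)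
    qed
    then have "indicator {\<omega> \<in> space good_space. \<forall>r\<in>J. age_at r \<omega> \<in> K' r} \<in> borel_measurable good_space"
      by (rule borel_measurable_indicator)
    then show ?thesis
      by (rule measurable_cong[THEN iffD1, rotated]) (auto simp: age_cyl_def indicator_def)
  qed
  have tr: "(\<integral>\<^sup>+\<omega>. g (c \<omega>) \<partial>P (x, 0)) = (\<integral>\<^sup>+\<eta>. g \<eta> \<partial>Q)" if "g \<in> borel_measurable good_space" for g
    unfolding d[symmetric] using that by (intro nn_integral_distr[OF c, symmetric]) simp
  have cE: "age_cyl J K' (c \<omega>) = indicator E \<omega>"
    if "\<forall>t\<ge>0. age_process t \<omega> = shift x (age_at t (c \<omega>))" "\<omega> \<in> space (P (x, 0))" for \<omega>
    using that J by (auto simp: age_cyl_def E_def K'_def indicator_def subset_iff)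
  have m1: "(\<lambda>\<eta>. h (age_at (s + t) \<eta>) * age_cyl J K' \<eta>) \<in> borel_measurable good_space"
    by (intro borel_measurable_times_ennreal cyl measurable_compose[OF age_at_good_measurable h])
  have m2: "(\<lambda>\<eta>. (\<integral>\<^sup>+y. h y \<partial>age_kernel t (age_at s \<eta>)) * age_cyl J K' \<eta>) \<in> borel_measurable good_space"
    by (intro borel_measurable_times_ennreal cyl nn_integral_age_kernel_measurable[OF h borel_measurable_const age_at_good_measurable])
  have "(\<integral>\<^sup>+\<omega>. indicator B (age_process (s + t) \<omega>) * indicator E \<omega> \<partial>P (x, 0))
    = (\<integral>\<^sup>+\<omega>. h (age_at (s + t) (c \<omega>)) * age_cyl J K' (c \<omega>) \<partial>P (x, 0))"
    using eq AE_space[of "P (x, 0)"]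
    by (intro nn_integral_cong_AE, eventually_elim) (use st in \<open>simp add: cE h_def\<close>)
  also have "\<dots> = (\<integral>\<^sup>+\<eta>. h (age_at (s + t) \<eta>) * age_cyl J K' \<eta> \<partial>Q)"
    by (rule tr[OF m1])
  also have "\<dots> = (\<integral>\<^sup>+\<eta>. (\<integral>\<^sup>+y. h y \<partial>age_kernel t (age_at s \<eta>)) * age_cyl J K' \<eta> \<partial>Q)"
    using markov_cyl[OF st J K' h] by (simp add: h_def indicator_def mult.commute)
  also have "\<dots> = (\<integral>\<^sup>+\<omega>. (\<integral>\<^sup>+y. h y \<partial>age_kernel t (age_at s (c \<omega>))) * age_cyl J K' (c \<omega>) \<partial>P (x, 0))"
    by (rule tr[OF m2, symmetric])
  also have "\<dots> = (\<integral>\<^sup>+\<omega>. emeasure (age_trans t (age_process s \<omega>)) B * indicator E \<omega> \<partial>P (x, 0))"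
  proof (rule nn_integral_cong_AE)
    show "AE \<omega> in P (x, 0). (\<integral>\<^sup>+y. h y \<partial>age_kernel t (age_at s (c \<omega>))) * age_cyl J K' (c \<omega>)
        = emeasure (age_trans t (age_process s \<omega>)) B * indicator E \<omega>"
      using eq AE_space[of "P (x, 0)"]
    proof eventually_elim
    case (elim \<omega>)
    have "c \<omega> \<in> good_paths" using measurable_space[OF c elim(2)] by (simp add: space_good_space)
    \<comment> \<open>Ages are nonnegative, so the clamping in \<open>age_trans\<close> has no
      effect at this state.\<close>
    then have "0 \<le> snd (age_at s (c \<omega>))" using undershoot_le[of "c \<omega>" s] st by (simp add: age_at_def)
    then have "emeasure (age_trans t (age_process s \<omega>)) B = (\<integral>\<^sup>+y. indicator B y \<partial>age_kernel t (shift x (age_at s (c \<omega>))))"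
      using elim(1) st emeasure_age_trans[OF st(2) B, of "age_process s \<omega>"] by (simp add: shift_def max_def)
    also have "\<dots> = (\<integral>\<^sup>+y. h y \<partial>age_kernel t (age_at s (c \<omega>)))"
      using age_kernel_shift[OF iB, where x=x and t=t and z="age_at s (c \<omega>)"] by (simp add: h_def shift_def)
    finally show ?case using cE[OF elim] by simp
    qed
  qed
  finally show ?thesis .
qed

lemma age_trans_borel:
  assumes t: "0 \<le> t" and B: "B \<in> sets borel" "B \<subseteq> age_states"
  shows "(\<lambda>z. emeasure (age_trans t z) B) \<in> borel_measurable borel"
proof -
  have "(\<lambda>z. (fst z, max 0 (snd z))) \<in> borel_measurable (borel :: (real \<times> real) measure)"
    by (intro borel_measurable_continuous_onI continuous_intros)
  from nn_integral_age_kernel_measurable[OF borel_measurable_indicator[OF B(1)] borel_measurable_const this, of t]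
  show ?thesis by (simp add: emeasure_age_trans[OF t B])
qed

text \<open>For fixed s, t and B both sides are finite measures of the event A, and they agree on an
  intersection-stable generator that contains the whole space.\<close>

lemma markov_natural_filtration:
  assumes st: "0 \<le> s" "0 \<le> t" and B: "B \<in> sets borel" "B \<subseteq> age_states"
    and A: "A \<in> sets (natural_filtration (P (x, 0)) age_process s)"
  shows "(\<integral>\<^sup>+\<omega>. indicator B (age_process (s + t) \<omega>) * indicator A \<omega> \<partial>P (x, 0))
    = (\<integral>\<^sup>+\<omega>. emeasure (age_trans t (age_process s \<omega>)) B * indicator A \<omega> \<partial>P (x, 0))"
proof -
  define M where "M = P (x, 0)"
  interpret M: prob_space M unfolding M_def by (rule prob_P)
  define N where "N = natural_filtration M age_process s"
  have ap: "age_process r \<in> borel_measurable M" for r unfolding M_def by (rule age_process_measurable)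
  have sub: "subalgebra M N" unfolding N_def by (rule subalgebra_natural_filtration[OF ap])
  have id: "(\<lambda>\<omega>. \<omega>) \<in> M \<rightarrow>\<^sub>M N" using sub by (auto simp: measurable_def subalgebra_def)
  define f1 where "f1 \<omega> = (indicator B (age_process (s + t) \<omega>) :: ennreal)" for \<omega>
  define f2 where "f2 \<omega> = emeasure (age_trans t (age_process s \<omega>)) B" for \<omega>
  have f1: "f1 \<in> borel_measurable M" unfolding f1_def[abs_def]
    by (rule measurable_compose[OF ap borel_measurable_indicator[OF B(1)]])
  have f2: "f2 \<in> borel_measurable M" unfolding f2_def[abs_def]
    by (rule measurable_compose[OF ap age_trans_borel[OF st(2) B]])
  have em: "emeasure (distr (density M f) N (\<lambda>\<omega>. \<omega>)) X = (\<integral>\<^sup>+\<omega>. f \<omega> * indicator X \<omega> \<partial>M)"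
    if f: "f \<in> borel_measurable M" and X: "X \<in> sets N" for f X
  proof -
    have XM: "X \<in> sets M" using X sub by (auto simp: subalgebra_def)
    have "emeasure (distr (density M f) N (\<lambda>\<omega>. \<omega>)) X = emeasure (density M f) X"
      using id X sets.sets_into_space[OF XM] by (subst emeasure_distr) (auto intro!: arg_cong2[where f=emeasure])
    then show ?thesis using f XM by (simp add: emeasure_density)
  qed
  have sN: "sets N = sigma_sets (space M) (closed_cylinders M age_process s)"
    unfolding N_def by (rule sets_natural_filtration_closed[OF st(1)])
  have "distr (density M f1) N (\<lambda>\<omega>. \<omega>) = distr (density M f2) N (\<lambda>\<omega>. \<omega>)"
  proof (rule measure_eqI_generator_eq[where \<Omega>="space M" and E="closed_cylinders M age_process s" and A="\<lambda>_. space M"])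
    show "Int_stable (closed_cylinders M age_process s)" by (rule Int_stable_closed_cylinders)
    show "closed_cylinders M age_process s \<subseteq> Pow (space M)" by (auto simp: closed_cylinders_def)
    show "sets (distr (density M f1) N (\<lambda>\<omega>. \<omega>)) = sigma_sets (space M) (closed_cylinders M age_process s)"
      "sets (distr (density M f2) N (\<lambda>\<omega>. \<omega>)) = sigma_sets (space M) (closed_cylinders M age_process s)"
      by (simp_all add: sN)
    have "space M = {\<omega> \<in> space M. \<forall>r\<in>{}. age_process r \<omega> \<in> (\<lambda>_. UNIV) r}" by simp
    then show S: "range (\<lambda>_::nat. space M) \<subseteq> closed_cylinders M age_process s"
      unfolding closed_cylinders_def by blast
    then have "space M \<in> sets N" unfolding sN by blast
    then have "emeasure (distr (density M f1) N (\<lambda>\<omega>. \<omega>)) (space M) \<le> (\<integral>\<^sup>+\<omega>. 1 \<partial>M)"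
      unfolding em[OF f1 \<open>space M \<in> sets N\<close>] by (intro nn_integral_mono) (auto simp: f1_def indicator_def)
    then show "emeasure (distr (density M f1) N (\<lambda>\<omega>. \<omega>)) (space M) \<noteq> \<infinity>"
      by (auto simp: M.emeasure_space_1 top_unique)
    fix X assume X: "X \<in> closed_cylinders M age_process s"
    then have XN: "X \<in> sets N" unfolding sN by blast
    obtain J K where JK: "X = {\<omega> \<in> space M. \<forall>r\<in>J. age_process r \<omega> \<in> K r}" "finite J" "J \<subseteq> {0..s}" "\<forall>r. closed (K r)"
      using X unfolding closed_cylinders_def by blast
    show "emeasure (distr (density M f1) N (\<lambda>\<omega>. \<omega>)) X = emeasure (distr (density M f2) N (\<lambda>\<omega>. \<omega>)) X"
      unfolding em[OF f1 XN] em[OF f2 XN]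
      using markov_closed_cylinder[OF st JK(2-4) B, of x] by (simp add: f1_def f2_def JK(1) M_def)
  qed simp
  moreover have "A \<in> sets N" using A by (simp add: N_def M_def)
  ultimately show ?thesis using em[OF f1] em[OF f2] by (simp add: f1_def f2_def M_def)
qed

text \<open>The integrated identity over all events of the past characterises the conditional
  expectation, because the candidate is a function of the present state and hence measurable for the
  natural filtration at s.\<close>

lemma homogeneous_markov_age: "homogeneous_markov_process (P (x, 0)) age_states age_process age_trans"
  unfolding homogeneous_markov_process_def
proof (intro conjI allI impI ballI)
  define M where "M = P (x, 0)"
  interpret M: prob_space M unfolding M_def by (rule prob_P)
  show "prob_space (P (x, 0))" by (rule prob_P)
  show "transition_function age_states age_trans" by (rule transition_function_age_trans)
  have ap: "age_process r \<in> borel_measurable M" for r unfolding M_def by (rule age_process_measurable)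
  show "age_process t \<in> borel_measurable (P (x, 0))" for t by (rule age_process_measurable)
  show "AE \<omega> in P (x, 0). age_process t \<omega> \<in> age_states" if t: "0 \<le> t" for t
  proof -
    obtain c where c: "c \<in> P (x, 0) \<rightarrow>\<^sub>M good_space"
      and eq: "AE \<omega> in P (x, 0). \<forall>t\<ge>0. age_process t \<omega> = shift x (age_at t (c \<omega>))"
      using age_transfer[of x] by blast
    show ?thesis using eq AE_space[of "P (x, 0)"]
    proof eventually_elim
      case (elim \<omega>)
      have "c \<omega> \<in> good_paths" using measurable_space[OF c elim(2)] by (simp add: space_good_space)
      then show ?case using elim(1) t undershoot_le[of "c \<omega>" t] by (simp add: shift_def age_at_def age_states_def)
    qed
  qed
  fix s t :: real and B assume st: "0 \<le> s" "0 \<le> t" and B: "B \<in> sets (borel :: (real \<times> real) measure)" "B \<subseteq> age_states"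
  define N where "N = natural_filtration M age_process s"
  have sub: "subalgebra M N" unfolding N_def by (rule subalgebra_natural_filtration[OF ap])
  interpret N: finite_measure_subalgebra M N by unfold_locales (rule sub)
  define f where "f \<omega> = (indicator B (age_process (s + t) \<omega>) :: real)" for \<omega>
  define g where "g \<omega> = measure (age_trans t (age_process s \<omega>)) B" for \<omega>
  have f: "f \<in> borel_measurable M" unfolding f_def[abs_def]
    by (rule measurable_compose[OF ap borel_measurable_indicator[OF B(1)]])
  have gm: "(\<lambda>z. measure (age_trans t z) B) \<in> borel_measurable borel"
    unfolding measure_def by (intro borel_measurable_enn2real age_trans_borel[OF st(2) B])
  have gN: "g \<in> borel_measurable N" unfolding g_def[abs_def] N_def
    by (rule measurable_compose[OF natural_filtration_measurable[OF st(1) order_refl] gm])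
  have g: "g \<in> borel_measurable M" by (rule measurable_from_subalg[OF sub gN])
  have ge: "emeasure (age_trans t z) B = ennreal (measure (age_trans t z) B)" and g1: "measure (age_trans t z) B \<le> 1" for z
  proof -
    interpret T: prob_space "age_trans t z" by (rule prob_space_age_trans[OF st(2)])
    show "emeasure (age_trans t z) B = ennreal (measure (age_trans t z) B)" by (rule T.emeasure_eq_measure)
    show "measure (age_trans t z) B \<le> 1" by (rule T.prob_le_1)
  qed
  have b: "0 \<le> f \<omega>" "f \<omega> \<le> 1" "0 \<le> g \<omega>" "g \<omega> \<le> 1" for \<omega>
    using g1 by (auto simp: f_def g_def)
  have nn: "(\<integral>\<^sup>+\<omega>. ennreal (U \<omega>) * indicator A \<omega> \<partial>M) = ennreal (\<integral>\<omega>\<in>A. U \<omega> \<partial>M)" "0 \<le> (\<integral>\<omega>\<in>A. U \<omega> \<partial>M)"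
    if "U \<in> borel_measurable M" "\<And>\<omega>. 0 \<le> U \<omega>" "\<And>\<omega>. U \<omega> \<le> 1" "A \<in> sets M" for U and A
  proof -
    have "(\<integral>\<^sup>+\<omega>. ennreal (U \<omega>) * indicator A \<omega> \<partial>M) = (\<integral>\<^sup>+\<omega>. ennreal (indicator A \<omega> * U \<omega>) \<partial>M)"
      by (intro nn_integral_cong) (auto simp: indicator_def)
    also have "\<dots> = ennreal (\<integral>\<omega>. indicator A \<omega> * U \<omega> \<partial>M)"
      using that by (intro nn_integral_eq_integral M.integrable_const_bound[where B=1]) (auto simp: indicator_def)
    finally show "(\<integral>\<^sup>+\<omega>. ennreal (U \<omega>) * indicator A \<omega> \<partial>M) = ennreal (\<integral>\<omega>\<in>A. U \<omega> \<partial>M)"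
      by (simp add: set_lebesgue_integral_def)
    show "0 \<le> (\<integral>\<omega>\<in>A. U \<omega> \<partial>M)"
      unfolding set_lebesgue_integral_def using that by (intro integral_nonneg_AE) (auto simp: indicator_def)
  qed
  have "AE \<omega> in M. real_cond_exp M N f \<omega> = g \<omega>"
  proof (rule N.real_cond_exp_charact)
    show "integrable M f" "integrable M g"
      using b by (auto intro!: M.integrable_const_bound[where B=1] f g)
    fix A assume A: "A \<in> sets N"
    then have AM: "A \<in> sets M" using sub by (auto simp: subalgebra_def)
    have "(\<integral>\<^sup>+\<omega>. ennreal (f \<omega>) * indicator A \<omega> \<partial>M) = (\<integral>\<^sup>+\<omega>. ennreal (g \<omega>) * indicator A \<omega> \<partial>M)"
      using markov_natural_filtration[OF st B A[unfolded N_def M_def]]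
      by (simp add: f_def g_def ge M_def ennreal_indicator)
    then show "(\<integral>\<omega>\<in>A. f \<omega> \<partial>M) = (\<integral>\<omega>\<in>A. g \<omega> \<partial>M)"
      using nn[OF f b(1,2) AM] nn[OF g b(3,4) AM] by simp
  qed (rule gN)
  then show "AE \<omega> in P (x, 0). real_cond_exp (P (x, 0)) (natural_filtration (P (x, 0)) age_process s)
      (\<lambda>\<omega>. indicator B (age_process (s + t) \<omega>)) \<omega> = measure (age_trans t (age_process s \<omega>)) B"
    unfolding M_def N_def f_def[abs_def] g_def .
qed

lemma age_trans_law:
  assumes t: "0 \<le> t" and B: "B \<in> sets borel" "B \<subseteq> age_states"
  shows "emeasure (age_trans t (x, 0)) B = emeasure (P (x, 0)) {\<omega> \<in> space (P (x, 0)). age_process t \<omega> \<in> B}"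
proof -
  obtain c where c: "c \<in> P (x, 0) \<rightarrow>\<^sub>M good_space" and d: "distr (P (x, 0)) good_space c = Q"
    and eq: "AE \<omega> in P (x, 0). \<forall>t\<ge>0. age_process t \<omega> = shift x (age_at t (c \<omega>))"
    using age_transfer[of x] by blast
  have iB: "indicator B \<in> borel_measurable borel" using B by simp
  have m: "(\<lambda>\<eta>. indicator B (shift x (age_at t \<eta>)) :: ennreal) \<in> borel_measurable good_space"
    by (rule measurable_compose[OF measurable_compose[OF age_at_good_measurable shift_measurable] borel_measurable_indicator[OF B(1)]])
  have "{\<omega> \<in> space (P (x, 0)). age_process t \<omega> \<in> B} = age_process t -` B \<inter> space (P (x, 0))" by auto
  then have E: "{\<omega> \<in> space (P (x, 0)). age_process t \<omega> \<in> B} \<in> sets (P (x, 0))"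
    using measurable_sets[OF age_process_measurable B(1)] by simp
  have "emeasure (age_trans t (x, 0)) B = (\<integral>\<^sup>+\<eta>. indicator B (shift x (age_at t \<eta>)) \<partial>Q)"
    using emeasure_age_trans[OF t B, of "(x, 0)"] age_trans_fresh[OF t iB, of x] by (simp add: shift_def)
  also have "\<dots> = (\<integral>\<^sup>+\<omega>. indicator B (shift x (age_at t (c \<omega>))) \<partial>P (x, 0))"
    unfolding d[symmetric] using m by (intro nn_integral_distr[OF c]) simp
  also have "\<dots> = (\<integral>\<^sup>+\<omega>. indicator {\<omega> \<in> space (P (x, 0)). age_process t \<omega> \<in> B} \<omega> \<partial>P (x, 0))"
    using eq AE_space[of "P (x, 0)"] by (intro nn_integral_cong_AE, eventually_elim) (use t in \<open>simp add: indicator_def\<close>)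
  also have "\<dots> = emeasure (P (x, 0)) {\<omega> \<in> space (P (x, 0)). age_process t \<omega> \<in> B}" using E by simp
  finally show ?thesis .
qed

end

theorem theorem2p1:
  fixes b :: real
    and \<nu> :: "real measure"
    and \<mu> :: "real \<Rightarrow> real measure"
    and P :: "real \<times> real \<Rightarrow> (real \<Rightarrow> real \<times> real) measure"
  assumes "b \<ge> 0"
    and "levy_measure \<nu>"
    and "b > 0 \<or> emeasure \<nu> {0<..} = \<infinity>"
    and "subordinator_laws (laplace_exponent b \<nu>) \<mu>"
    and "canonical_process (conv_semigroup \<mu>) P"
  shows "\<exists>p :: real \<Rightarrow> real \<times> real \<Rightarrow> (real \<times> real) measure.
    (\<forall>x. homogeneous_markov_process (P (x, 0)) age_states age_process p) \<and>
    (\<forall>t\<ge>0. \<forall>x. \<forall>B\<in>sets borel. B \<subseteq> age_states \<longrightarrow>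
       emeasure (p t (x, 0)) B
         = emeasure (P (x, 0)) {\<omega> \<in> space (P (x, 0)).
             (proc_A (proc_L t \<omega>) \<omega>, proc_gamma t \<omega>) \<in> B}) \<and>
    (\<forall>t\<ge>0. \<forall>x. \<forall>v>0. emeasure \<nu> {v..} > 0 \<longrightarrow> (\<forall>B\<in>sets borel. B \<subseteq> age_states \<longrightarrow>
       emeasure (p t (x, v)) B
         = emeasure (return borel x \<Otimes>\<^sub>M return borel (v + t)) B
             * (emeasure \<nu> {v + t..} / emeasure \<nu> {v..})
           + (\<integral>\<^sup>+ s\<in>{v..<v + t}. emeasure (p (v + t - s) (x, 0)) B \<partial>\<nu>) / emeasure \<nu> {v..}))"
proof -
  interpret canonical_subordinator b \<nu> \<mu> P by unfold_locales (use assms in auto)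
  \<comment> \<open>Any starting position would define the same \<open>Q\<close>, because the law of
    the clock does not depend on it; 0 is chosen.\<close>
  obtain c where c: "c \<in> P (0, 0) \<rightarrow>\<^sub>M good_space" "AE \<omega> in P (0, 0). c \<omega> = clock \<omega>"
    using clock_version by blast
  define Q where "Q = distr (P (0, 0)) good_space c"
  interpret canonical_age b \<nu> \<mu> Q P by unfold_locales (simp add: Q_def clock_law[OF c])
  show ?thesis
    apply (rule exI[of _ age_trans])
    apply (rule conjI)
    subgoal by (intro allI) (rule homogeneous_markov_age)
    apply (rule conjI)
    subgoal by (intro allI ballI impI) (rule age_trans_law[unfolded age_process_def])
    subgoal by (intro allI ballI impI) (rule age_trans_formula)
  done
qed

end
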